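(* Let $G$ be a finite group, $p$ a prime, and $H$ a normal subgroup of $G$ of index $p$, with $G/H=\langle \overline{x}\rangle$ and $x\in G$ a lift of $\overline{x}$. Let $F$ be a field of characteristic $0$ or of characteristic prime to $|G|$. Let $\eta$ be an irreducible $F$-representation of $H$ with corresponding primitive central idempotent $e_\eta\in F[H]$, and suppose $\eta^x\cong\eta$ (so $e_\eta$ is central in $F[G]$). Let $Z$ be the center of $F[H]e_\eta$ (a finite field extension of $F$ with identity element $e_\eta$), $\delta=[Z:F]$, and let $\eta\otimes_F Z\cong\eta_1\oplus\cdots\oplus\eta_\delta$ be the decomposition into pairwise inequivalent irreducible $Z$-representations of $H$. (1) If $\eta_1^x\not\cong\eta_1$, then $e_\eta$ does not split in $F[G]$, i.e. $e_\eta$ is a primitive central idempotent of $F[G]$. (2) If $\eta_1^x\cong\eta_1$, then there exists $y\in G\setminus H$ such that $\overline{C(y)}^{\,p}e_\eta=\lambda$ with $\lambda\in Z\setminus\{0\}$. Moreover, for any such $y$ (with its $\lambda$): (A) If $\lambda$ has no $p$-th root in $Z$, then $e_\eta$ does not split in $F[G]$. (B) If $\lambda$ has two distinct $p$-th roots in $Z$ (in which case $Z$ contains $p$ distinct $p$-th roots $\mu_1,\dots,\mu_p$ of $\lambda$), then $e_\eta$ is the sum of exactly $p$ primitive central idempotents of $F[G]$, namely $e_{c_i}e_\eta=\frac1p\left(e_\eta+c_i+c_i^2+\cdots+c_i^{p-1}\right)$, $i=1,\dots,p$, where $c_i=\overline{C(y)}\,\mu_i^{-1}$ (inverse taken in $Z$).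 (C) If $\lambda$ has exactly one $p$-th root $\mu$ in $Z$, then $e_\eta$ is the sum of exactly $1+k$ primitive central idempotents of $F[G]$, where $\Phi_p(X)=f_1(X)\cdots f_k(X)$ is the factorization of the $p$-th cyclotomic polynomial into monic irreducible polynomials over $Z$. They are $$e_ce_\eta=\frac1p\sum_{l=0}^{p-1}c^l\qquad\text{and}\qquad e_{f_i(X)}=\frac1p\sum_{l=0}^{p-1}\Big(\sum_{j=1}^{d}\zeta_{ij}^{-l}\Big)c^l\quad(i=1,\dots,k),$$ where $c=\overline{C(y)}\,\mu^{-1}$, $c^0=e_\eta$, $d$ is the common degree of the $f_i$, and $\zeta_{i1},\dots,\zeta_{id}$ are the roots of $f_i(X)$ in an algebraic closure of $Z$ (so that each $\sum_j\zeta_{ij}^{-l}$ lies in $Z$).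
   Context: Representations are finite-dimensional. For an irreducible $F$-representation $\rho$ of a finite group, $e_\rho$ denotes the unique primitive central idempotent of the group algebra that acts as the identity on $\rho$. For a representation $\eta$ of a normal subgroup $H\trianglelefteq G$ and $x\in G$, $\eta^x$ is the conjugate representation $h\mapsto \eta(xhx^{-1})$ of $H$. For $y\in G$, $\overline{C(y)}\in F[G]$ is the sum of the elements in the conjugacy class of $y$ in $G$; $\overline{C(y)}^{\,p}$ lies in the center of $F[H]$ when $y\in G$ and $[G:H]=p$, so $\overline{C(y)}^{\,p}e_\eta\in Z$. All products in the claim are taken in $F[G]$, with $Z=Z(F[H]e_\eta)\subseteq F[H]\subseteq F[G]$. If $e_\eta$ is central in $F[G]$, "$e_\eta$ does not split in $F[G]$" means that $e_\eta$ is still a primitive central idempotent in $F[G]$. For an element $c$, $e_c=(1+c+\cdots+c^{p-1})/p$. *)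

theory Defs
  imports
    "HOL-Algebra.Algebraic_Closure"
    "HOL-Algebra.Multiplicative_Group"
    "HOL-Algebra.Module"
    "HOL-Computational_Algebra.Primes"
begin

section \<open>Group algebras\<close>

definition characteristic :: "('f, 'r) ring_scheme \<Rightarrow> nat" where
  "characteristic K = group.ord (add_monoid K) \<one>\<^bsub>K\<^esub>"

text \<open>Functions that vanish outside \<open>S\<close> (rather than extensional ones), so that for
  \<open>H \<subseteq> G\<close> the group algebra of \<open>H\<close> is literally a subset of that of \<open>G\<close>. The
  multiplicative fields are irrelevant for the module structure.\<close>

definition fun_space :: "('k, 'r) ring_scheme \<Rightarrow> 's set \<Rightarrow> ('k, 's \<Rightarrow> 'k) module" where
  "fun_space K S =
     \<lparr>carrier = {v. (\<forall>s\<in>S. v s \<in> carrier K) \<and> (\<forall>s. s \<notin> S \<longrightarrow> v s = \<zero>\<^bsub>K\<^esub>)},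
      monoid.mult = undefined, one = undefined,
      zero = (\<lambda>_. \<zero>\<^bsub>K\<^esub>), add = (\<lambda>u v s. u s \<oplus>\<^bsub>K\<^esub> v s),
      smult = (\<lambda>a v s. a \<otimes>\<^bsub>K\<^esub> v s)\<rparr>"

definition group_algebra ::
  "('f, 'r) ring_scheme \<Rightarrow> ('g, 'm) monoid_scheme \<Rightarrow> ('f, 'g \<Rightarrow> 'f) module" where
  "group_algebra F G = (fun_space F (carrier G))
     \<lparr>monoid.mult := (\<lambda>a b g. if g \<in> carrier G
                then \<Oplus>\<^bsub>F\<^esub>h\<in>carrier G. a h \<otimes>\<^bsub>F\<^esub> b (inv\<^bsub>G\<^esub> h \<otimes>\<^bsub>G\<^esub> g)
                else \<zero>\<^bsub>F\<^esub>),
      one := (\<lambda>g. if g = \<one>\<^bsub>G\<^esub> then \<one>\<^bsub>F\<^esub> else \<zero>\<^bsub>F\<^esub>)\<rparr>"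

definition class_sum ::
  "('f, 'r) ring_scheme \<Rightarrow> ('g, 'm) monoid_scheme \<Rightarrow> 'g \<Rightarrow> 'g \<Rightarrow> 'f" where
  "class_sum F G y =
     (\<lambda>g. if g \<in> {u \<otimes>\<^bsub>G\<^esub> y \<otimes>\<^bsub>G\<^esub> inv\<^bsub>G\<^esub> u | u. u \<in> carrier G} then \<one>\<^bsub>F\<^esub> else \<zero>\<^bsub>F\<^esub>)"


section \<open>Central idempotents\<close>

definition ring_center :: "('a, 'r) ring_scheme \<Rightarrow> 'a set" where
  "ring_center R = {z \<in> carrier R. \<forall>a\<in>carrier R. z \<otimes>\<^bsub>R\<^esub> a = a \<otimes>\<^bsub>R\<^esub> z}"

definition central_idempotent :: "('a, 'r) ring_scheme \<Rightarrow> 'a \<Rightarrow> bool" where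
  "central_idempotent R e \<longleftrightarrow> e \<in> ring_center R \<and> e \<otimes>\<^bsub>R\<^esub> e = e"

definition primitive_central_idempotent :: "('a, 'r) ring_scheme \<Rightarrow> 'a \<Rightarrow> bool" where
  "primitive_central_idempotent R e \<longleftrightarrow>
     central_idempotent R e \<and> e \<noteq> \<zero>\<^bsub>R\<^esub> \<and>
     (\<forall>u v. central_idempotent R u \<and> central_idempotent R v \<and>
            u \<otimes>\<^bsub>R\<^esub> v = \<zero>\<^bsub>R\<^esub> \<and> u \<oplus>\<^bsub>R\<^esub> v = e \<longrightarrow> u = \<zero>\<^bsub>R\<^esub> \<or> v = \<zero>\<^bsub>R\<^esub>)"

text \<open>Since \<open>S\<close> is a set, \<open>card S\<close> counts distinct primitive central idempotents.\<close>

definition pci_decomposition :: "('a, 'r) ring_scheme \<Rightarrow> 'a \<Rightarrow> 'a set \<Rightarrow> bool" where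
  "pci_decomposition R e S \<longleftrightarrow>
     finite S \<and> (\<forall>f\<in>S. primitive_central_idempotent R f) \<and> (\<Oplus>\<^bsub>R\<^esub>f\<in>S. f) = e"

text \<open>The ring \<open>R e\<close> for a central idempotent \<open>e\<close>, and its center as a ring. Both have
  identity \<open>e\<close>, so powers with exponent \<open>0\<close> and inverses are taken relative to \<open>e\<close>;
  the other operations are those of \<open>R\<close>.\<close>

definition block :: "('a, 'r) ring_scheme \<Rightarrow> 'a \<Rightarrow> ('a, 'r) ring_scheme" where
  "block R e = R\<lparr>carrier := (\<lambda>a. a \<otimes>\<^bsub>R\<^esub> e) ` carrier R, one := e\<rparr>"

definition block_center :: "('a, 'r) ring_scheme \<Rightarrow> 'a \<Rightarrow> ('a, 'r) ring_scheme" where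
  "block_center R e = (block R e)\<lparr>carrier := ring_center (block R e)\<rparr>"

definition mean ::
  "('f, 'r) ring_scheme \<Rightarrow> ('f, 'a, 's) module_scheme \<Rightarrow> nat \<Rightarrow> (nat \<Rightarrow> 'a) \<Rightarrow> 'a" where
  "mean F A p a = inv\<^bsub>F\<^esub> (add_pow F p \<one>\<^bsub>F\<^esub>) \<odot>\<^bsub>A\<^esub> (\<Oplus>\<^bsub>A\<^esub>l\<in>{..<p}. a l)"


section \<open>Finite-dimensional representations\<close>

text \<open>A representation on \<open>K\<^sup>I\<close>, for a finite index set \<open>I\<close>, is given by its matrices;
  only entries with indices in \<open>I\<close> matter.\<close>

definition mat_mult ::
  "('k, 'r) ring_scheme \<Rightarrow> 'j set \<Rightarrow> ('i \<Rightarrow> 'j \<Rightarrow> 'k) \<Rightarrow> ('j \<Rightarrow> 'l \<Rightarrow> 'k) \<Rightarrow> 'i \<Rightarrow> 'l \<Rightarrow> 'k" where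
  "mat_mult K J M N = (\<lambda>i l. \<Oplus>\<^bsub>K\<^esub>j\<in>J. M i j \<otimes>\<^bsub>K\<^esub> N j l)"

definition mat_one :: "('k, 'r) ring_scheme \<Rightarrow> 'i \<Rightarrow> 'i \<Rightarrow> 'k" where
  "mat_one K = (\<lambda>i j. if i = j then \<one>\<^bsub>K\<^esub> else \<zero>\<^bsub>K\<^esub>)"

definition mat_vec ::
  "('k, 'r) ring_scheme \<Rightarrow> 'i set \<Rightarrow> ('i \<Rightarrow> 'i \<Rightarrow> 'k) \<Rightarrow> ('i \<Rightarrow> 'k) \<Rightarrow> 'i \<Rightarrow> 'k" where
  "mat_vec K I M v = (\<lambda>i. if i \<in> I then \<Oplus>\<^bsub>K\<^esub>j\<in>I. M i j \<otimes>\<^bsub>K\<^esub> v j else \<zero>\<^bsub>K\<^esub>)"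

definition mat_carrier :: "('k, 'r) ring_scheme \<Rightarrow> 'i set \<Rightarrow> 'j set \<Rightarrow> ('i \<Rightarrow> 'j \<Rightarrow> 'k) set" where
  "mat_carrier K I J = {M. \<forall>i\<in>I. \<forall>j\<in>J. M i j \<in> carrier K}"

definition mat_eq_on :: "'i set \<Rightarrow> 'j set \<Rightarrow> ('i \<Rightarrow> 'j \<Rightarrow> 'k) \<Rightarrow> ('i \<Rightarrow> 'j \<Rightarrow> 'k) \<Rightarrow> bool" where
  "mat_eq_on I J M N \<longleftrightarrow> (\<forall>i\<in>I. \<forall>j\<in>J. M i j = N i j)"

definition representation ::
  "('g, 'm) monoid_scheme \<Rightarrow> ('k, 'r) ring_scheme \<Rightarrow> 'i set \<Rightarrow> ('g \<Rightarrow> 'i \<Rightarrow> 'i \<Rightarrow> 'k) \<Rightarrow> bool" where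
  "representation G K I \<rho> \<longleftrightarrow>
     finite I \<and> (\<forall>g\<in>carrier G. \<rho> g \<in> mat_carrier K I I) \<and>
     mat_eq_on I I (\<rho> \<one>\<^bsub>G\<^esub>) (mat_one K) \<and>
     (\<forall>g\<in>carrier G. \<forall>h\<in>carrier G.
        mat_eq_on I I (\<rho> (g \<otimes>\<^bsub>G\<^esub> h)) (mat_mult K I (\<rho> g) (\<rho> h)))"

definition irreducible_representation ::
  "('g, 'm) monoid_scheme \<Rightarrow> ('k, 'r) ring_scheme \<Rightarrow> 'i set \<Rightarrow> ('g \<Rightarrow> 'i \<Rightarrow> 'i \<Rightarrow> 'k) \<Rightarrow> bool" where
  "irreducible_representation G K I \<rho> \<longleftrightarrow>
     representation G K I \<rho> \<and> I \<noteq> {} \<and>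
     (\<forall>W. submodule W K (fun_space K I) \<and>
          (\<forall>g\<in>carrier G. \<forall>w\<in>W. mat_vec K I (\<rho> g) w \<in> W) \<longrightarrow>
          W = {\<zero>\<^bsub>fun_space K I\<^esub>} \<or> W = carrier (fun_space K I))"

definition rep_equiv ::
  "('g, 'm) monoid_scheme \<Rightarrow> ('k, 'r) ring_scheme \<Rightarrow> 'i set \<Rightarrow> ('g \<Rightarrow> 'i \<Rightarrow> 'i \<Rightarrow> 'k) \<Rightarrow>
   'j set \<Rightarrow> ('g \<Rightarrow> 'j \<Rightarrow> 'j \<Rightarrow> 'k) \<Rightarrow> bool" where
  "rep_equiv G K I \<rho> J \<sigma> \<longleftrightarrow>
     (\<exists>T\<in>mat_carrier K J I. \<exists>S\<in>mat_carrier K I J.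
        mat_eq_on I I (mat_mult K J S T) (mat_one K) \<and>
        mat_eq_on J J (mat_mult K I T S) (mat_one K) \<and>
        (\<forall>g\<in>carrier G. mat_eq_on J I (mat_mult K I T (\<rho> g)) (mat_mult K J (\<sigma> g) T)))"

definition conj_rep ::
  "('g, 'm) monoid_scheme \<Rightarrow> 'g \<Rightarrow> ('g \<Rightarrow> 'i \<Rightarrow> 'i \<Rightarrow> 'k) \<Rightarrow> 'g \<Rightarrow> 'i \<Rightarrow> 'i \<Rightarrow> 'k" where
  "conj_rep G x \<rho> = (\<lambda>h. \<rho> (x \<otimes>\<^bsub>G\<^esub> h \<otimes>\<^bsub>G\<^esub> inv\<^bsub>G\<^esub> x))"

text \<open>Extension of scalars along a homomorphism \<open>\<phi>\<close> applies \<open>\<phi>\<close> to the matrix entries.\<close>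

definition extend_scalars ::
  "('k \<Rightarrow> 'l) \<Rightarrow> ('g \<Rightarrow> 'i \<Rightarrow> 'i \<Rightarrow> 'k) \<Rightarrow> 'g \<Rightarrow> 'i \<Rightarrow> 'i \<Rightarrow> 'l" where
  "extend_scalars \<phi> \<rho> = (\<lambda>g i j. \<phi> (\<rho> g i j))"

text \<open>The direct sum of the \<open>\<rho> s\<close>, each on \<open>I s\<close>, has index set \<open>SIGMA s:S. I s\<close>.\<close>

definition direct_sum ::
  "('k, 'r) ring_scheme \<Rightarrow> ('s \<Rightarrow> 'g \<Rightarrow> 'i \<Rightarrow> 'i \<Rightarrow> 'k) \<Rightarrow> 'g \<Rightarrow> 's \<times> 'i \<Rightarrow> 's \<times> 'i \<Rightarrow> 'k" where
  "direct_sum K \<rho> =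
     (\<lambda>g (s, i) (t, j). if s = t then \<rho> s g i j else \<zero>\<^bsub>K\<^esub>)"

definition acts_as_identity ::
  "('g, 'm) monoid_scheme \<Rightarrow> ('k, 'r) ring_scheme \<Rightarrow> 'i set \<Rightarrow> ('g \<Rightarrow> 'i \<Rightarrow> 'i \<Rightarrow> 'k) \<Rightarrow>
   ('g \<Rightarrow> 'k) \<Rightarrow> bool" where
  "acts_as_identity G K I \<rho> a \<longleftrightarrow>
     mat_eq_on I I (\<lambda>i j. \<Oplus>\<^bsub>K\<^esub>g\<in>carrier G. a g \<otimes>\<^bsub>K\<^esub> \<rho> g i j) (mat_one K)"

definition corresponding_pci ::
  "('g, 'm) monoid_scheme \<Rightarrow> ('k, 'r) ring_scheme \<Rightarrow> 'i set \<Rightarrow> ('g \<Rightarrow> 'i \<Rightarrow> 'i \<Rightarrow> 'k) \<Rightarrow>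
   ('g \<Rightarrow> 'k) \<Rightarrow> bool" where
  "corresponding_pci G K I \<rho> e \<longleftrightarrow>
     primitive_central_idempotent (group_algebra K G) e \<and> acts_as_identity G K I \<rho> e"


section \<open>The cyclotomic polynomial of prime order\<close>

text \<open>\<open>1 + X + \<dots> + X\<^sup>p\<^sup>-\<^sup>1\<close>; polynomials are lists of coefficients, leading one first.\<close>

definition cyclotomic_prime :: "('k, 'r) ring_scheme \<Rightarrow> nat \<Rightarrow> 'k list" where
  "cyclotomic_prime K p = replicate p \<one>\<^bsub>K\<^esub>"

definition monic_irreducible_factorization ::
  "('k, 'r) ring_scheme \<Rightarrow> 'k list \<Rightarrow> 'k list list \<Rightarrow> bool" where
  "monic_irreducible_factorization K q fs \<longleftrightarrow>
     (\<forall>f\<in>set fs. f \<in> carrier (poly_ring K) \<and> pirreducible\<^bsub>K\<^esub> (carrier K) f \<and>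
                 Polynomials.lead_coeff f = \<one>\<^bsub>K\<^esub>) \<and>
     foldr (\<lambda>f g. f \<otimes>\<^bsub>poly_ring K\<^esub> g) fs \<one>\<^bsub>poly_ring K\<^esub> = q"

text \<open>Roots of a polynomial over \<open>K\<close> in a field \<open>L\<close> into which \<open>K\<close> is embedded by \<open>\<iota>\<close>.\<close>

definition roots_in :: "('k \<Rightarrow> 'l) \<Rightarrow> ('l, 's) ring_scheme \<Rightarrow> 'k list \<Rightarrow> 'l set" where
  "roots_in \<iota> L f = {\<zeta>. ring.is_root L (map \<iota> f) \<zeta>}"

definition inv_power_sum ::
  "('k \<Rightarrow> 'l) \<Rightarrow> ('l, 's) ring_scheme \<Rightarrow> 'k list \<Rightarrow> nat \<Rightarrow> 'l" where
  "inv_power_sum \<iota> L f l = (\<Oplus>\<^bsub>L\<^esub>\<zeta>\<in>roots_in \<iota> L f. inv\<^bsub>L\<^esub> (\<zeta> [^]\<^bsub>L\<^esub> l))"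

end

(*
Write Z and C for the centers of F[H]e and F[G]e. Conjugation by x acts on Z. If it moves some z in Z,
then every element of C is supported on H (compare the two sides of z c = c z coset by coset), so C is
contained in the field Z and e stays primitive. Otherwise the bimodule F[H]e and its twist by x are not
separated by central elements of F[H x H], hence some average of h (b x) h^-1 over H is nonzero; it is a unit
of C of degree Hx, and therefore some class sum C(y) with y outside H is a unit of C as well. Then
C = Z[t] with t = C(y)e, i.e. C = Z[X]/(X^p - lambda), graded by G/H, and the three cases are read off
from the values of polynomials at the p-th roots of lambda in an extension field: idempotents of C are the
indicator functions of sets of roots that polynomials over Z cannot separate, and their coefficients are
computed by a finite Fourier transform.

That x centralizes Z exactly when eta_1 and eta_1^x are equivalent is a dimension count: the delta central
idempotents of Z[H] belonging to the eta_i lie in the Z-span of the image of Z, which has dimension at most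
delta, so each z in Z acts on eta_1 by a scalar, and x fixes these scalars if it fixes eta_1.
*)
theory Submission
  imports Defs
begin

text \<open>With this, structure indices can be written as in \<open>\<zero>\<^sub>L\<close>.\<close>
syntax (input) "_index" :: "logic \<Rightarrow> index" ("\<^sub>_" [1000] 1000)

section \<open>Linear maps and Maschke averaging\<close>

text \<open>Semisimplicity is used in one form: a two-sided ideal of a group algebra has a central
  identity element. Simplicity of the block of e, the field property of its center and the absence
  of central nilpotents follow from it. Applied to H x H, it makes the annihilator of the bimodule
  F[H]e generated by a central element of F[H x H], a combination of products of two class sums.
  Such a product acts on F[H]e by central elements from the left and from the right, and the twist
  only conjugates the right factor by x; so once x centralizes Z, the bimodule and its twist are
  annihilated alike.

  Elements of C are studied through values in a field L that contains p roots of X^p - lambda: an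
  algebraic closure of Z in (A), Z itself in (B), the given closure in (C). Bezout relations show
  that the zeros of an irreducible factor cannot be separated over Z, and the power maps u -> u^a,
  in the role of Galois conjugation, show that all factors of Phi_p have equal degree. In (C)
  dividing by mu reduces to lambda = 1, where the roots are 1 and the zeros of Phi_p.\<close>

lemma (in abelian_monoid) finsum_single:
 assumes "finite A" "i \<in> A" "f i \<in> carrier G"
  and "\<And>j. [|j \<in> A; j \<noteq> i|] ==> f j = \<zero>\<^sub>G"
 shows "finsum G f A = f i"
proof -
 have "finsum G f A = finsum G (\<lambda>j. if i = j then f j else \<zero>\<^sub>G) A"
  by (rule finsum_cong') (use assms in auto)
 also have "... = f i"
  by (rule finsum_singleton) (use assms in \<open>auto simp: Pi_def\<close>, metis assms(3,4) zero_closed)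
 finally show ?thesis .
qed

lemma (in abelian_monoid) finsum_swap:
 assumes "finite A" "finite B" "\<And>i j. [|i \<in> A; j \<in> B|] ==> f i j \<in> carrier G"
 shows "(\<Oplus>\<^sub>G i\<in>A. \<Oplus>\<^sub>G j\<in>B. f i j) = (\<Oplus>\<^sub>G j\<in>B. \<Oplus>\<^sub>G i\<in>A. f i j)"
 using assms(1,3)
proof (induction rule: finite_induct)
 case empty
 then show ?case by simp
next
 case (insert a A)
 have "(\<Oplus>\<^sub>G i\<in>insert a A. \<Oplus>\<^sub>G j\<in>B. f i j)
   = (\<Oplus>\<^sub>G j\<in>B. f a j) \<oplus>\<^sub>G (\<Oplus>\<^sub>G j\<in>B. \<Oplus>\<^sub>G i\<in>A. f i j)"
  using insert by (simp add: Pi_def)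
 also have "... = (\<Oplus>\<^sub>G j\<in>B. f a j \<oplus>\<^sub>G (\<Oplus>\<^sub>G i\<in>A. f i j))"
  by (rule finsum_addf[symmetric]) (use insert in \<open>auto simp: Pi_def\<close>)
 also have "... = (\<Oplus>\<^sub>G j\<in>B. \<Oplus>\<^sub>G i\<in>insert a A. f i j)"
  by (rule finsum_cong') (use insert in \<open>auto simp: Pi_def\<close>)
 finally show ?case .
qed

lemma (in abelian_monoid) finsum_bij:
 assumes "bij_betw \<pi> A B" "\<And>i. i \<in> B ==> f i \<in> carrier G"
 shows "(\<Oplus>\<^sub>G i\<in>A. f (\<pi> i)) = (\<Oplus>\<^sub>G i\<in>B. f i)"
 using finsum_reindex[of f \<pi> A] assms unfolding bij_betw_def Pi_def by auto

lemma (in abelian_monoid) finsum_in_closed: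
 assumes "finite A" "\<zero>\<^sub>G \<in> U" "U \<subseteq> carrier G" "\<And>u v. [|u \<in> U; v \<in> U|] ==> u \<oplus>\<^sub>G v \<in> U"
  and "\<And>i. i \<in> A ==> f i \<in> U"
 shows "finsum G f A \<in> U"
 using assms(1,5)
proof (induction rule: finite_induct)
 case empty
 then show ?case using assms by simp
next
 case (insert a A)
 then have "finsum G f (insert a A) = f a \<oplus>\<^sub>G finsum G f A"
  by (intro finsum_insert) (use assms(3) in \<open>auto simp: Pi_def\<close>)
 then show ?case using insert assms(4) by auto
qed

lemma fun_space_carrier:
 "v \<in> carrier (fun_space K S) \<longleftrightarrow> (\<forall>s\<in>S. v s \<in> carrier K) \<and> (\<forall>s. s \<notin> S \<longrightarrow> v s = \<zero>\<^sub>K)"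
 by (auto simp: fun_space_def)

lemma fun_space_simps [simp]:
 "zero (fun_space K S) = (\<lambda>_. \<zero>\<^sub>K)"
 "add (fun_space K S) = (\<lambda>u v s. u s \<oplus>\<^sub>K v s)"
 "smult (fun_space K S) = (\<lambda>a v s. a \<otimes>\<^sub>K v s)"
 by (auto simp: fun_space_def)

lemma fun_space_val [simp, intro]:
 assumes "cring K" "v \<in> carrier (fun_space K S)" shows "v s \<in> carrier K"
proof -
 interpret K: cring K by fact
 show ?thesis using assms(2) by (cases "s \<in> S") (auto simp: fun_space_carrier)
qed

lemma fun_space_out: "v \<in> carrier (fun_space K S) ==> s \<notin> S ==> v s = \<zero>\<^sub>K"
 by (simp add: fun_space_carrier)

lemma fun_space_module:
 assumes "cring K"
 shows "module K (fun_space K S)"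
proof -
 interpret K: cring K by fact
 let ?V = "fun_space K S"
 show ?thesis
 proof (rule moduleI)
  show "abelian_group ?V"
  proof (rule abelian_groupI)
   fix u assume u: "u \<in> carrier ?V"
   have "(\<lambda>s. \<ominus>\<^sub>K u s) \<in> carrier ?V" "(\<lambda>s. \<ominus>\<^sub>K u s) \<oplus>\<^bsub>?V\<^esub> u = \<zero>\<^bsub>?V\<^esub>"
    using u fun_space_val[OF assms u] by (auto simp: fun_space_carrier K.l_neg)
   then show "\<exists>v\<in>carrier ?V. v \<oplus>\<^bsub>?V\<^esub> u = \<zero>\<^bsub>?V\<^esub>" by blast
  next
   fix u v w assume c: "u \<in> carrier ?V" "v \<in> carrier ?V" "w \<in> carrier ?V"
   show "u \<oplus>\<^bsub>?V\<^esub> v \<oplus>\<^bsub>?V\<^esub> w = u \<oplus>\<^bsub>?V\<^esub> (v \<oplus>\<^bsub>?V\<^esub> w)"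
    using c assms by (simp add: K.a_assoc)
  next
   fix u v assume c: "u \<in> carrier ?V" "v \<in> carrier ?V"
   show "u \<oplus>\<^bsub>?V\<^esub> v = v \<oplus>\<^bsub>?V\<^esub> u" using c assms by (simp add: K.a_comm)
   show "u \<oplus>\<^bsub>?V\<^esub> v \<in> carrier ?V" using c by (auto simp: fun_space_carrier)
  next
   fix u assume c: "u \<in> carrier ?V"
   show "\<zero>\<^bsub>?V\<^esub> \<oplus>\<^bsub>?V\<^esub> u = u" using c assms by simp
  next
   show "\<zero>\<^bsub>?V\<^esub> \<in> carrier ?V" by (simp add: fun_space_carrier)
  qed
 next
  fix a u assume c: "a \<in> carrier K" "u \<in> carrier ?V"
  show "a \<odot>\<^bsub>?V\<^esub> u \<in> carrier ?V"
   using c by (simp add: fun_space_carrier)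
 next
  fix a b u assume c: "a \<in> carrier K" "b \<in> carrier K" "u \<in> carrier ?V"
  show "(a \<oplus>\<^sub>K b) \<odot>\<^bsub>?V\<^esub> u = a \<odot>\<^bsub>?V\<^esub> u \<oplus>\<^bsub>?V\<^esub> b \<odot>\<^bsub>?V\<^esub> u"
   using c assms by (simp add: K.l_distr)
 next
  fix a u v assume c: "a \<in> carrier K" "u \<in> carrier ?V" "v \<in> carrier ?V"
  show "a \<odot>\<^bsub>?V\<^esub> (u \<oplus>\<^bsub>?V\<^esub> v) = a \<odot>\<^bsub>?V\<^esub> u \<oplus>\<^bsub>?V\<^esub> a \<odot>\<^bsub>?V\<^esub> v"
   using c assms by (simp add: K.r_distr)
 next
  fix a b u assume c: "a \<in> carrier K" "b \<in> carrier K" "u \<in> carrier ?V"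
  show "(a \<otimes>\<^sub>K b) \<odot>\<^bsub>?V\<^esub> u = a \<odot>\<^bsub>?V\<^esub> (b \<odot>\<^bsub>?V\<^esub> u)"
   using c assms by (simp add: K.m_assoc)
 next
  fix u assume c: "u \<in> carrier ?V"
  show "\<one>\<^sub>K \<odot>\<^bsub>?V\<^esub> u = u"
   using c assms by simp
 qed (rule assms)
qed

lemma fun_space_finsum:
 assumes "cring K" "finite A" "\<And>i. i \<in> A ==> f i \<in> carrier (fun_space K S)"
 shows "(\<Oplus>\<^bsub>fun_space K S\<^esub>i\<in>A. f i) s = (\<Oplus>\<^sub>K i\<in>A. f i s)"
 using assms(2,3)
proof (induction rule: finite_induct)
 case empty
 interpret module K "fun_space K S" using fun_space_module[OF assms(1)] .
 show ?case by simp
next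
 case (insert a A)
 interpret module K "fun_space K S" using fun_space_module[OF assms(1)] .
 have "finsum (fun_space K S) f (insert a A) = f a \<oplus>\<^bsub>fun_space K S\<^esub> finsum (fun_space K S) f A"
  using insert by (intro M.finsum_insert) (auto simp: Pi_def)
 then show ?case
  using insert fun_space_val[OF assms(1) insert.prems] cring.cring_simprules(1)[OF assms(1)]
  by (subst abelian_monoid.finsum_insert[of K])
   (auto simp: Pi_def intro: ring.is_abelian_group cring.axioms(1) abelian_group.axioms(1) assms(1))
qed

definition lin :: "('k, 'r) ring_scheme \<Rightarrow> ('k, 'a, 'm) module_scheme \<Rightarrow> ('k, 'b, 'n) module_scheme \<Rightarrow> ('a \<Rightarrow> 'b) \<Rightarrow> bool" where
 "lin K V W T \<longleftrightarrow> (\<forall>v\<in>carrier V. T v \<in> carrier W) \<and>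
   (\<forall>u\<in>carrier V. \<forall>v\<in>carrier V. T (u \<oplus>\<^sub>V v) = T u \<oplus>\<^sub>W T v) \<and>
   (\<forall>a\<in>carrier K. \<forall>v\<in>carrier V. T (a \<odot>\<^sub>V v) = a \<odot>\<^sub>W T v)"

lemma linD:
 assumes "lin K V W T"
 shows "v \<in> carrier V ==> T v \<in> carrier W"
  and "[|u \<in> carrier V; v \<in> carrier V|] ==> T (u \<oplus>\<^sub>V v) = T u \<oplus>\<^sub>W T v"
  and "[|a \<in> carrier K; v \<in> carrier V|] ==> T (a \<odot>\<^sub>V v) = a \<odot>\<^sub>W T v"
 using assms by (auto simp: lin_def)

lemma lin_zero:
 assumes "module K V" "module K W" "lin K V W T"
 shows "T \<zero>\<^sub>V = \<zero>\<^sub>W"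
proof -
 interpret V: module K V by fact
 interpret W: module K W by fact
 have "T (\<zero>\<^sub>K \<odot>\<^sub>V \<zero>\<^sub>V) = \<zero>\<^sub>K \<odot>\<^sub>W T \<zero>\<^sub>V"
  using linD(3)[OF assms(3)] by blast
 then show ?thesis using linD(1)[OF assms(3), of "\<zero>\<^sub>V"] by simp
qed

lemma lin_finsum:
 assumes "module K V" "module K W" "lin K V W T" "finite A" "\<And>i. i \<in> A ==> f i \<in> carrier V"
 shows "T (\<Oplus>\<^sub>V i\<in>A. f i) = (\<Oplus>\<^sub>W i\<in>A. T (f i))"
proof -
 interpret V: module K V by fact
 interpret W: module K W by fact
 show ?thesis
  using assms(4,5)
 proof (induction rule: finite_induct)
  case empty
  then show ?case using lin_zero[OF assms(1-3)] by simp
 next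
  case (insert a A)
  then show ?case using linD[OF assms(3)] by (simp add: Pi_def)
 qed
qed

text \<open>Gaussian elimination, one coordinate s per step of the induction: a vector
  \<open>w\<close> of \<open>U\<close> with value 1 at s is a pivot, and \<open>U\<close> is the sum
  of its line and of the part \<open>U'\<close> vanishing at s, onto which the induction hypothesis
  projects. Without a pivot \<open>U = U'\<close>, and \<open>w = 0\<close> serves.\<close>

lemma projection_exists:
 assumes "field K" "finite S" "submodule U K (fun_space K S)"
 shows "\<exists>P. lin K (fun_space K S) (fun_space K S) P \<and>
   (\<forall>v\<in>carrier (fun_space K S). P v \<in> U) \<and> (\<forall>u\<in>U. P u = u)"
 using assms(2,3)
proof (induction S arbitrary: U rule: finite_induct)
 case empty
 interpret field K by fact
 note [simp] = is_cring
 interpret V: module K "fun_space K {}" using fun_space_module[OF is_cring] .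
 have z: "carrier (fun_space K {}) = {\<lambda>_. \<zero>\<^sub>K}"
  by (simp add: set_eq_iff fun_space_carrier fun_eq_iff)
 have "U = {\<lambda>_. \<zero>\<^sub>K}"
  using V.submoduleE(1)[OF empty] V.submoduleE(2)[OF empty] unfolding z by (auto dest: subset_singletonD)
 moreover have "lin K (fun_space K {}) (fun_space K {}) (\<lambda>v. v)" by (simp add: lin_def)
 ultimately show ?case unfolding z by blast
next
 case (insert s S)
 interpret field K by fact
 note [simp] = is_cring
 let ?V' = "fun_space K S" and ?V = "fun_space K (insert s S)"
 interpret V': module K ?V' using fun_space_module[OF is_cring] .
 interpret V: module K ?V using fun_space_module[OF is_cring] .
 note U = V.submoduleE[OF insert.prems]
 have zU: "(\<lambda>_. \<zero>\<^sub>K) \<in> U"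
  using subgroup.one_closed[OF submodule.axioms(1)[OF insert.prems]] by simp
 have neg: "\<ominus>\<^bsub>?V\<^esub> u = (\<lambda>t. \<ominus>\<^sub>K u t)" if "u \<in> carrier ?V" for u
  by (rule V.M.minus_equality) (use that fun_space_val[OF is_cring that] in \<open>auto simp: l_neg fun_space_carrier\<close>)
 have neg': "\<ominus>\<^bsub>?V'\<^esub> u = (\<lambda>t. \<ominus>\<^sub>K u t)" if "u \<in> carrier ?V'" for u
  by (rule V'.M.minus_equality) (use that fun_space_val[OF is_cring that] in \<open>auto simp: l_neg fun_space_carrier\<close>)
 define U' where "U' = {u \<in> U. u s = \<zero>\<^sub>K}"
 have U'c: "u \<in> carrier ?V'" if "u \<in> U'" for u
 proof -
  have "u \<in> carrier ?V" "u s = \<zero>\<^sub>K" using that U(1) by (auto simp: U'_def)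
  then show ?thesis unfolding fun_space_carrier by (metis insert_iff)
 qed
 have "submodule U' K ?V'"
 proof (rule V'.submoduleI)
  show "U' \<subseteq> carrier ?V'" using U'c by blast
  show "\<zero>\<^bsub>?V'\<^esub> \<in> U'" using zU by (simp add: U'_def)
  show "\<ominus>\<^bsub>?V'\<^esub> a \<in> U'" if "a \<in> U'" for a
  proof -
   have a: "a \<in> U" "a s = \<zero>\<^sub>K" "a \<in> carrier ?V" using that U(1) by (auto simp: U'_def)
   show ?thesis using U(3)[OF a(1)] a(2) unfolding neg[OF a(3)] neg'[OF U'c[OF that]] by (simp add: U'_def)
  qed
  show "a \<oplus>\<^bsub>?V'\<^esub> b \<in> U'" if "a \<in> U'" "b \<in> U'" for a b
   using that U(5)[of a b] zU by (simp add: U'_def)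
  show "a \<odot>\<^bsub>?V'\<^esub> x \<in> U'" if "a \<in> carrier K" "x \<in> U'" for a x
   using that U(4)[of a x] by (auto simp: U'_def)
 qed
 from insert.IH[OF this] obtain P where P: "lin K ?V' ?V' P" "\<And>v. v \<in> carrier ?V' ==> P v \<in> U'"
  "\<And>u. u \<in> U' ==> P u = u" by blast
 obtain w where w: "w \<in> U" "\<And>u. u \<in> U ==> (\<lambda>t. u t \<ominus>\<^sub>K u s \<otimes>\<^sub>K w t) \<in> U'"
  "w s = \<one>\<^sub>K \<or> U = U' \<and> w = (\<lambda>_. \<zero>\<^sub>K)"
 proof (cases "U = U'")
  case True
  have "(\<lambda>t. u t \<ominus>\<^sub>K u s \<otimes>\<^sub>K \<zero>\<^sub>K) = u" if "u \<in> U" for u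
  proof -
   have "u \<in> carrier ?V" using that U(1) by blast
   then show ?thesis using fun_space_val[OF is_cring] by (auto simp: fun_eq_iff minus_eq)
  qed
  then show ?thesis using that[of "\<lambda>_. \<zero>\<^sub>K"] True zU by simp
 next
  case False
  then obtain w0 where w0: "w0 \<in> U" "w0 s \<noteq> \<zero>\<^sub>K" by (auto simp: U'_def)
  then have c0: "w0 \<in> carrier ?V" using U(1) by blast
  have s0: "w0 s \<in> carrier K" using fun_space_val[OF is_cring c0] .
  then have un: "w0 s \<in> Units K" using w0 field_Units by auto
  define w where "w = inv\<^bsub>K\<^esub> (w0 s) \<odot>\<^bsub>?V\<^esub> w0"
  have wU: "w \<in> U" unfolding w_def using U(4) w0 un by blast
  have ws: "w s = \<one>\<^sub>K" unfolding w_def using un by simp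
  have wc: "w \<in> carrier ?V" using wU U(1) by blast
  have "(\<lambda>t. u t \<ominus>\<^sub>K u s \<otimes>\<^sub>K w t) \<in> U'" if "u \<in> U" for u
  proof -
   have uc: "u \<in> carrier ?V" using that U(1) by blast
   have us: "u s \<in> carrier K" using fun_space_val[OF is_cring uc] .
   have m: "u s \<odot>\<^bsub>?V\<^esub> w \<in> U" using U(4)[OF us wU] .
   then have mc: "u s \<odot>\<^bsub>?V\<^esub> w \<in> carrier ?V" using U(1) by blast
   have "u \<oplus>\<^bsub>?V\<^esub> (\<ominus>\<^bsub>?V\<^esub> (u s \<odot>\<^bsub>?V\<^esub> w)) \<in> U" using U(5)[OF that U(3)[OF m]] .
   then show ?thesis unfolding neg[OF mc] U'_def
    using us ws by (simp add: minus_eq r_neg)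
  qed
  then show ?thesis using that[of w] wU ws by blast
 qed
 have wc: "w \<in> carrier ?V" using w(1) U(1) by blast
 \<comment> \<open>Erasing coordinate s matters when \<open>w = 0\<close>: the difference then still
   has the value of v at s, while \<open>Q v\<close> has to live on \<open>S\<close>.\<close>
 define Q where "Q v = (\<lambda>t. v t \<ominus>\<^sub>K v s \<otimes>\<^sub>K w t)(s := \<zero>\<^sub>K)" for v
 have Qc: "Q v \<in> carrier ?V'" if "v \<in> carrier ?V" for v
  using that wc fun_space_val[OF is_cring that] insert(2)
  by (auto simp: Q_def minus_eq fun_space_carrier)
 have Qadd: "Q (u \<oplus>\<^bsub>?V\<^esub> v) = Q u \<oplus>\<^bsub>?V'\<^esub> Q v" if "u \<in> carrier ?V" "v \<in> carrier ?V" for u v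
  unfolding Q_def using fun_space_val[OF is_cring] that wc
  by (simp add: fun_eq_iff minus_eq l_distr minus_add a_ac)
 have Qsm: "Q (a \<odot>\<^bsub>?V\<^esub> v) = a \<odot>\<^bsub>?V'\<^esub> Q v" if "a \<in> carrier K" "v \<in> carrier ?V" for a v
  unfolding Q_def using fun_space_val[OF is_cring] that wc
  by (simp add: fun_eq_iff minus_eq r_distr r_minus m_assoc)
 define R where "R v = (\<lambda>t. v s \<otimes>\<^sub>K w t \<oplus>\<^sub>K P (Q v) t)" for v
 have Rv: "P (Q v) \<in> carrier ?V'" "P (Q v) \<in> U'" if "v \<in> carrier ?V" for v
  using P(2) Qc that U'c by auto
 have "lin K ?V ?V R"
  unfolding lin_def
 proof (intro conjI ballI)
  fix v assume v: "v \<in> carrier ?V"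
  show "R v \<in> carrier ?V"
   using v Rv(1)[OF v] wc fun_space_val[OF is_cring] insert(2) by (auto simp: R_def fun_space_carrier)
  fix u assume u: "u \<in> carrier ?V"
  show "R (v \<oplus>\<^bsub>?V\<^esub> u) = R v \<oplus>\<^bsub>?V\<^esub> R u"
   unfolding R_def Qadd[OF v u] linD(2)[OF P(1) Qc[OF v] Qc[OF u]]
   using fun_space_val[OF is_cring u] fun_space_val[OF is_cring v] fun_space_val[OF is_cring wc]
    fun_space_val[OF is_cring Rv(1)[OF v]] fun_space_val[OF is_cring Rv(1)[OF u]]
   by (simp add: fun_eq_iff l_distr a_ac)
 next
  fix a v assume a: "a \<in> carrier K" and v: "v \<in> carrier ?V"
  show "R (a \<odot>\<^bsub>?V\<^esub> v) = a \<odot>\<^bsub>?V\<^esub> R v"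
   unfolding R_def Qsm[OF a v] linD(3)[OF P(1) a Qc[OF v]]
   using a fun_space_val[OF is_cring v] fun_space_val[OF is_cring wc]
    fun_space_val[OF is_cring Rv(1)[OF v]]
   by (simp add: fun_eq_iff r_distr m_assoc)
 qed
 moreover have "R v \<in> U" if v: "v \<in> carrier ?V" for v
 proof -
  have "v s \<odot>\<^bsub>?V\<^esub> w \<oplus>\<^bsub>?V\<^esub> P (Q v) \<in> U"
   using U(5)[OF U(4)[OF fun_space_val[OF is_cring v] w(1)]] Rv(2)[OF v] by (simp add: U'_def)
  then show ?thesis by (simp add: R_def)
 qed
 moreover have "R u = u" if u: "u \<in> U" for u
 proof -
  have uc: "u \<in> carrier ?V" using u U(1) by blast
  have "Q u = (\<lambda>t. u t \<ominus>\<^sub>K u s \<otimes>\<^sub>K w t)"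
   using w(2)[OF u] by (auto simp: Q_def U'_def fun_eq_iff)
  then have "Q u \<in> U'" "P (Q u) = (\<lambda>t. u t \<ominus>\<^sub>K u s \<otimes>\<^sub>K w t)" using w(2)[OF u] P(3) by auto
  moreover have "a \<oplus>\<^sub>K (b \<ominus>\<^sub>K a) = b" if "a \<in> carrier K" "b \<in> carrier K" for a b
   using that by (simp add: minus_eq a_lcomm[of a b] r_neg)
  ultimately show ?thesis unfolding R_def
   using fun_space_val[OF is_cring uc] fun_space_val[OF is_cring wc] by (simp add: fun_eq_iff)
 qed
 ultimately show ?case by blast
qed

definition lin_act :: "('g, 'm) monoid_scheme \<Rightarrow> ('k, 'r) ring_scheme \<Rightarrow> ('k, 'a, 'n) module_scheme \<Rightarrow>
  ('g \<Rightarrow> 'a \<Rightarrow> 'a) \<Rightarrow> bool" where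
 "lin_act G K V act \<longleftrightarrow> (\<forall>g\<in>carrier G. lin K V V (act g)) \<and>
   (\<forall>g\<in>carrier G. \<forall>h\<in>carrier G. \<forall>v\<in>carrier V. act (g \<otimes>\<^sub>G h) v = act g (act h v)) \<and>
   (\<forall>v\<in>carrier V. act \<one>\<^sub>G v = v)"

lemma lin_actD:
 assumes "lin_act G K V act"
 shows "g \<in> carrier G ==> lin K V V (act g)"
  and "[|g \<in> carrier G; h \<in> carrier G; v \<in> carrier V|] ==> act (g \<otimes>\<^sub>G h) v = act g (act h v)"
  and "v \<in> carrier V ==> act \<one>\<^sub>G v = v"
  and "[|g \<in> carrier G; v \<in> carrier V|] ==> act g v \<in> carrier V"
 using assms by (auto simp: lin_act_def lin_def)

lemma (in group) bij_mult_left: "g \<in> carrier G ==> bij_betw (\<lambda>h. g \<otimes> h) (carrier G) (carrier G)"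
 by (rule bij_betw_byWitness[of _ "\<lambda>h. inv g \<otimes> h"]) (auto simp: m_assoc[symmetric])

lemma lin_comp: "[|lin K V W T; lin K U V S|] ==> lin K U W (\<lambda>v. T (S v))"
 by (simp add: lin_def)

lemma lin_finsum_fun:
 assumes "module K V" "module K W" "finite A" "\<And>i. i \<in> A ==> lin K V W (T i)"
 shows "lin K V W (\<lambda>v. \<Oplus>\<^sub>W i\<in>A. T i v)"
proof -
 interpret V: module K V by fact
 interpret W: module K W by fact
 show ?thesis
  unfolding lin_def
 proof (intro conjI ballI)
  fix v assume v: "v \<in> carrier V"
  show "(\<Oplus>\<^sub>W i\<in>A. T i v) \<in> carrier W"
   by (rule W.finsum_closed) (use linD(1)[OF assms(4) v] in auto)
  fix u assume u: "u \<in> carrier V"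
  have "(\<Oplus>\<^sub>W i\<in>A. T i (v \<oplus>\<^sub>V u)) = (\<Oplus>\<^sub>W i\<in>A. T i v \<oplus>\<^sub>W T i u)"
   by (rule W.finsum_cong') (use linD(1,2)[OF assms(4)] u v in auto)
  also have "... = (\<Oplus>\<^sub>W i\<in>A. T i v) \<oplus>\<^sub>W (\<Oplus>\<^sub>W i\<in>A. T i u)"
   by (rule W.finsum_addf) (use linD(1)[OF assms(4)] u v in auto)
  finally show "(\<Oplus>\<^sub>W i\<in>A. T i (v \<oplus>\<^sub>V u)) = (\<Oplus>\<^sub>W i\<in>A. T i v) \<oplus>\<^sub>W (\<Oplus>\<^sub>W i\<in>A. T i u)" .
 next
  fix a v assume a: "a \<in> carrier K" and v: "v \<in> carrier V"
  have "(\<Oplus>\<^sub>W i\<in>A. T i (a \<odot>\<^sub>V v)) = (\<Oplus>\<^sub>W i\<in>A. a \<odot>\<^sub>W T i v)"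
   by (rule W.finsum_cong') (use linD(1,3)[OF assms(4)] a v in auto)
  also have "... = a \<odot>\<^sub>W (\<Oplus>\<^sub>W i\<in>A. T i v)"
   by (rule W.finsum_smult_ldistr[symmetric]) (use linD(1)[OF assms(4)] a v assms(3) in auto)
  finally show "(\<Oplus>\<^sub>W i\<in>A. T i (a \<odot>\<^sub>V v)) = a \<odot>\<^sub>W (\<Oplus>\<^sub>W i\<in>A. T i v)" .
 qed
qed

lemma (in module) lin_smult: 
 assumes "c \<in> carrier R" shows "lin R M M (\<lambda>v. c \<odot>\<^sub>M v)"
 unfolding lin_def using assms by (auto simp: smult_r_distr smult_assoc1[symmetric] R.m_comm)

lemma (in module) finsum_smult_rdistr:
 assumes "finite A" "\<And>i. i \<in> A ==> f i \<in> carrier R" "v \<in> carrier M"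
 shows "(\<Oplus>\<^sub>R i\<in>A. f i) \<odot>\<^sub>M v = (\<Oplus>\<^sub>M i\<in>A. f i \<odot>\<^sub>M v)"
 using assms(1,2)
proof (induction rule: finite_induct)
 case empty
 then show ?case using assms(3) by simp
next
 case (insert a A)
 then show ?case using assms(3) by (simp add: Pi_def smult_l_distr)
qed

text \<open>Maschke's argument: the conjugates g P g^-1 all map into \<open>U\<close> and fix it
  pointwise, so their mean does too, and the substitution g -> k g makes the mean equivariant. The
  inverse \<open>c\<close> of the group order is a parameter, so that a product group can supply its
  own.\<close>

lemma equivariant_projection:
 assumes "group G" "finite (carrier G)" "module K V" "lin_act G K V act"
  and c: "c \<in> carrier K" "c \<otimes>\<^sub>K (\<Oplus>\<^sub>K g\<in>carrier G. \<one>\<^sub>K) = \<one>\<^sub>K"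
  and U: "submodule U K V" "\<And>g u. [|g \<in> carrier G; u \<in> U|] ==> act g u \<in> U"
  and P: "lin K V V P" "\<And>v. v \<in> carrier V ==> P v \<in> U" "\<And>u. u \<in> U ==> P u = u"
 obtains Q where "lin K V V Q" "\<And>v. v \<in> carrier V ==> Q v \<in> U" "\<And>u. u \<in> U ==> Q u = u"
  "\<And>g v. [|g \<in> carrier G; v \<in> carrier V|] ==> Q (act g v) = act g (Q v)"
proof -
 interpret G: group G by fact
 interpret V: module K V by fact
 note A = lin_actD[OF assms(4)]
 note U' = V.submoduleE[OF U(1)]
 have zU: "\<zero>\<^sub>V \<in> U" using subgroup.one_closed[OF submodule.axioms(1)[OF U(1)]] by simp
 define T where "T g v = act g (P (act (inv\<^bsub>G\<^esub> g) v))" for g v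
 have T: "lin K V V (T g)" if "g \<in> carrier G" for g
  unfolding T_def using lin_comp[OF A(1)[OF that] lin_comp[OF P(1) A(1)[OF G.inv_closed[OF that]]]] .
 have TU: "T g v \<in> U" if "g \<in> carrier G" "v \<in> carrier V" for g v
  unfolding T_def using that by (intro U(2) P(2) A(4)) auto
 define Q where "Q v = c \<odot>\<^sub>V (\<Oplus>\<^sub>V g\<in>carrier G. T g v)" for v
 have Q: "lin K V V Q"
  unfolding Q_def using lin_comp[OF V.lin_smult[OF c(1)] lin_finsum_fun[OF assms(3,3,2) T]] by simp
 moreover have "Q v \<in> U" if "v \<in> carrier V" for v
  unfolding Q_def using U'(1,5) zU TU that
  by (intro U'(4) c(1) V.M.finsum_in_closed assms(2)) auto
 moreover have "Q u = u" if u: "u \<in> U" for u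
 proof -
  have uc: "u \<in> carrier V" using u U'(1) by blast
  have "T g u = \<one>\<^sub>K \<odot>\<^sub>V u" if g: "g \<in> carrier G" for g
  proof -
   have "P (act (inv\<^bsub>G\<^esub> g) u) = act (inv\<^bsub>G\<^esub> g) u" using g u by (intro P(3) U(2)) auto
   then have "T g u = act (g \<otimes>\<^sub>G inv\<^bsub>G\<^esub> g) u"
    unfolding T_def using A(2)[OF g _ uc] g by (metis G.inv_closed)
   then show ?thesis using A(3)[OF uc] g uc by simp
  qed
  then have "(\<Oplus>\<^sub>V g\<in>carrier G. T g u) = (\<Oplus>\<^sub>V g\<in>carrier G. \<one>\<^sub>K \<odot>\<^sub>V u)"
   using uc by (intro V.M.finsum_cong') auto
  also have "... = (\<Oplus>\<^sub>K g\<in>carrier G. \<one>\<^sub>K) \<odot>\<^sub>V u"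
   by (rule V.finsum_smult_rdistr[symmetric]) (use assms(2) uc in auto)
  finally show ?thesis unfolding Q_def using c uc by (simp add: V.smult_assoc1[symmetric])
 qed
 moreover have "Q (act k v) = act k (Q v)" if k: "k \<in> carrier G" and v: "v \<in> carrier V" for k v
 proof -
  have kv: "act k v \<in> carrier V" using A(4) k v by blast
  have Tc: "T g w \<in> carrier V" if "g \<in> carrier G" "w \<in> carrier V" for g w
   using linD(1)[OF T] that by blast
  have "T (k \<otimes>\<^sub>G g) (act k v) = act k (T g v)" if g: "g \<in> carrier G" for g
  proof -
   have "act (inv\<^bsub>G\<^esub> (k \<otimes>\<^sub>G g)) (act k v) = act (inv\<^bsub>G\<^esub> (k \<otimes>\<^sub>G g) \<otimes>\<^sub>G k) v"
    using A(2) g k v by simp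
   also have "inv\<^bsub>G\<^esub> (k \<otimes>\<^sub>G g) \<otimes>\<^sub>G k = inv\<^bsub>G\<^esub> g"
    using g k by (simp add: G.inv_mult_group G.m_assoc)
   finally show ?thesis unfolding T_def
    using A(2)[OF k g] linD(1)[OF P(1)] A(4) g v by simp
  qed
  then have "(\<Oplus>\<^sub>V g\<in>carrier G. act k (T g v)) = (\<Oplus>\<^sub>V g\<in>carrier G. T (k \<otimes>\<^sub>G g) (act k v))"
   using Tc kv k v A(4)[OF k] by (intro V.M.finsum_cong') auto
  also have "... = (\<Oplus>\<^sub>V g\<in>carrier G. T g (act k v))"
   by (rule V.M.finsum_bij[OF G.bij_mult_left[OF k]]) (use Tc kv in auto)
  finally have "act k (\<Oplus>\<^sub>V g\<in>carrier G. T g v) = (\<Oplus>\<^sub>V g\<in>carrier G. T g (act k v))"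
   using lin_finsum[OF assms(3,3) A(1)[OF k] assms(2), of "\<lambda>g. T g v"] Tc v by simp
  then show ?thesis unfolding Q_def
   using linD(3)[OF A(1)[OF k] c(1)] Tc v by (simp add: V.M.finsum_closed)
 qed
 ultimately show ?thesis using that by blast
qed

section \<open>The action of the group algebra\<close>

text \<open>The element w of the group algebra acting on the vector v, by linear extension of the
  action of the group.\<close>

definition ext_act :: "('g, 'm) monoid_scheme \<Rightarrow> ('k, 'a, 'n) module_scheme \<Rightarrow>
  ('g \<Rightarrow> 'a \<Rightarrow> 'a) \<Rightarrow> ('g \<Rightarrow> 'k) \<Rightarrow> 'a \<Rightarrow> 'a" where
 "ext_act G V act w v = (\<Oplus>\<^sub>V g\<in>carrier G. w g \<odot>\<^sub>V act g v)"

text \<open>The point mass at g. It is the group element g inside the group algebra, and it is also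
  used as the standard basis vector of any \<open>fun_space\<close>.\<close>

definition gel :: "('k, 'r) ring_scheme \<Rightarrow> 'g \<Rightarrow> 'g \<Rightarrow> 'k" where
 "gel K g = (\<lambda>h. if h = g then \<one>\<^sub>K else \<zero>\<^sub>K)"

lemma group_algebra_simps:
 "carrier (group_algebra K G) = carrier (fun_space K (carrier G))"
 "zero (group_algebra K G) = (\<lambda>_. \<zero>\<^sub>K)"
 "add (group_algebra K G) = (\<lambda>u v s. u s \<oplus>\<^sub>K v s)"
 "smult (group_algebra K G) = (\<lambda>a v s. a \<otimes>\<^sub>K v s)"
 "one (group_algebra K G) = gel K \<one>\<^sub>G"
 "add_monoid (group_algebra K G) = add_monoid (fun_space K (carrier G))"
 "finsum (group_algebra K G) = finsum (fun_space K (carrier G))"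
 by (auto simp: group_algebra_def fun_space_def gel_def finsum_def fun_eq_iff)

lemma gel_carrier:
 assumes "cring K" "g \<in> carrier G"
 shows "gel K g \<in> carrier (group_algebra K G)"
proof -
 interpret cring K by fact
 show ?thesis using assms(2) by (auto simp: group_algebra_simps fun_space_carrier gel_def)
qed

locale action = G: group G + V: module K V for G :: "('c, 'm) monoid_scheme" (structure)
  and K :: "('a, 'r) ring_scheme" and V :: "('a, 'b, 'n) module_scheme" +
 fixes act :: "'c \<Rightarrow> 'b \<Rightarrow> 'b"
 assumes fin: "finite (carrier G)" and act: "lin_act G K V act"
begin

abbreviation Ext where "Ext \<equiv> ext_act G V act"
abbreviation KG where "KG \<equiv> group_algebra K G"

lemmas actD = lin_actD[OF act]

lemma KG_val: "w \<in> carrier KG ==> w g \<in> carrier K"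
 using fun_space_val[OF V.R.is_cring] by (simp add: group_algebra_simps)

lemma Ext_closed: "[|w \<in> carrier KG; v \<in> carrier V|] ==> Ext w v \<in> carrier V"
 unfolding ext_act_def using KG_val actD(4) by (intro V.M.finsum_closed) auto

lemma Ext_lin: "w \<in> carrier KG ==> lin K V V (Ext w)"
 unfolding ext_act_def
 by (rule lin_finsum_fun[OF V.module_axioms V.module_axioms fin])
   (use lin_comp[OF V.lin_smult actD(1)] KG_val in auto)

lemma Ext_add:
 assumes "w \<in> carrier KG" "w' \<in> carrier KG" "v \<in> carrier V"
 shows "Ext (w \<oplus>\<^bsub>KG\<^esub> w') v = Ext w v \<oplus>\<^sub>V Ext w' v"
proof -
 have "Ext (w \<oplus>\<^bsub>KG\<^esub> w') v = (\<Oplus>\<^sub>V g\<in>carrier G. w g \<odot>\<^sub>V act g v \<oplus>\<^sub>V w' g \<odot>\<^sub>V act g v)"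
  unfolding ext_act_def
  by (rule V.M.finsum_cong') (use KG_val assms actD(4) in \<open>auto simp: group_algebra_simps(3) V.smult_l_distr\<close>)
 also have "... = Ext w v \<oplus>\<^sub>V Ext w' v"
  unfolding ext_act_def
  by (rule V.M.finsum_addf) (use KG_val assms actD(4) in auto)
 finally show ?thesis .
qed

lemma Ext_smult:
 assumes "w \<in> carrier KG" "a \<in> carrier K" "v \<in> carrier V"
 shows "Ext (a \<odot>\<^bsub>KG\<^esub> w) v = a \<odot>\<^sub>V Ext w v"
proof -
 have "Ext (a \<odot>\<^bsub>KG\<^esub> w) v = (\<Oplus>\<^sub>V g\<in>carrier G. a \<odot>\<^sub>V (w g \<odot>\<^sub>V act g v))"
  unfolding ext_act_def
  by (rule V.M.finsum_cong') (use KG_val assms actD(4) in \<open>auto simp: group_algebra_simps(4) V.smult_assoc1\<close>)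
 also have "... = a \<odot>\<^sub>V Ext w v"
  unfolding ext_act_def
  by (rule V.finsum_smult_ldistr[symmetric]) (use fin KG_val assms actD(4) in auto)
 finally show ?thesis .
qed

lemma Ext_zero: "v \<in> carrier V ==> Ext \<zero>\<^bsub>KG\<^esub> v = \<zero>\<^sub>V"
 unfolding ext_act_def
 by (rule V.M.add.finprod_one_eqI) (use actD(4) in \<open>auto simp: group_algebra_simps(2)\<close>)

lemma Ext_gel:
 assumes "g \<in> carrier G" "v \<in> carrier V"
 shows "Ext (gel K g) v = act g v"
proof -
 have "Ext (gel K g) v = gel K g g \<odot>\<^sub>V act g v"
  unfolding ext_act_def
  by (rule V.M.finsum_single) (use assms fin actD(4) in \<open>auto simp: gel_def\<close>)
 then show ?thesis using assms actD(4) by (simp add: gel_def)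
qed

lemma mult_carrier:
 assumes "a \<in> carrier KG" "b \<in> carrier KG"
 shows "a \<otimes>\<^bsub>KG\<^esub> b \<in> carrier KG"
 using KG_val[OF assms(1)] KG_val[OF assms(2)]
 by (auto simp: group_algebra_def fun_space_def intro!: V.R.finsum_closed)

lemma Ext_mult:
 assumes a: "a \<in> carrier KG" and b: "b \<in> carrier KG" and v: "v \<in> carrier V"
 shows "Ext (a \<otimes>\<^bsub>KG\<^esub> b) v = Ext a (Ext b v)"
proof -
 note va = KG_val[OF a] and vb = KG_val[OF b]
 have "Ext (a \<otimes>\<^bsub>KG\<^esub> b) v
   = (\<Oplus>\<^sub>V g\<in>carrier G. \<Oplus>\<^sub>V h\<in>carrier G. (a h \<otimes>\<^sub>K b (inv h \<otimes> g)) \<odot>\<^sub>V act g v)"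
  unfolding ext_act_def
 proof (rule V.M.finsum_cong')
  fix g assume g: "g \<in> carrier G"
  then show "(a \<otimes>\<^bsub>KG\<^esub> b) g \<odot>\<^sub>V act g v
   = (\<Oplus>\<^sub>V h\<in>carrier G. (a h \<otimes>\<^sub>K b (inv h \<otimes> g)) \<odot>\<^sub>V act g v)"
   using va vb fin actD(4)[OF g v]
   by (simp add: group_algebra_def) (rule V.finsum_smult_rdistr, auto)
 qed (use va vb actD(4) v in \<open>auto intro!: V.M.finsum_closed\<close>)
 also have "... = (\<Oplus>\<^sub>V h\<in>carrier G. \<Oplus>\<^sub>V g\<in>carrier G. (a h \<otimes>\<^sub>K b (inv h \<otimes> g)) \<odot>\<^sub>V act g v)"
  by (rule V.M.finsum_swap) (use va vb actD(4) v fin in auto)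
 also have "... = (\<Oplus>\<^sub>V h\<in>carrier G. a h \<odot>\<^sub>V act h (Ext b v))"
 proof (rule V.M.finsum_cong')
  fix h assume h: "h \<in> carrier G"
  have "(\<Oplus>\<^sub>V g\<in>carrier G. (a h \<otimes>\<^sub>K b (inv h \<otimes> g)) \<odot>\<^sub>V act g v)
   = (\<Oplus>\<^sub>V k\<in>carrier G. (a h \<otimes>\<^sub>K b (inv h \<otimes> (h \<otimes> k))) \<odot>\<^sub>V act (h \<otimes> k) v)"
   by (rule V.M.finsum_bij[OF G.bij_mult_left[OF h], symmetric]) (use va vb actD(4) v in auto)
  also have "... = (\<Oplus>\<^sub>V k\<in>carrier G. a h \<odot>\<^sub>V act h (b k \<odot>\<^sub>V act k v))"
  proof (rule V.M.finsum_cong')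
   fix k assume k: "k \<in> carrier G"
   have "inv h \<otimes> (h \<otimes> k) = k" using h k by (simp add: G.m_assoc[symmetric])
   then show "(a h \<otimes>\<^sub>K b (inv h \<otimes> (h \<otimes> k))) \<odot>\<^sub>V act (h \<otimes> k) v = a h \<odot>\<^sub>V act h (b k \<odot>\<^sub>V act k v)"
    using h k v va vb actD(2,4) linD(3)[OF actD(1)[OF h]] by (simp add: V.smult_assoc1)
  qed (use va vb actD(4) v h in auto)
  also have "... = a h \<odot>\<^sub>V (\<Oplus>\<^sub>V k\<in>carrier G. act h (b k \<odot>\<^sub>V act k v))"
   by (rule V.finsum_smult_ldistr[symmetric]) (use fin va vb actD(4) v h in auto)
  also have "... = a h \<odot>\<^sub>V act h (Ext b v)"
   unfolding ext_act_def
   by (subst lin_finsum[OF V.module_axioms V.module_axioms actD(1)[OF h] fin])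
     (use vb actD(4) v in auto)
  finally show "(\<Oplus>\<^sub>V g\<in>carrier G. (a h \<otimes>\<^sub>K b (inv h \<otimes> g)) \<odot>\<^sub>V act g v) = a h \<odot>\<^sub>V act h (Ext b v)" .
 qed (use va actD(4) Ext_closed[OF b v] in auto)
 finally show ?thesis by (simp add: ext_act_def)
qed

end

section \<open>The group algebra as a ring, its center and the class sums\<close>

locale fin_group_field = G: group G + K: field K
 for G :: "('g, 'm) monoid_scheme" (structure) and K :: "('k, 'r) ring_scheme" +
 assumes fin: "finite (carrier G)"
  and order_nz: "(\<Oplus>\<^sub>K g\<in>carrier G. \<one>\<^sub>K) \<noteq> \<zero>\<^sub>K"
begin

abbreviation KG :: "('k, 'g \<Rightarrow> 'k) module" where "KG \<equiv> group_algebra K G"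
abbreviation \<delta> :: "'g \<Rightarrow> 'g \<Rightarrow> 'k" where "\<delta> \<equiv> gel K"
abbreviation KG_mult (infixl "\<star>" 70) where "a \<star> b \<equiv> a \<otimes>\<^bsub>KG\<^esub> b"

lemma module_KG: "module K KG"
proof -
 interpret V: module K "fun_space K (carrier G)" by (rule fun_space_module[OF K.is_cring])
 have carr: "carrier KG = carrier (fun_space K (carrier G))" "zero KG = zero (fun_space K (carrier G))"
  "add KG = add (fun_space K (carrier G))" "smult KG = smult (fun_space K (carrier G))"
  by (simp_all add: group_algebra_simps)
 show ?thesis
 proof (rule moduleI[OF K.is_cring], rule abelian_groupI)
  fix x assume "x \<in> carrier KG"
  then show "\<exists>y\<in>carrier KG. y \<oplus>\<^bsub>KG\<^esub> x = \<zero>\<^bsub>KG\<^esub>"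
   unfolding carr by (intro bexI[of _ "\<ominus>\<^bsub>fun_space K (carrier G)\<^esub> x"] V.M.l_neg V.M.a_inv_closed)
 qed (unfold carr, auto simp only: V.M.a_closed V.M.zero_closed V.M.a_assoc V.M.l_zero V.smult_closed
   V.smult_l_distr V.smult_r_distr V.smult_assoc1 V.smult_one intro: V.M.a_comm)
qed

lemma KG_val [simp]: "w \<in> carrier KG ==> w g \<in> carrier K"
 using fun_space_val[OF K.is_cring] by (simp add: group_algebra_simps)

lemma KG_out: "w \<in> carrier KG ==> g \<notin> carrier G ==> w g = \<zero>\<^sub>K"
 using fun_space_out by (simp add: group_algebra_simps)

lemma KG_carrierI: "[|\<And>g. g \<in> carrier G ==> w g \<in> carrier K; \<And>g. g \<notin> carrier G ==> w g = \<zero>\<^sub>K|] ==> w \<in> carrier KG"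
 by (simp add: group_algebra_simps fun_space_carrier)

lemma KG_eqI: "[|v \<in> carrier KG; w \<in> carrier KG; \<And>g. g \<in> carrier G ==> v g = w g|] ==> v = w"
 using KG_out by (metis ext)

lemma KG_finsum:
 "[|finite A; \<And>i. i \<in> A ==> f i \<in> carrier KG|] ==> (\<Oplus>\<^bsub>KG\<^esub>i\<in>A. f i) s = (\<Oplus>\<^sub>K i\<in>A. f i s)"
 using fun_space_finsum[OF K.is_cring, of A f "carrier G" s] by (simp add: group_algebra_simps)

definition ltrans :: "'g \<Rightarrow> ('g \<Rightarrow> 'k) \<Rightarrow> 'g \<Rightarrow> 'k" where
 "ltrans g v = (\<lambda>k. if k \<in> carrier G then v (inv g \<otimes> k) else \<zero>\<^sub>K)"

lemma ltrans_action: "action G K KG ltrans"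
proof -
 interpret V: module K KG by (rule module_KG)
 have "lin_act G K KG ltrans"
  unfolding lin_act_def
 proof (intro conjI ballI)
  fix g assume g: "g \<in> carrier G"
  show "lin K KG KG (ltrans g)"
   unfolding lin_def using g
   by (auto simp: ltrans_def fun_eq_iff group_algebra_simps(3,4) intro!: KG_carrierI)
  fix h v assume h: "h \<in> carrier G" and v: "v \<in> carrier KG"
  show "ltrans (g \<otimes> h) v = ltrans g (ltrans h v)"
   using g h by (auto simp: ltrans_def fun_eq_iff G.inv_mult_group G.m_assoc)
 next
  fix v assume v: "v \<in> carrier KG"
  show "ltrans \<one> v = v"
   using KG_out[OF v] by (auto simp: ltrans_def fun_eq_iff)
 qed
 then show ?thesis by unfold_locales (rule fin)
qed

text \<open>The product is the linear extension of left translation. Associativity and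
  distributivity are thereby instances of the general facts on \<open>Ext\<close>.\<close>

lemma mult_eq_Ext:
 assumes "a \<in> carrier KG" "b \<in> carrier KG"
 shows "a \<star> b = ext_act G KG ltrans a b"
proof -
 interpret L: action G K KG ltrans by (rule ltrans_action)
 show ?thesis
 proof (rule KG_eqI[OF L.mult_carrier[OF assms] L.Ext_closed[OF assms]])
  fix g assume g: "g \<in> carrier G"
  have "ext_act G KG ltrans a b g = (\<Oplus>\<^sub>K h\<in>carrier G. (a h \<odot>\<^bsub>KG\<^esub> ltrans h b) g)"
   unfolding ext_act_def using assms L.actD(4) by (intro KG_finsum fin) auto
  then show "(a \<star> b) g = ext_act G KG ltrans a b g"
   using g by (simp add: group_algebra_simps(4) ltrans_def) (simp add: group_algebra_def)
 qed
qed

lemma gel_left: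
 assumes "g \<in> carrier G" "b \<in> carrier KG" "k \<in> carrier G"
 shows "(\<delta> g \<star> b) k = b (inv g \<otimes> k)"
proof -
 interpret L: action G K KG ltrans by (rule ltrans_action)
 show ?thesis
  using assms by (simp add: mult_eq_Ext gel_carrier[OF K.is_cring] L.Ext_gel) (simp add: ltrans_def)
qed

lemma gel_right:
 assumes "g \<in> carrier G" "a \<in> carrier KG" "k \<in> carrier G"
 shows "(a \<star> \<delta> g) k = a (k \<otimes> inv g)"
proof -
 have eq: "\<delta> g (inv h \<otimes> k) = (if h = k \<otimes> inv g then \<one>\<^sub>K else \<zero>\<^sub>K)" if "h \<in> carrier G" for h
 proof -
  have "inv h \<otimes> k = g \<longleftrightarrow> h = k \<otimes> inv g"
   using assms(1,3) that by (metis G.inv_closed G.inv_solve_left G.inv_solve_right G.m_closed)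
  then show ?thesis by (simp add: gel_def)
 qed
 have "(a \<star> \<delta> g) k = (\<Oplus>\<^sub>K h\<in>carrier G. a h \<otimes>\<^sub>K \<delta> g (inv h \<otimes> k))"
  using assms(3) by (simp add: group_algebra_def)
 also have "... = a (k \<otimes> inv g) \<otimes>\<^sub>K \<delta> g (inv (k \<otimes> inv g) \<otimes> k)"
  by (rule K.finsum_single[OF fin]) (use assms eq in auto)
 also have "... = a (k \<otimes> inv g)" using assms eq by simp
 finally show ?thesis .
qed

lemma gel_closed [simp]: "g \<in> carrier G ==> \<delta> g \<in> carrier KG"
 by (rule gel_carrier[OF K.is_cring])

lemma ring_KG: "ring KG"
proof -
 interpret V: module K KG by (rule module_KG)
 interpret L: action G K KG ltrans by (rule ltrans_action)
 have one: "\<one>\<^bsub>KG\<^esub> = \<delta> \<one>" by (simp add: group_algebra_simps)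
 show ?thesis
 proof (rule ringI)
  show "abelian_group KG" by (rule V.abelian_group_axioms)
  show "monoid KG"
  proof (rule monoidI)
   fix x y z assume c: "x \<in> carrier KG" "y \<in> carrier KG" "z \<in> carrier KG"
   show "x \<star> y \<in> carrier KG" by (rule L.mult_carrier[OF c(1,2)])
   show "x \<star> y \<star> z = x \<star> (y \<star> z)"
    using L.Ext_mult[OF c] c L.mult_carrier by (simp add: mult_eq_Ext)
  next
   fix x assume c: "x \<in> carrier KG"
   show "\<one>\<^bsub>KG\<^esub> \<star> x = x" unfolding one
    by (rule KG_eqI) (use c L.mult_carrier gel_left in auto)
   show "x \<star> \<one>\<^bsub>KG\<^esub> = x" unfolding one
    by (rule KG_eqI) (use c L.mult_carrier gel_right in auto)
  qed (auto simp: one)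
  fix x y z assume c: "x \<in> carrier KG" "y \<in> carrier KG" "z \<in> carrier KG"
  show "(x \<oplus>\<^bsub>KG\<^esub> y) \<star> z = x \<star> z \<oplus>\<^bsub>KG\<^esub> y \<star> z"
   using c L.Ext_add[OF c] by (simp add: mult_eq_Ext)
  show "z \<star> (x \<oplus>\<^bsub>KG\<^esub> y) = z \<star> x \<oplus>\<^bsub>KG\<^esub> z \<star> y"
   using c linD(2)[OF L.Ext_lin[OF c(3)] c(1,2)] by (simp add: mult_eq_Ext)
 qed
qed

sublocale A: ring KG by (rule ring_KG)
sublocale V: module K KG by (rule module_KG)

lemma smult_mult:
 assumes "a \<in> carrier K" "u \<in> carrier KG" "v \<in> carrier KG"
 shows "(a \<odot>\<^bsub>KG\<^esub> u) \<star> v = a \<odot>\<^bsub>KG\<^esub> (u \<star> v)"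
  and "u \<star> (a \<odot>\<^bsub>KG\<^esub> v) = a \<odot>\<^bsub>KG\<^esub> (u \<star> v)"
proof -
 interpret L: action G K KG ltrans by (rule ltrans_action)
 show "(a \<odot>\<^bsub>KG\<^esub> u) \<star> v = a \<odot>\<^bsub>KG\<^esub> (u \<star> v)"
  using assms L.Ext_smult[OF assms(2,1,3)] by (simp add: mult_eq_Ext)
 show "u \<star> (a \<odot>\<^bsub>KG\<^esub> v) = a \<odot>\<^bsub>KG\<^esub> (u \<star> v)"
  using assms linD(3)[OF L.Ext_lin[OF assms(2)] assms(1,3)] by (simp add: mult_eq_Ext)
qed

lemma one_KG: "\<one>\<^bsub>KG\<^esub> = \<delta> \<one>"
 by (simp add: group_algebra_simps)

lemma gel_mult:
 assumes "g \<in> carrier G" "h \<in> carrier G"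
 shows "\<delta> g \<star> \<delta> h = \<delta> (g \<otimes> h)"
proof (rule KG_eqI)
 fix k assume k: "k \<in> carrier G"
 have "inv g \<otimes> k = h \<longleftrightarrow> k = g \<otimes> h" using assms k G.inv_solve_left'[of h g k] by auto
 then show "(\<delta> g \<star> \<delta> h) k = \<delta> (g \<otimes> h) k"
  using assms k by (simp add: gel_left) (simp add: gel_def)
qed (use assms in auto)

lemma gel_inv: "g \<in> carrier G ==> \<delta> g \<star> \<delta> (inv g) = \<one>\<^bsub>KG\<^esub>" "g \<in> carrier G ==> \<delta> (inv g) \<star> \<delta> g = \<one>\<^bsub>KG\<^esub>"
 by (simp_all add: gel_mult one_KG)

lemma KG_expand:
 assumes "a \<in> carrier KG"
 shows "a = (\<Oplus>\<^bsub>KG\<^esub>g\<in>carrier G. a g \<odot>\<^bsub>KG\<^esub> \<delta> g)"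
proof (rule KG_eqI[OF assms])
 show "(\<Oplus>\<^bsub>KG\<^esub>g\<in>carrier G. a g \<odot>\<^bsub>KG\<^esub> \<delta> g) \<in> carrier KG"
  using assms by (intro A.finsum_closed) auto
 fix h assume h: "h \<in> carrier G"
 have "(\<Oplus>\<^bsub>KG\<^esub>g\<in>carrier G. a g \<odot>\<^bsub>KG\<^esub> \<delta> g) h = (\<Oplus>\<^sub>K g\<in>carrier G. (a g \<odot>\<^bsub>KG\<^esub> \<delta> g) h)"
  using assms by (intro KG_finsum fin) auto
 also have "... = (a h \<odot>\<^bsub>KG\<^esub> \<delta> h) h"
  by (rule K.finsum_single[OF fin h]) (use assms in \<open>auto simp: group_algebra_simps(4) gel_def\<close>)
 also have "... = a h" using assms by (simp add: group_algebra_simps(4) gel_def)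
 finally show "a h = (\<Oplus>\<^bsub>KG\<^esub>g\<in>carrier G. a g \<odot>\<^bsub>KG\<^esub> \<delta> g) h" by simp
qed

lemma lin_eqI:
 assumes "module K W" "lin K KG W S" "lin K KG W T" "\<And>g. g \<in> carrier G ==> S (\<delta> g) = T (\<delta> g)"
  and "a \<in> carrier KG"
 shows "S a = T a"
proof -
 interpret W: module K W by fact
 have c: "a g \<odot>\<^bsub>KG\<^esub> \<delta> g \<in> carrier KG" if "g \<in> carrier G" for g using assms(5) that by simp
 have *: "L a = (\<Oplus>\<^sub>W g\<in>carrier G. a g \<odot>\<^sub>W L (\<delta> g))" if L: "lin K KG W L" for L
 proof -
  have "L a = L (\<Oplus>\<^bsub>KG\<^esub>g\<in>carrier G. a g \<odot>\<^bsub>KG\<^esub> \<delta> g)" using KG_expand[OF assms(5)] by simp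
  also have "... = (\<Oplus>\<^sub>W g\<in>carrier G. L (a g \<odot>\<^bsub>KG\<^esub> \<delta> g))"
   by (rule lin_finsum[OF module_KG assms(1) L fin c])
  also have "... = (\<Oplus>\<^sub>W g\<in>carrier G. a g \<odot>\<^sub>W L (\<delta> g))"
   by (rule W.M.finsum_cong') (use linD(1,3)[OF L] assms(5) in auto)
  finally show ?thesis .
 qed
 show ?thesis unfolding *[OF assms(2)] *[OF assms(3)]
  by (rule W.M.finsum_cong') (use assms(4,5) linD(1)[OF assms(3)] in auto)
qed

lemma lin_mult_left: "u \<in> carrier KG ==> lin K KG KG (\<lambda>v. u \<star> v)"
 by (simp add: lin_def A.r_distr smult_mult)

lemma lin_mult_right: "u \<in> carrier KG ==> lin K KG KG (\<lambda>v. v \<star> u)"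
 by (simp add: lin_def A.l_distr smult_mult)

lemma centralI:
 assumes "z \<in> carrier KG" "\<And>g. g \<in> carrier G ==> \<delta> g \<star> z = z \<star> \<delta> g"
 shows "z \<in> ring_center KG"
 using assms lin_eqI[OF module_KG lin_mult_left[OF assms(1)] lin_mult_right[OF assms(1)]]
 by (simp add: ring_center_def)

lemma centralD:
 assumes "z \<in> ring_center KG"
 shows "z \<in> carrier KG" "a \<in> carrier KG ==> z \<star> a = a \<star> z"
 using assms by (auto simp: ring_center_def)

lemma central_iff_class_function:
 assumes "z \<in> carrier KG"
 shows "z \<in> ring_center KG \<longleftrightarrow> (\<forall>g\<in>carrier G. \<forall>k\<in>carrier G. z (g \<otimes> k \<otimes> inv g) = z k)"
proof
 assume z: "z \<in> ring_center KG"
 show "\<forall>g\<in>carrier G. \<forall>k\<in>carrier G. z (g \<otimes> k \<otimes> inv g) = z k"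
 proof (intro ballI)
  fix g k assume g: "g \<in> carrier G" and k: "k \<in> carrier G"
  have "(z \<star> \<delta> g) (g \<otimes> k) = (\<delta> g \<star> z) (g \<otimes> k)"
   using centralD(2)[OF z] g by simp
  then show "z (g \<otimes> k \<otimes> inv g) = z k"
   using g k assms by (simp add: gel_left gel_right G.m_assoc[symmetric])
 qed
next
 assume *: "\<forall>g\<in>carrier G. \<forall>k\<in>carrier G. z (g \<otimes> k \<otimes> inv g) = z k"
 show "z \<in> ring_center KG"
 proof (rule centralI[OF assms], rule KG_eqI)
  fix g k assume g: "g \<in> carrier G" and k: "k \<in> carrier G"
  have "z (g \<otimes> (inv g \<otimes> k) \<otimes> inv g) = z (inv g \<otimes> k)" using * g k by simp
  then show "(\<delta> g \<star> z) k = (z \<star> \<delta> g) k"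
   using g k assms by (simp add: gel_left gel_right G.m_assoc[symmetric])
 qed (use assms in auto)
qed

lemma class_sum_carrier: "y \<in> carrier G ==> class_sum K G y \<in> carrier KG"
 by (rule KG_carrierI) (auto simp: class_sum_def)

lemma class_sum_central:
 assumes y: "y \<in> carrier G"
 shows "class_sum K G y \<in> ring_center KG"
proof -
 have *: "g \<otimes> k \<otimes> inv g \<in> {u \<otimes> y \<otimes> inv u | u. u \<in> carrier G}"
  if g: "g \<in> carrier G" and k: "k \<in> {u \<otimes> y \<otimes> inv u | u. u \<in> carrier G}" for g k
 proof -
  obtain u where u: "u \<in> carrier G" "k = u \<otimes> y \<otimes> inv u" using k by blast
  have "g \<otimes> k \<otimes> inv g = (g \<otimes> u) \<otimes> y \<otimes> inv (g \<otimes> u)"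
   using u g y by (simp add: G.inv_mult_group G.m_assoc)
  then show ?thesis using u g by blast
 qed
 show ?thesis
  unfolding central_iff_class_function[OF class_sum_carrier[OF y]]
 proof (intro ballI)
  fix g k assume g: "g \<in> carrier G" and k: "k \<in> carrier G"
  have "inv g \<otimes> (g \<otimes> k \<otimes> inv g) \<otimes> inv (inv g) = k"
   using g k by (simp add: G.m_assoc) (simp add: G.m_assoc[symmetric])
  then have "g \<otimes> k \<otimes> inv g \<in> {u \<otimes> y \<otimes> inv u | u. u \<in> carrier G} \<longleftrightarrow>
    k \<in> {u \<otimes> y \<otimes> inv u | u. u \<in> carrier G}"
   using *[OF g, of k] *[of "inv g" "g \<otimes> k \<otimes> inv g"] g by auto
  then show "class_sum K G y (g \<otimes> k \<otimes> inv g) = class_sum K G y k"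
   by (simp add: class_sum_def)
 qed
qed

lemma class_sum_self: "y \<in> carrier G ==> class_sum K G y y = \<one>\<^sub>K"
 unfolding class_sum_def by (auto intro!: exI[of _ \<one>])

lemma class_sum_nonzeroD:
 assumes "class_sum K G y k \<noteq> \<zero>\<^sub>K" obtains u where "u \<in> carrier G" "k = u \<otimes> y \<otimes> inv u"
 using assms unfolding class_sum_def by (auto split: if_splits)

lemma ring_center_closed:
 assumes "u \<in> ring_center KG" "v \<in> ring_center KG"
 shows "u \<oplus>\<^bsub>KG\<^esub> v \<in> ring_center KG" "u \<star> v \<in> ring_center KG"
  "a \<in> carrier K ==> a \<odot>\<^bsub>KG\<^esub> u \<in> ring_center KG" "\<ominus>\<^bsub>KG\<^esub> u \<in> ring_center KG"
proof -
 note c = centralD[OF assms(1)] centralD[OF assms(2)]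
 show "u \<oplus>\<^bsub>KG\<^esub> v \<in> ring_center KG" "a \<in> carrier K ==> a \<odot>\<^bsub>KG\<^esub> u \<in> ring_center KG"
  "\<ominus>\<^bsub>KG\<^esub> u \<in> ring_center KG"
  using c by (auto simp: ring_center_def A.l_distr A.r_distr smult_mult A.l_minus A.r_minus)
 have "u \<star> v \<star> a = a \<star> (u \<star> v)" if a: "a \<in> carrier KG" for a
  using c(2)[OF a] c(4)[OF a] c(1,3) a
  by (simp add: A.m_assoc) (simp add: A.m_assoc[symmetric])
 then show "u \<star> v \<in> ring_center KG" using c(1,3) by (simp add: ring_center_def)
qed

text \<open>A central element is constant on classes, so subtracting z(y) times the class sum of y
  removes a class from its support; the induction is on the size of the support. Class sums are
  needed only for y in the support of z: this is how \<open>exists_class_sum\<close> finds y in a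
  prescribed coset.\<close>

lemma center_induct:
 assumes "z \<in> ring_center KG"
  and "P \<zero>\<^bsub>KG\<^esub>"
  and "\<And>u v. [|u \<in> carrier KG; v \<in> carrier KG; P u; P v|] ==> P (u \<oplus>\<^bsub>KG\<^esub> v)"
  and "\<And>a u. [|a \<in> carrier K; u \<in> carrier KG; P u|] ==> P (a \<odot>\<^bsub>KG\<^esub> u)"
  and "\<And>y. [|y \<in> carrier G; z y \<noteq> \<zero>\<^sub>K|] ==> P (class_sum K G y)"
 shows "P z"
 using assms(1,5)
proof (induction "card {g \<in> carrier G. z g \<noteq> \<zero>\<^sub>K}" arbitrary: z rule: less_induct)
 case less
 note zc = centralD(1)[OF less.prems(1)]
 show ?case
 proof (cases "\<exists>y\<in>carrier G. z y \<noteq> \<zero>\<^sub>K")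
  case False
  then have "z = \<zero>\<^bsub>KG\<^esub>" using zc by (intro KG_eqI[OF zc A.zero_closed]) (auto simp: group_algebra_simps(2))
  then show ?thesis using assms(2) by simp
 next
  case True
  then obtain y where y: "y \<in> carrier G" "z y \<noteq> \<zero>\<^sub>K" by blast
  define c where "c = class_sum K G y"
  have c: "c \<in> ring_center KG" "c \<in> carrier KG" unfolding c_def
   using class_sum_central class_sum_carrier y by auto
  define w where "w = z \<oplus>\<^bsub>KG\<^esub> (\<ominus>\<^sub>K z y) \<odot>\<^bsub>KG\<^esub> c"
  have w: "w \<in> ring_center KG" unfolding w_def
   using less.prems(1) c zc by (intro ring_center_closed(1,3)) auto
  have wv: "w g = z g \<oplus>\<^sub>K (\<ominus>\<^sub>K z y) \<otimes>\<^sub>K c g" for g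
   by (simp add: w_def group_algebra_simps(3,4))
  \<comment> \<open>The subtraction adds nothing to the support: where the class sum of y is
    nonzero, z takes the nonzero value z(y).\<close>
  have sup: "w g = \<zero>\<^sub>K" if g: "g \<in> carrier G" "z g = \<zero>\<^sub>K" for g
  proof (cases "c g = \<zero>\<^sub>K")
   case True
   then show ?thesis using g zc unfolding wv by simp
  next
   case False
   then obtain u where "u \<in> carrier G" "g = u \<otimes> y \<otimes> inv u" unfolding c_def by (rule class_sum_nonzeroD)
   then have "z g = z y" using less.prems(1) zc central_iff_class_function y by blast
   then show ?thesis using g y by simp
  qed
  have wy: "w y = \<zero>\<^sub>K" unfolding wv c_def using class_sum_self[OF y(1)] zc by (simp add: K.r_neg)
  have "{g \<in> carrier G. w g \<noteq> \<zero>\<^sub>K} \<subset> {g \<in> carrier G. z g \<noteq> \<zero>\<^sub>K}"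
   using sup wy y by blast
  then have "card {g \<in> carrier G. w g \<noteq> \<zero>\<^sub>K} < card {g \<in> carrier G. z g \<noteq> \<zero>\<^sub>K}"
   using fin by (intro psubset_card_mono) auto
  then have Pw: "P w" using less.hyps w less.prems(2) sup by blast
  have "z = w \<oplus>\<^bsub>KG\<^esub> z y \<odot>\<^bsub>KG\<^esub> c"
   unfolding w_def using zc c
   by (simp add: A.a_assoc V.smult_l_minus A.l_neg)
  moreover have "P (w \<oplus>\<^bsub>KG\<^esub> z y \<odot>\<^bsub>KG\<^esub> c)"
   using centralD(1)[OF w] c zc y less.prems(2) Pw
   by (intro assms(3,4)) (auto simp: c_def)
  ultimately show ?thesis by simp
 qed
qed

end

section \<open>Two-sided ideals and their central generators\<close>

lemma (in ring) ideal_submodule: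
 fixes V
 assumes "ideal I R"
 shows "I \<subseteq> carrier R" "\<zero> \<in> I" "[|a \<in> I; b \<in> I|] ==> a \<oplus> b \<in> I" "a \<in> I ==> \<ominus> a \<in> I"
  "[|a \<in> I; x \<in> carrier R|] ==> x \<otimes> a \<in> I" "[|a \<in> I; x \<in> carrier R|] ==> a \<otimes> x \<in> I"
proof -
 interpret ideal I R by fact
 show "I \<subseteq> carrier R" "\<zero> \<in> I" "[|a \<in> I; b \<in> I|] ==> a \<oplus> b \<in> I" "a \<in> I ==> \<ominus> a \<in> I"
  "[|a \<in> I; x \<in> carrier R|] ==> x \<otimes> a \<in> I" "[|a \<in> I; x \<in> carrier R|] ==> a \<otimes> x \<in> I"
  using a_subset additive_subgroup.zero_closed[OF is_additive_subgroup]
   additive_subgroup.a_closed[OF is_additive_subgroup]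
   additive_subgroup.a_inv_closed[OF is_additive_subgroup] I_l_closed I_r_closed by auto
qed

lemma (in ring) idealI':
 assumes "I \<subseteq> carrier R" "\<zero> \<in> I" "\<And>a b. [|a \<in> I; b \<in> I|] ==> a \<oplus> b \<in> I"
  "\<And>a x. [|a \<in> I; x \<in> carrier R|] ==> x \<otimes> a \<in> I" "\<And>a x. [|a \<in> I; x \<in> carrier R|] ==> a \<otimes> x \<in> I"
 shows "ideal I R"
proof (rule idealI)
 have "\<ominus> a \<in> I" if "a \<in> I" for a
  using assms(4)[OF that, of "\<ominus> \<one>"] that assms(1) by (auto simp: l_minus)
 then show "subgroup I (add_monoid R)"
  using assms(1-3) by (intro add.subgroupI) (auto simp: a_inv_def)
qed (use assms ring_axioms in auto)

context fin_group_field
begin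

lemma order_inv:
 obtains c where "c \<in> carrier K" "c \<otimes>\<^sub>K (\<Oplus>\<^sub>K g\<in>carrier G. \<one>\<^sub>K) = \<one>\<^sub>K"
proof -
 have "(\<Oplus>\<^sub>K g\<in>carrier G. \<one>\<^sub>K) \<in> Units K"
  using order_nz K.field_Units K.finsum_closed by simp
 then show ?thesis using that K.Units_inv_closed K.Units_l_inv by blast
qed

lemma order_inv_square:
 obtains c where "c \<in> carrier K" "c \<otimes>\<^sub>K (\<Oplus>\<^sub>K g\<in>carrier (G \<times>\<times> G). \<one>\<^sub>K) = \<one>\<^sub>K"
proof -
 let ?n = "\<Oplus>\<^sub>K g\<in>carrier G. \<one>\<^sub>K"
 have n: "?n \<in> carrier K" by (rule K.finsum_closed) auto
 have const: "(\<Oplus>\<^sub>K i\<in>A. \<one>\<^sub>K) = [card A] \<cdot>\<^bsub>K\<^esub> \<one>\<^sub>K" for A :: "'z set"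
  by (rule K.add.finprod_const) auto
 have "(\<Oplus>\<^sub>K g\<in>carrier (G \<times>\<times> G). \<one>\<^sub>K) = ?n \<otimes>\<^sub>K ?n"
  unfolding const DirProd_def by (simp add: card_cartesian_product K.add_pow_ldistr K.add.nat_pow_pow mult.commute)
 moreover obtain c where "c \<in> carrier K" "c \<otimes>\<^sub>K ?n = \<one>\<^sub>K" by (rule order_inv)
 moreover have "(c \<otimes>\<^sub>K c) \<otimes>\<^sub>K (m \<otimes>\<^sub>K m) = (c \<otimes>\<^sub>K m) \<otimes>\<^sub>K (c \<otimes>\<^sub>K m)"
  if "m \<in> carrier K" "c \<in> carrier K" for m c
  using that by (simp add: K.m_ac)
 ultimately have "(c \<otimes>\<^sub>K c) \<otimes>\<^sub>K (\<Oplus>\<^sub>K g\<in>carrier (G \<times>\<times> G). \<one>\<^sub>K) = (c \<otimes>\<^sub>K ?n) \<otimes>\<^sub>K (c \<otimes>\<^sub>K ?n)"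
  using n by metis
 then show ?thesis using that[of "c \<otimes>\<^sub>K c"] \<open>c \<in> carrier K\<close> \<open>c \<otimes>\<^sub>K ?n = \<one>\<^sub>K\<close> by simp
qed

text \<open>The group algebra as a bimodule, with the right factor composed with
  \<open>\<tau>\<close>. The identity gives the usual bimodule, and conjugation by x^-1 on H gives
  the twisted one.\<close>

definition two_sided :: "('g \<Rightarrow> 'g) \<Rightarrow> 'g \<times> 'g \<Rightarrow> ('g \<Rightarrow> 'k) \<Rightarrow> ('g \<Rightarrow> 'k)" where
 "two_sided \<tau> = (\<lambda>(g, h) a. \<delta> g \<star> a \<star> \<delta> (inv (\<tau> h)))"

lemma two_sided_action:
 assumes S: "subgroup S G" and \<tau>: "\<And>h. h \<in> S ==> \<tau> h \<in> carrier G"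
  "\<And>g h. [|g \<in> S; h \<in> S|] ==> \<tau> (g \<otimes> h) = \<tau> g \<otimes> \<tau> h"
 shows "action (G\<lparr>carrier := S\<rparr> \<times>\<times> G\<lparr>carrier := S\<rparr>) K KG (two_sided \<tau>)"
proof -
 interpret S: subgroup S G by fact
 let ?S = "G\<lparr>carrier := S\<rparr>"
 have grS: "group ?S" by (rule G.subgroup_imp_group[OF S])
 interpret \<Gamma>: group "?S \<times>\<times> ?S" by (rule DirProd_group[OF grS grS])
 have Sc: "h \<in> S ==> h \<in> carrier G" for h by simp
 have t1: "\<tau> \<one> = \<one>"
 proof -
  have "\<tau> \<one> \<otimes> \<tau> \<one> = \<tau> \<one> \<otimes> \<one>" using \<tau>(2)[of \<one> \<one>] \<tau>(1)[of \<one>] by simp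
  then show ?thesis using \<tau>(1)[of \<one>] G.l_cancel[of "\<tau> \<one>"] by (metis G.one_closed S.one_closed)
 qed
 have "lin_act (?S \<times>\<times> ?S) K KG (two_sided \<tau>)"
  unfolding lin_act_def
 proof (intro conjI ballI)
  fix \<gamma> assume \<gamma>: "\<gamma> \<in> carrier (?S \<times>\<times> ?S)"
  obtain g h where gh: "\<gamma> = (g, h)" "g \<in> S" "h \<in> S" using \<gamma> by (auto simp: DirProd_def)
  show "lin K KG KG (two_sided \<tau> \<gamma>)"
   unfolding gh two_sided_def prod.case
   by (rule lin_comp[OF lin_mult_right lin_mult_left]) (use gh \<tau> in auto)
  fix \<gamma>' v assume \<gamma>': "\<gamma>' \<in> carrier (?S \<times>\<times> ?S)" and v: "v \<in> carrier KG"
  obtain g' h' where gh': "\<gamma>' = (g', h')" "g' \<in> S" "h' \<in> S" using \<gamma>' by (auto simp: DirProd_def)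
  have "\<delta> (g \<otimes> g') = \<delta> g \<star> \<delta> g'" "\<delta> (inv (\<tau> (h \<otimes> h'))) = \<delta> (inv (\<tau> h')) \<star> \<delta> (inv (\<tau> h))"
   using gh gh' \<tau> by (simp_all add: gel_mult G.inv_mult_group)
  then show "two_sided \<tau> (\<gamma> \<otimes>\<^bsub>?S \<times>\<times> ?S\<^esub> \<gamma>') v = two_sided \<tau> \<gamma> (two_sided \<tau> \<gamma>' v)"
   unfolding gh gh' two_sided_def using gh gh' \<tau> v by (simp add: DirProd_def A.m_assoc)
 next
  fix v assume v: "v \<in> carrier KG"
  show "two_sided \<tau> \<one>\<^bsub>?S \<times>\<times> ?S\<^esub> v = v"
   unfolding two_sided_def using v by (simp add: DirProd_def t1 one_KG[symmetric])
 qed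
 moreover have "finite (carrier (?S \<times>\<times> ?S))"
  using finite_subset[OF S.subset fin] by (simp add: DirProd_def)
 ultimately show ?thesis by unfold_locales
qed

text \<open>Maschke for bimodules: project onto \<open>I\<close>, average over \<open>G \<times> G\<close>, and take the image of \<open>1\<close>.\<close>

lemma ideal_generator:
 assumes I: "ideal I KG"
 obtains f where "f \<in> I" "f \<in> ring_center KG" "\<And>a. a \<in> I ==> f \<star> a = a" "\<And>a. a \<in> I ==> a \<star> f = a"
proof -
 note I' = A.ideal_submodule[OF I]
 have sc: "G\<lparr>carrier := carrier G\<rparr> = G" by simp
 have act: "action (G \<times>\<times> G) K KG (two_sided (\<lambda>h. h))"
  using two_sided_action[OF G.subgroup_self, of "\<lambda>h. h"] by simp
 interpret T: action "G \<times>\<times> G" K KG "two_sided (\<lambda>h. h)" by (rule act)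
 have sm: "a \<odot>\<^bsub>KG\<^esub> u \<in> I" if "a \<in> carrier K" "u \<in> I" for a u
 proof -
  have "a \<odot>\<^bsub>KG\<^esub> u = (a \<odot>\<^bsub>KG\<^esub> \<one>\<^bsub>KG\<^esub>) \<star> u"
   using that I'(1) by (subst smult_mult) auto
  then show ?thesis using that I' by simp
 qed
 have sub: "submodule I K KG"
  by (rule V.submoduleI) (use I' sm in auto)
 have "submodule I K (fun_space K (carrier G))"
  using sub unfolding submodule_def submodule_axioms_def by (simp add: group_algebra_simps)
 from projection_exists[OF K.field_axioms fin this]
 obtain P where P: "lin K KG KG P" "\<And>v. v \<in> carrier KG ==> P v \<in> I" "\<And>u. u \<in> I ==> P u = u"
  unfolding lin_def by (auto simp: group_algebra_simps)
 obtain c where c: "c \<in> carrier K" "c \<otimes>\<^sub>K (\<Oplus>\<^sub>K g\<in>carrier (G \<times>\<times> G). \<one>\<^sub>K) = \<one>\<^sub>K"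
  by (rule order_inv_square)
 have inv: "two_sided (\<lambda>h. h) \<gamma> u \<in> I" if "\<gamma> \<in> carrier (G \<times>\<times> G)" "u \<in> I" for \<gamma> u
  using that I' by (auto simp: DirProd_def two_sided_def)
 obtain Q where Q: "lin K KG KG Q" "\<And>v. v \<in> carrier KG ==> Q v \<in> I" "\<And>u. u \<in> I ==> Q u = u"
  "\<And>\<gamma> v. [|\<gamma> \<in> carrier (G \<times>\<times> G); v \<in> carrier KG|] ==> Q (two_sided (\<lambda>h. h) \<gamma> v) = two_sided (\<lambda>h. h) \<gamma> (Q v)"
  using equivariant_projection[OF T.G.group_axioms T.fin module_KG T.act c sub inv P] by blast
 define f where "f = Q \<one>\<^bsub>KG\<^esub>"
 have f: "f \<in> I" "f \<in> carrier KG" unfolding f_def using Q(2) linD(1)[OF Q(1)] by auto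
 \<comment> \<open>Equivariance under (g, 1) and under (1, g^-1), applied to the image
   \<open>f\<close> of 1, evaluates \<open>Q\<close> at g in two ways; their agreement is the
   centrality of \<open>f\<close>.\<close>
 have Ql: "Q (\<delta> g) = \<delta> g \<star> f" and Qr: "Q (\<delta> g) = f \<star> \<delta> g" if g: "g \<in> carrier G" for g
 proof -
  show "Q (\<delta> g) = \<delta> g \<star> f"
   using Q(4)[of "(g, \<one>)" "\<one>\<^bsub>KG\<^esub>"] g f
   by (simp add: DirProd_def two_sided_def one_KG[symmetric] f_def[symmetric])
  show "Q (\<delta> g) = f \<star> \<delta> g"
   using Q(4)[of "(\<one>, inv g)" "\<one>\<^bsub>KG\<^esub>"] g f
   by (simp add: DirProd_def two_sided_def one_KG[symmetric] f_def[symmetric])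
 qed
 have l: "Q u = u \<star> f" and r: "Q u = f \<star> u" if "u \<in> carrier KG" for u
  using lin_eqI[OF module_KG Q(1) lin_mult_right[OF f(2)] Ql that]
   lin_eqI[OF module_KG Q(1) lin_mult_left[OF f(2)] Qr that] by auto
 have "f \<in> ring_center KG" using Ql Qr f by (intro centralI) auto
 then show ?thesis using that f l r Q(3) I'(1) by (metis subsetD)
qed

text \<open>The condition u A \<subseteq> A u makes the left ideal A u two-sided. Central u satisfy
  it; so does the H-part u of a central element u x, which commutes with F[H] only up to conjugation
  by x.\<close>

lemma central_left_ideal: 
 assumes "u \<in> carrier KG" "\<And>a. a \<in> carrier KG ==> \<exists>b\<in>carrier KG. u \<star> a = b \<star> u"
 shows "ideal ((\<lambda>a. a \<star> u) ` carrier KG) KG"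
proof (rule A.idealI')
 show "(\<lambda>a. a \<star> u) ` carrier KG \<subseteq> carrier KG" using assms(1) by auto
 show "\<zero>\<^bsub>KG\<^esub> \<in> (\<lambda>a. a \<star> u) ` carrier KG"
  by (rule image_eqI[of _ _ "\<zero>\<^bsub>KG\<^esub>"]) (use assms in auto)
next
 fix a b assume "a \<in> (\<lambda>a. a \<star> u) ` carrier KG" "b \<in> (\<lambda>a. a \<star> u) ` carrier KG"
 then obtain a' b' where "a = a' \<star> u" "b = b' \<star> u" "a' \<in> carrier KG" "b' \<in> carrier KG" by auto
 then show "a \<oplus>\<^bsub>KG\<^esub> b \<in> (\<lambda>a. a \<star> u) ` carrier KG"
  using assms(1) by (intro image_eqI[of _ _ "a' \<oplus>\<^bsub>KG\<^esub> b'"]) (auto simp: A.l_distr)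
next
 fix a x assume "a \<in> (\<lambda>a. a \<star> u) ` carrier KG" and x: "x \<in> carrier KG"
 then obtain a' where a: "a = a' \<star> u" "a' \<in> carrier KG" by auto
 show "x \<star> a \<in> (\<lambda>a. a \<star> u) ` carrier KG"
  using a x assms(1) by (intro image_eqI[of _ _ "x \<star> a'"]) (auto simp: A.m_assoc)
 obtain b where b: "b \<in> carrier KG" "u \<star> x = b \<star> u" using assms(2)[OF x] by blast
 have "a \<star> x = a' \<star> b \<star> u" using a x b assms(1) by (simp add: A.m_assoc)
 then show "a \<star> x \<in> (\<lambda>a. a \<star> u) ` carrier KG" using a b by auto
qed

text \<open>The ideal of z has an identity element f = b z, which is idempotent and fixes z. If z^n
  = 0, then f = f f^n = f b^n z^n = 0, and z = f z = 0.\<close>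

lemma central_pow_nonzero:
 assumes z: "z \<in> ring_center KG" "z \<noteq> \<zero>\<^bsub>KG\<^esub>"
 shows "z [^]\<^bsub>KG\<^esub> (n::nat) \<noteq> \<zero>\<^bsub>KG\<^esub>"
proof
 assume n: "z [^]\<^bsub>KG\<^esub> n = \<zero>\<^bsub>KG\<^esub>"
 note zc = centralD[OF z(1)]
 have I: "ideal ((\<lambda>a. a \<star> z) ` carrier KG) KG"
  by (rule central_left_ideal) (use zc in auto)
 then obtain f where f: "f \<in> (\<lambda>a. a \<star> z) ` carrier KG" "f \<in> ring_center KG"
  "\<And>a. a \<in> (\<lambda>a. a \<star> z) ` carrier KG ==> f \<star> a = a" by (rule ideal_generator) blast
 then obtain b where b: "b \<in> carrier KG" "f = b \<star> z" by auto
 have fc: "f \<in> carrier KG" using b zc by simp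
 have ff: "f \<star> f = f" using f by blast
 have "z = \<one>\<^bsub>KG\<^esub> \<star> z" using zc by simp
 then have fz: "f \<star> z = z" using f(3) by (metis A.one_closed image_eqI)
 have "f \<star> (f [^]\<^bsub>KG\<^esub> (k::nat)) = f" for k
  by (induction k) (use fc ff in \<open>auto simp: A.m_assoc[symmetric]\<close>)
 moreover have "f [^]\<^bsub>KG\<^esub> k = b [^]\<^bsub>KG\<^esub> k \<star> z [^]\<^bsub>KG\<^esub> k" for k :: nat
  unfolding b(2) using A.pow_mult_distrib[of b z k] zc b by metis
 ultimately have "f = \<zero>\<^bsub>KG\<^esub>" using n b fc by (metis A.nat_pow_closed A.r_null)
 then show False using fz z zc by simp
qed

end

section \<open>Blocks\<close>

lemma block_simps [simp]:
 "monoid.mult (block R e) = monoid.mult R" "add (block R e) = add R" "zero (block R e) = zero R" "one (block R e) = e"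
 "monoid.mult (block_center R e) = monoid.mult R" "add (block_center R e) = add R" "zero (block_center R e) = zero R"
 "one (block_center R e) = e"
 by (simp_all add: block_def block_center_def)

lemma block_smult [simp]:
 fixes R :: "('a, 'b, 'c) module_scheme"
 shows "smult (block R e) = smult R" "smult (block_center R e) = smult R"
 by (simp_all add: block_def block_center_def)

locale ring_block = ring R for R (structure) +
 fixes e assumes ec: "e \<in> ring_center R" and ee: "e \<otimes> e = e"
begin

abbreviation C where "C \<equiv> block_center R e"

lemma e_closed [simp]: "e \<in> carrier R" and e_comm: "a \<in> carrier R ==> e \<otimes> a = a \<otimes> e"
 using ec by (auto simp: ring_center_def)

lemma carrier_block: "carrier (block R e) = {a \<in> carrier R. a \<otimes> e = a}"
proof -
 have "a \<otimes> e \<otimes> e = a \<otimes> e" if "a \<in> carrier R" for a using that ee by (simp add: m_assoc)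
 then show ?thesis unfolding block_def by (auto intro: image_eqI[OF sym])
qed

text \<open>If z = z e, then z b = z (b e) and b z = (b e) z for every b in R, so commuting with the
  block already means commuting with all of R.\<close>

lemma carrier_C: "carrier C = {z \<in> ring_center R. z \<otimes> e = z}"
proof -
 have "z \<otimes> b = b \<otimes> z" if z: "z \<in> carrier R" "z \<otimes> e = z" "\<forall>a\<in>carrier R. a \<otimes> e = a \<longrightarrow> z \<otimes> a = a \<otimes> z"
  and b: "b \<in> carrier R" for z b
 proof -
  have ze: "e \<otimes> z = z" using z(1,2) e_comm[OF z(1)] by simp
  have "b \<otimes> e \<otimes> e = b \<otimes> e" using b ee by (simp add: m_assoc)
  then have "z \<otimes> (b \<otimes> e) = (b \<otimes> e) \<otimes> z" using z(3) b by simp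
  moreover have "z \<otimes> (b \<otimes> e) = z \<otimes> b" using z(1,2) b e_comm[OF b] by (metis m_assoc e_closed)
  moreover have "(b \<otimes> e) \<otimes> z = b \<otimes> z" using z(1) b ze by (simp add: m_assoc)
  ultimately show ?thesis by simp
 qed
 then show ?thesis
  unfolding block_center_def ring_center_def partial_object.select_convs
  by (auto simp: carrier_block)
qed

lemma C_carrierD:
 assumes "z \<in> carrier C"
 shows "z \<in> carrier R" "z \<in> ring_center R" "z \<otimes> e = z" "e \<otimes> z = z" "a \<in> carrier R ==> z \<otimes> a = a \<otimes> z"
 using assms e_comm unfolding carrier_C ring_center_def by auto

lemma center_times_e: "z \<in> ring_center R ==> z \<otimes> e \<in> carrier C"
proof -
 assume z: "z \<in> ring_center R"
 then have zc: "z \<in> carrier R" "\<And>a. a \<in> carrier R ==> z \<otimes> a = a \<otimes> z" by (auto simp: ring_center_def)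
 have "z \<otimes> e \<otimes> a = a \<otimes> (z \<otimes> e)" if a: "a \<in> carrier R" for a
  using zc(1) zc(2)[OF a] e_comm[OF a] a by (metis m_assoc e_closed)
 moreover have "z \<otimes> e \<otimes> e = z \<otimes> e" using zc(1) ee by (simp add: m_assoc)
 ultimately show ?thesis unfolding carrier_C ring_center_def using zc(1) by simp
qed

lemma cring_C: "cring C"
proof -
 have c: "u \<oplus> v \<in> carrier C" "u \<otimes> v \<in> carrier C" "\<ominus> u \<in> carrier C"
  if u: "u \<in> carrier C" and v: "v \<in> carrier C" for u v
 proof -
  note U = C_carrierD[OF u] and V = C_carrierD[OF v]
  show "u \<oplus> v \<in> carrier C" "\<ominus> u \<in> carrier C"
   unfolding carrier_C ring_center_def using U(1,3,5) V(1,3,5)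
   by (auto simp: l_distr r_distr l_minus r_minus)
  have "u \<otimes> v \<otimes> a = a \<otimes> (u \<otimes> v)" if "a \<in> carrier R" for a
   using U(1) V(1) U(5)[OF that] V(5)[OF that] that by (metis m_assoc)
  then show "u \<otimes> v \<in> carrier C"
   unfolding carrier_C ring_center_def using U(1) V(1,3) by (auto simp: m_assoc)
 qed
 have z: "\<zero> \<in> carrier C" unfolding carrier_C ring_center_def by simp
 have e: "e \<in> carrier C" unfolding carrier_C using ec ee by simp
 note D = C_carrierD
 show ?thesis
 proof (rule cringI)
  show "abelian_group C"
  proof (rule abelian_groupI)
   fix u assume u: "u \<in> carrier C"
   show "\<exists>v\<in>carrier C. v \<oplus>\<^sub>C u = \<zero>\<^sub>C"
    by (rule bexI[of _ "\<ominus> u"]) (use u c D(1) in \<open>auto simp: l_neg\<close>)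
  qed (use c z D(1) in \<open>auto simp: a_assoc intro: a_comm\<close>)
  show "comm_monoid C"
  proof (rule comm_monoidI)
   fix u v w assume "u \<in> carrier C" "v \<in> carrier C" "w \<in> carrier C"
   then show "u \<otimes>\<^sub>C v \<otimes>\<^sub>C w = u \<otimes>\<^sub>C (v \<otimes>\<^sub>C w)"
    using D(1) by (simp add: m_assoc)
  qed (use c e D(1,4,5) in auto)
 qed (use D(1) in \<open>auto simp: l_distr\<close>)
qed

lemma e_in_C: "e \<in> carrier C"
 unfolding carrier_C using ec ee by simp

text \<open>The zeroth power in the block is e and not 1. The factor e corrects this one exponent
  and changes no other.\<close>

lemma block_pow:
 assumes "z \<in> carrier R"
 shows "z \<otimes> e = z ==> z [^]\<^bsub>block R e\<^esub> (n::nat) = z [^] n \<otimes> e"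
  and "z [^]\<^sub>C (n::nat) = z [^]\<^bsub>block R e\<^esub> n"
proof -
 show "z [^]\<^sub>C n = z [^]\<^bsub>block R e\<^esub> n" by (simp add: nat_pow_def)
 assume "z \<otimes> e = z"
 then show "z [^]\<^bsub>block R e\<^esub> n = z [^] n \<otimes> e"
 proof (induction n)
  case 0
  then show ?case by (simp add: nat_pow_def)
 next
  case (Suc n)
  have "z [^]\<^bsub>block R e\<^esub> Suc n = z [^]\<^bsub>block R e\<^esub> n \<otimes> z" by (simp add: nat_pow_def)
  then show ?case using Suc assms e_comm[OF assms] by (simp add: m_assoc)
 qed
qed

lemma C_idempotent: "u \<in> carrier C ==> central_idempotent R u \<longleftrightarrow> u \<otimes> u = u"
 unfolding central_idempotent_def using C_carrierD by blast

text \<open>In an orthogonal decomposition u = v + w the summand satisfies v u = v. Hence v e = v,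
  and v is an idempotent of \<open>C\<close>: primitivity in R can be tested inside the center of
  the block.\<close>

lemma primitive_in_C:
 assumes u: "u \<in> carrier C" "u \<otimes> u = u" "u \<noteq> \<zero>"
  and "\<And>v. [|v \<in> carrier C; v \<otimes> v = v; v \<otimes> u = v|] ==> v = \<zero> \<or> v = u"
 shows "primitive_central_idempotent R u"
 unfolding primitive_central_idempotent_def
proof (intro conjI allI impI)
 show "central_idempotent R u" using u C_idempotent by blast
 show "u \<noteq> \<zero>" by fact
 fix v w assume *: "central_idempotent R v \<and> central_idempotent R w \<and> v \<otimes> w = \<zero> \<and> v \<oplus> w = u"
 then have vw: "v \<in> carrier R" "w \<in> carrier R" "v \<otimes> v = v" "v \<otimes> w = \<zero>" "u = v \<oplus> w" "v \<in> ring_center R"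
  by (auto simp: central_idempotent_def ring_center_def)
 have vu: "v \<otimes> u = v" unfolding vw(5) using vw by (simp add: r_distr)
 have "v \<otimes> e = v \<otimes> u \<otimes> e" using vu by simp
 also have "... = v \<otimes> (u \<otimes> e)" using C_carrierD(1)[OF u(1)] vw(1) by (simp add: m_assoc)
 also have "... = v" using C_carrierD(3)[OF u(1)] vu by simp
 finally have "v \<in> carrier C" unfolding carrier_C using vw by simp
 then have "v = \<zero> \<or> v = u" using assms(4) vw vu by blast
 moreover have "w = \<zero>" if "v = u"
 proof -
  have "v \<oplus> w = v \<oplus> \<zero>" using that vw by simp
  then show ?thesis using vw by (metis add.l_cancel zero_closed)
 qed
 ultimately show "v = \<zero> \<or> w = \<zero>" by blast
qed

end

context fin_group_field
begin

lemma block_of_pci: "primitive_central_idempotent KG e ==> ring_block KG e"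
 unfolding primitive_central_idempotent_def central_idempotent_def
 by unfold_locales auto

text \<open>The identity element f of the ideal is a central idempotent with f e = f, so e = f + (e
  - f) is an orthogonal decomposition. As f is nonzero, primitivity leaves e = f.\<close>

lemma primitive_block_simple:
 assumes e: "primitive_central_idempotent KG e"
  and I: "ideal I KG" "\<And>a. a \<in> I ==> a \<star> e = a" "a \<in> I" "a \<noteq> \<zero>\<^bsub>KG\<^esub>"
 shows "e \<in> I"
proof -
 interpret B: ring_block KG e by (rule block_of_pci[OF e])
 obtain f where f: "f \<in> I" "f \<in> ring_center KG" "\<And>a. a \<in> I ==> f \<star> a = a"
  by (rule ideal_generator[OF I(1)]) blast
 have fc: "f \<in> carrier KG" using f(2) by (simp add: ring_center_def)
 have ff: "f \<star> f = f" and fe: "f \<star> e = f" using f I(2) by auto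
 have ef: "e \<star> f = f" using fe B.e_comm[OF fc] by simp
 define g where "g = e \<ominus>\<^bsub>KG\<^esub> f"
 have gc: "g \<in> carrier KG" unfolding g_def using fc by simp
 have "g \<in> ring_center KG" unfolding g_def A.minus_eq using B.ec f(2) ring_center_closed(1,4) by blast
 moreover have "g \<star> g = g" unfolding g_def A.minus_eq using fc ff fe ef B.ee
  by (simp add: A.l_distr A.r_distr A.l_minus A.r_minus A.r_neg A.l_neg A.a_assoc)
 moreover have "f \<star> g = \<zero>\<^bsub>KG\<^esub>" unfolding g_def A.minus_eq using fc ff fe
  by (simp add: A.r_distr A.r_minus A.r_neg)
 moreover have "f \<oplus>\<^bsub>KG\<^esub> g = e" unfolding g_def A.minus_eq using fc
  by (simp add: A.a_lcomm A.r_neg)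
 ultimately have "f = \<zero>\<^bsub>KG\<^esub> \<or> g = \<zero>\<^bsub>KG\<^esub>"
  using e f(2) ff unfolding primitive_central_idempotent_def central_idempotent_def by blast
 moreover have "f \<noteq> \<zero>\<^bsub>KG\<^esub>"
  using f(3)[OF I(3)] I(3,4) A.ideal_submodule(1)[OF I(1)] by (metis A.l_null subsetD)
 ultimately have "g = \<zero>\<^bsub>KG\<^esub>" by blast
 then have "e = f" using \<open>f \<oplus>\<^bsub>KG\<^esub> g = e\<close> fc by simp
 then show ?thesis using f(1) by simp
qed

text \<open>A nonzero central z of the block generates an ideal that contains e, so e = b z for some
  b. The inverse of a central element is central.\<close>

lemma block_center_field:
 assumes e: "primitive_central_idempotent KG e"
 shows "field (block_center KG e)"
proof -
 interpret B: ring_block KG e by (rule block_of_pci[OF e])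
 interpret C: cring "block_center KG e" by (rule B.cring_C)
 have e0: "e \<noteq> \<zero>\<^bsub>KG\<^esub>" using e by (simp add: primitive_central_idempotent_def)
 show ?thesis
 proof (rule C.cring_fieldI2)
  show "\<zero>\<^bsub>B.C\<^esub> \<noteq> \<one>\<^bsub>B.C\<^esub>" using e0 by simp
  fix z assume z: "z \<in> carrier B.C" "z \<noteq> \<zero>\<^bsub>B.C\<^esub>"
  note zC = B.C_carrierD[OF z(1)]
  have I: "ideal ((\<lambda>a. a \<star> z) ` carrier KG) KG"
   by (rule central_left_ideal) (use zC(1,5) in auto)
  have "z \<in> (\<lambda>a. a \<star> z) ` carrier KG"
   by (rule image_eqI[of _ _ "\<one>\<^bsub>KG\<^esub>"]) (use zC(1) in auto)
  then have "e \<in> (\<lambda>a. a \<star> z) ` carrier KG"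
   by (intro primitive_block_simple[OF e I]) (use z zC in \<open>auto simp: A.m_assoc\<close>)
  then obtain b where b: "b \<in> carrier KG" "e = b \<star> z" by auto
  \<comment> \<open>The factor b may lie outside the block; its component b e is the inverse within
    it.\<close>
  define w where "w = b \<star> e"
  have wc: "w \<in> carrier KG" "w \<star> e = w" unfolding w_def using b(1) B.ee by (auto simp: A.m_assoc)
  have wz: "w \<star> z = e"
   unfolding w_def using b zC(1,4) by (simp add: A.m_assoc)
  then have zw: "z \<star> w = e" using zC(5)[OF wc(1)] by simp
  have "w \<star> a = a \<star> w" if a: "a \<in> carrier KG" for a
  proof -
   have ew: "e \<star> w = w" using wc B.e_comm by simp
   have "w \<star> a = w \<star> e \<star> a" using wc by simp
   also have "... = w \<star> (a \<star> e)" using wc(1) a B.e_comm[OF a] by (simp add: A.m_assoc)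
   also have "... = w \<star> ((a \<star> z) \<star> w)"
    unfolding zw[symmetric] using wc a zC(1) by (simp add: A.m_assoc)
   also have "a \<star> z = z \<star> a" using zC(5)[OF a] by simp
   also have "w \<star> ((z \<star> a) \<star> w) = (w \<star> z) \<star> (a \<star> w)"
    using wc a zC(1) by (simp add: A.m_assoc)
   also have "... = e \<star> a \<star> w" unfolding wz using wc a by (simp add: A.m_assoc)
   also have "... = a \<star> w"
    using wc a B.e_comm[OF a] ew by (simp add: A.m_assoc)
   finally show ?thesis .
  qed
  then have "w \<in> carrier B.C" unfolding B.carrier_C ring_center_def using wc by simp
  then show "\<exists>b\<in>carrier B.C. z \<otimes>\<^bsub>B.C\<^esub> b = \<one>\<^bsub>B.C\<^esub>" using zw by auto
 qed
qed

end

section \<open>Matrix representations\<close>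

text \<open>The rectangular version of \<open>mat_vec\<close>, for intertwiners between
  representations of different degrees.\<close>

definition mv :: "('k, 'r) ring_scheme \<Rightarrow> 'j set \<Rightarrow> 'i set \<Rightarrow> ('j \<Rightarrow> 'i \<Rightarrow> 'k) \<Rightarrow> ('i \<Rightarrow> 'k) \<Rightarrow> 'j \<Rightarrow> 'k" where
 "mv K J I M v = (\<lambda>j. if j \<in> J then \<Oplus>\<^sub>K i\<in>I. M j i \<otimes>\<^sub>K v i else \<zero>\<^sub>K)"

lemma mat_vec_mv: "mat_vec K I = mv K I I"
 by (simp add: fun_eq_iff mat_vec_def mv_def)

context cring
begin

abbreviation fs :: "'i set \<Rightarrow> ('a, 'i \<Rightarrow> 'a) module" where "fs I \<equiv> fun_space R I"

lemma fs_module: "module R (fs I)"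
 by (rule fun_space_module[OF is_cring])

lemma fs_val [simp]: "v \<in> carrier (fs I) ==> v i \<in> carrier R"
 by (rule fun_space_val[OF is_cring])

lemma mv_lin:
 assumes "finite I" "M \<in> mat_carrier R J I"
 shows "lin R (fs I) (fs J) (mv R J I M)"
proof -
 have M: "M j i \<in> carrier R" if "j \<in> J" "i \<in> I" for i j using assms(2) that by (simp add: mat_carrier_def)
 show ?thesis
  unfolding lin_def
 proof (intro conjI ballI)
  fix v assume v: "v \<in> carrier (fs I)"
  show "mv R J I M v \<in> carrier (fs J)"
   using M v by (auto simp: fun_space_carrier mv_def intro!: finsum_closed)
  fix u assume u: "u \<in> carrier (fs I)"
  have "(\<Oplus>i\<in>I. M j i \<otimes> (v i \<oplus> u i)) = (\<Oplus>i\<in>I. M j i \<otimes> v i) \<oplus> (\<Oplus>i\<in>I. M j i \<otimes> u i)" if "j \<in> J" for j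
  proof -
   have "(\<Oplus>i\<in>I. M j i \<otimes> (v i \<oplus> u i)) = (\<Oplus>i\<in>I. M j i \<otimes> v i \<oplus> M j i \<otimes> u i)"
    by (rule finsum_cong') (use M u v that in \<open>auto simp: r_distr\<close>)
   also have "... = (\<Oplus>i\<in>I. M j i \<otimes> v i) \<oplus> (\<Oplus>i\<in>I. M j i \<otimes> u i)"
    by (rule finsum_addf) (use M u v that in auto)
   finally show ?thesis .
  qed
  then show "mv R J I M (v \<oplus>\<^bsub>fs I\<^esub> u) = mv R J I M v \<oplus>\<^bsub>fs J\<^esub> mv R J I M u"
   by (simp add: mv_def fun_eq_iff)
 next
  fix a v assume a: "a \<in> carrier R" and v: "v \<in> carrier (fs I)"
  have "(\<Oplus>i\<in>I. M j i \<otimes> (a \<otimes> v i)) = a \<otimes> (\<Oplus>i\<in>I. M j i \<otimes> v i)" if "j \<in> J" for j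
  proof -
   have "(\<Oplus>i\<in>I. M j i \<otimes> (a \<otimes> v i)) = (\<Oplus>i\<in>I. a \<otimes> (M j i \<otimes> v i))"
    by (rule finsum_cong') (use M a v that in \<open>auto simp: m_lcomm\<close>)
   also have "... = a \<otimes> (\<Oplus>i\<in>I. M j i \<otimes> v i)"
    by (rule finsum_rdistr[symmetric]) (use assms(1) M a v that in auto)
   finally show ?thesis .
  qed
  then show "mv R J I M (a \<odot>\<^bsub>fs I\<^esub> v) = a \<odot>\<^bsub>fs J\<^esub> mv R J I M v"
   using a by (simp add: mv_def fun_eq_iff)
 qed
qed

lemma mv_cong:
 assumes "mat_eq_on J I M N" "M \<in> mat_carrier R J I" "v \<in> carrier (fs I)"
 shows "mv R J I M v = mv R J I N v"
proof -
 have "(\<Oplus>i\<in>I. M j i \<otimes> v i) = (\<Oplus>i\<in>I. N j i \<otimes> v i)" if "j \<in> J" for j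
  by (rule finsum_cong') (use assms that in \<open>auto simp: mat_eq_on_def mat_carrier_def\<close>)
 then show ?thesis by (simp add: mv_def fun_eq_iff)
qed

lemma mv_mult:
 assumes "finite I" "finite L" "M \<in> mat_carrier R J I" "N \<in> mat_carrier R I L" "v \<in> carrier (fs L)"
 shows "mv R J L (mat_mult R I M N) v = mv R J I M (mv R I L N v)"
proof -
 have M: "M j i \<in> carrier R" if "j \<in> J" "i \<in> I" for i j using assms(3) that by (simp add: mat_carrier_def)
 have N: "N j i \<in> carrier R" if "j \<in> I" "i \<in> L" for i j using assms(4) that by (simp add: mat_carrier_def)
 have "(\<Oplus>l\<in>L. (\<Oplus>i\<in>I. M j i \<otimes> N i l) \<otimes> v l) = (\<Oplus>i\<in>I. M j i \<otimes> mv R I L N v i)" if j: "j \<in> J" for j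
 proof -
  have "(\<Oplus>l\<in>L. (\<Oplus>i\<in>I. M j i \<otimes> N i l) \<otimes> v l) = (\<Oplus>l\<in>L. \<Oplus>i\<in>I. M j i \<otimes> N i l \<otimes> v l)"
   by (rule finsum_cong') (use assms M N j in \<open>auto intro!: finsum_ldistr finsum_closed\<close>)
  also have "... = (\<Oplus>i\<in>I. \<Oplus>l\<in>L. M j i \<otimes> N i l \<otimes> v l)"
   by (rule finsum_swap) (use assms M N j in auto)
  also have "... = (\<Oplus>i\<in>I. M j i \<otimes> mv R I L N v i)"
  proof (rule finsum_cong')
   fix i assume i: "i \<in> I"
   have "(\<Oplus>l\<in>L. M j i \<otimes> N i l \<otimes> v l) = (\<Oplus>l\<in>L. M j i \<otimes> (N i l \<otimes> v l))"
    by (rule finsum_cong') (use assms M N i j in \<open>auto simp: m_assoc\<close>)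
   also have "... = M j i \<otimes> (\<Oplus>l\<in>L. N i l \<otimes> v l)"
    by (rule finsum_rdistr[symmetric]) (use assms M N i j in auto)
   finally show "(\<Oplus>l\<in>L. M j i \<otimes> N i l \<otimes> v l) = M j i \<otimes> mv R I L N v i" using i by (simp add: mv_def)
  qed (use assms M N j linD(1)[OF mv_lin[OF assms(2,4)] assms(5)] in auto)
  finally show ?thesis .
 qed
 then show ?thesis by (simp add: mv_def[of _ J] mat_mult_def fun_eq_iff)
qed

lemma mv_one:
 assumes "finite I" "v \<in> carrier (fs I)"
 shows "mv R I I (mat_one R) v = v"
proof -
 have "(\<Oplus>j\<in>I. mat_one R i j \<otimes> v j) = v i" if i: "i \<in> I" for i
 proof -
  have "(\<Oplus>j\<in>I. mat_one R i j \<otimes> v j) = mat_one R i i \<otimes> v i"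
   by (rule finsum_single) (use assms i in \<open>auto simp: mat_one_def\<close>)
  then show ?thesis using assms by (simp add: mat_one_def)
 qed
 then show ?thesis using fun_space_out[OF assms(2)] by (simp add: mv_def fun_eq_iff)
qed

lemma gel_fs [simp]: "i \<in> I ==> gel R i \<in> carrier (fs I)"
 by (auto simp: fun_space_carrier gel_def)

lemma fs_expand:
 assumes "finite I" "v \<in> carrier (fs I)"
 shows "v = (\<Oplus>\<^bsub>fs I\<^esub>i\<in>I. v i \<odot>\<^bsub>fs I\<^esub> gel R i)"
proof
 interpret V: module R "fs I" by (rule fs_module)
 have c: "v i \<odot>\<^bsub>fs I\<^esub> gel R i \<in> carrier (fs I)" if "i \<in> I" for i
  using assms(2) that by (intro V.smult_closed) auto
 fix k
 have "(\<Oplus>\<^bsub>fs I\<^esub>i\<in>I. v i \<odot>\<^bsub>fs I\<^esub> gel R i) k = (\<Oplus>i\<in>I. (v i \<odot>\<^bsub>fs I\<^esub> gel R i) k)"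
  by (rule fun_space_finsum[OF is_cring assms(1) c])
 also have "... = v k"
 proof (cases "k \<in> I")
  case True
  have "(\<Oplus>i\<in>I. (v i \<odot>\<^bsub>fs I\<^esub> gel R i) k) = (v k \<odot>\<^bsub>fs I\<^esub> gel R k) k"
   by (rule finsum_single[OF assms(1) True]) (use assms True in \<open>auto simp: gel_def\<close>)
  then show ?thesis using assms by (simp add: gel_def)
 next
  case False
  then show ?thesis using assms fun_space_out[OF assms(2) False]
   by (auto simp: gel_def intro!: add.finprod_one_eqI)
 qed
 finally show "v k = (\<Oplus>\<^bsub>fs I\<^esub>i\<in>I. v i \<odot>\<^bsub>fs I\<^esub> gel R i) k" by simp
qed

lemma lin_is_mv:
 assumes "finite I" "lin R (fs I) (fs J) T" "v \<in> carrier (fs I)"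
 shows "T v = mv R J I (\<lambda>j i. T (gel R i) j) v"
proof
 interpret V: module R "fs I" by (rule fs_module)
 fix k
 have T: "T (gel R i) \<in> carrier (fs J)" if "i \<in> I" for i using linD(1)[OF assms(2)] that by simp
 have c: "v i \<odot>\<^bsub>fs I\<^esub> gel R i \<in> carrier (fs I)" if "i \<in> I" for i
  using assms(3) that by (intro V.smult_closed) auto
 have "T v = (\<Oplus>\<^bsub>fs J\<^esub>i\<in>I. T (v i \<odot>\<^bsub>fs I\<^esub> gel R i))"
  using lin_finsum[OF fs_module fs_module assms(2,1), of "\<lambda>i. v i \<odot>\<^bsub>fs I\<^esub> gel R i"] c
   arg_cong[OF fs_expand[OF assms(1,3)], of T] by (simp del: fun_space_simps)
 then have "T v k = (\<Oplus>i\<in>I. T (v i \<odot>\<^bsub>fs I\<^esub> gel R i) k)"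
  using fun_space_finsum[OF is_cring assms(1), of "\<lambda>i. T (v i \<odot>\<^bsub>fs I\<^esub> gel R i)" J k]
   linD(1)[OF assms(2) c] by simp
 also have "... = (\<Oplus>i\<in>I. T (gel R i) k \<otimes> v i)"
 proof (rule finsum_cong')
  fix i assume i: "i \<in> I"
  show "T (v i \<odot>\<^bsub>fs I\<^esub> gel R i) k = T (gel R i) k \<otimes> v i"
   using linD(3)[OF assms(2) fs_val[OF assms(3)] gel_fs[OF i]] fs_val[OF T[OF i]] fs_val[OF assms(3)]
   by (simp add: m_comm)
 qed (use fs_val[OF T] fs_val[OF assms(3)] in auto)
 also have "... = mv R J I (\<lambda>j i. T (gel R i) j) v k"
 proof (cases "k \<in> J")
  case False
  then show ?thesis using fun_space_out[OF T False] assms(3)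
   by (auto simp: mv_def intro!: add.finprod_one_eqI)
 qed (simp add: mv_def)
 finally show "T v k = mv R J I (\<lambda>j i. T (gel R i) j) v k" .
qed

end

lemma rep_lin_act:
 assumes "cring K" "monoid G" "representation G K I \<rho>"
 shows "lin_act G K (fun_space K I) (\<lambda>g. mat_vec K I (\<rho> g))"
proof -
 interpret K: cring K by fact
 interpret G: monoid G by fact
 note r = assms(3)[unfolded representation_def]
 show ?thesis
  unfolding lin_act_def mat_vec_mv
 proof (intro conjI ballI)
  fix g assume g: "g \<in> carrier G"
  show "lin K (fun_space K I) (fun_space K I) (mv K I I (\<rho> g))"
   using K.mv_lin r g by blast
  fix h v assume h: "h \<in> carrier G" and v: "v \<in> carrier (fun_space K I)"
  have "mv K I I (\<rho> (g \<otimes>\<^sub>G h)) v = mv K I I (mat_mult K I (\<rho> g) (\<rho> h)) v"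
   by (rule K.mv_cong) (use r g h v in auto)
  also have "... = mv K I I (\<rho> g) (mv K I I (\<rho> h) v)"
   by (rule K.mv_mult) (use r g h v in auto)
  finally show "mv K I I (\<rho> (g \<otimes>\<^sub>G h)) v = mv K I I (\<rho> g) (mv K I I (\<rho> h) v)" .
 next
  fix v assume v: "v \<in> carrier (fun_space K I)"
  have "mv K I I (\<rho> \<one>\<^sub>G) v = mv K I I (mat_one K) v"
   by (rule K.mv_cong) (use r v in auto)
  then show "mv K I I (\<rho> \<one>\<^sub>G) v = v" using K.mv_one r v by metis
 qed
qed

lemma rep_equivD:
 assumes "cring K" "monoid G" "representation G K I \<rho>" "representation G K J \<sigma>" "rep_equiv G K I \<rho> J \<sigma>"
 obtains T S where "lin K (fun_space K I) (fun_space K J) T" "lin K (fun_space K J) (fun_space K I) S"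
  "\<And>v. v \<in> carrier (fun_space K I) ==> S (T v) = v" "\<And>w. w \<in> carrier (fun_space K J) ==> T (S w) = w"
  "\<And>g v. [|g \<in> carrier G; v \<in> carrier (fun_space K I)|] ==> T (mat_vec K I (\<rho> g) v) = mat_vec K J (\<sigma> g) (T v)"
proof -
 interpret K: cring K by fact
 note r = assms(3)[unfolded representation_def] and s = assms(4)[unfolded representation_def]
 obtain M N where M: "M \<in> mat_carrier K J I" and N: "N \<in> mat_carrier K I J"
  and NM: "mat_eq_on I I (mat_mult K J N M) (mat_one K)" and MN: "mat_eq_on J J (mat_mult K I M N) (mat_one K)"
  and eq: "\<forall>g\<in>carrier G. mat_eq_on J I (mat_mult K I M (\<rho> g)) (mat_mult K J (\<sigma> g) M)"
  using assms(5) unfolding rep_equiv_def by blast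
 have fin: "finite I" "finite J" using r s by auto
 have mc: "mat_mult K L P Q \<in> mat_carrier K A B" if "P \<in> mat_carrier K A L" "Q \<in> mat_carrier K L B" for P Q L A B
  using that by (auto simp: mat_carrier_def mat_mult_def intro!: K.finsum_closed)
 have 1: "mv K I J N (mv K J I M v) = v" if v: "v \<in> carrier (fun_space K I)" for v
 proof -
  have "mv K I J N (mv K J I M v) = mv K I I (mat_mult K J N M) v"
   using K.mv_mult[OF fin(2,1) N M v] by simp
  also have "... = mv K I I (mat_one K) v" by (rule K.mv_cong[OF NM mc[OF N M] v])
  finally show ?thesis using K.mv_one[OF fin(1) v] by simp
 qed
 have 2: "mv K J I M (mv K I J N v) = v" if v: "v \<in> carrier (fun_space K J)" for v
 proof -
  have "mv K J I M (mv K I J N v) = mv K J J (mat_mult K I M N) v"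
   using K.mv_mult[OF fin M N v] by simp
  also have "... = mv K J J (mat_one K) v" by (rule K.mv_cong[OF MN mc[OF M N] v])
  finally show ?thesis using K.mv_one[OF fin(2) v] by simp
 qed
 have 3: "mv K J I M (mat_vec K I (\<rho> g) v) = mat_vec K J (\<sigma> g) (mv K J I M v)"
  if g: "g \<in> carrier G" and v: "v \<in> carrier (fun_space K I)" for g v
 proof -
  have rg: "\<rho> g \<in> mat_carrier K I I" and sg: "\<sigma> g \<in> mat_carrier K J J" using r s g by auto
  have "mv K J I M (mv K I I (\<rho> g) v) = mv K J I (mat_mult K I M (\<rho> g)) v"
   using K.mv_mult[OF fin(1,1) M rg v] by simp
  also have "... = mv K J I (mat_mult K J (\<sigma> g) M) v"
   by (rule K.mv_cong[OF _ mc[OF M rg] v]) (use eq g in blast)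
  also have "... = mv K J J (\<sigma> g) (mv K J I M v)" by (rule K.mv_mult[OF fin(2,1) sg M v])
  finally show ?thesis by (simp add: mat_vec_mv)
 qed
 show ?thesis
  using that[OF K.mv_lin[OF fin(1) M] K.mv_lin[OF fin(2) N]] 1 2 3 by blast
qed

lemma rep_equivI:
 assumes "cring K" "monoid G" "representation G K I \<rho>" "representation G K J \<sigma>"
  and T: "lin K (fun_space K I) (fun_space K J) T" and S: "lin K (fun_space K J) (fun_space K I) S"
  and ST: "\<And>v. v \<in> carrier (fun_space K I) ==> S (T v) = v" and TS: "\<And>w. w \<in> carrier (fun_space K J) ==> T (S w) = w"
  and eq: "\<And>g v. [|g \<in> carrier G; v \<in> carrier (fun_space K I)|] ==> T (mat_vec K I (\<rho> g) v) = mat_vec K J (\<sigma> g) (T v)"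
 shows "rep_equiv G K I \<rho> J \<sigma>"
proof -
 interpret K: cring K by fact
 note r = assms(3)[unfolded representation_def] and s = assms(4)[unfolded representation_def]
 have fin: "finite I" "finite J" using r s by auto
 define M where "M j i = T (gel K i) j" for i j
 define N where "N i j = S (gel K j) i" for i j
 have Mv: "T v = mv K J I M v" if "v \<in> carrier (fun_space K I)" for v
  using K.lin_is_mv[OF fin(1) T that] unfolding M_def .
 have Nv: "S v = mv K I J N v" if "v \<in> carrier (fun_space K J)" for v
  using K.lin_is_mv[OF fin(2) S that] unfolding N_def .
 have M: "M \<in> mat_carrier K J I" unfolding M_def mat_carrier_def
  using linD(1)[OF T K.gel_fs] by (auto intro: K.fs_val)
 have N: "N \<in> mat_carrier K I J" unfolding N_def mat_carrier_def
  using linD(1)[OF S K.gel_fs] by (auto intro: K.fs_val)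
 \<comment> \<open>Entries are values on basis vectors, so each matrix identity required by
   \<open>rep_equiv\<close> becomes an identity of linear maps.\<close>
 have ent: "P j i = mv K A B P (gel K i) j" if "P \<in> mat_carrier K A B" "finite B" "i \<in> B" "j \<in> A" for P A B i j
 proof -
  have P: "P j k \<in> carrier K" if "k \<in> B" for k using \<open>P \<in> _\<close> \<open>j \<in> A\<close> that by (simp add: mat_carrier_def)
  have "mv K A B P (gel K i) j = (\<Oplus>\<^sub>K k\<in>B. P j k \<otimes>\<^sub>K gel K i k)" using that by (simp add: mv_def)
  also have "... = P j i \<otimes>\<^sub>K gel K i i"
   by (rule K.finsum_single[OF that(2,3)]) (use P that in \<open>auto simp: gel_def\<close>)
  finally show ?thesis using P that by (simp add: gel_def)
 qed
 have mc: "mat_mult K L P Q \<in> mat_carrier K A B" if "P \<in> mat_carrier K A L" "Q \<in> mat_carrier K L B" for P Q L A B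
  using that by (auto simp: mat_carrier_def mat_mult_def intro!: K.finsum_closed)
 have eqI: "mat_eq_on A B P Q" if "P \<in> mat_carrier K A B" "Q \<in> mat_carrier K A B" "finite B"
  "\<And>i. i \<in> B ==> mv K A B P (gel K i) = mv K A B Q (gel K i)" for A B P Q
  unfolding mat_eq_on_def using ent[OF that(1,3)] ent[OF that(2,3)] that(4) by simp
 have one: "mat_one K \<in> mat_carrier K A A" for A by (simp add: mat_carrier_def mat_one_def)
 have Tc: "mv K J I M v \<in> carrier (fun_space K J)" if "v \<in> carrier (fun_space K I)" for v
  using linD(1)[OF T that] Mv[OF that] by simp
 have Sc: "mv K I J N v \<in> carrier (fun_space K I)" if "v \<in> carrier (fun_space K J)" for v
  using linD(1)[OF S that] Nv[OF that] by simp
 have "mat_eq_on I I (mat_mult K J N M) (mat_one K)"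
 proof (rule eqI[OF mc[OF N M] one fin(1)])
  fix i assume i: "i \<in> I"
  show "mv K I I (mat_mult K J N M) (gel K i) = mv K I I (mat_one K) (gel K i)"
   using K.mv_mult[OF fin(2,1) N M] K.mv_one[OF fin(1)] ST Mv Nv Tc K.gel_fs[OF i] by simp
 qed
 moreover have "mat_eq_on J J (mat_mult K I M N) (mat_one K)"
 proof (rule eqI[OF mc[OF M N] one fin(2)])
  fix i assume i: "i \<in> J"
  show "mv K J J (mat_mult K I M N) (gel K i) = mv K J J (mat_one K) (gel K i)"
   using K.mv_mult[OF fin M N] K.mv_one[OF fin(2)] TS Mv Nv Sc K.gel_fs[OF i] by simp
 qed
 moreover have "mat_eq_on J I (mat_mult K I M (\<rho> g)) (mat_mult K J (\<sigma> g) M)" if g: "g \<in> carrier G" for g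
 proof -
  have rg: "\<rho> g \<in> mat_carrier K I I" and sg: "\<sigma> g \<in> mat_carrier K J J" using r s g by auto
  show ?thesis
  proof (rule eqI[OF mc[OF M rg] mc[OF sg M] fin(1)])
   fix i assume i: "i \<in> I"
   have c: "mv K I I (\<rho> g) (gel K i) \<in> carrier (fun_space K I)"
    using linD(1)[OF K.mv_lin[OF fin(1) rg] K.gel_fs[OF i]] .
   show "mv K J I (mat_mult K I M (\<rho> g)) (gel K i) = mv K J I (mat_mult K J (\<sigma> g) M) (gel K i)"
    using K.mv_mult[OF fin(1,1) M rg K.gel_fs[OF i]] K.mv_mult[OF fin(2,1) sg M K.gel_fs[OF i]]
     eq[OF g K.gel_fs[OF i]] Mv[OF K.gel_fs[OF i]] Mv[OF c] by (simp add: mat_vec_mv)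
  qed
 qed
 ultimately show ?thesis unfolding rep_equiv_def using M N by blast
qed

lemma irreducible_repD:
 assumes "irreducible_representation G K I \<rho>"
 shows "representation G K I \<rho>" "I \<noteq> {}" "finite I"
  and "[|submodule W K (fun_space K I); \<And>g w. [|g \<in> carrier G; w \<in> W|] ==> mat_vec K I (\<rho> g) w \<in> W;
   w \<in> W; w \<noteq> (\<lambda>_. \<zero>\<^sub>K)|] ==> W = carrier (fun_space K I)"
proof -
 note r = assms[unfolded irreducible_representation_def]
 show "representation G K I \<rho>" "I \<noteq> {}" "finite I" using r by (auto simp: representation_def)
 assume "submodule W K (fun_space K I)" "\<And>g w. [|g \<in> carrier G; w \<in> W|] ==> mat_vec K I (\<rho> g) w \<in> W"
  and w: "w \<in> W" "w \<noteq> (\<lambda>_. \<zero>\<^sub>K)"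
 then have "W = {\<zero>\<^bsub>fun_space K I\<^esub>} \<or> W = carrier (fun_space K I)" using r by meson
 then show "W = carrier (fun_space K I)" using w by auto
qed

lemma lin_kernel_submodule:
 assumes "module K V" "module K W" "lin K V W T"
 shows "submodule {v \<in> carrier V. T v = \<zero>\<^sub>W} K V"
proof -
 interpret V: module K V by fact
 interpret W: module K W by fact
 note T = linD[OF assms(3)]
 have "T (\<ominus>\<^sub>V a) = \<zero>\<^sub>W" if a: "a \<in> carrier V" "T a = \<zero>\<^sub>W" for a
 proof -
  have "\<ominus>\<^sub>V a = (\<ominus>\<^sub>K \<one>\<^sub>K) \<odot>\<^sub>V a" using a by (simp add: V.smult_l_minus)
  then show ?thesis using T(3)[of "\<ominus>\<^sub>K \<one>\<^sub>K" a] a by simp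
 qed
 then show ?thesis
  by (intro V.submoduleI) (use T lin_zero[OF assms] in auto)
qed

lemma lin_image_submodule:
 assumes "module K V" "module K W" "lin K V W T"
 shows "submodule (T ` carrier V) K W"
proof -
 interpret V: module K V by fact
 interpret W: module K W by fact
 note T = linD[OF assms(3)]
 have neg: "\<ominus>\<^sub>W T a = T (\<ominus>\<^sub>V a)" if a: "a \<in> carrier V" for a
 proof -
  have "\<ominus>\<^sub>V a = (\<ominus>\<^sub>K \<one>\<^sub>K) \<odot>\<^sub>V a" using a by (simp add: V.smult_l_minus)
  then show ?thesis using T(3)[of "\<ominus>\<^sub>K \<one>\<^sub>K" a] T(1)[OF a] a by (simp add: W.smult_l_minus)
 qed
 show ?thesis
 proof (intro W.submoduleI)
  show "T ` carrier V \<subseteq> carrier W" using T(1) by blast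
  show "\<zero>\<^sub>W \<in> T ` carrier V" using lin_zero[OF assms] V.M.zero_closed by (metis image_eqI)
  show "\<ominus>\<^sub>W a \<in> T ` carrier V" if "a \<in> T ` carrier V" for a using that neg by auto
  show "a \<oplus>\<^sub>W b \<in> T ` carrier V" if "a \<in> T ` carrier V" "b \<in> T ` carrier V" for a b
  proof -
   from that obtain u v where "a = T u" "b = T v" "u \<in> carrier V" "v \<in> carrier V" by blast
   then show ?thesis using T(2)[of u v] V.M.a_closed[of u v] by (metis image_eqI)
  qed
  show "a \<odot>\<^sub>W b \<in> T ` carrier V" if "a \<in> carrier K" "b \<in> T ` carrier V" for a b
  proof -
   from that obtain u where "b = T u" "u \<in> carrier V" by blast
   then show ?thesis using T(3)[of a u] V.smult_closed[of a u] \<open>a \<in> carrier K\<close> by (metis image_eqI)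
  qed
 qed
qed

text \<open>Kernel and image of an intertwiner are invariant subspaces. The vector v excludes the
  full kernel and the zero image, so T is bijective, and its inverse is linear.\<close>

lemma schur:
 assumes "cring K" "monoid G" "irreducible_representation G K I \<rho>" "irreducible_representation G K J \<sigma>"
  and T: "lin K (fun_space K I) (fun_space K J) T"
  and eq: "\<And>g v. [|g \<in> carrier G; v \<in> carrier (fun_space K I)|] ==> T (mat_vec K I (\<rho> g) v) = mat_vec K J (\<sigma> g) (T v)"
  and nz: "v \<in> carrier (fun_space K I)" "T v \<noteq> (\<lambda>_. \<zero>\<^sub>K)"
 shows "rep_equiv G K I \<rho> J \<sigma>"
proof -
 interpret K: cring K by fact
 let ?V = "fun_space K I" and ?W = "fun_space K J"
 interpret V: module K ?V by (rule K.fs_module)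
 interpret W: module K ?W by (rule K.fs_module)
 note r = irreducible_repD[OF assms(3)] and s = irreducible_repD[OF assms(4)]
 note rl = lin_actD[OF rep_lin_act[OF assms(1,2) r(1)]] and sl = lin_actD[OF rep_lin_act[OF assms(1,2) s(1)]]
 have ker: "w = (\<lambda>_. \<zero>\<^sub>K)" if w: "w \<in> carrier ?V" "T w = (\<lambda>_. \<zero>\<^sub>K)" for w
 proof (rule ccontr)
  assume w0: "w \<noteq> (\<lambda>_. \<zero>\<^sub>K)"
  have sub: "submodule {v \<in> carrier ?V. T v = \<zero>\<^bsub>?W\<^esub>} K ?V"
   by (rule lin_kernel_submodule[OF K.fs_module K.fs_module T])
  have inv: "mat_vec K I (\<rho> g) u \<in> {v \<in> carrier ?V. T v = \<zero>\<^bsub>?W\<^esub>}"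
   if "g \<in> carrier G" "u \<in> {v \<in> carrier ?V. T v = \<zero>\<^bsub>?W\<^esub>}" for g u
   using that rl(4) eq lin_zero[OF K.fs_module K.fs_module sl(1)[OF that(1)]] by simp
  have "{v \<in> carrier ?V. T v = \<zero>\<^bsub>?W\<^esub>} = carrier ?V"
   by (rule r(4)[OF sub inv _ w0]) (use w in auto)
  then show False using nz by auto
 qed
 have "T ` carrier ?V = carrier ?W"
 proof (rule s(4)[OF lin_image_submodule[OF K.fs_module K.fs_module T] _ _ nz(2)])
  show "T v \<in> T ` carrier ?V" using nz by blast
  show "mat_vec K J (\<sigma> g) w \<in> T ` carrier ?V" if g: "g \<in> carrier G" and w: "w \<in> T ` carrier ?V" for g w
  proof -
   obtain u where u: "u \<in> carrier ?V" "w = T u" using w by blast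
   then have "mat_vec K J (\<sigma> g) w = T (mat_vec K I (\<rho> g) u)" using eq[OF g u(1)] by simp
   then show ?thesis using rl(4)[OF g u(1)] by blast
  qed
 qed
 moreover have inj: "inj_on T (carrier ?V)"
 proof (rule inj_onI)
  fix a b assume a: "a \<in> carrier ?V" and b: "b \<in> carrier ?V" and ab: "T a = T b"
  have "T (a \<oplus>\<^bsub>?V\<^esub> (\<ominus>\<^sub>K \<one>\<^sub>K) \<odot>\<^bsub>?V\<^esub> b) = T b \<oplus>\<^bsub>?W\<^esub> (\<ominus>\<^sub>K \<one>\<^sub>K) \<odot>\<^bsub>?W\<^esub> T b"
   using linD(2)[OF T a V.smult_closed[OF _ b]] linD(3)[OF T _ b] ab by (simp del: fun_space_simps)
  also have "... = \<zero>\<^bsub>?W\<^esub>" using linD(1)[OF T b] by (simp add: W.smult_l_minus W.M.r_neg del: fun_space_simps)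
  finally have "a \<oplus>\<^bsub>?V\<^esub> (\<ominus>\<^sub>K \<one>\<^sub>K) \<odot>\<^bsub>?V\<^esub> b = \<zero>\<^bsub>?V\<^esub>"
   using ker[of "a \<oplus>\<^bsub>?V\<^esub> (\<ominus>\<^sub>K \<one>\<^sub>K) \<odot>\<^bsub>?V\<^esub> b"] a b
    V.M.a_closed[OF a V.smult_closed[OF _ b], of "\<ominus>\<^sub>K \<one>\<^sub>K"] by simp
  then have "a \<ominus>\<^bsub>?V\<^esub> b = \<zero>\<^bsub>?V\<^esub>"
   using b by (simp add: V.smult_l_minus V.M.minus_eq del: fun_space_simps)
  then show "a = b" using a b V.M.minus_equality[of a "\<ominus>\<^bsub>?V\<^esub> b"] V.M.minus_minus[OF b]
   by (simp add: V.M.minus_eq del: fun_space_simps)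
 qed
 ultimately have bij: "bij_betw T (carrier ?V) (carrier ?W)" by (simp add: bij_betw_def)
 define S where "S = inv_into (carrier ?V) T"
 have ST: "S (T u) = u" if "u \<in> carrier ?V" for u using that inj by (simp add: S_def)
 have TS: "T (S w) = w" "S w \<in> carrier ?V" if "w \<in> carrier ?W" for w
  using that bij by (auto simp: S_def bij_betw_def f_inv_into_f inv_into_into)
 have "lin K ?W ?V S"
  unfolding lin_def
 proof (intro conjI ballI)
  fix w assume w: "w \<in> carrier ?W"
  show "S w \<in> carrier ?V" using TS(2)[OF w] .
  fix w' assume w': "w' \<in> carrier ?W"
  have "S (T (S w \<oplus>\<^bsub>?V\<^esub> S w')) = S w \<oplus>\<^bsub>?V\<^esub> S w'" using TS w w' by (intro ST V.M.a_closed)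
  then show "S (w \<oplus>\<^bsub>?W\<^esub> w') = S w \<oplus>\<^bsub>?V\<^esub> S w'" using linD(2)[OF T TS(2)[OF w] TS(2)[OF w']] TS(1) w w' by simp
 next
  fix a w assume a: "a \<in> carrier K" and w: "w \<in> carrier ?W"
  have "S (T (a \<odot>\<^bsub>?V\<^esub> S w)) = a \<odot>\<^bsub>?V\<^esub> S w" using TS w a by (intro ST V.smult_closed)
  then show "S (a \<odot>\<^bsub>?W\<^esub> w) = a \<odot>\<^bsub>?V\<^esub> S w" using linD(3)[OF T a TS(2)[OF w]] TS(1) w by simp
 qed
 from rep_equivI[OF assms(1,2) r(1) s(1) T this ST TS(1) eq] show ?thesis by blast
qed

abbreviation rep_ext :: "('g, 'm) monoid_scheme \<Rightarrow> ('k, 'r) ring_scheme \<Rightarrow> 'i set \<Rightarrow> ('g \<Rightarrow> 'i \<Rightarrow> 'i \<Rightarrow> 'k) \<Rightarrow>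
  ('g \<Rightarrow> 'k) \<Rightarrow> ('i \<Rightarrow> 'k) \<Rightarrow> 'i \<Rightarrow> 'k" where
 "rep_ext G K I \<rho> \<equiv> ext_act G (fun_space K I) (\<lambda>g. mat_vec K I (\<rho> g))"

context fin_group_field
begin

lemma rep_action: "representation G K I \<rho> ==> action G K (fun_space K I) (\<lambda>g. mat_vec K I (\<rho> g))"
 by (intro action.intro action_axioms.intro rep_lin_act K.fs_module K.is_cring fin G.is_group G.is_monoid)

lemma rep_ext_equivariant:
 assumes "representation G K I \<rho>" "representation G K J \<sigma>" "lin K (fun_space K I) (fun_space K J) T"
  and eq: "\<And>g v. [|g \<in> carrier G; v \<in> carrier (fun_space K I)|] ==> T (mat_vec K I (\<rho> g) v) = mat_vec K J (\<sigma> g) (T v)"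
  and "a \<in> carrier KG" "v \<in> carrier (fun_space K I)"
 shows "T (rep_ext G K I \<rho> a v) = rep_ext G K J \<sigma> a (T v)"
proof -
 interpret R: action G K "fun_space K I" "\<lambda>g. mat_vec K I (\<rho> g)" by (rule rep_action[OF assms(1)])
 interpret S: action G K "fun_space K J" "\<lambda>g. mat_vec K J (\<sigma> g)" by (rule rep_action[OF assms(2)])
 note T = linD[OF assms(3)]
 have "T (rep_ext G K I \<rho> a v) = (\<Oplus>\<^bsub>fun_space K J\<^esub>g\<in>carrier G. T (a g \<odot>\<^bsub>fun_space K I\<^esub> mat_vec K I (\<rho> g) v))"
  unfolding ext_act_def
  by (rule lin_finsum[OF K.fs_module K.fs_module assms(3) fin]) (use assms R.actD(4) in \<open>auto intro!: R.V.smult_closed simp del: fun_space_simps\<close>)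
 also have "... = rep_ext G K J \<sigma> a (T v)"
  unfolding ext_act_def
  by (rule S.V.M.finsum_cong')
   (use assms R.actD(4) S.actD(4) T in \<open>auto intro!: S.V.smult_closed simp del: fun_space_simps\<close>)
 finally show ?thesis .
qed

text \<open>Schur orthogonality. The witness is a matrix coefficient h -> (h^-1 v)_i of \<rho>, as
  an element of the group algebra. Acting on w under \<sigma>, it is the value at v of the
  intertwiner u -> sum over h of (h^-1 u)_i h w, which vanishes by Schur's lemma.\<close>

lemma matrix_coefficient:
 assumes r: "irreducible_representation G K I \<rho>" and s: "irreducible_representation G K J \<sigma>"
  and ineq: "\<not> rep_equiv G K I \<rho> J \<sigma>"
 obtains a v where "a \<in> carrier KG" "v \<in> carrier (fun_space K I)" "rep_ext G K I \<rho> a v \<noteq> (\<lambda>_. \<zero>\<^sub>K)"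
  "\<And>w. w \<in> carrier (fun_space K J) ==> rep_ext G K J \<sigma> a w = (\<lambda>_. \<zero>\<^sub>K)"
proof -
 note r' = irreducible_repD[OF r] and s' = irreducible_repD[OF s]
 interpret R: action G K "fun_space K I" "\<lambda>g. mat_vec K I (\<rho> g)" by (rule rep_action[OF r'(1)])
 interpret S: action G K "fun_space K J" "\<lambda>g. mat_vec K J (\<sigma> g)" by (rule rep_action[OF s'(1)])
 let ?V = "fun_space K I" and ?W = "fun_space K J"
 let ?r = "\<lambda>g. mat_vec K I (\<rho> g)" and ?s = "\<lambda>g. mat_vec K J (\<sigma> g)"
 define a where "a i v = (\<lambda>h. if h \<in> carrier G then ?r (inv h) v i else \<zero>\<^sub>K)" for i v
 have rv: "?r g v i \<in> carrier K" if "g \<in> carrier G" "v \<in> carrier ?V" for g v i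
  using K.fs_val[OF R.actD(4)[OF that]] .
 have aKG: "a i v \<in> carrier KG" if "v \<in> carrier ?V" for i v
  by (rule KG_carrierI) (use rv that in \<open>auto simp: a_def\<close>)
 have kill: "rep_ext G K J \<sigma> (a i v) w = (\<lambda>_. \<zero>\<^sub>K)" if v: "v \<in> carrier ?V" and w: "w \<in> carrier ?W" for i v w
 proof (rule ccontr)
  assume nz: "rep_ext G K J \<sigma> (a i v) w \<noteq> (\<lambda>_. \<zero>\<^sub>K)"
  define T where "T u = (\<Oplus>\<^bsub>?W\<^esub>h\<in>carrier G. ?r (inv h) u i \<odot>\<^bsub>?W\<^esub> ?s h w)" for u
  have "T v = rep_ext G K J \<sigma> (a i v) w"
   unfolding T_def ext_act_def
   by (rule S.V.M.finsum_cong') (use rv S.actD(4) v w in \<open>auto simp: a_def intro!: S.V.smult_closed simp del: fun_space_simps\<close>)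
  then have nz': "T v \<noteq> (\<lambda>_. \<zero>\<^sub>K)" using nz by simp
  have lin1: "lin K ?V ?W (\<lambda>u. ?r (inv h) u i \<odot>\<^bsub>?W\<^esub> ?s h w)" if h: "h \<in> carrier G" for h
   unfolding lin_def
  proof (intro conjI ballI)
   fix u assume u: "u \<in> carrier ?V"
   note l = linD[OF R.actD(1)[OF G.inv_closed[OF h]]]
   show "?r (inv h) u i \<odot>\<^bsub>?W\<^esub> ?s h w \<in> carrier ?W"
    using rv[OF G.inv_closed[OF h] u] S.actD(4)[OF h w] by (rule S.V.smult_closed)
   fix u' assume u': "u' \<in> carrier ?V"
   have "?r (inv h) (u \<oplus>\<^bsub>?V\<^esub> u') i = ?r (inv h) u i \<oplus>\<^sub>K ?r (inv h) u' i"
    using l(2)[OF u u'] by simp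
   then show "?r (inv h) (u \<oplus>\<^bsub>?V\<^esub> u') i \<odot>\<^bsub>?W\<^esub> ?s h w = ?r (inv h) u i \<odot>\<^bsub>?W\<^esub> ?s h w \<oplus>\<^bsub>?W\<^esub> ?r (inv h) u' i \<odot>\<^bsub>?W\<^esub> ?s h w"
    using S.V.smult_l_distr[OF rv[OF G.inv_closed[OF h] u] rv[OF G.inv_closed[OF h] u'] S.actD(4)[OF h w]] by simp
  next
   fix c u assume c: "c \<in> carrier K" and u: "u \<in> carrier ?V"
   have "?r (inv h) (c \<odot>\<^bsub>?V\<^esub> u) i = c \<otimes>\<^sub>K ?r (inv h) u i"
    using linD(3)[OF R.actD(1)[OF G.inv_closed[OF h]] c u] by simp
   then show "?r (inv h) (c \<odot>\<^bsub>?V\<^esub> u) i \<odot>\<^bsub>?W\<^esub> ?s h w = c \<odot>\<^bsub>?W\<^esub> (?r (inv h) u i \<odot>\<^bsub>?W\<^esub> ?s h w)"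
    using S.V.smult_assoc1[OF c rv[OF G.inv_closed[OF h] u] S.actD(4)[OF h w]] by simp
  qed
  have Tl: "lin K ?V ?W T" unfolding T_def by (rule lin_finsum_fun[OF K.fs_module K.fs_module fin lin1])
  have "T (?r k u) = ?s k (T u)" if k: "k \<in> carrier G" and u: "u \<in> carrier ?V" for k u
  proof -
   have c: "?r (inv h) u' i \<odot>\<^bsub>?W\<^esub> ?s h w \<in> carrier ?W" if "h \<in> carrier G" "u' \<in> carrier ?V" for h u'
    using linD(1)[OF lin1] that by blast
   have "T (?r k u) = (\<Oplus>\<^bsub>?W\<^esub>h\<in>carrier G. ?r (inv (k \<otimes> h)) (?r k u) i \<odot>\<^bsub>?W\<^esub> ?s (k \<otimes> h) w)"
    unfolding T_def
    by (rule S.V.M.finsum_bij[OF G.bij_mult_left[OF k], symmetric]) (use c R.actD(4)[OF k u] in blast)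
   also have "... = (\<Oplus>\<^bsub>?W\<^esub>h\<in>carrier G. ?s k (?r (inv h) u i \<odot>\<^bsub>?W\<^esub> ?s h w))"
   proof (rule S.V.M.finsum_cong')
    fix h assume h: "h \<in> carrier G"
    have "?r (inv (k \<otimes> h)) (?r k u) = ?r (inv (k \<otimes> h) \<otimes> k) u"
     using R.actD(2)[of "inv (k \<otimes> h)" k u] h k u by simp
    also have "inv (k \<otimes> h) \<otimes> k = inv h" using h k by (simp add: G.inv_mult_group G.m_assoc)
    finally have "?r (inv (k \<otimes> h)) (?r k u) i = ?r (inv h) u i" by simp
    then show "?r (inv (k \<otimes> h)) (?r k u) i \<odot>\<^bsub>?W\<^esub> ?s (k \<otimes> h) w = ?s k (?r (inv h) u i \<odot>\<^bsub>?W\<^esub> ?s h w)"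
     using S.actD(2)[OF k h w] linD(3)[OF S.actD(1)[OF k] rv[OF G.inv_closed[OF h] u] S.actD(4)[OF h w]]
     by simp
   qed (use c u S.actD(4)[OF k] in blast)+
   also have "... = ?s k (T u)"
    unfolding T_def using lin_finsum[OF K.fs_module K.fs_module S.actD(1)[OF k] fin, of "\<lambda>h. ?r (inv h) u i \<odot>\<^bsub>?W\<^esub> ?s h w"]
     c u by (simp del: fun_space_simps)
   finally show ?thesis .
  qed
  then show False using schur[OF K.is_cring G.is_monoid r s Tl _ v nz'] ineq by blast
 qed
 obtain i0 where i0: "i0 \<in> I" using r'(2) by blast
 define v where "v = gel K i0"
 have v: "v \<in> carrier ?V" unfolding v_def using i0 by simp
 \<comment> \<open>For each h the sum over i of (h^-1 v)_i h e_i is h h^-1 v = v. Summed over h this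
   gives |G| v, which is nonzero, so not every coefficient acts as zero on its basis vector.\<close>
 have "\<exists>i\<in>I. rep_ext G K I \<rho> (a i v) (gel K i) \<noteq> (\<lambda>_. \<zero>\<^sub>K)"
 proof (rule ccontr)
  assume "\<not> ?thesis"
  then have z: "rep_ext G K I \<rho> (a i v) (gel K i) = \<zero>\<^bsub>?V\<^esub>" if "i \<in> I" for i using that by auto
  have c: "a i v h \<odot>\<^bsub>?V\<^esub> ?r h (gel K i) \<in> carrier ?V" if "i \<in> I" "h \<in> carrier G" for i h
   using KG_val[OF aKG[OF v]] R.actD(4)[OF that(2)] K.gel_fs[OF that(1)] by (intro R.V.smult_closed) auto
  have "\<zero>\<^bsub>?V\<^esub> = (\<Oplus>\<^bsub>?V\<^esub>i\<in>I. rep_ext G K I \<rho> (a i v) (gel K i))"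
   by (rule sym, rule R.V.M.add.finprod_one_eqI) (use z in auto)
  also have "... = (\<Oplus>\<^bsub>?V\<^esub>h\<in>carrier G. \<Oplus>\<^bsub>?V\<^esub>i\<in>I. a i v h \<odot>\<^bsub>?V\<^esub> ?r h (gel K i))"
   unfolding ext_act_def by (rule R.V.M.finsum_swap[OF r'(3) fin c])
  also have "... = (\<Oplus>\<^bsub>?V\<^esub>h\<in>carrier G. \<one>\<^sub>K \<odot>\<^bsub>?V\<^esub> v)"
  proof (rule R.V.M.finsum_cong')
   fix h assume h: "h \<in> carrier G"
   let ?u = "?r (inv h) v"
   have u: "?u \<in> carrier ?V" using R.actD(4) h v by simp
   have uc: "?u i \<odot>\<^bsub>?V\<^esub> gel K i \<in> carrier ?V" if "i \<in> I" for i
    using K.fs_val[OF u] K.gel_fs[OF that] by (intro R.V.smult_closed) auto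
   have "(\<Oplus>\<^bsub>?V\<^esub>i\<in>I. a i v h \<odot>\<^bsub>?V\<^esub> ?r h (gel K i)) = (\<Oplus>\<^bsub>?V\<^esub>i\<in>I. ?r h (?u i \<odot>\<^bsub>?V\<^esub> gel K i))"
   proof (rule R.V.M.finsum_cong')
    fix i assume i: "i \<in> I"
    show "a i v h \<odot>\<^bsub>?V\<^esub> ?r h (gel K i) = ?r h (?u i \<odot>\<^bsub>?V\<^esub> gel K i)"
     using linD(3)[OF R.actD(1)[OF h] K.fs_val[OF u] K.gel_fs[OF i]] h by (simp add: a_def)
   qed (use R.actD(4)[OF h] uc in blast)+
   also have "... = ?r h ?u"
    using lin_finsum[OF K.fs_module K.fs_module R.actD(1)[OF h] r'(3), of "\<lambda>i. ?u i \<odot>\<^bsub>?V\<^esub> gel K i"] uc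
     K.fs_expand[OF r'(3) u] by (simp del: fun_space_simps)
   also have "... = v" using R.actD(2)[of h "inv h" v] R.actD(3)[OF v] h v by simp
   also have "... = \<one>\<^sub>K \<odot>\<^bsub>?V\<^esub> v" using R.V.smult_one[OF v] by simp
   finally show "(\<Oplus>\<^bsub>?V\<^esub>i\<in>I. a i v h \<odot>\<^bsub>?V\<^esub> ?r h (gel K i)) = \<one>\<^sub>K \<odot>\<^bsub>?V\<^esub> v" .
  qed (use R.V.smult_closed[OF K.one_closed v] in blast)+
  also have "... = (\<Oplus>\<^sub>K h\<in>carrier G. \<one>\<^sub>K) \<odot>\<^bsub>?V\<^esub> v"
   by (rule R.V.finsum_smult_rdistr[symmetric]) (use fin v in auto)
  finally have "(\<Oplus>\<^sub>K h\<in>carrier G. \<one>\<^sub>K) \<otimes>\<^sub>K v i0 = \<zero>\<^sub>K" by (simp add: fun_eq_iff)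
  then show False using order_nz by (simp add: v_def gel_def)
 qed
 then obtain i where "i \<in> I" "rep_ext G K I \<rho> (a i v) (gel K i) \<noteq> (\<lambda>_. \<zero>\<^sub>K)" by blast
 then show ?thesis using that[of "a i v" "gel K i"] aKG[OF v] kill[OF v] by simp
qed

text \<open>f is the identity element of the annihilator of \<sigma>. For irreducible \<sigma> it is
  one minus the central idempotent belonging to \<sigma>.\<close>

definition annihilator_gen :: "'j set \<Rightarrow> ('g \<Rightarrow> 'j \<Rightarrow> 'j \<Rightarrow> 'k) \<Rightarrow> ('g \<Rightarrow> 'k) \<Rightarrow> bool" where
 "annihilator_gen J \<sigma> f \<longleftrightarrow> f \<in> ring_center KG \<and> (\<forall>w\<in>carrier (fun_space K J). rep_ext G K J \<sigma> f w = (\<lambda>_. \<zero>\<^sub>K)) \<and>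
   (\<forall>a\<in>carrier KG. (\<forall>w\<in>carrier (fun_space K J). rep_ext G K J \<sigma> a w = (\<lambda>_. \<zero>\<^sub>K)) \<longrightarrow> f \<otimes>\<^bsub>KG\<^esub> a = a)"

text \<open>Stability of \<open>S\<close> under the algebra gives the ideal its closure under right
  multiplication. The lemma is applied to a whole representation space and to the block
  F[H]e.\<close>

lemma action_annihilator:
 assumes "action G K V act" "S \<subseteq> carrier V" "\<And>w s. [|w \<in> carrier KG; s \<in> S|] ==> ext_act G V act w s \<in> S"
 shows "ideal {a \<in> carrier KG. \<forall>s\<in>S. ext_act G V act a s = \<zero>\<^sub>V} KG"
proof -
 interpret T: action G K V act by fact
 have l: "T.Ext x \<zero>\<^sub>V = \<zero>\<^sub>V" if "x \<in> carrier KG" for x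
  using lin_zero[OF T.V.module_axioms T.V.module_axioms T.Ext_lin[OF that]] .
 have S: "s \<in> carrier V" if "s \<in> S" for s using assms(2) that by blast
 show ?thesis
 proof (rule A.idealI')
  fix a b assume "a \<in> {a \<in> carrier KG. \<forall>s\<in>S. T.Ext a s = \<zero>\<^sub>V}" "b \<in> {a \<in> carrier KG. \<forall>s\<in>S. T.Ext a s = \<zero>\<^sub>V}"
  then show "a \<oplus>\<^bsub>KG\<^esub> b \<in> {a \<in> carrier KG. \<forall>s\<in>S. T.Ext a s = \<zero>\<^sub>V}"
   using T.Ext_add S by simp
 next
  fix a x assume a: "a \<in> {a \<in> carrier KG. \<forall>s\<in>S. T.Ext a s = \<zero>\<^sub>V}" and x: "x \<in> carrier KG"
  show "x \<otimes>\<^bsub>KG\<^esub> a \<in> {a \<in> carrier KG. \<forall>s\<in>S. T.Ext a s = \<zero>\<^sub>V}"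
   using a x S l by (simp add: T.Ext_mult)
  show "a \<otimes>\<^bsub>KG\<^esub> x \<in> {a \<in> carrier KG. \<forall>s\<in>S. T.Ext a s = \<zero>\<^sub>V}"
   using a x S assms(3) by (simp add: T.Ext_mult)
 qed (use T.Ext_zero S in auto)
qed

lemma annihilator_gen_exists:
 assumes "representation G K J \<sigma>"
 obtains f where "annihilator_gen J \<sigma> f"
proof -
 interpret S: action G K "fun_space K J" "\<lambda>g. mat_vec K J (\<sigma> g)" by (rule rep_action[OF assms])
 have I: "ideal {a \<in> carrier KG. \<forall>s\<in>carrier (fun_space K J). rep_ext G K J \<sigma> a s = \<zero>\<^bsub>fun_space K J\<^esub>} KG"
  by (rule action_annihilator[OF S.action_axioms]) (use S.Ext_closed in auto)
 obtain f where f: "f \<in> {a \<in> carrier KG. \<forall>s\<in>carrier (fun_space K J). rep_ext G K J \<sigma> a s = \<zero>\<^bsub>fun_space K J\<^esub>}"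
   "f \<in> ring_center KG" "\<And>a. a \<in> {a \<in> carrier KG. \<forall>s\<in>carrier (fun_space K J). rep_ext G K J \<sigma> a s = \<zero>\<^bsub>fun_space K J\<^esub>} ==> f \<otimes>\<^bsub>KG\<^esub> a = a"
  by (rule ideal_generator[OF I]) blast
 have "annihilator_gen J \<sigma> f"
  unfolding annihilator_gen_def
 proof (intro conjI ballI impI)
  fix w assume "w \<in> carrier (fun_space K J)"
  then show "rep_ext G K J \<sigma> f w = (\<lambda>_. \<zero>\<^sub>K)" using f(1) by simp
 next
  fix a assume "a \<in> carrier KG" "\<forall>w\<in>carrier (fun_space K J). rep_ext G K J \<sigma> a w = (\<lambda>_. \<zero>\<^sub>K)"
  then show "f \<otimes>\<^bsub>KG\<^esub> a = a" by (intro f(3)) simp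
 qed (rule f(2))
 then show ?thesis using that by blast
qed

text \<open>Some a kills \<sigma> but moves a vector u of \<rho> to a nonzero vector. As f a = a,
  the vector a u is fixed by f, and the vectors fixed by a central element form an invariant
  subspace, here the whole space.\<close>

lemma separation:
 assumes r: "irreducible_representation G K I \<rho>" and s: "irreducible_representation G K J \<sigma>"
  and ineq: "\<not> rep_equiv G K I \<rho> J \<sigma>" and f: "annihilator_gen J \<sigma> f"
  and v: "v \<in> carrier (fun_space K I)"
 shows "rep_ext G K I \<rho> f v = v"
proof -
 note r' = irreducible_repD[OF r]
 interpret R: action G K "fun_space K I" "\<lambda>g. mat_vec K I (\<rho> g)" by (rule rep_action[OF r'(1)])
 let ?V = "fun_space K I" and ?E = "rep_ext G K I \<rho>"
 obtain a u where a: "a \<in> carrier KG" "u \<in> carrier ?V" "?E a u \<noteq> (\<lambda>_. \<zero>\<^sub>K)"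
  "\<And>w. w \<in> carrier (fun_space K J) ==> rep_ext G K J \<sigma> a w = (\<lambda>_. \<zero>\<^sub>K)"
  by (rule matrix_coefficient[OF r s ineq]) blast
 have fc: "f \<in> ring_center KG" "f \<in> carrier KG" and fa: "f \<otimes>\<^bsub>KG\<^esub> a = a"
  using f a unfolding annihilator_gen_def ring_center_def by auto
 have fix1: "?E f (?E a u) = ?E a u" using R.Ext_mult[OF fc(2) a(1,2)] fa by simp
 note L = linD[OF R.Ext_lin[OF fc(2)]]
 have neg: "\<ominus>\<^bsub>?V\<^esub> w = (\<ominus>\<^sub>K \<one>\<^sub>K) \<odot>\<^bsub>?V\<^esub> w" if "w \<in> carrier ?V" for w
  using that by (simp add: R.V.smult_l_minus del: fun_space_simps)
 have "{w \<in> carrier ?V. ?E f w = w} = carrier ?V"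
 proof (rule r'(4)[OF _ _ _ a(3)])
  show "submodule {w \<in> carrier ?V. ?E f w = w} K ?V"
  proof (rule R.V.submoduleI)
   show "\<zero>\<^bsub>?V\<^esub> \<in> {w \<in> carrier ?V. ?E f w = w}"
    using lin_zero[OF K.fs_module K.fs_module R.Ext_lin[OF fc(2)]] R.V.M.zero_closed by blast
   show "\<ominus>\<^bsub>?V\<^esub> w \<in> {w \<in> carrier ?V. ?E f w = w}" if "w \<in> {w \<in> carrier ?V. ?E f w = w}" for w
    using that L(3)[of "\<ominus>\<^sub>K \<one>\<^sub>K" w] R.V.M.a_inv_closed[of w] neg[of w] by (simp del: fun_space_simps)
  qed (use L R.V.M.a_closed R.V.smult_closed in \<open>auto simp del: fun_space_simps\<close>)
  show "mat_vec K I (\<rho> g) w \<in> {w \<in> carrier ?V. ?E f w = w}"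
   if g: "g \<in> carrier G" and w: "w \<in> {w \<in> carrier ?V. ?E f w = w}" for g w
  proof -
   have wc: "w \<in> carrier ?V" "?E f w = w" using w by auto
   have "?E f (mat_vec K I (\<rho> g) w) = ?E f (?E (\<delta> g) w)" using R.Ext_gel[OF g wc(1)] by simp
   also have "... = ?E (\<delta> g) (?E f w)"
    using R.Ext_mult[OF fc(2) gel_closed[OF g] wc(1)] R.Ext_mult[OF gel_closed[OF g] fc(2) wc(1)]
     centralD(2)[OF fc(1) gel_closed[OF g]] by simp
   also have "... = mat_vec K I (\<rho> g) w" using R.Ext_gel[OF g wc(1)] wc(2) by simp
   finally show ?thesis using R.actD(4)[OF g wc(1)] by simp
  qed
  show "?E a u \<in> {w \<in> carrier ?V. ?E f w = w}" using fix1 R.Ext_closed[OF a(1,2)] by blast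
 qed
 then show ?thesis using v by blast
qed

lemma acts_as_identityD:
 assumes "representation G K I \<rho>" "acts_as_identity G K I \<rho> a" "a \<in> carrier KG" "v \<in> carrier (fun_space K I)"
 shows "rep_ext G K I \<rho> a v = v"
proof
 interpret R: action G K "fun_space K I" "\<lambda>g. mat_vec K I (\<rho> g)" by (rule rep_action[OF assms(1)])
 fix i
 have fI: "finite I" and \<rho>: "\<And>g i j. [|g \<in> carrier G; i \<in> I; j \<in> I|] ==> \<rho> g i j \<in> carrier K"
  using assms(1) by (auto simp: representation_def mat_carrier_def)
 have c: "a g \<odot>\<^bsub>fun_space K I\<^esub> mat_vec K I (\<rho> g) v \<in> carrier (fun_space K I)" if "g \<in> carrier G" for g
  using R.actD(4)[OF that assms(4)] assms(3) by (intro R.V.smult_closed) auto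
 show "rep_ext G K I \<rho> a v i = v i"
 proof (cases "i \<in> I")
  case False
  then show ?thesis
   using fun_space_out[OF R.Ext_closed[OF assms(3,4)] False] fun_space_out[OF assms(4) False] by simp
 next
  case True
  have "rep_ext G K I \<rho> a v i = (\<Oplus>\<^sub>K g\<in>carrier G. (a g \<odot>\<^bsub>fun_space K I\<^esub> mat_vec K I (\<rho> g) v) i)"
   unfolding ext_act_def by (rule fun_space_finsum[OF K.is_cring fin c])
  also have "... = (\<Oplus>\<^sub>K g\<in>carrier G. \<Oplus>\<^sub>K j\<in>I. a g \<otimes>\<^sub>K \<rho> g i j \<otimes>\<^sub>K v j)"
  proof (rule K.finsum_cong')
   fix g assume g: "g \<in> carrier G"
   have "a g \<otimes>\<^sub>K (\<Oplus>\<^sub>K j\<in>I. \<rho> g i j \<otimes>\<^sub>K v j) = (\<Oplus>\<^sub>K j\<in>I. a g \<otimes>\<^sub>K (\<rho> g i j \<otimes>\<^sub>K v j))"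
    by (rule K.finsum_rdistr) (use fI \<rho> g True assms in auto)
   also have "... = (\<Oplus>\<^sub>K j\<in>I. a g \<otimes>\<^sub>K \<rho> g i j \<otimes>\<^sub>K v j)"
    by (rule K.finsum_cong') (use \<rho> g True assms in \<open>auto simp: K.m_assoc\<close>)
   finally show "(a g \<odot>\<^bsub>fun_space K I\<^esub> mat_vec K I (\<rho> g) v) i = (\<Oplus>\<^sub>K j\<in>I. a g \<otimes>\<^sub>K \<rho> g i j \<otimes>\<^sub>K v j)"
    using True by (simp add: mat_vec_def)
  qed (use \<rho> True assms in \<open>auto intro!: K.finsum_closed\<close>)
  also have "... = (\<Oplus>\<^sub>K j\<in>I. \<Oplus>\<^sub>K g\<in>carrier G. a g \<otimes>\<^sub>K \<rho> g i j \<otimes>\<^sub>K v j)"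
   by (rule K.finsum_swap) (use fin fI \<rho> True assms in auto)
  also have "... = (\<Oplus>\<^sub>K j\<in>I. mat_one K i j \<otimes>\<^sub>K v j)"
  proof (rule K.finsum_cong')
   fix j assume j: "j \<in> I"
   have "(\<Oplus>\<^sub>K g\<in>carrier G. a g \<otimes>\<^sub>K \<rho> g i j \<otimes>\<^sub>K v j) = (\<Oplus>\<^sub>K g\<in>carrier G. a g \<otimes>\<^sub>K \<rho> g i j) \<otimes>\<^sub>K v j"
    by (rule K.finsum_ldistr[symmetric]) (use fin \<rho> True j assms in auto)
   then show "(\<Oplus>\<^sub>K g\<in>carrier G. a g \<otimes>\<^sub>K \<rho> g i j \<otimes>\<^sub>K v j) = mat_one K i j \<otimes>\<^sub>K v j"
    using assms(2) True j by (simp add: acts_as_identity_def mat_eq_on_def)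
  qed (use assms in \<open>auto simp: mat_one_def\<close>)
  also have "... = v i" using fun_cong[OF K.mv_one[OF fI assms(4)], of i] True by (simp add: mv_def)
  finally show ?thesis .
 qed
qed

end

section \<open>A normal subgroup of prime index\<close>

locale normal_sub = fin_group_field G K
 for G :: "('g, 'm) monoid_scheme" (structure) and K :: "('k, 'r) ring_scheme" +
 fixes H :: "'g set" assumes normal: "H \<lhd> G"
begin

abbreviation HG where "HG \<equiv> G\<lparr>carrier := H\<rparr>"
abbreviation KH :: "('k, 'g \<Rightarrow> 'k) module" where "KH \<equiv> group_algebra K HG"

lemma H_sub: "subgroup H G"
 using normal by (rule normal_imp_subgroup)

sublocale N: normal H G by (rule normal)

lemma H_in [simp]: "h \<in> H ==> h \<in> carrier G"
 using N.subset by blast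

lemma H_inv [simp]: "h \<in> H ==> inv h \<in> H"
 by (rule N.m_inv_closed)

lemma conj_H: "[|g \<in> carrier G; h \<in> H|] ==> g \<otimes> h \<otimes> inv g \<in> H"
 by (rule N.inv_op_closed2)

lemma sub_order_nz:
 assumes S: "subgroup S G"
 shows "(\<Oplus>\<^sub>K g\<in>S. \<one>\<^sub>K) \<noteq> \<zero>\<^sub>K"
proof
 have const: "(\<Oplus>\<^sub>K i\<in>A. \<one>\<^sub>K) = [card A] \<cdot>\<^bsub>K\<^esub> \<one>\<^sub>K" for A :: "'z set"
  by (rule K.add.finprod_const) auto
 assume "(\<Oplus>\<^sub>K g\<in>S. \<one>\<^sub>K) = \<zero>\<^sub>K"
 then have "[card S] \<cdot>\<^bsub>K\<^esub> \<one>\<^sub>K = \<zero>\<^sub>K" unfolding const .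
 moreover have "card S * card (rcosets S) = card (carrier G)"
  using G.lagrange[OF S] by (simp add: order_def mult.commute)
 ultimately have "[card (carrier G)] \<cdot>\<^bsub>K\<^esub> \<one>\<^sub>K = \<zero>\<^sub>K"
  using K.add.nat_pow_pow[OF K.one_closed, of "card (rcosets S)" "card S"] by (simp add: K.add.nat_pow_one)
 then show False using order_nz unfolding const by simp
qed

lemma KH_group_field: "fin_group_field HG K"
proof (intro fin_group_field.intro fin_group_field_axioms.intro)
 show "group HG" by (rule G.subgroup_imp_group[OF H_sub])
 show "field K" by (rule K.field_axioms)
 have "carrier HG = H" by simp
 then show "finite (carrier HG)" "(\<Oplus>\<^sub>K g\<in>carrier HG. \<one>\<^sub>K) \<noteq> \<zero>\<^sub>K"
  using sub_order_nz[OF H_sub] finite_subset[OF N.subset fin] by metis+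
qed

sublocale B: fin_group_field HG K by (rule KH_group_field)

lemma KH_iff: "a \<in> carrier KH \<longleftrightarrow> a \<in> carrier KG \<and> (\<forall>g\<in>carrier G. g \<notin> H \<longrightarrow> a g = \<zero>\<^sub>K)"
proof -
 have *: "(\<forall>g\<in>H. a g \<in> carrier K) \<and> (\<forall>g. g \<notin> H \<longrightarrow> a g = \<zero>\<^sub>K) \<longleftrightarrow>
  ((\<forall>g\<in>carrier G. a g \<in> carrier K) \<and> (\<forall>g. g \<notin> carrier G \<longrightarrow> a g = \<zero>\<^sub>K)) \<and>
  (\<forall>g\<in>carrier G. g \<notin> H \<longrightarrow> a g = \<zero>\<^sub>K)"
 proof (intro iffI conjI ballI allI impI)
  fix g assume "(\<forall>g\<in>H. a g \<in> carrier K) \<and> (\<forall>g. g \<notin> H \<longrightarrow> a g = \<zero>\<^sub>K)"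
  then show "a g \<in> carrier K" by (cases "g \<in> H") auto
 qed (use N.subset in auto)
 have "carrier HG = H" by simp
 then show ?thesis unfolding group_algebra_simps(1) fun_space_carrier using * by metis
qed

lemma KH_KG [simp]: "a \<in> carrier KH ==> a \<in> carrier KG"
 by (simp add: KH_iff)

lemma KH_ops [simp]:
 "add KH = add KG" "zero KH = zero KG" "smult KH = smult KG" "one KH = one KG"
 by (simp_all add: group_algebra_simps)

lemma inv_HG: "h \<in> H ==> inv\<^bsub>HG\<^esub> h = inv h"
 using G.m_inv_consistent[OF H_sub] by simp

text \<open>Homogeneous elements of degree A in the grading of the group algebra by G/H. Zero has
  every degree.\<close>

definition deg :: "'g set \<Rightarrow> ('g \<Rightarrow> 'k) \<Rightarrow> bool" where
 "deg A v \<longleftrightarrow> v \<in> carrier KG \<and> (\<forall>g\<in>carrier G. v g \<noteq> \<zero>\<^sub>K \<longrightarrow> H #> g = A)"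

lemma coset_H_iff: "g \<in> carrier G ==> H #> g = H \<longleftrightarrow> g \<in> H"
 using G.coset_join1[OF _ _ H_sub] G.coset_join2[OF _ H_sub] by blast

lemma deg_H_iff: "deg H v \<longleftrightarrow> v \<in> carrier KH"
 unfolding deg_def KH_iff using coset_H_iff by blast

lemma coset_mult: "[|g \<in> carrier G; h \<in> carrier G|] ==> H #> (g \<otimes> h) = (H #> g) <#> (H #> h)"
 using N.rcos_sum by simp

lemma deg_gel: "g \<in> carrier G ==> deg (H #> g) (\<delta> g)"
 by (simp add: deg_def) (simp add: gel_def)

lemma mult_nonzeroD:
 assumes "v \<in> carrier KG" "w \<in> carrier KG" "g \<in> carrier G" "(v \<star> w) g \<noteq> \<zero>\<^sub>K"
 obtains h where "h \<in> carrier G" "v h \<noteq> \<zero>\<^sub>K" "w (inv h \<otimes> g) \<noteq> \<zero>\<^sub>K"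
proof -
 have "(v \<star> w) g = (\<Oplus>\<^sub>K h\<in>carrier G. v h \<otimes>\<^sub>K w (inv h \<otimes> g))"
  using assms(3) by (simp add: group_algebra_def)
 then have "\<exists>h\<in>carrier G. v h \<otimes>\<^sub>K w (inv h \<otimes> g) \<noteq> \<zero>\<^sub>K"
  using assms(4) K.add.finprod_one_eqI[of "carrier G" "\<lambda>h. v h \<otimes>\<^sub>K w (inv h \<otimes> g)"] by auto
 then obtain h where h: "h \<in> carrier G" "v h \<otimes>\<^sub>K w (inv h \<otimes> g) \<noteq> \<zero>\<^sub>K" by blast
 then have "v h \<noteq> \<zero>\<^sub>K" "w (inv h \<otimes> g) \<noteq> \<zero>\<^sub>K"
  using KG_val[OF assms(1)] KG_val[OF assms(2)] by auto
 then show ?thesis using that h(1) by blast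
qed

lemma deg_mult:
 assumes "deg A v" "deg B w"
 shows "deg (A <#> B) (v \<star> w)"
 unfolding deg_def
proof (intro conjI ballI impI)
 note c = assms[unfolded deg_def]
 show "v \<star> w \<in> carrier KG" using c by simp
 fix g assume g: "g \<in> carrier G" "(v \<star> w) g \<noteq> \<zero>\<^sub>K"
 obtain h where h: "h \<in> carrier G" "v h \<noteq> \<zero>\<^sub>K" "w (inv h \<otimes> g) \<noteq> \<zero>\<^sub>K"
  using mult_nonzeroD[OF _ _ g] c by blast
 have "H #> g = H #> (h \<otimes> (inv h \<otimes> g))" using g h by (simp add: G.m_assoc[symmetric])
 also have "... = (H #> h) <#> (H #> (inv h \<otimes> g))" using g h by (intro coset_mult) auto
 also have "... = A <#> B" using c h g by simp
 finally show "H #> g = A <#> B" .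
qed

lemma KH_mult_closed: "[|a \<in> carrier KH; b \<in> carrier KH|] ==> a \<star> b \<in> carrier KH"
proof -
 assume ab: "a \<in> carrier KH" "b \<in> carrier KH"
 have "H <#> H = H" using coset_mult[of \<one> \<one>] coset_H_iff[of \<one>] N.one_closed by (metis G.one_closed G.r_one)
 then show ?thesis using deg_mult[of H a H b] ab by (simp add: deg_H_iff)
qed

lemma KH_mult:
 assumes "a \<in> carrier KH" "b \<in> carrier KH"
 shows "a \<otimes>\<^bsub>KH\<^esub> b = a \<star> b"
proof (rule B.KG_eqI)
 show "a \<star> b \<in> carrier KH" by (rule KH_mult_closed[OF assms])
 fix g assume "g \<in> carrier HG"
 then have g: "g \<in> H" by simp
 have "(\<Oplus>\<^sub>K h\<in>carrier G. a h \<otimes>\<^sub>K b (inv h \<otimes> g))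
   = (\<Oplus>\<^sub>K h\<in>H \<union> (carrier G - H). a h \<otimes>\<^sub>K b (inv h \<otimes> g))"
  using N.subset by (simp add: Un_absorb1)
 also have "... = (\<Oplus>\<^sub>K h\<in>H. a h \<otimes>\<^sub>K b (inv h \<otimes> g)) \<oplus>\<^sub>K
   (\<Oplus>\<^sub>K h\<in>carrier G - H. a h \<otimes>\<^sub>K b (inv h \<otimes> g))"
  by (rule K.finsum_Un_disjoint) (use fin finite_subset[OF N.subset fin] assms in auto)
 also have "(\<Oplus>\<^sub>K h\<in>carrier G - H. a h \<otimes>\<^sub>K b (inv h \<otimes> g)) = \<zero>\<^sub>K"
  by (rule K.add.finprod_one_eqI) (use assms in \<open>auto simp: KH_iff\<close>)
 finally have "(a \<star> b) g = (\<Oplus>\<^sub>K h\<in>H. a h \<otimes>\<^sub>K b (inv h \<otimes> g))"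
  using g assms by (simp add: group_algebra_def K.finsum_closed)
 moreover have "(a \<otimes>\<^bsub>KH\<^esub> b) g = (\<Oplus>\<^sub>K h\<in>H. a h \<otimes>\<^sub>K b (inv\<^bsub>HG\<^esub> h \<otimes> g))"
  using g by (simp add: group_algebra_def)
 moreover have "... = (\<Oplus>\<^sub>K h\<in>H. a h \<otimes>\<^sub>K b (inv h \<otimes> g))"
  by (rule K.finsum_cong') (use assms inv_HG in auto)
 ultimately show "(a \<otimes>\<^bsub>KH\<^esub> b) g = (a \<star> b) g" by simp
qed (use assms in auto)

lemma gel_KH [simp]: "h \<in> H ==> \<delta> h \<in> carrier KH"
 using B.gel_closed by simp

definition conj_by :: "'g \<Rightarrow> ('g \<Rightarrow> 'k) \<Rightarrow> 'g \<Rightarrow> 'k" where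
 "conj_by g v = \<delta> g \<star> v \<star> \<delta> (inv g)"

lemma conj_by_closed [simp]: "[|g \<in> carrier G; v \<in> carrier KG|] ==> conj_by g v \<in> carrier KG"
 by (simp add: conj_by_def)

lemma conj_by_val: "[|g \<in> carrier G; v \<in> carrier KG; k \<in> carrier G|] ==> conj_by g v k = v (inv g \<otimes> k \<otimes> g)"
 unfolding conj_by_def by (simp add: gel_left gel_right G.m_assoc)

lemma conj_by_mult:
 assumes "g \<in> carrier G" "u \<in> carrier KG" "v \<in> carrier KG"
 shows "conj_by g (u \<star> v) = conj_by g u \<star> conj_by g v"
proof -
 have "conj_by g u \<star> conj_by g v
   = \<delta> g \<star> u \<star> (\<delta> (inv g) \<star> \<delta> g) \<star> v \<star> \<delta> (inv g)"
  using assms by (simp add: conj_by_def A.m_assoc)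
 then show ?thesis using assms by (simp only: gel_inv) (simp add: conj_by_def A.m_assoc)
qed

lemma conj_by_lin: "g \<in> carrier G ==> lin K KG KG (conj_by g)"
 unfolding conj_by_def by (rule lin_comp[OF lin_mult_right lin_mult_left]) auto

lemma conj_by_fixed_iff:
 assumes "g \<in> carrier G" "v \<in> carrier KG"
 shows "conj_by g v = v \<longleftrightarrow> \<delta> g \<star> v = v \<star> \<delta> g"
proof
 assume "conj_by g v = v"
 then have "v \<star> \<delta> g = \<delta> g \<star> v \<star> (\<delta> (inv g) \<star> \<delta> g)"
  using assms by (simp add: conj_by_def A.m_assoc) (metis A.m_assoc A.m_closed G.inv_closed gel_closed)
 then show "\<delta> g \<star> v = v \<star> \<delta> g" using assms by (simp add: gel_inv)
next
 assume "\<delta> g \<star> v = v \<star> \<delta> g"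
 then show "conj_by g v = v" unfolding conj_by_def using assms by (simp add: A.m_assoc gel_inv)
qed

lemma conj_by_KH:
 assumes "g \<in> carrier G" "v \<in> carrier KH"
 shows "conj_by g v \<in> carrier KH"
proof -
 have "inv g \<otimes> k \<otimes> g \<notin> H" if "k \<in> carrier G" "k \<notin> H" for k
 proof
  assume "inv g \<otimes> k \<otimes> g \<in> H"
  then have "g \<otimes> (inv g \<otimes> k \<otimes> g) \<otimes> inv g \<in> H" using conj_H assms by blast
  moreover have "g \<otimes> (inv g \<otimes> k \<otimes> g) \<otimes> inv g = k"
   using assms that by (simp add: G.m_assoc) (simp add: G.m_assoc[symmetric])
  ultimately show False using that by simp
 qed
 then show ?thesis using assms by (auto simp: KH_iff conj_by_val)
qed

lemma conj_by_center:
 assumes g: "g \<in> carrier G" and z: "z \<in> ring_center KH"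
 shows "conj_by g z \<in> ring_center KH"
proof -
 note zc = B.centralD[OF z]
 have "conj_by g z \<star> v = v \<star> conj_by g z" if v: "v \<in> carrier KH" for v
 proof -
  define w where "w = conj_by (inv g) v"
  have w: "w \<in> carrier KH" unfolding w_def using g v by (intro conj_by_KH) auto
  have v': "conj_by g w = v"
  proof (rule KG_eqI)
   fix k assume k: "k \<in> carrier G"
   then show "conj_by g w k = v k"
    unfolding w_def using g v by (simp add: conj_by_val G.m_assoc) (simp add: G.m_assoc[symmetric])
  qed (use g v w in auto)
  have "z \<star> w = w \<star> z" using zc(2)[OF w] KH_mult[OF zc(1) w] KH_mult[OF w zc(1)] by simp
  then show ?thesis using conj_by_mult[OF g, of z w] conj_by_mult[OF g, of w z] zc(1) w v' by simp
 qed
 then show ?thesis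
  using conj_by_KH[OF g zc(1)] by (simp add: ring_center_def KH_mult)
qed

end

section \<open>The cyclic quotient G/H and the grading by it\<close>

locale prime_index = normal_sub G K H
 for G :: "('g, 'm) monoid_scheme" (structure) and K :: "('k, 'r) ring_scheme" and H +
 fixes p :: nat assumes p: "Factorial_Ring.prime p" and index: "card (rcosets H) = p"
begin

sublocale Q: group "G Mod H" by (rule N.factorgroup_is_group)

lemma coset_in_Q: "g \<in> carrier G ==> H #> g \<in> carrier (G Mod H)"
 by (simp add: carrier_FactGroup)

lemma order_Q: "order (G Mod H) = p"
 unfolding order_def FactGroup_def using index by simp

lemma ord_coset:
 assumes "y \<in> carrier G" "y \<notin> H"
 shows "Q.ord (H #> y) = p"
proof -
 have "Q.ord (H #> y) dvd p" using Q.ord_dvd_group_order[OF coset_in_Q[OF assms(1)]] order_Q by simp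
 moreover have "Q.ord (H #> y) \<noteq> 1"
  using Q.ord_eq_1[OF coset_in_Q[OF assms(1)]] coset_H_iff assms by simp
 ultimately show ?thesis using p by (auto simp: prime_nat_iff)
qed

lemma p_pos: "p > 0" "p > 1" using p prime_gt_1_nat by (auto intro: prime_gt_0_nat)

lemma coset_pow: "y \<in> carrier G ==> H #> (y [^] (k::nat)) = (H #> y) [^]\<^bsub>G Mod H\<^esub> k"
 using N.FactGroup_pow by simp

lemma pow_coset_inj:
 assumes "y \<in> carrier G" "y \<notin> H"
 shows "inj_on (\<lambda>k::nat. H #> (y [^] k)) {..<p}"
proof -
 have "{0..Q.ord (H #> y) - 1} = {..<p}" using ord_coset[OF assms] p_pos by auto
 then show ?thesis using Q.ord_inj[OF coset_in_Q[OF assms(1)]] by (simp add: coset_pow[OF assms(1)])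
qed

lemma pow_coset_surj:
 assumes "y \<in> carrier G" "y \<notin> H"
 shows "(\<lambda>k::nat. H #> (y [^] k)) ` {..<p} = carrier (G Mod H)"
proof (rule card_subset_eq)
 show "finite (carrier (G Mod H))" using order_Q p_pos by (metis Q.order_gt_0_iff_finite)
 show "(\<lambda>k. H #> y [^] k) ` {..<p} \<subseteq> carrier (G Mod H)" using assms(1) coset_in_Q by auto
 show "card ((\<lambda>k. H #> y [^] k) ` {..<p}) = card (carrier (G Mod H))"
  using card_image[OF pow_coset_inj[OF assms]] order_Q by (simp add: order_def)
qed

lemma pow_p_in_H: "y \<in> carrier G ==> y \<notin> H ==> y [^] p \<in> H"
 using Q.pow_ord_eq_1[OF coset_in_Q, of y] ord_coset[of y] coset_pow[of y p] coset_H_iff[of "y [^] p"] by simp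

lemma decompose:
 assumes "y \<in> carrier G" "y \<notin> H" "g \<in> carrier G"
 obtains h k where "h \<in> H" "k < p" "g = h \<otimes> y [^] (k::nat)"
proof -
 have "H #> g \<in> (\<lambda>k::nat. H #> (y [^] k)) ` {..<p}" using pow_coset_surj[OF assms(1,2)] coset_in_Q[OF assms(3)] by simp
 then obtain k where k: "k < p" "H #> g = H #> (y [^] k)" by auto
 have "g \<in> H #> (y [^] k)" using G.rcos_self[OF assms(3) H_sub] k by simp
 then show ?thesis using that k by (auto simp: r_coset_def)
qed

text \<open>The quotient has prime order, so any coset other than H generates it; in particular it
  is abelian.\<close>

lemma coset_comm:
 assumes "u \<in> carrier G" "k \<in> carrier G"
 shows "(H #> u) <#> (H #> k) = (H #> k) <#> (H #> u)"
proof (cases "k \<in> H")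
 case True
 then have "H #> k = H" using coset_H_iff assms by simp
 then show ?thesis
  using Q.l_one[OF coset_in_Q[OF assms(1)]] Q.r_one[OF coset_in_Q[OF assms(1)]] by simp
next
 case False
 have "H #> u \<in> (\<lambda>i::nat. H #> (k [^] i)) ` {..<p}"
  using pow_coset_surj[OF assms(2) False] coset_in_Q[OF assms(1)] by simp
 then obtain i :: nat where "H #> u = H #> (k [^] i)" by blast
 then have i: "H #> u = (H #> k) [^]\<^bsub>G Mod H\<^esub> i" using coset_pow[OF assms(2)] by simp
 have "(H #> k) [^]\<^bsub>G Mod H\<^esub> i \<otimes>\<^bsub>G Mod H\<^esub> (H #> k) = (H #> k) \<otimes>\<^bsub>G Mod H\<^esub> (H #> k) [^]\<^bsub>G Mod H\<^esub> i"
  using Q.nat_pow_Suc2[OF coset_in_Q[OF assms(2)], of i] by simp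
 then show ?thesis using i by simp
qed

text \<open>A conjugacy class of G thus lies in a single coset of H. Class sums are homogeneous, and
  homogeneous components of central elements are central.\<close>

lemma coset_conj:
 assumes "u \<in> carrier G" "k \<in> carrier G"
 shows "H #> (u \<otimes> k \<otimes> inv u) = H #> k"
proof -
 have "H #> (u \<otimes> k \<otimes> inv u) = ((H #> u) <#> (H #> k)) <#> (H #> inv u)"
  using assms coset_mult by simp
 also have "... = (H #> (k \<otimes> u)) <#> (H #> inv u)" using assms coset_comm coset_mult by simp
 also have "... = H #> (k \<otimes> u \<otimes> inv u)" using assms coset_mult by simp
 finally show ?thesis using assms by (simp add: G.m_assoc)
qed

text \<open>H together with any one element outside it generates G, because the index is prime. The
  freedom to choose y is used with elements other than x.\<close>

lemma commute_generated:
 assumes y: "y \<in> carrier G" "y \<notin> H" and v: "v \<in> carrier KG"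
  and "\<And>h. h \<in> H ==> \<delta> h \<star> v = v \<star> \<delta> h" "\<delta> y \<star> v = v \<star> \<delta> y"
 shows "v \<in> ring_center KG"
proof (rule centralI[OF v])
 have comp: "\<delta> (g \<otimes> k) \<star> v = v \<star> \<delta> (g \<otimes> k)"
  if "g \<in> carrier G" "k \<in> carrier G" "\<delta> g \<star> v = v \<star> \<delta> g" "\<delta> k \<star> v = v \<star> \<delta> k" for g k
 proof -
  have "\<delta> (g \<otimes> k) \<star> v = \<delta> g \<star> (\<delta> k \<star> v)"
   using that(1,2) v by (simp add: gel_mult[symmetric] A.m_assoc)
  also have "... = \<delta> g \<star> v \<star> \<delta> k" unfolding that(4) using that(1,2) v by (simp add: A.m_assoc)
  also have "... = v \<star> \<delta> (g \<otimes> k)" unfolding that(3)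
   using that(1,2) v by (simp add: gel_mult[symmetric] A.m_assoc)
  finally show ?thesis .
 qed
 have pow: "\<delta> (y [^] (k::nat)) \<star> v = v \<star> \<delta> (y [^] k)" for k
 proof (induction k)
  case 0
  then show ?case using assms(4)[of \<one>] N.one_closed by simp
 next
  case (Suc k)
  then show ?case using comp[of "y [^] k" y] y assms(5) by simp
 qed
 fix g assume "g \<in> carrier G"
 then obtain h k where "h \<in> H" "k < p" "g = h \<otimes> y [^] (k::nat)" by (rule decompose[OF y])
 then show "\<delta> g \<star> v = v \<star> \<delta> g" using comp[of h "y [^] k"] pow y assms(4) by simp
qed

text \<open>The homogeneous component of degree C for the grading by G/H.\<close>

definition restr :: "'g set \<Rightarrow> ('g \<Rightarrow> 'k) \<Rightarrow> 'g \<Rightarrow> 'k" where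
 "restr C v = (\<lambda>g. if g \<in> carrier G \<and> H #> g = C then v g else \<zero>\<^sub>K)"

lemma restr_deg: "v \<in> carrier KG ==> deg C (restr C v)"
 unfolding deg_def restr_def by (auto intro!: KG_carrierI)

lemma restr_closed [simp]: "v \<in> carrier KG ==> restr C v \<in> carrier KG"
 using restr_deg by (simp add: deg_def)

lemma restr_central:
 assumes "v \<in> ring_center KG"
 shows "restr C v \<in> ring_center KG"
proof -
 have vc: "v \<in> carrier KG" using centralD(1)[OF assms] .
 show ?thesis
  using assms unfolding central_iff_class_function[OF vc] central_iff_class_function[OF restr_closed[OF vc]]
  by (auto simp: restr_def coset_conj)
qed

lemma restr_mult:
 assumes v: "v \<in> carrier KG" and e: "e \<in> carrier KH"
 shows "restr C v \<star> e = restr C (v \<star> e)"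
proof (rule KG_eqI)
 fix g assume g: "g \<in> carrier G"
 have eq: "H #> h = H #> g" if "h \<in> carrier G" "e (inv h \<otimes> g) \<noteq> \<zero>\<^sub>K" for h
 proof -
  have i: "inv h \<otimes> g \<in> H" using e that g by (auto simp: KH_iff)
  have "H #> g = H #> (h \<otimes> (inv h \<otimes> g))" using that(1) g by (simp add: G.m_assoc[symmetric])
  also have "... = (H #> h) <#> H" using coset_mult[of h "inv h \<otimes> g"] coset_H_iff[of "inv h \<otimes> g"] i that(1) g by simp
  also have "... = H #> h" using Q.r_one[OF coset_in_Q[OF that(1)]] by simp
  finally show ?thesis by simp
 qed
 have "(restr C v \<star> e) g = (\<Oplus>\<^sub>K h\<in>carrier G. restr C v h \<otimes>\<^sub>K e (inv h \<otimes> g))"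
  using g by (simp add: group_algebra_def)
 also have "... = (\<Oplus>\<^sub>K h\<in>carrier G. if H #> g = C then v h \<otimes>\<^sub>K e (inv h \<otimes> g) else \<zero>\<^sub>K)"
 proof (rule K.finsum_cong')
  fix h assume h: "h \<in> carrier G"
  show "restr C v h \<otimes>\<^sub>K e (inv h \<otimes> g) = (if H #> g = C then v h \<otimes>\<^sub>K e (inv h \<otimes> g) else \<zero>\<^sub>K)"
  proof (cases "e (inv h \<otimes> g) = \<zero>\<^sub>K")
   case True
   then show ?thesis using v KG_val[OF restr_closed[OF v]] by simp
  next
   case False
   then show ?thesis using eq[OF h False] h e by (auto simp: restr_def)
  qed
 qed (use v e in auto)
 also have "... = restr C (v \<star> e) g"
  using g by (simp add: restr_def) (simp add: group_algebra_def)
 finally show "(restr C v \<star> e) g = restr C (v \<star> e) g" .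
qed (use assms in auto)

lemma restr_sum:
 assumes y: "y \<in> carrier G" "y \<notin> H" and v: "v \<in> carrier KG"
 shows "v = (\<Oplus>\<^bsub>KG\<^esub>k\<in>{..<p}. restr (H #> (y [^] k)) v)"
proof (rule KG_eqI[OF v])
 show "(\<Oplus>\<^bsub>KG\<^esub>k\<in>{..<p}. restr (H #> (y [^] k)) v) \<in> carrier KG" using v by (intro A.finsum_closed) auto
 fix g assume g: "g \<in> carrier G"
 obtain k where k: "k < p" "H #> g = H #> (y [^] (k::nat))"
  using pow_coset_surj[OF y] coset_in_Q[OF g] by auto
 have inj: "H #> g \<noteq> H #> (y [^] j)" if "j < p" "j \<noteq> k" for j :: nat
  using inj_onD[OF pow_coset_inj[OF y], of j k] that k by auto
 have "(\<Oplus>\<^bsub>KG\<^esub>k\<in>{..<p}. restr (H #> (y [^] k)) v) g = (\<Oplus>\<^sub>K k\<in>{..<p}. restr (H #> (y [^] k)) v g)"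
  using v by (intro KG_finsum) auto
 also have "... = restr (H #> (y [^] k)) v g"
  by (rule K.finsum_single) (use k v inj g in \<open>auto simp: restr_def\<close>)
 also have "... = v g" using g k by (simp add: restr_def)
 finally show "v g = (\<Oplus>\<^bsub>KG\<^esub>k\<in>{..<p}. restr (H #> (y [^] k)) v) g" by simp
qed

end

lemma (in abelian_monoid) finsum_cartesian:
 assumes "finite A" "finite B" "\<And>i j. [|i \<in> A; j \<in> B|] ==> f (i, j) \<in> carrier G"
 shows "(\<Oplus>\<^sub>G q\<in>A \<times> B. f q) = (\<Oplus>\<^sub>G i\<in>A. \<Oplus>\<^sub>G j\<in>B. f (i, j))"
 using assms(1,3)
proof (induction rule: finite_induct)
 case empty
 then show ?case by simp
next
 case (insert a A)
 have eq: "insert a A \<times> B = ({a} \<times> B) \<union> (A \<times> B)" by auto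
 have bij: "bij_betw (\<lambda>j. (a, j)) B ({a} \<times> B)" by (auto simp: bij_betw_def inj_on_def)
 have "(\<Oplus>\<^sub>G q\<in>insert a A \<times> B. f q) = (\<Oplus>\<^sub>G q\<in>{a} \<times> B. f q) \<oplus>\<^sub>G (\<Oplus>\<^sub>G q\<in>A \<times> B. f q)"
  unfolding eq by (rule finsum_Un_disjoint) (use insert assms(2) in auto)
 also have "(\<Oplus>\<^sub>G q\<in>{a} \<times> B. f q) = (\<Oplus>\<^sub>G j\<in>B. f (a, j))"
  by (rule finsum_bij[OF bij, symmetric]) (use insert in auto)
 finally show ?case using insert assms(2) by (simp add: Pi_def)
qed

context action
begin

lemma Ext_lin_left: "v \<in> carrier V ==> module K KG ==> lin K KG V (\<lambda>w. Ext w v)"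
 unfolding lin_def by (simp add: Ext_closed Ext_add Ext_smult)

end

section \<open>A block of F[H] whose idempotent is central in F[G]\<close>

locale inv_block = prime_index G K H p
 for G :: "('g, 'm) monoid_scheme" (structure) and K :: "('k, 'r) ring_scheme" and H p +
 fixes e :: "'g \<Rightarrow> 'k" and x :: 'g
 assumes pci: "primitive_central_idempotent KH e" and e_central: "e \<in> ring_center KG"
  and x: "x \<in> carrier G" "x \<notin> H"
begin

abbreviation Z :: "('k, 'g \<Rightarrow> 'k) module" where "Z \<equiv> block_center KH e"
abbreviation C :: "('k, 'g \<Rightarrow> 'k) module" where "C \<equiv> block_center KG e"

sublocale BZ: ring_block KH e by (rule B.block_of_pci[OF pci])

lemma e_KH [simp]: "e \<in> carrier KH" and e_nz: "e \<noteq> \<zero>\<^bsub>KG\<^esub>"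
 using pci BZ.e_closed by (auto simp: primitive_central_idempotent_def KH_ops)

lemma ee: "e \<star> e = e"
 using BZ.ee by (simp add: KH_mult)

sublocale BC: ring_block KG e
 by unfold_locales (use e_central ee in auto)

lemma Z_field: "field Z"
 by (rule B.block_center_field[OF pci])

lemma Z_mult: "[|u \<in> carrier KH; v \<in> carrier KH|] ==> u \<otimes>\<^sub>Z v = u \<star> v"
 by (simp add: KH_mult)

lemma Z_ops: "add Z = add KG" "zero Z = zero KG" "one Z = e" "smult Z = smult KG"
 by (simp_all add: KH_ops)

lemma Z_D:
 assumes "z \<in> carrier Z"
 shows "z \<in> carrier KH" "z \<in> carrier KG" "z \<in> ring_center KH" "z \<star> e = z" "e \<star> z = z"
  "b \<in> carrier KH ==> z \<star> b = b \<star> z"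
proof -
 note D = BZ.C_carrierD[OF assms]
 show 1: "z \<in> carrier KH" "z \<in> ring_center KH" by fact+
 then show "z \<in> carrier KG" by simp
 show "z \<star> e = z" "e \<star> z = z" using D(3,4) 1 by (simp_all add: KH_mult)
 show "z \<star> b = b \<star> z" if "b \<in> carrier KH" using D(5)[OF that] 1 that by (simp add: KH_mult)
qed

lemma Z_I:
 assumes "z \<in> ring_center KH" "z \<star> e = z" shows "z \<in> carrier Z"
 unfolding BZ.carrier_C using assms B.centralD(1)[OF assms(1)] by (simp add: KH_mult)

lemma central_KG_KH: "[|v \<in> ring_center KG; v \<in> carrier KH|] ==> v \<in> ring_center KH"
 unfolding ring_center_def by (auto simp: KH_mult)

lemma conj_by_e: "g \<in> carrier G ==> conj_by g e = e"
 using conj_by_fixed_iff[of g e] centralD(2)[OF e_central, of "\<delta> g"] by simp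

lemma conj_by_Z:
 assumes "g \<in> carrier G" "z \<in> carrier Z"
 shows "conj_by g z \<in> carrier Z"
 using conj_by_center[OF assms(1) Z_D(3)[OF assms(2)]] conj_by_mult[OF assms(1) Z_D(2)[OF assms(2)], of e]
  Z_D(4)[OF assms(2)] conj_by_e[OF assms(1)] by (intro Z_I) auto

lemma Z_inverse:
 assumes "z \<in> carrier Z" "z \<noteq> \<zero>\<^bsub>KG\<^esub>"
 obtains w where "w \<in> carrier Z" "z \<star> w = e" "w \<star> z = e" "w = inv\<^bsub>Z\<^esub> z"
proof -
 interpret Z: field Z by (rule Z_field)
 have z: "z \<in> Units Z" using assms Z.field_Units by (simp add: Z_ops)
 then have "inv\<^bsub>Z\<^esub> z \<in> carrier Z" "z \<otimes>\<^sub>Z inv\<^bsub>Z\<^esub> z = e" "inv\<^bsub>Z\<^esub> z \<otimes>\<^sub>Z z = e"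
  using Z.Units_inv_closed Z.Units_r_inv Z.Units_l_inv by (auto simp: Z_ops)
 then show ?thesis using that Z_mult[OF Z_D(1) Z_D(1)] assms(1) by metis
qed

text \<open>An idempotent v of \<open>C\<close> satisfies v (e - v) = 0, so it is 0 or e.\<close>

lemma primitive_if_no_zero_divisors:
 assumes "\<And>u v. [|u \<in> carrier C; v \<in> carrier C; u \<star> v = \<zero>\<^bsub>KG\<^esub>|] ==> u = \<zero>\<^bsub>KG\<^esub> \<or> v = \<zero>\<^bsub>KG\<^esub>"
 shows "primitive_central_idempotent KG e"
proof (rule BC.primitive_in_C[OF BC.e_in_C ee e_nz])
 interpret C: cring C by (rule BC.cring_C)
 fix v assume v: "v \<in> carrier C" "v \<star> v = v" "v \<star> e = v"
 have neg: "\<ominus>\<^sub>C v \<in> carrier C" using v by simp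
 have "v \<otimes>\<^sub>C (e \<ominus>\<^sub>C v) = \<zero>\<^sub>C"
  using v BC.e_in_C by (simp only: C.minus_eq C.r_distr C.r_minus C.a_inv_closed) (simp add: C.r_neg[simplified])
 then have "v = \<zero>\<^bsub>KG\<^esub> \<or> e \<ominus>\<^sub>C v = \<zero>\<^sub>C"
  using assms[of v "e \<ominus>\<^sub>C v"] v BC.e_in_C by simp
 then show "v = \<zero>\<^bsub>KG\<^esub> \<or> v = e"
  using C.minus_equality[of e "\<ominus>\<^sub>C v"] C.minus_minus[OF v(1)] v BC.e_in_C by (auto simp: C.minus_eq)
qed

text \<open>H centralizes Z in any case, so this condition on x places Z inside the center of
  F[G].\<close>

definition fixed :: bool where "fixed \<longleftrightarrow> (\<forall>z\<in>carrier Z. \<delta> x \<star> z = z \<star> \<delta> x)"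

lemma primitive_if_not_fixed:
 assumes "\<not> fixed"
 shows "primitive_central_idempotent KG e"
proof -
 obtain z0 where z0: "z0 \<in> carrier Z" "\<delta> x \<star> z0 \<noteq> z0 \<star> \<delta> x" using assms by (auto simp: fixed_def)
 have van: "v g = \<zero>\<^sub>K" if v: "v \<in> carrier C" and g: "g \<in> carrier G" "g \<notin> H" for v g
 proof -
  note vD = BC.C_carrierD[OF v]
  define c where "c = restr (H #> g) v"
  have cc: "c \<in> ring_center KG" unfolding c_def by (rule restr_central[OF vD(2)])
  note cD = centralD[OF cc]
  have ce: "c \<star> e = c" unfolding c_def using restr_mult[OF vD(1) e_KH] vD(3) by simp
  \<comment> \<open>H and g generate G. If g commuted with \<open>z0\<close>, then \<open>z0\<close>
    would be central in F[G] and x would commute with it.\<close>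
  have "\<exists>z\<in>carrier Z. conj_by g z \<noteq> z"
  proof (rule ccontr)
   assume "\<not> ?thesis"
   then have "\<delta> g \<star> z0 = z0 \<star> \<delta> g" using z0 conj_by_fixed_iff[OF g(1) Z_D(2)[OF z0(1)]] by blast
   then have "z0 \<in> ring_center KG"
    using commute_generated[OF g Z_D(2)[OF z0(1)]] Z_D(6)[OF z0(1)] by simp
   then show False using z0(2) centralD(2)[of z0 "\<delta> x"] x by simp
  qed
  then obtain z where z: "z \<in> carrier Z" "conj_by g z \<noteq> z" by blast
  note zD = Z_D[OF z(1)] and wD = Z_D[OF conj_by_Z[OF g(1) z(1)]]
  \<comment> \<open>\<open>b\<close> is the H-part of c, with c = b g. Commuting c with z gives b (g
    z g^-1) = b z, that is b d = 0 for the nonzero element d = g z g^-1 - z of the field Z;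
    inverting d yields b = 0.\<close>
  define b where "b = c \<star> \<delta> (inv g)"
  have "deg ((H #> g) <#> (H #> inv g)) b" unfolding b_def
   using deg_mult[OF restr_deg[OF vD(1)] deg_gel] g by (simp add: c_def)
  moreover have "(H #> g) <#> (H #> inv g) = H" using coset_mult[of g "inv g"] g coset_H_iff[of \<one>] N.one_closed by simp
  ultimately have bKH: "b \<in> carrier KH" using deg_H_iff by simp
  have bc: "b \<in> carrier KG" using bKH by simp
  have "b \<star> conj_by g z = c \<star> (\<delta> (inv g) \<star> \<delta> g) \<star> z \<star> \<delta> (inv g)"
   unfolding b_def conj_by_def using cD(1) zD(2) g by (simp add: A.m_assoc)
  also have "... = c \<star> z \<star> \<delta> (inv g)" using cD(1) gel_inv(2)[OF g(1)] by simp
  also have "... = z \<star> b" unfolding b_def cD(2)[OF zD(2)] using cD(1) zD(2) g by (simp add: A.m_assoc)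
  also have "... = b \<star> z" by (rule zD(6)[OF bKH])
  finally have bz: "b \<star> conj_by g z = b \<star> z" .
  define d where "d = conj_by g z \<ominus>\<^sub>Z z"
  interpret Z: field Z by (rule Z_field)
  have dZ: "d \<in> carrier Z" unfolding d_def using conj_by_Z[OF g(1) z(1)] z(1) by simp
  have "d \<oplus>\<^sub>Z z = conj_by g z"
   unfolding d_def using conj_by_Z[OF g(1) z(1)] z(1)
   by (simp add: Z.minus_eq Z.a_assoc Z.l_neg del: block_simps KH_ops)
  then have dz: "d \<oplus>\<^bsub>KG\<^esub> z = conj_by g z" by simp
  then have d0: "d \<noteq> \<zero>\<^bsub>KG\<^esub>" using z(2) zD(2) by auto
  have dc: "d \<in> carrier KG" using Z_D(2)[OF dZ] .
  have "b \<star> d \<oplus>\<^bsub>KG\<^esub> b \<star> z = \<zero>\<^bsub>KG\<^esub> \<oplus>\<^bsub>KG\<^esub> b \<star> z"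
   using bz dz bc dc zD(2) A.r_distr[of d z b] by simp
  then have bd: "b \<star> d = \<zero>\<^bsub>KG\<^esub>" using bc dc zD(2) A.add.r_cancel by simp
  obtain d' where d': "d' \<in> carrier Z" "d \<star> d' = e" by (rule Z_inverse[OF dZ d0])
  have "b \<star> e = b \<star> d \<star> d'" using d' bc dc Z_D(2)[OF d'(1)] by (simp add: A.m_assoc)
  then have be: "b \<star> e = \<zero>\<^bsub>KG\<^esub>" using bd Z_D(2)[OF d'(1)] by simp
  have "b \<star> e = c \<star> (\<delta> (inv g) \<star> e)" unfolding b_def using cD(1) g by (simp add: A.m_assoc)
  also have "... = c \<star> e \<star> \<delta> (inv g)" using centralD(2)[OF e_central, of "\<delta> (inv g)"] cD(1) g by (simp add: A.m_assoc)
  also have "... = b" unfolding ce b_def ..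
  finally have b0: "b = \<zero>\<^bsub>KG\<^esub>" using be by simp
  have "c = b \<star> \<delta> g" unfolding b_def using cD(1) g gel_inv(2)[OF g(1)] by (simp add: A.m_assoc)
  then have "c = \<zero>\<^bsub>KG\<^esub>" using b0 g by simp
  then have "c g = \<zero>\<^sub>K" by (simp add: group_algebra_simps(2))
  then show ?thesis using g by (simp add: c_def restr_def)
 qed
 have CZ: "v \<in> carrier Z" if v: "v \<in> carrier C" for v
  using central_KG_KH BC.C_carrierD[OF v] van[OF v] by (intro Z_I) (auto simp: KH_iff)
 interpret Z: field Z by (rule Z_field)
 show ?thesis
 proof (rule primitive_if_no_zero_divisors)
  fix u v assume "u \<in> carrier C" "v \<in> carrier C" and uv: "u \<star> v = \<zero>\<^bsub>KG\<^esub>"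
  then have "u \<in> carrier Z" "v \<in> carrier Z" using CZ by auto
  then show "u = \<zero>\<^bsub>KG\<^esub> \<or> v = \<zero>\<^bsub>KG\<^esub>"
   using Z.integral[of u v] uv Z_mult Z_D(1) by (simp add: Z_ops)
 qed
qed

end

section \<open>The bimodule F[H]e and its twist by x\<close>

context inv_block
begin

abbreviation HH where "HH \<equiv> HG \<times>\<times> HG"

lemma HH_group_field: "fin_group_field HH K"
proof (intro fin_group_field.intro fin_group_field_axioms.intro)
 show "group HH" by (rule DirProd_group[OF B.G.group_axioms B.G.group_axioms])
 show "field K" by (rule K.field_axioms)
 show "finite (carrier HH)" using B.fin by (simp add: DirProd_def)
 obtain c where c: "c \<in> carrier K" "c \<otimes>\<^sub>K (\<Oplus>\<^sub>K g\<in>carrier HH. \<one>\<^sub>K) = \<one>\<^sub>K"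
  by (rule B.order_inv_square)
 then show "(\<Oplus>\<^sub>K g\<in>carrier HH. \<one>\<^sub>K) \<noteq> \<zero>\<^sub>K" by auto
qed

interpretation HH: fin_group_field HH K by (rule HH_group_field)

abbreviation tw :: "'g \<Rightarrow> 'g" where "tw h \<equiv> inv x \<otimes> h \<otimes> x"

lemma tw_H: "h \<in> H ==> tw h \<in> H"
 using conj_H[of "inv x" h] x by simp

lemma tw_mult: "[|g \<in> H; h \<in> H|] ==> tw (g \<otimes> h) = tw g \<otimes> tw h"
proof -
 assume "g \<in> H" "h \<in> H"
 then have gh: "g \<in> carrier G" "h \<in> carrier G" by auto
 have "tw g \<otimes> tw h = inv x \<otimes> g \<otimes> (x \<otimes> inv x) \<otimes> h \<otimes> x"
  using gh x(1) by (simp only: G.m_assoc G.m_closed G.inv_closed)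
 then show ?thesis using gh x(1) by (simp add: G.m_assoc)
qed

interpretation T1: action HH K KG "two_sided (\<lambda>h. h)"
 by (rule two_sided_action[OF H_sub]) auto

interpretation T2: action HH K KG "two_sided tw"
 by (rule two_sided_action[OF H_sub]) (use tw_H tw_mult in auto)

abbreviation KHH where "KHH \<equiv> group_algebra K HH"

text \<open>A pure tensor of K[H x H] separates into left multiplication by u and right
  multiplication by v, the latter carried along h -> \<tau>(h)^-1. This exposes the right factor,
  the only place where the twist is felt.\<close>

lemma Ext_product:
 assumes act: "action HH K KG (two_sided \<tau>)" and \<tau>: "\<And>h. h \<in> H ==> \<tau> h \<in> H"
  and u: "u \<in> carrier KH" and v: "v \<in> carrier KH" and s: "s \<in> carrier KG"
 shows "ext_act HH KG (two_sided \<tau>) (\<lambda>(a, b). u a \<otimes>\<^sub>K v b) s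
  = u \<star> s \<star> (\<Oplus>\<^bsub>KG\<^esub>b\<in>H. v b \<odot>\<^bsub>KG\<^esub> \<delta> (inv (\<tau> b)))"
proof -
 have fH: "finite H" using B.fin by simp
 have val: "u a \<in> carrier K" "v a \<in> carrier K" for a using u v by auto
 have ua: "u a \<odot>\<^bsub>KG\<^esub> \<delta> a \<in> carrier KG" if "a \<in> H" for a using val that by simp
 have vb: "v b \<odot>\<^bsub>KG\<^esub> \<delta> (inv (\<tau> b)) \<in> carrier KG" if "b \<in> H" for b using val \<tau>[OF that] by simp
 have tm: "(u a \<otimes>\<^sub>K v b) \<odot>\<^bsub>KG\<^esub> two_sided \<tau> (a, b) s
   = (u a \<odot>\<^bsub>KG\<^esub> \<delta> a \<star> s) \<star> (v b \<odot>\<^bsub>KG\<^esub> \<delta> (inv (\<tau> b)))" if "a \<in> H" "b \<in> H" for a b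
  using val that \<tau>[OF that(2)] s by (simp add: two_sided_def smult_mult V.smult_assoc1[symmetric] K.m_comm)
 have "ext_act HH KG (two_sided \<tau>) (\<lambda>(a, b). u a \<otimes>\<^sub>K v b) s
   = (\<Oplus>\<^bsub>KG\<^esub>a\<in>H. \<Oplus>\<^bsub>KG\<^esub>b\<in>H. (u a \<otimes>\<^sub>K v b) \<odot>\<^bsub>KG\<^esub> two_sided \<tau> (a, b) s)"
  unfolding ext_act_def DirProd_def
  by (simp, subst A.finsum_cartesian[OF fH fH])
   (use tm ua vb s in \<open>auto intro!: A.m_closed simp del: V.smult_closed\<close>)
 also have "... = (\<Oplus>\<^bsub>KG\<^esub>a\<in>H. (u a \<odot>\<^bsub>KG\<^esub> \<delta> a \<star> s) \<star> (\<Oplus>\<^bsub>KG\<^esub>b\<in>H. v b \<odot>\<^bsub>KG\<^esub> \<delta> (inv (\<tau> b))))"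
 proof (rule A.finsum_cong')
  fix a assume a: "a \<in> H"
  have "(\<Oplus>\<^bsub>KG\<^esub>b\<in>H. (u a \<otimes>\<^sub>K v b) \<odot>\<^bsub>KG\<^esub> two_sided \<tau> (a, b) s)
   = (\<Oplus>\<^bsub>KG\<^esub>b\<in>H. (u a \<odot>\<^bsub>KG\<^esub> \<delta> a \<star> s) \<star> (v b \<odot>\<^bsub>KG\<^esub> \<delta> (inv (\<tau> b))))"
   by (rule A.finsum_cong') (use tm a ua vb s in \<open>auto intro!: A.m_closed\<close>)
  then show "(\<Oplus>\<^bsub>KG\<^esub>b\<in>H. (u a \<otimes>\<^sub>K v b) \<odot>\<^bsub>KG\<^esub> two_sided \<tau> (a, b) s)
   = (u a \<odot>\<^bsub>KG\<^esub> \<delta> a \<star> s) \<star> (\<Oplus>\<^bsub>KG\<^esub>b\<in>H. v b \<odot>\<^bsub>KG\<^esub> \<delta> (inv (\<tau> b)))"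
   using A.finsum_rdistr[OF fH, of "u a \<odot>\<^bsub>KG\<^esub> \<delta> a \<star> s" "\<lambda>b. v b \<odot>\<^bsub>KG\<^esub> \<delta> (inv (\<tau> b))"] ua[OF a] vb s
   by (simp add: Pi_def)
 qed (use ua vb s in \<open>auto intro!: A.m_closed A.finsum_closed\<close>)
 also have "... = (\<Oplus>\<^bsub>KG\<^esub>a\<in>H. u a \<odot>\<^bsub>KG\<^esub> \<delta> a \<star> s) \<star> (\<Oplus>\<^bsub>KG\<^esub>b\<in>H. v b \<odot>\<^bsub>KG\<^esub> \<delta> (inv (\<tau> b)))"
  by (rule A.finsum_ldistr[symmetric]) (use fH ua vb s in \<open>auto intro!: A.m_closed A.finsum_closed\<close>)
 also have "(\<Oplus>\<^bsub>KG\<^esub>a\<in>H. u a \<odot>\<^bsub>KG\<^esub> \<delta> a \<star> s) = (\<Oplus>\<^bsub>KG\<^esub>a\<in>H. u a \<odot>\<^bsub>KG\<^esub> \<delta> a) \<star> s"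
  by (rule A.finsum_ldistr[symmetric]) (use fH ua s in auto)
 also have "(\<Oplus>\<^bsub>KG\<^esub>a\<in>H. u a \<odot>\<^bsub>KG\<^esub> \<delta> a) = u"
 proof -
  have uaH: "u a \<odot>\<^bsub>KH\<^esub> \<delta> a \<in> carrier KH" if "a \<in> H" for a
   using B.V.smult_closed[OF val(1) gel_KH[OF that]] .
  have "(\<Oplus>\<^bsub>KG\<^esub>a\<in>H. u a \<odot>\<^bsub>KG\<^esub> \<delta> a) = (\<Oplus>\<^bsub>KH\<^esub>a\<in>H. u a \<odot>\<^bsub>KH\<^esub> \<delta> a)"
  proof
   fix k
   show "(\<Oplus>\<^bsub>KG\<^esub>a\<in>H. u a \<odot>\<^bsub>KG\<^esub> \<delta> a) k = (\<Oplus>\<^bsub>KH\<^esub>a\<in>H. u a \<odot>\<^bsub>KH\<^esub> \<delta> a) k"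
    using KG_finsum[OF fH, of "\<lambda>a. u a \<odot>\<^bsub>KG\<^esub> \<delta> a" k] ua B.KG_finsum[OF fH, of "\<lambda>a. u a \<odot>\<^bsub>KH\<^esub> \<delta> a" k] uaH
    by simp
  qed
  then show ?thesis using B.KG_expand[OF u] by simp
 qed
 finally show ?thesis .
qed

lemma class_sum_HH:
 assumes "g \<in> H" "h \<in> H"
 shows "class_sum K HH (g, h) = (\<lambda>(a, b). class_sum K HG g a \<otimes>\<^sub>K class_sum K HG h b)"
proof -
 have "(a, b) \<in> {u \<otimes>\<^bsub>HH\<^esub> (g, h) \<otimes>\<^bsub>HH\<^esub> inv\<^bsub>HH\<^esub> u | u. u \<in> carrier HH} \<longleftrightarrow>
   a \<in> {u \<otimes>\<^bsub>HG\<^esub> g \<otimes>\<^bsub>HG\<^esub> inv\<^bsub>HG\<^esub> u | u. u \<in> carrier HG} \<and>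
   b \<in> {u \<otimes>\<^bsub>HG\<^esub> h \<otimes>\<^bsub>HG\<^esub> inv\<^bsub>HG\<^esub> u | u. u \<in> carrier HG}" (is "?L \<longleftrightarrow> ?R1 \<and> ?R2") for a b
 proof
  assume ?L
  then obtain u1 u2 where u: "u1 \<in> carrier HG" "u2 \<in> carrier HG" "(a, b) = (u1, u2) \<otimes>\<^bsub>HH\<^esub> (g, h) \<otimes>\<^bsub>HH\<^esub> inv\<^bsub>HH\<^esub> (u1, u2)"
   by (auto simp: DirProd_def)
  then show "?R1 \<and> ?R2"
   unfolding inv_DirProd[OF B.G.group_axioms B.G.group_axioms u(1,2)] mult_DirProd' by auto
 next
  assume "?R1 \<and> ?R2"
  then obtain u1 u2 where u: "u1 \<in> carrier HG" "u2 \<in> carrier HG" "a = u1 \<otimes>\<^bsub>HG\<^esub> g \<otimes>\<^bsub>HG\<^esub> inv\<^bsub>HG\<^esub> u1" "b = u2 \<otimes>\<^bsub>HG\<^esub> h \<otimes>\<^bsub>HG\<^esub> inv\<^bsub>HG\<^esub> u2"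
   by blast
  then have "(a, b) = (u1, u2) \<otimes>\<^bsub>HH\<^esub> (g, h) \<otimes>\<^bsub>HH\<^esub> inv\<^bsub>HH\<^esub> (u1, u2)"
   unfolding inv_DirProd[OF B.G.group_axioms B.G.group_axioms u(1,2)] by simp
  moreover have "(u1, u2) \<in> carrier HH" using u by (simp add: DirProd_def)
  ultimately show ?L by blast
 qed
 then show ?thesis by (auto simp: class_sum_def fun_eq_iff)
qed

text \<open>n is the sum of the class of h^-1: its value at k is that of the class sum of h at k^-1,
  again a class function on H.\<close>

lemma class_sum_inverse_center:
 assumes "h \<in> H"
 defines "n \<equiv> (\<Oplus>\<^bsub>KG\<^esub>b\<in>H. class_sum K HG h b \<odot>\<^bsub>KG\<^esub> \<delta> (inv b))"
 shows "n \<in> ring_center KH"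
proof -
 have fH: "finite H" using B.fin by simp
 have cc: "class_sum K HG h \<in> ring_center KH" "class_sum K HG h \<in> carrier KH"
  using B.class_sum_central B.class_sum_carrier assms(1) by auto
 have c: "class_sum K HG h b \<odot>\<^bsub>KG\<^esub> \<delta> (inv b) \<in> carrier KG" if "b \<in> H" for b
  using that cc(2) by simp
 have nv: "n k = (if k \<in> H then class_sum K HG h (inv k) else \<zero>\<^sub>K)" for k
 proof -
  have "n k = (\<Oplus>\<^sub>K b\<in>H. (class_sum K HG h b \<odot>\<^bsub>KG\<^esub> \<delta> (inv b)) k)"
   unfolding n_def by (rule KG_finsum[OF fH c])
  also have "... = (if k \<in> H then class_sum K HG h (inv k) else \<zero>\<^sub>K)"
  proof (cases "k \<in> H")
   case True
   have "(\<Oplus>\<^sub>K b\<in>H. (class_sum K HG h b \<odot>\<^bsub>KG\<^esub> \<delta> (inv b)) k) = (class_sum K HG h (inv k) \<odot>\<^bsub>KG\<^esub> \<delta> (inv (inv k))) k"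
    by (rule K.finsum_single[OF fH]) (use True cc(2) in \<open>auto simp: group_algebra_simps(4) gel_def\<close>)
   then show ?thesis using True cc(2) by (simp add: group_algebra_simps(4)) (simp add: gel_def)
  next
   case False
   then show ?thesis using cc(2)
    by (auto simp: group_algebra_simps(4) gel_def intro!: K.add.finprod_one_eqI)
  qed
  finally show ?thesis .
 qed
 have nKH: "n \<in> carrier KH"
  by (rule B.KG_carrierI) (use nv cc(2) in auto)
 show ?thesis
  unfolding B.central_iff_class_function[OF nKH]
 proof (intro ballI)
  fix g k assume g: "g \<in> carrier HG" and k: "k \<in> carrier HG"
  have i: "inv\<^bsub>HG\<^esub> g = inv g" using inv_HG g by simp
  have gH: "g \<in> H" "k \<in> H" using g k by auto
  have gk: "g \<otimes> k \<otimes> inv g \<in> H" using gH by (intro conj_H) auto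
  have "class_sum K HG h (inv (g \<otimes> k \<otimes> inv g)) = class_sum K HG h (g \<otimes> inv k \<otimes> inv g)"
   using gH by (simp add: G.inv_mult_group G.m_assoc)
  also have "... = class_sum K HG h (inv k)"
  proof -
   have "class_sum K HG h (g \<otimes>\<^bsub>HG\<^esub> inv k \<otimes>\<^bsub>HG\<^esub> inv\<^bsub>HG\<^esub> g) = class_sum K HG h (inv k)"
    using cc(1) gH unfolding B.central_iff_class_function[OF cc(2)] by simp
   then show ?thesis using i by simp
  qed
  finally show "n (g \<otimes>\<^bsub>HG\<^esub> k \<otimes>\<^bsub>HG\<^esub> inv\<^bsub>HG\<^esub> g) = n k" unfolding nv i using gk gH by simp
 qed
qed

definition Be where "Be = {s \<in> carrier KH. s \<star> e = s}"

text \<open>By linearity f may be a class sum of H x H, which is a pure tensor of class sums. The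
  two actions then differ only in the right factor, n against x^-1 n x. On s = s e only n e counts,
  and this is an element of Z, with which x commutes.\<close>

lemma center_acts_same:
 assumes fixed: fixed and f: "f \<in> ring_center KHH" and s: "s \<in> Be"
 shows "T1.Ext f s = T2.Ext f s"
proof -
 have sc: "s \<in> carrier KG" "s \<star> e = s" using s by (auto simp: Be_def)
 show ?thesis
 proof (rule HH.center_induct[OF f, of "\<lambda>w. T1.Ext w s = T2.Ext w s"])
  fix y assume "y \<in> carrier HH"
  then obtain g h where y: "y = (g, h)" "g \<in> H" "h \<in> H" by (auto simp: DirProd_def)
  define n where "n = (\<Oplus>\<^bsub>KG\<^esub>b\<in>H. class_sum K HG h b \<odot>\<^bsub>KG\<^esub> \<delta> (inv b))"
  have n: "n \<in> ring_center KH" unfolding n_def by (rule class_sum_inverse_center[OF y(3)])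
  have nc: "n \<in> carrier KH" using B.centralD(1)[OF n] .
  have g: "class_sum K HG g \<in> carrier KH" and h: "class_sum K HG h \<in> carrier KH"
   using B.class_sum_carrier y by auto
  have ne: "n \<star> e \<in> carrier Z" using BZ.center_times_e[OF n] nc by (simp add: KH_mult)
  have neG: "n \<star> e \<in> ring_center KG"
   using commute_generated[OF x Z_D(2)[OF ne]] Z_D(6)[OF ne] ne fixed[unfolded fixed_def] by simp
  have c: "class_sum K HG h b \<odot>\<^bsub>KG\<^esub> \<delta> (inv b) \<in> carrier KG" if "b \<in> H" for b using that h by simp
  have tw: "(\<Oplus>\<^bsub>KG\<^esub>b\<in>H. class_sum K HG h b \<odot>\<^bsub>KG\<^esub> \<delta> (inv (tw b))) = conj_by (inv x) n"
  proof -
   have "conj_by (inv x) n = (\<Oplus>\<^bsub>KG\<^esub>b\<in>H. conj_by (inv x) (class_sum K HG h b \<odot>\<^bsub>KG\<^esub> \<delta> (inv b)))"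
    unfolding n_def using lin_finsum[OF module_KG module_KG conj_by_lin[of "inv x"] _ c] x B.fin by simp
   also have "... = (\<Oplus>\<^bsub>KG\<^esub>b\<in>H. class_sum K HG h b \<odot>\<^bsub>KG\<^esub> \<delta> (inv (tw b)))"
   proof (rule A.finsum_cong')
    fix b assume b: "b \<in> H"
    have "conj_by (inv x) (\<delta> (inv b)) = \<delta> (inv (tw b))"
     using b x by (simp add: conj_by_def gel_mult G.inv_mult_group G.m_assoc)
    then show "conj_by (inv x) (class_sum K HG h b \<odot>\<^bsub>KG\<^esub> \<delta> (inv b)) = class_sum K HG h b \<odot>\<^bsub>KG\<^esub> \<delta> (inv (tw b))"
     using linD(3)[OF conj_by_lin[of "inv x"], of "class_sum K HG h b" "\<delta> (inv b)"] x h b by simp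
   qed (use h x in auto)
   finally show ?thesis by simp
  qed
  have cn: "conj_by (inv x) n \<star> e = n \<star> e"
   using conj_by_mult[of "inv x" n e] conj_by_e[of "inv x"] x nc
    conj_by_fixed_iff[of "inv x" "n \<star> e"] centralD(2)[OF neG, of "\<delta> (inv x)"] by simp
  let ?g = "class_sum K HG g"
  have move: "?g \<star> s \<star> m = ?g \<star> s \<star> (m \<star> e)" if m: "m \<in> carrier KG" for m
  proof -
   have "?g \<star> s \<star> m = ?g \<star> (s \<star> e) \<star> m" using sc by simp
   also have "... = ?g \<star> s \<star> (e \<star> m)" using sc(1) g m by (simp add: A.m_assoc)
   finally show ?thesis using centralD(2)[OF e_central m] by simp
  qed
  have "T1.Ext (class_sum K HH y) s = ?g \<star> s \<star> n"
   unfolding y(1) class_sum_HH[OF y(2,3)]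
   using Ext_product[OF T1.action_axioms _ g h sc(1)] by (simp add: n_def)
  also have "... = ?g \<star> s \<star> conj_by (inv x) n"
   using move[of n] move[of "conj_by (inv x) n"] nc x cn by simp
  also have "... = T2.Ext (class_sum K HH y) s"
   unfolding y(1) class_sum_HH[OF y(2,3)]
   using Ext_product[OF T2.action_axioms tw_H g h sc(1)] tw by simp
  finally show "T1.Ext (class_sum K HH y) s = T2.Ext (class_sum K HH y) s" .
 next
  show "T1.Ext \<zero>\<^bsub>KHH\<^esub> s = T2.Ext \<zero>\<^bsub>KHH\<^esub> s" using T1.Ext_zero[OF sc(1)] T2.Ext_zero[OF sc(1)] by simp
 next
  fix u v assume "u \<in> carrier KHH" "v \<in> carrier KHH" "T1.Ext u s = T2.Ext u s" "T1.Ext v s = T2.Ext v s"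
  then show "T1.Ext (u \<oplus>\<^bsub>KHH\<^esub> v) s = T2.Ext (u \<oplus>\<^bsub>KHH\<^esub> v) s"
   using T1.Ext_add[OF _ _ sc(1)] T2.Ext_add[OF _ _ sc(1)] by simp
 next
  fix a u assume "a \<in> carrier K" "u \<in> carrier KHH" "T1.Ext u s = T2.Ext u s"
  then show "T1.Ext (a \<odot>\<^bsub>KHH\<^esub> u) s = T2.Ext (a \<odot>\<^bsub>KHH\<^esub> u) s"
   using T1.Ext_smult[OF _ _ sc(1)] T2.Ext_smult[OF _ _ sc(1)] by simp
 qed
qed

lemma Be_closed_Ext:
 assumes "action HH K KG (two_sided \<tau>)" "\<And>h. h \<in> H ==> \<tau> h \<in> H" "w \<in> carrier KHH" "s \<in> Be"
 shows "ext_act HH KG (two_sided \<tau>) w s \<in> Be"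
 unfolding ext_act_def
proof (rule A.finsum_in_closed)
 show "finite (carrier HH)" by (rule HH.fin)
 show "\<zero>\<^bsub>KG\<^esub> \<in> Be" using B.A.zero_closed by (simp add: Be_def)
 show "Be \<subseteq> carrier KG" by (auto simp: Be_def)
 fix u v assume "u \<in> Be" "v \<in> Be"
 then show "u \<oplus>\<^bsub>KG\<^esub> v \<in> Be" using B.A.a_closed[of u v] by (simp add: Be_def A.l_distr)
next
 fix y assume "y \<in> carrier HH"
 then obtain g h where y: "y = (g, h)" "g \<in> H" "h \<in> H" by (auto simp: DirProd_def)
 have s: "s \<in> carrier KH" "s \<star> e = s" using assms(4) by (auto simp: Be_def)
 have t: "\<delta> (inv (\<tau> h)) \<in> carrier KH" using assms(2) y(3) by simp
 have 1: "two_sided \<tau> y s \<in> carrier KH"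
  unfolding two_sided_def y prod.case using y s t by (intro KH_mult_closed) auto
 have "\<delta> g \<star> s \<star> \<delta> (inv (\<tau> h)) \<star> e = \<delta> g \<star> (s \<star> e) \<star> \<delta> (inv (\<tau> h))"
  using centralD(2)[OF e_central, of "\<delta> (inv (\<tau> h))"] s(1) t y(2) by (simp add: A.m_assoc)
 then have 2: "two_sided \<tau> y s \<star> e = two_sided \<tau> y s" unfolding s(2) by (simp add: two_sided_def y)
 have w: "w y \<in> carrier K" using HH.KG_val[OF assms(3)] .
 have "w y \<odot>\<^bsub>KG\<^esub> two_sided \<tau> y s \<in> carrier KH" using B.V.smult_closed[OF w 1] by simp
 then show "w y \<odot>\<^bsub>KG\<^esub> two_sided \<tau> y s \<in> Be"
  using 2 1 w by (simp add: Be_def smult_mult)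
qed

lemma Be_mult_Z: "e \<in> Be"
 using ee by (simp add: Be_def)

text \<open>If \<open>x\<close> centralizes \<open>Z\<close>, then the bimodule \<open>Be\<close> and its twist by \<open>x\<close> have the same
 annihilator in the group algebra of \<open>H \<times> H\<close>, since that annihilator is generated by a central
 element. This replaces the Skolem-Noether theorem.\<close>

lemma twisted_average_nonzero:
 assumes fixed: fixed
 shows "\<exists>s\<in>Be. (\<Oplus>\<^bsub>KG\<^esub>h\<in>H. \<delta> h \<star> (s \<star> \<delta> x) \<star> \<delta> (inv h)) \<noteq> \<zero>\<^bsub>KG\<^esub>"
proof (rule ccontr)
 assume "\<not> ?thesis"
 then have z: "(\<Oplus>\<^bsub>KG\<^esub>h\<in>H. \<delta> h \<star> (s \<star> \<delta> x) \<star> \<delta> (inv h)) = \<zero>\<^bsub>KG\<^esub>" if "s \<in> Be" for s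
  using that by blast
 have fH: "finite H" using B.fin by simp
 have BeG: "s \<in> carrier KG" if "s \<in> Be" for s using that by (simp add: Be_def)
 \<comment> \<open>In the untwisted action (h, x h x^-1) sends s to h (s x) h^-1 x^-1, so
   \<open>\<omega>\<close> computes the average in question times x^-1. In the twisted action the
   same pair conjugates by h.\<close>
 define q where "q h = (h, x \<otimes> h \<otimes> inv x)" for h
 have q: "q h \<in> carrier HH" if "h \<in> H" for h using conj_H[OF x(1) that] that by (simp add: q_def DirProd_def)
 define \<omega> where "\<omega> = (\<Oplus>\<^bsub>KHH\<^esub>h\<in>H. gel K (q h))"
 have \<omega>: "\<omega> \<in> carrier KHH" unfolding \<omega>_def using q HH.gel_closed by (intro HH.A.finsum_closed) auto
 have E: "ext_act HH KG act \<omega> s = (\<Oplus>\<^bsub>KG\<^esub>h\<in>H. act (q h) s)"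
  if "action HH K KG act" "s \<in> carrier KG" for act s
 proof -
  interpret T: action HH K KG act by fact
  have "T.Ext \<omega> s = (\<Oplus>\<^bsub>KG\<^esub>h\<in>H. T.Ext (gel K (q h)) s)"
   unfolding \<omega>_def using q HH.gel_closed
   by (intro lin_finsum[OF HH.module_KG module_KG T.Ext_lin_left[OF that(2) HH.module_KG] fH]) auto
  also have "... = (\<Oplus>\<^bsub>KG\<^esub>h\<in>H. act (q h) s)"
   by (rule A.finsum_cong') (use q T.Ext_gel T.actD(4) that(2) in auto)
  finally show ?thesis .
 qed
 have kill: "T1.Ext \<omega> s = \<zero>\<^bsub>KG\<^esub>" if s: "s \<in> Be" for s
 proof -
  have sc: "s \<in> carrier KG" using BeG[OF s] .
  have "T1.Ext \<omega> s = (\<Oplus>\<^bsub>KG\<^esub>h\<in>H. two_sided (\<lambda>h. h) (q h) s)" by (rule E[OF T1.action_axioms sc])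
  also have "... = (\<Oplus>\<^bsub>KG\<^esub>h\<in>H. \<delta> h \<star> (s \<star> \<delta> x) \<star> \<delta> (inv h) \<star> \<delta> (inv x))"
  proof (rule A.finsum_cong')
   fix h assume h: "h \<in> H"
   have "\<delta> (inv (x \<otimes> h \<otimes> inv x)) = \<delta> x \<star> \<delta> (inv h) \<star> \<delta> (inv x)"
    using h x by (simp add: gel_mult G.inv_mult_group G.m_assoc)
   then show "two_sided (\<lambda>h. h) (q h) s = \<delta> h \<star> (s \<star> \<delta> x) \<star> \<delta> (inv h) \<star> \<delta> (inv x)"
    using h x sc by (simp add: two_sided_def q_def A.m_assoc)
  qed (use x sc in auto)
  also have "... = (\<Oplus>\<^bsub>KG\<^esub>h\<in>H. \<delta> h \<star> (s \<star> \<delta> x) \<star> \<delta> (inv h)) \<star> \<delta> (inv x)"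
   by (rule A.finsum_ldistr[symmetric]) (use fH x sc in auto)
  finally show ?thesis using z[OF s] x by simp
 qed
 have I: "ideal {a \<in> carrier KHH. \<forall>s\<in>Be. T1.Ext a s = \<zero>\<^bsub>KG\<^esub>} KHH"
  by (rule HH.action_annihilator[OF T1.action_axioms]) (use Be_closed_Ext[OF T1.action_axioms] BeG in auto)
 obtain f where f: "f \<in> {a \<in> carrier KHH. \<forall>s\<in>Be. T1.Ext a s = \<zero>\<^bsub>KG\<^esub>}" "f \<in> ring_center KHH"
  "\<And>a. a \<in> {a \<in> carrier KHH. \<forall>s\<in>Be. T1.Ext a s = \<zero>\<^bsub>KG\<^esub>} ==> a \<otimes>\<^bsub>KHH\<^esub> f = a"
  by (rule HH.ideal_generator[OF I]) blast
 have \<omega>f: "\<omega> \<otimes>\<^bsub>KHH\<^esub> f = \<omega>" using f(3) \<omega> kill by blast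
 have fc: "f \<in> carrier KHH" using f(1) by blast
 \<comment> \<open>Since \<open>\<omega>\<close> is a multiple of the central \<open>f\<close>, and
   \<open>f\<close> also kills e in the twisted action, \<open>\<omega>\<close> does so too. But
   there each h fixes e, and \<open>\<omega>\<close> multiplies e by |H|.\<close>
 have "T2.Ext f e = \<zero>\<^bsub>KG\<^esub>" using center_acts_same[OF fixed f(2) Be_mult_Z] f(1) Be_mult_Z by simp
 then have "T2.Ext \<omega> e = \<zero>\<^bsub>KG\<^esub>"
  using T2.Ext_mult[OF \<omega> fc, of e] \<omega>f lin_zero[OF module_KG module_KG T2.Ext_lin[OF \<omega>]] by simp
 moreover have "T2.Ext \<omega> e = (\<Oplus>\<^bsub>KG\<^esub>h\<in>H. two_sided tw (q h) e)" by (rule E[OF T2.action_axioms]) simp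
 moreover have "... = (\<Oplus>\<^bsub>KG\<^esub>h\<in>H. \<one>\<^sub>K \<odot>\<^bsub>KG\<^esub> e)"
 proof (rule A.finsum_cong')
  fix h assume h: "h \<in> H"
  have "tw (x \<otimes> h \<otimes> inv x) = (inv x \<otimes> x) \<otimes> h \<otimes> (inv x \<otimes> x)"
   using h x(1) by (simp only: G.m_assoc G.m_closed G.inv_closed H_in)
  then have "tw (x \<otimes> h \<otimes> inv x) = h" using h x by simp
  then show "two_sided tw (q h) e = \<one>\<^sub>K \<odot>\<^bsub>KG\<^esub> e"
   using conj_by_e[of h] h unfolding two_sided_def q_def prod.case conj_by_def by simp
 qed auto
 moreover have "... = (\<Oplus>\<^sub>K h\<in>H. \<one>\<^sub>K) \<odot>\<^bsub>KG\<^esub> e"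
  by (rule V.finsum_smult_rdistr[symmetric]) (use fH in auto)
 ultimately have 0: "(\<Oplus>\<^sub>K h\<in>H. \<one>\<^sub>K) \<odot>\<^bsub>KG\<^esub> e = \<zero>\<^bsub>KG\<^esub>" by simp
 obtain c where c: "c \<in> carrier K" "c \<otimes>\<^sub>K (\<Oplus>\<^sub>K g\<in>carrier HG. \<one>\<^sub>K) = \<one>\<^sub>K" by (rule B.order_inv)
 have "e = c \<odot>\<^bsub>KG\<^esub> ((\<Oplus>\<^sub>K h\<in>H. \<one>\<^sub>K) \<odot>\<^bsub>KG\<^esub> e)"
  using c by (simp add: V.smult_assoc1[symmetric] K.finsum_closed)
 then show False using 0 c e_nz by simp
qed

end

section \<open>From the twisted average to an invertible class sum\<close>

context inv_block
begin

text \<open>An average c over H commutes with F[H], but a priori not with x. Write c = u x with u in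
  F[H]. The left ideal of u is two-sided in F[H], so it contains e, say e = w u. Then x e = w c, and
  c commutes with w and with itself, hence with x.\<close>

lemma central_twisted_unit:
 assumes fixed: fixed
 obtains c where "c \<in> ring_center KG" "c \<noteq> \<zero>\<^bsub>KG\<^esub>" "c \<star> e = c" "deg (H #> x) c"
proof -
 obtain s where s: "s \<in> Be" and nz: "(\<Oplus>\<^bsub>KG\<^esub>h\<in>H. \<delta> h \<star> (s \<star> \<delta> x) \<star> \<delta> (inv h)) \<noteq> \<zero>\<^bsub>KG\<^esub>"
  using twisted_average_nonzero[OF fixed] by blast
 have sH: "s \<in> carrier KH" "s \<star> e = s" using s by (auto simp: Be_def)
 then have sG: "s \<in> carrier KG" by simp
 have fH: "finite H" using B.fin by simp
 define t where "t h = \<delta> h \<star> (s \<star> \<delta> x) \<star> \<delta> (inv h)" for h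
 have t: "t h \<in> carrier KG" if "h \<in> H" for h unfolding t_def using that sG x by simp
 define c where "c = (\<Oplus>\<^bsub>KG\<^esub>h\<in>H. t h)"
 have c0: "c \<noteq> \<zero>\<^bsub>KG\<^esub>" using nz by (simp add: c_def t_def)
 have cc: "c \<in> carrier KG" unfolding c_def using t by (intro A.finsum_closed) auto
 have ecomm: "e \<star> v = v \<star> e" if "v \<in> carrier KG" for v by (rule centralD(2)[OF e_central that])
 have te: "t h \<star> e = t h" if h: "h \<in> H" for h
 proof -
  have "t h \<star> e = \<delta> h \<star> (s \<star> (\<delta> x \<star> (\<delta> (inv h) \<star> e)))"
   unfolding t_def using h x sG by (simp add: A.m_assoc)
  also have "... = \<delta> h \<star> (s \<star> (\<delta> x \<star> e \<star> \<delta> (inv h)))"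
   using ecomm[of "\<delta> (inv h)"] h x by (simp add: A.m_assoc)
  also have "... = \<delta> h \<star> ((s \<star> e) \<star> \<delta> x \<star> \<delta> (inv h))"
   unfolding ecomm[of "\<delta> x", OF gel_closed[OF x(1)], symmetric] using h x sG by (simp add: A.m_assoc)
  also have "... = t h" unfolding sH(2) t_def using h x sG by (simp add: A.m_assoc)
  finally show ?thesis .
 qed
 have ce: "c \<star> e = c"
 proof -
  have "c \<star> e = (\<Oplus>\<^bsub>KG\<^esub>h\<in>H. t h \<star> e)"
   unfolding c_def by (rule A.finsum_ldistr) (use fH t in auto)
  also have "... = c" unfolding c_def by (rule A.finsum_cong') (use te t in auto)
  finally show ?thesis .
 qed
 have td: "deg (H #> x) (t h)" if h: "h \<in> H" for h
 proof -
  have "deg ((H #> h) <#> (H <#> (H #> x)) <#> (H #> inv h)) (t h)"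
   unfolding t_def using sH(1) h x deg_H_iff by (intro deg_mult deg_gel) auto
  moreover have "H #> h = H" "H #> inv h = H" using h coset_H_iff by auto
  moreover have "H <#> (H #> x) = H #> x" "(H #> x) <#> H = H #> x"
   using Q.l_one[OF coset_in_Q[OF x(1)]] Q.r_one[OF coset_in_Q[OF x(1)]] by auto
  ultimately show ?thesis by simp
 qed
 have cd: "deg (H #> x) c"
  unfolding deg_def
 proof (intro conjI ballI impI)
  fix g assume g: "g \<in> carrier G" "c g \<noteq> \<zero>\<^sub>K"
  have "c g = (\<Oplus>\<^sub>K h\<in>H. t h g)" unfolding c_def by (rule KG_finsum[OF fH t])
  then have "\<exists>h\<in>H. t h g \<noteq> \<zero>\<^sub>K" using g(2) K.add.finprod_one_eqI[of H "\<lambda>h. t h g"] by auto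
  then show "H #> g = H #> x" using td g(1) by (auto simp: deg_def)
 qed (rule cc)
 have comm: "\<delta> k \<star> c = c \<star> \<delta> k" if k: "k \<in> H" for k
 proof -
  have "\<delta> k \<star> c = (\<Oplus>\<^bsub>KG\<^esub>h\<in>H. \<delta> k \<star> t h)"
   unfolding c_def by (rule A.finsum_rdistr) (use fH t k in auto)
  also have "... = (\<Oplus>\<^bsub>KG\<^esub>h\<in>H. t (k \<otimes> h) \<star> \<delta> k)"
  proof (rule A.finsum_cong')
   fix h assume h: "h \<in> H"
   have "\<delta> (k \<otimes> h) = \<delta> k \<star> \<delta> h" using h k by (simp add: gel_mult)
   moreover have "\<delta> (inv (k \<otimes> h)) \<star> \<delta> k = \<delta> (inv h)"
    using h k by (simp add: gel_mult G.inv_mult_group G.m_assoc)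
   ultimately show "\<delta> k \<star> t h = t (k \<otimes> h) \<star> \<delta> k"
    unfolding t_def using h k x sG by (simp add: A.m_assoc)
  qed (use t k N.m_closed in auto)
  also have "... = (\<Oplus>\<^bsub>KG\<^esub>h\<in>H. t h \<star> \<delta> k)"
   by (rule A.finsum_bij[of "\<lambda>h. k \<otimes> h" H H "\<lambda>h. t h \<star> \<delta> k"]) (use B.G.bij_mult_left[of k] k t in auto)
  also have "... = c \<star> \<delta> k"
   unfolding c_def by (rule A.finsum_ldistr[symmetric]) (use fH t k in auto)
  finally show ?thesis .
 qed
 have commKH: "c \<star> a = a \<star> c" if a: "a \<in> carrier KH" for a
 proof (rule B.lin_eqI[OF module_KG _ _ _ a])
  show "lin K KH KG (\<lambda>a. c \<star> a)" "lin K KH KG (\<lambda>a. a \<star> c)"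
   using cc by (simp_all add: lin_def A.r_distr A.l_distr smult_mult)
  show "c \<star> \<delta> g = \<delta> g \<star> c" if "g \<in> carrier HG" for g using comm that by simp
 qed
 define u where "u = c \<star> \<delta> (inv x)"
 have "deg ((H #> x) <#> (H #> inv x)) u" unfolding u_def using x by (intro deg_mult cd deg_gel) auto
 moreover have "(H #> x) <#> (H #> inv x) = H" using coset_mult[of x "inv x"] x coset_H_iff[of \<one>] N.one_closed by simp
 ultimately have uH: "u \<in> carrier KH" using deg_H_iff by simp
 have cu: "c = u \<star> \<delta> x" unfolding u_def using cc x gel_inv(2)[OF x(1)] by (simp add: A.m_assoc)
 have u0: "u \<noteq> \<zero>\<^bsub>KH\<^esub>" using cu c0 x by auto
 have ue: "u \<star> e = u" unfolding u_def using ecomm[of "\<delta> (inv x)"] cc x ce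
  by (metis A.m_assoc BC.e_closed G.inv_closed gel_closed)
 have I: "ideal ((\<lambda>a. a \<otimes>\<^bsub>KH\<^esub> u) ` carrier KH) KH"
 proof (rule B.central_left_ideal[OF uH])
  fix a assume a: "a \<in> carrier KH"
  have b: "conj_by (inv x) a \<in> carrier KH" using conj_by_KH[of "inv x" a] a x by simp
  have "u \<star> a = c \<star> conj_by (inv x) a \<star> \<delta> (inv x)"
   unfolding u_def conj_by_def using cc a x gel_inv(1)[OF x(1)] by (simp add: A.m_assoc)
  also have "... = conj_by (inv x) a \<star> u" unfolding u_def commKH[OF b] using cc b x by (simp add: A.m_assoc)
  finally show "\<exists>b\<in>carrier KH. u \<otimes>\<^bsub>KH\<^esub> a = b \<otimes>\<^bsub>KH\<^esub> u" using b a uH KH_mult by metis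
 qed
 have "e \<in> (\<lambda>a. a \<otimes>\<^bsub>KH\<^esub> u) ` carrier KH"
 proof (rule B.primitive_block_simple[OF pci I])
  fix a assume "a \<in> (\<lambda>a. a \<otimes>\<^bsub>KH\<^esub> u) ` carrier KH"
  then obtain b where b: "b \<in> carrier KH" "a = b \<otimes>\<^bsub>KH\<^esub> u" by blast
  then show "a \<otimes>\<^bsub>KH\<^esub> e = a" using uH ue KH_mult[OF uH e_KH] by (simp add: B.A.m_assoc)
 next
  show "u \<in> (\<lambda>a. a \<otimes>\<^bsub>KH\<^esub> u) ` carrier KH" by (rule image_eqI[of _ _ "\<one>\<^bsub>KH\<^esub>"]) (use B.A.l_one[OF uH] B.A.one_closed in auto)
 qed (rule u0)
 then obtain w where w: "w \<in> carrier KH" "e = w \<star> u" using uH KH_mult by auto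
 have wG: "w \<in> carrier KG" using w(1) by simp
 have xe: "\<delta> x \<star> e = w \<star> c"
  using ecomm[of "\<delta> x"] x wG uH unfolding cu by (simp add: A.m_assoc[symmetric] w(2)[symmetric])
 have "c \<star> \<delta> x = c \<star> (e \<star> \<delta> x)" using cc x ce by (simp add: A.m_assoc[symmetric])
 also have "... = c \<star> (w \<star> c)" using ecomm[of "\<delta> x"] x xe by simp
 also have "... = (w \<star> c) \<star> c" using commKH[OF w(1)] cc wG by (simp add: A.m_assoc[symmetric])
 also have "... = \<delta> x \<star> (e \<star> c)" unfolding xe[symmetric] using cc x by (simp add: A.m_assoc)
 also have "... = \<delta> x \<star> c" using ecomm[OF cc] ce by simp
 finally have "\<delta> x \<star> c = c \<star> \<delta> x" by simp
 then have "c \<in> ring_center KG" using commute_generated[OF x cc] comm by blast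
 then show ?thesis using that c0 ce cd by blast
qed

lemma Z_in_C:
 assumes fixed "z \<in> carrier Z"
 shows "z \<in> carrier C"
proof -
 have "z \<in> ring_center KG"
  using commute_generated[OF x Z_D(2)[OF assms(2)]] Z_D(6)[OF assms(2)] assms by (simp add: fixed_def)
 then show ?thesis unfolding BC.carrier_C using Z_D(4)[OF assms(2)] by simp
qed

lemma C_deg_H: "v \<in> carrier C ==> deg H v ==> v \<in> carrier Z"
 using central_KG_KH BC.C_carrierD deg_H_iff by (intro Z_I) auto

lemma deg_pow:
 assumes y: "y \<in> carrier G" and v: "deg (H #> y) v"
 shows "deg (H #> (y [^] (k::nat))) (v [^]\<^bsub>KG\<^esub> k)"
proof (induction k)
 case 0
 then show ?case using deg_gel[of \<one>] by (simp add: one_KG)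
next
 case (Suc k)
 then show ?case using deg_mult[OF Suc v] coset_mult[of "y [^] k" y] y by simp
qed

lemma class_sum_deg:
 assumes y: "y \<in> carrier G"
 shows "deg (H #> y) (class_sum K G y)"
 unfolding deg_def using class_sum_carrier[OF y] coset_conj y by (auto elim!: class_sum_nonzeroD)

lemma deg_times_e: "deg A v ==> A \<in> carrier (G Mod H) ==> deg A (v \<star> e)"
 using deg_mult[of A v H e] deg_H_iff e_KH Q.r_one[of A] by simp

lemma class_sum_in_C: "y \<in> carrier G ==> class_sum K G y \<star> e \<in> carrier C"
 by (rule BC.center_times_e[OF class_sum_central])

lemma pow_times_e:
 assumes "v \<in> carrier KG"
 shows "v [^]\<^bsub>KG\<^esub> (n::nat) \<star> e = (v \<star> e) [^]\<^sub>C n"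
proof (induction n)
 case 0
 then show ?case by simp
next
 case (Suc n)
 have c: "v [^]\<^bsub>KG\<^esub> n \<in> carrier KG" using assms by simp
 have "v [^]\<^bsub>KG\<^esub> Suc n \<star> e = v [^]\<^bsub>KG\<^esub> n \<star> (v \<star> (e \<star> e))"
  using assms c by (simp add: A.m_assoc ee)
 also have "... = v [^]\<^bsub>KG\<^esub> n \<star> (e \<star> v) \<star> e"
  unfolding centralD(2)[OF e_central assms] using assms c by (simp add: A.m_assoc)
 also have "... = (v [^]\<^bsub>KG\<^esub> n \<star> e) \<star> (v \<star> e)"
  using assms c by (simp add: A.m_assoc)
 finally show ?case using Suc by simp
qed

text \<open>The degree of the power is the p-th power of Hy in G/H, which is trivial, and elements
  of C of degree H belong to Z.\<close>

lemma pow_p_in_Z: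
 assumes y: "y \<in> carrier G" "y \<notin> H"
 shows "class_sum K G y [^]\<^bsub>KG\<^esub> p \<star> e \<in> carrier Z"
proof (rule C_deg_H)
 interpret C: cring C by (rule BC.cring_C)
 show "class_sum K G y [^]\<^bsub>KG\<^esub> p \<star> e \<in> carrier C"
  using pow_times_e[OF class_sum_carrier[OF y(1)]] class_sum_in_C[OF y(1)] C.nat_pow_closed by simp
 have "H #> (y [^] p) = H" using pow_p_in_H[OF y] coset_H_iff[of "y [^] p"] y by simp
 then show "deg H (class_sum K G y [^]\<^bsub>KG\<^esub> p \<star> e)"
  using deg_times_e[OF deg_pow[OF y(1) class_sum_deg[OF y(1)], of p]] coset_in_Q[of "y [^] p"] y by simp
qed

text \<open>The central c of degree Hx is a combination of class sums of elements of Hx. As c e is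
  nonzero, one of them does not vanish when multiplied by e, and neither does its p-th power, the
  center having no nilpotents.\<close>

lemma exists_class_sum:
 assumes fixed: fixed
 shows "\<exists>y\<in>carrier G - H. class_sum K G y [^]\<^bsub>KG\<^esub> p \<star> e \<in> carrier Z - {\<zero>\<^bsub>KG\<^esub>}"
proof -
 obtain c where c: "c \<in> ring_center KG" "c \<noteq> \<zero>\<^bsub>KG\<^esub>" "c \<star> e = c" "deg (H #> x) c"
  by (rule central_twisted_unit[OF fixed])
 have "\<exists>y\<in>carrier G. c y \<noteq> \<zero>\<^sub>K \<and> class_sum K G y \<star> e \<noteq> \<zero>\<^bsub>KG\<^esub>"
 proof (rule ccontr)
  assume neg: "\<not> ?thesis"
  have "c \<star> e = \<zero>\<^bsub>KG\<^esub>"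
   by (rule center_induct[OF c(1), of "\<lambda>v. v \<star> e = \<zero>\<^bsub>KG\<^esub>"])
    (use neg in \<open>auto simp: A.l_distr smult_mult\<close>)
  then show False using c by simp
 qed
 then obtain y where y: "y \<in> carrier G" "c y \<noteq> \<zero>\<^sub>K" "class_sum K G y \<star> e \<noteq> \<zero>\<^bsub>KG\<^esub>" by blast
 have "H #> y = H #> x" using c(4) y by (simp add: deg_def)
 then have yH: "y \<notin> H" using coset_H_iff[OF y(1)] coset_H_iff[OF x(1)] x(2) by auto
 have tC: "class_sum K G y \<star> e \<in> ring_center KG" using BC.C_carrierD(2)[OF class_sum_in_C[OF y(1)]] .
 note tD = centralD(1)[OF tC] and tE = BC.C_carrierD(3)[OF class_sum_in_C[OF y(1)]]
 have "(class_sum K G y \<star> e) [^]\<^sub>C p = (class_sum K G y \<star> e) [^]\<^bsub>KG\<^esub> p \<star> e"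
  using BC.block_pow[OF tD] tE by metis
 also have "... = (class_sum K G y \<star> e) [^]\<^bsub>KG\<^esub> p"
 proof -
  obtain m where m: "p = Suc m" using p_pos by (cases p) auto
  show ?thesis unfolding m using tD tE by (simp add: A.m_assoc)
 qed
 finally have "class_sum K G y [^]\<^bsub>KG\<^esub> p \<star> e \<noteq> \<zero>\<^bsub>KG\<^esub>"
  using pow_times_e[OF class_sum_carrier[OF y(1)], of p] central_pow_nonzero[OF tC y(3)] by simp
 then show ?thesis using pow_p_in_Z[OF y(1) yH] y(1) yH by blast
qed

end

section \<open>Polynomials over a field and their values in extensions\<close>

lemma (in field) poly_ring_facts:
 shows "principal_domain (poly_ring R)" "domain (poly_ring R)" "cring (poly_ring R)" "ring (poly_ring R)"
  "one (poly_ring R) = [\<one>]" "zero (poly_ring R) = []"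
proof -
 show "principal_domain (poly_ring R)" by (rule univ_poly_is_principal[OF carrier_is_subfield])
 show d: "domain (poly_ring R)" by (rule univ_poly_is_domain[OF carrier_is_subring])
 then show "cring (poly_ring R)" by (rule domain.axioms(1))
 then show "ring (poly_ring R)" by (rule cring.axioms(1))
qed (simp_all add: univ_poly_one univ_poly_zero)

lemma (in field) poly_in_carrierD: "q \<in> carrier (poly_ring R) ==> set q \<subseteq> carrier R"
 by (auto simp: univ_poly_def polynomial_def)

text \<open>In a principal ideal domain the ideal of an irreducible f is maximal, so adding a q
  outside it yields the unit ideal.\<close>

lemma (in field) irreducible_bezout:
 assumes f: "f \<in> carrier (poly_ring R)" "pirreducible (carrier R) f" and q: "q \<in> carrier (poly_ring R)"
  and nd: "\<not> f divides\<^bsub>poly_ring R\<^esub> q"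
 obtains a b where "a \<in> carrier (poly_ring R)" "b \<in> carrier (poly_ring R)"
  "(a \<otimes>\<^bsub>poly_ring R\<^esub> f) \<oplus>\<^bsub>poly_ring R\<^esub> (b \<otimes>\<^bsub>poly_ring R\<^esub> q) = \<one>\<^bsub>poly_ring R\<^esub>"
proof -
 let ?P = "poly_ring R"
 interpret P: principal_domain ?P by (rule poly_ring_facts(1))
 have m: "maximalideal (PIdl\<^bsub>?P\<^esub> f) ?P" by (rule P.irreducible_imp_maximalideal[OF f])
 let ?J = "PIdl\<^bsub>?P\<^esub> f <+>\<^bsub>?P\<^esub> PIdl\<^bsub>?P\<^esub> q"
 have Jid: "ideal ?J ?P" using P.add_ideals[OF P.cgenideal_ideal[OF f(1)] P.cgenideal_ideal[OF q]] .
 have mem: "u \<in> ?J \<longleftrightarrow> (\<exists>a\<in>carrier ?P. \<exists>b\<in>carrier ?P. u = (a \<otimes>\<^bsub>?P\<^esub> f) \<oplus>\<^bsub>?P\<^esub> (b \<otimes>\<^bsub>?P\<^esub> q))" for u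
  unfolding set_add_def' cgenideal_def by blast
 have "PIdl\<^bsub>?P\<^esub> f \<subseteq> ?J"
 proof
  fix u assume "u \<in> PIdl\<^bsub>?P\<^esub> f"
  then obtain a where a: "a \<in> carrier ?P" "u = a \<otimes>\<^bsub>?P\<^esub> f" unfolding cgenideal_def by blast
  then have "u = (a \<otimes>\<^bsub>?P\<^esub> f) \<oplus>\<^bsub>?P\<^esub> (\<zero>\<^bsub>?P\<^esub> \<otimes>\<^bsub>?P\<^esub> q)" using f q by simp
  then show "u \<in> ?J" unfolding mem using a P.zero_closed by blast
 qed
 moreover have "?J \<subseteq> carrier ?P" using ideal.Icarr[OF Jid] by blast
 ultimately have "?J = PIdl\<^bsub>?P\<^esub> f \<or> ?J = carrier ?P" using maximalideal.I_maximal[OF m Jid] by blast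
 moreover have "?J \<noteq> PIdl\<^bsub>?P\<^esub> f"
 proof
  assume J: "?J = PIdl\<^bsub>?P\<^esub> f"
  have "q = (\<zero>\<^bsub>?P\<^esub> \<otimes>\<^bsub>?P\<^esub> f) \<oplus>\<^bsub>?P\<^esub> (\<one>\<^bsub>?P\<^esub> \<otimes>\<^bsub>?P\<^esub> q)" using f q by simp
  then have "q \<in> ?J" unfolding mem using P.zero_closed P.one_closed by blast
  then have "q \<in> PIdl\<^bsub>?P\<^esub> f" using J by simp
  then obtain a where a: "a \<in> carrier ?P" "q = a \<otimes>\<^bsub>?P\<^esub> f" unfolding cgenideal_def by blast
  then have "q = f \<otimes>\<^bsub>?P\<^esub> a" using P.m_comm[OF a(1) f(1)] by simp
  then show False using nd a(1) unfolding factor_def by blast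
 qed
 ultimately have "\<one>\<^bsub>?P\<^esub> \<in> ?J" using P.one_closed by simp
 then obtain a b where "a \<in> carrier ?P" "b \<in> carrier ?P" "\<one>\<^bsub>?P\<^esub> = (a \<otimes>\<^bsub>?P\<^esub> f) \<oplus>\<^bsub>?P\<^esub> (b \<otimes>\<^bsub>?P\<^esub> q)"
  unfolding mem by blast
 then show ?thesis using that[of a b] by simp
qed

text \<open>The value at r of a polynomial whose coefficients are first carried to S by j. This
  serves both for substituting t in C and for taking values at roots in L.\<close>

definition evm :: "('l, 's) ring_scheme \<Rightarrow> ('k \<Rightarrow> 'l) \<Rightarrow> 'l \<Rightarrow> 'k list \<Rightarrow> 'l" where
 "evm S j r q = ring.eval S (map j q) r"

locale coeff_hom = Z: field Z + S: cring S for Z :: "('k, 'a) ring_scheme" and S :: "('l, 'b) ring_scheme" +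
 fixes j assumes j: "j \<in> ring_hom Z S"
begin

sublocale J: ring_hom_ring Z S j
 by (rule ring_hom_ringI2) (use Z.is_ring S.ring_axioms j in auto)

lemma set_map: "set q \<subseteq> carrier Z ==> set (map j q) \<subseteq> carrier S"
 by auto

lemma evm_closed: "[|set q \<subseteq> carrier Z; r \<in> carrier S|] ==> evm S j r q \<in> carrier S"
 unfolding evm_def by (rule S.eval_in_carrier[OF set_map])

lemma evm_normalize:
 assumes "set q \<subseteq> carrier Z" "r \<in> carrier S"
 shows "evm S j r (Z.normalize q) = evm S j r q"
proof -
 define n where "n = length q - length (Z.normalize q)"
 have eq: "q = replicate n \<zero>\<^sub>Z @ Z.normalize q" unfolding n_def by (rule Z.normalize_trick)
 have "map j q = replicate n \<zero>\<^sub>S @ map j (Z.normalize q)" by (subst eq) simp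
 then show ?thesis
  unfolding evm_def using S.eval_replicate[OF set_map[OF Z.normalize_in_carrier[OF assms(1)]] assms(2)] by simp
qed

text \<open>Over S the image of a normalized list can start with zeros. The rules for sums and
  products are therefore applied to the normalization of the mapped list, which has the same
  values.\<close>

lemma evm_hom:
 assumes r: "r \<in> carrier S"
 shows "ring_hom_cring (poly_ring Z) S (evm S j r)"
proof -
 have c: "set q \<subseteq> carrier Z" if "q \<in> carrier (poly_ring Z)" for q by (rule Z.poly_in_carrierD[OF that])
 have "evm S j r \<in> ring_hom (poly_ring Z) S"
 proof (rule ring_hom_memI)
  fix q assume q: "q \<in> carrier (poly_ring Z)"
  show "evm S j r q \<in> carrier S" by (rule evm_closed[OF c[OF q] r])
  fix q' assume q': "q' \<in> carrier (poly_ring Z)"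
  note cc = c[OF q] c[OF q']
  have "evm S j r (Z.poly_mult q q') = S.eval (S.normalize (map j (Z.poly_mult q q'))) r"
   unfolding evm_def using S.eval_normalize[OF set_map[OF Z.poly_mult_in_carrier[OF cc]] r] by simp
  also have "... = evm S j r q \<otimes>\<^sub>S evm S j r q'"
   unfolding J.poly_mult_hom'[OF cc] evm_def by (rule S.eval_poly_mult[OF set_map[OF cc(1)] set_map[OF cc(2)] r])
  finally show "evm S j r (q \<otimes>\<^bsub>poly_ring Z\<^esub> q') = evm S j r q \<otimes>\<^sub>S evm S j r q'" unfolding univ_poly_mult .
  have "evm S j r (Z.poly_add q q') = S.eval (S.normalize (map j (Z.poly_add q q'))) r"
   unfolding evm_def using S.eval_normalize[OF set_map[OF Z.poly_add_in_carrier[OF cc]] r] by (simp del: ring.poly_add.simps)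
  also have "... = evm S j r q \<oplus>\<^sub>S evm S j r q'"
   unfolding J.poly_add_hom'[OF cc] evm_def by (rule S.eval_poly_add[OF set_map[OF cc(1)] set_map[OF cc(2)] r])
  finally show "evm S j r (q \<oplus>\<^bsub>poly_ring Z\<^esub> q') = evm S j r q \<oplus>\<^sub>S evm S j r q'" unfolding univ_poly_add .
 next
  show "evm S j r \<one>\<^bsub>poly_ring Z\<^esub> = \<one>\<^sub>S" by (simp add: univ_poly_one evm_def)
 qed
 then show ?thesis
  using Z.poly_ring_facts(3) S.is_cring by (simp add: ring_hom_cring_def ring_hom_cring_axioms_def)
qed

text \<open>The polynomial with coefficient a l at X^l for l < n. The order is reversed because
  lists begin with the leading coefficient; normalization drops vanishing top coefficients.\<close>

definition pol :: "nat \<Rightarrow> (nat \<Rightarrow> 'k) \<Rightarrow> 'k list" where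
 "pol n a = Z.normalize (map a (rev [0..<n]))"

lemma pol_carrier: "(\<And>l. l < n ==> a l \<in> carrier Z) ==> pol n a \<in> carrier (poly_ring Z)"
 unfolding pol_def univ_poly_carrier[symmetric] by (rule Z.normalize_gives_polynomial) auto

lemma evm_pol:
 assumes a: "\<And>l. l < n ==> a l \<in> carrier Z" and r: "r \<in> carrier S"
 shows "evm S j r (pol n a) = (\<Oplus>\<^sub>S l\<in>{..<n}. j (a l) \<otimes>\<^sub>S r [^]\<^sub>S l)"
proof -
 have "evm S j r (pol n a) = evm S j r (map a (rev [0..<n]))"
  unfolding pol_def by (rule evm_normalize) (use a r in auto)
 also have "... = (\<Oplus>\<^sub>S l\<in>{..<n}. j (a l) \<otimes>\<^sub>S r [^]\<^sub>S l)"
  using a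
 proof (induction n)
  case 0
  then show ?case by (simp add: evm_def)
 next
  case (Suc n)
  have "evm S j r (map a (rev [0..<Suc n])) = j (a n) \<otimes>\<^sub>S r [^]\<^sub>S n \<oplus>\<^sub>S evm S j r (map a (rev [0..<n]))"
   by (simp add: evm_def)
  also have "... = j (a n) \<otimes>\<^sub>S r [^]\<^sub>S n \<oplus>\<^sub>S (\<Oplus>\<^sub>S l\<in>{..<n}. j (a l) \<otimes>\<^sub>S r [^]\<^sub>S l)"
   using Suc by simp
  also have "... = (\<Oplus>\<^sub>S l\<in>{..<Suc n}. j (a l) \<otimes>\<^sub>S r [^]\<^sub>S l)"
   unfolding lessThan_Suc using Suc.prems r by (subst S.finsum_insert) (auto intro!: J.hom_closed)
  finally show ?case .
 qed
 finally show ?thesis .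
qed

lemma poly_is_pol:
 assumes q: "q \<in> carrier (poly_ring Z)" "length q \<le> n"
 obtains a where "\<And>l. a l \<in> carrier Z" "q = pol n a"
proof -
 define a where "a = Z.coeff q"
 have a: "a l \<in> carrier Z" for l unfolding a_def using Z.coeff_in_carrier[OF Z.poly_in_carrierD[OF q(1)]] .
 have P: "polynomial\<^bsub>Z\<^esub> (carrier Z) q" using q(1) by (simp add: univ_poly_carrier)
 have "rev [0..<n] = rev [length q..<n] @ rev [0..<length q]"
  using upt_add_eq_append[of 0 "length q" "n - length q"] q(2) by simp
 then have "map a (rev [0..<n]) = map a (rev [length q..<n]) @ q"
  unfolding a_def using Z.coeff_list[of q] by simp
 also have "map a (rev [length q..<n]) = replicate (n - length q) \<zero>\<^sub>Z"
 proof (rule nth_equalityI)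
  fix i assume "i < length (map a (rev [length q..<n]))"
  then have i: "i < length (rev [length q..<n])" by simp
  then have "rev [length q..<n] ! i \<in> set (rev [length q..<n])" by (rule nth_mem)
  then have "a (rev [length q..<n] ! i) = \<zero>\<^sub>Z" unfolding a_def by (intro Z.coeff_length) simp
  then show "map a (rev [length q..<n]) ! i = replicate (n - length q) \<zero>\<^sub>Z ! i" using i by simp
 qed simp
 finally have "pol n a = Z.normalize q"
  unfolding pol_def using Z.normalize_replicate_zero by simp
 then show ?thesis using that[of a] a Z.normalize_polynomial[OF P] by simp
qed

end

section \<open>Counting roots in a field; p-th roots\<close>

lemma (in field) card_roots_le:
 assumes "q \<in> carrier (poly_ring R)" "q \<noteq> []" "\<And>r. r \<in> S ==> r \<in> carrier R" "\<And>r. r \<in> S ==> eval q r = \<zero>"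
 shows "finite S \<and> card S \<le> degree q"
proof -
 have "S \<subseteq> set_mset (roots q)" using roots_mem_iff_is_root[OF assms(1)] assms(2-4) by (auto simp: is_root_def)
 then have "finite S" "card S \<le> card (set_mset (roots q))"
  using finite_subset[OF _ finite_set_mset] card_mono[OF finite_set_mset] by blast+
 moreover have "card (set_mset M) \<le> size M" for M :: "'a multiset"
  by (induction M) (auto simp: card_insert_if)
 ultimately show ?thesis using size_roots_le_degree[OF assms(1)] le_trans by blast
qed

locale coeff_hom_field = coeff_hom Z L \<iota> + L: field L for Z :: "('k, 'a) ring_scheme" and L :: "('l, 'b) ring_scheme" and \<iota>
begin

lemma \<iota>_inj: "inj_on \<iota> (carrier Z)"
proof (rule inj_onI)
 fix a b assume a: "a \<in> carrier Z" and b: "b \<in> carrier Z" and eq: "\<iota> a = \<iota> b"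
 show "a = b"
 proof (rule ccontr)
  assume ne: "a \<noteq> b"
  define d where "d = a \<ominus>\<^sub>Z b"
  have d: "d \<in> carrier Z" "\<iota> d = \<zero>\<^sub>L"
   unfolding d_def Z.minus_eq using a b eq by (auto simp: S.r_neg)
  have "d \<noteq> \<zero>\<^sub>Z"
  proof
   assume "d = \<zero>\<^sub>Z"
   then have "a \<oplus>\<^sub>Z (\<ominus>\<^sub>Z b) = \<zero>\<^sub>Z" by (simp add: d_def Z.minus_eq)
   then show False using ne Z.sum_zero_eq_neg[of a "\<ominus>\<^sub>Z b"] a b by simp
  qed
  then have "d \<in> Units Z" using d Z.field_Units by simp
  then have "\<iota> (d \<otimes>\<^sub>Z inv\<^bsub>Z\<^esub> d) = \<one>\<^sub>L" "inv\<^bsub>Z\<^esub> d \<in> carrier Z" by auto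
  then show False using d by simp
 qed
qed

lemma \<iota>_zero_iff: "a \<in> carrier Z ==> \<iota> a = \<zero>\<^sub>L \<longleftrightarrow> a = \<zero>\<^sub>Z"
 using inj_onD[OF \<iota>_inj, of a "\<zero>\<^sub>Z"] by auto

lemma map_poly: "q \<in> carrier (poly_ring Z) ==> map \<iota> q \<in> carrier (poly_ring L)"
 by (rule polynomial_hom[OF j Z.field_axioms L.field_axioms])

lemma card_zeros_le:
 assumes "q \<in> carrier (poly_ring Z)" "q \<noteq> []" "\<And>r. r \<in> S ==> r \<in> carrier L" "\<And>r. r \<in> S ==> evm L \<iota> r q = \<zero>\<^sub>L"
 shows "finite S \<and> card S \<le> degree q"
 using L.card_roots_le[OF map_poly[OF assms(1)], of S] assms unfolding evm_def by simp

end

text \<open>As p is prime, \<zeta> has order exactly p in the multiplicative group. The r \<zeta>^i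
  are then p distinct roots of X^p - r^p, which has no more than p.\<close>

lemma (in field) pth_root_powers:
 assumes p: "Factorial_Ring.prime (p::nat)" and \<zeta>: "\<zeta> \<in> carrier R" "\<zeta> \<noteq> \<one>" "\<zeta> [^] p = \<one>"
  and r: "r \<in> carrier R" "r \<noteq> \<zero>"
 shows "(\<lambda>i. r \<otimes> \<zeta> [^] i) ` {..<p} = {s \<in> carrier R. s [^] p = r [^] p}" "inj_on (\<lambda>i. r \<otimes> \<zeta> [^] i) {..<p}"
  "card {s \<in> carrier R. s [^] p = r [^] p} = p"
proof -
 have p0: "p > 0" using p by (rule prime_gt_0_nat)
 have z0: "\<zeta> \<noteq> \<zero>" using \<zeta>(3) p0 by (metis nat_pow_zero not_gr_zero zero_not_one)
 have U: "\<zeta> \<in> carrier (Multiplicative_Group.mult_of R)" using \<zeta>(1) z0 by simp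
 interpret M: group "Multiplicative_Group.mult_of R" by (rule field_mult_group)
 have pw: "\<zeta> [^]\<^bsub>Multiplicative_Group.mult_of R\<^esub> (k::nat) = \<zeta> [^] k" for k using Multiplicative_Group.nat_pow_mult_of[of R] by simp
 have "M.ord \<zeta> dvd p" using M.pow_eq_id[OF U, of p] \<zeta>(3) pw by simp
 moreover have "M.ord \<zeta> \<noteq> 1" using M.ord_eq_1[OF U] \<zeta>(2) by simp
 ultimately have ord: "M.ord \<zeta> = p" using p by (auto simp: prime_nat_iff)
 have inj0: "inj_on (\<lambda>i. \<zeta> [^] (i::nat)) {..<p}"
 proof -
  have "{0..M.ord \<zeta> - 1} = {..<p}" using ord p0 by auto
  then show ?thesis using M.ord_inj[OF U] by (simp add: pw)
 qed
 show inj: "inj_on (\<lambda>i. r \<otimes> \<zeta> [^] i) {..<p}"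
  using inj0 m_lcancel[OF r(2,1)] \<zeta>(1) by (auto simp: inj_on_def)
 have sub: "(\<lambda>i. r \<otimes> \<zeta> [^] i) ` {..<p} \<subseteq> {s \<in> carrier R. s [^] p = r [^] p}"
 proof (rule image_subsetI)
  fix i :: nat
  have "(\<zeta> [^] i) [^] p = (\<zeta> [^] p) [^] i" using \<zeta>(1) by (simp add: nat_pow_pow mult.commute)
  then have "(r \<otimes> \<zeta> [^] i) [^] p = r [^] p" using \<zeta> r by (simp add: pow_mult_distrib m_comm)
  then show "r \<otimes> \<zeta> [^] i \<in> {s \<in> carrier R. s [^] p = r [^] p}" using r \<zeta> by simp
 qed
 define q where "q = \<one> # replicate (p - 1) \<zero> @ [\<ominus> (r [^] p)]"
 have q: "q \<in> carrier (poly_ring R)" "q \<noteq> []" "degree q = p"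
  using p0 r by (auto simp: q_def univ_poly_def polynomial_def)
 have "eval q s = \<zero>" if "s \<in> carrier R" "s [^] p = r [^] p" for s
 proof -
  have "eval q s = s [^] p \<oplus> eval (replicate (p - 1) \<zero> @ [\<ominus> (r [^] p)]) s"
   unfolding q_def using that p0 r by simp
  also have "... = \<zero>" using eval_replicate[of "[\<ominus> (r [^] p)]" s "p - 1"] that r by (simp add: r_neg)
  finally show ?thesis .
 qed
 then have fc: "finite {s \<in> carrier R. s [^] p = r [^] p} \<and> card {s \<in> carrier R. s [^] p = r [^] p} \<le> p"
  using card_roots_le[OF q(1,2), of "{s \<in> carrier R. s [^] p = r [^] p}"] q(3) by simp
 have ci: "card ((\<lambda>i. r \<otimes> \<zeta> [^] i) ` {..<p}) = p" using card_image[OF inj] by simp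
 show "(\<lambda>i. r \<otimes> \<zeta> [^] i) ` {..<p} = {s \<in> carrier R. s [^] p = r [^] p}"
  by (rule card_seteq) (use fc sub ci in auto)
 then show "card {s \<in> carrier R. s [^] p = r [^] p} = p" using ci by simp
qed

lemma (in cring) geometric_zero:
 assumes "s \<in> carrier R"
 shows "(s \<ominus> \<one>) \<otimes> (\<Oplus>l\<in>{..<n::nat}. s [^] l) = s [^] n \<ominus> \<one>"
proof (induction n)
 case 0
 then show ?case using assms by (simp add: minus_eq r_neg)
next
 case (Suc n)
 have c: "(\<Oplus>l\<in>{..<n}. s [^] l) \<in> carrier R" using assms by (intro finsum_closed) auto
 have "(\<Oplus>l\<in>{..<Suc n}. s [^] l) = s [^] n \<oplus> (\<Oplus>l\<in>{..<n}. s [^] l)"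
  unfolding lessThan_Suc using assms by (subst finsum_insert) auto
 then have "(s \<ominus> \<one>) \<otimes> (\<Oplus>l\<in>{..<Suc n}. s [^] l) = (s \<ominus> \<one>) \<otimes> s [^] n \<oplus> (s [^] n \<ominus> \<one>)"
  using Suc c assms by (simp add: r_distr)
 also have "... = s [^] Suc n \<ominus> \<one>"
 proof -
  have "(s \<ominus> \<one>) \<otimes> m \<oplus> (m \<ominus> \<one>) = m \<otimes> s \<ominus> \<one>" if "m \<in> carrier R" for m
   using that assms by algebra
  then show ?thesis using assms by simp
 qed
 finally show ?case .
qed

text \<open>Vieta's formula for the constant term of a polynomial with as many distinct roots as its
  degree; one linear factor is split off per root.\<close>

lemma (in field) eval_zero_prod_roots:
 assumes "finite S"
 shows "[|q \<in> carrier (poly_ring R); q \<noteq> []; degree q = card S; S \<subseteq> carrier R; \<And>s. s \<in> S ==> eval q s = \<zero>|]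
  ==> eval q \<zero> = lead_coeff q \<otimes> (\<Otimes>s\<in>S. \<ominus> s)"
 using assms
proof (induction S arbitrary: q rule: finite_induct)
 case empty
 then have "length q = 1" by (metis One_nat_def Suc_diff_1 card.empty length_greater_0_conv)
 then obtain a where a: "q = [a]" by (metis length_0_conv length_Suc_conv One_nat_def)
 have "a \<in> carrier R" using poly_in_carrierD[OF empty(1)] a by simp
 then show ?case using a by simp
next
 case (insert s S)
 let ?P = "poly_ring R" and ?l = "[\<one>, \<ominus> s]"
 interpret P: domain ?P by (rule poly_ring_facts(2))
 have s: "s \<in> carrier R" using insert by simp
 have lc: "?l \<in> carrier ?P" using s by (simp add: univ_poly_def polynomial_def)
 have ev: "eval ?l u = u \<ominus> s" if "u \<in> carrier R" for u using that s by (simp add: minus_eq)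
 have "is_root q s" using insert s by (simp add: is_root_def)
 then have "?l pdivides q" by (rule is_root_imp_pdivides[OF insert.prems(1)])
 then obtain q' where q': "q' \<in> carrier ?P" "q = ?l \<otimes>\<^bsub>?P\<^esub> q'" unfolding pdivides_def factor_def by blast
 have nz: "q' \<noteq> []" using q' insert.prems(2) lc P.r_null[of ?l] by (auto simp: univ_poly_zero)
 have pol: "polynomial (carrier R) ?l" "polynomial (carrier R) q'" using lc q' by (simp_all add: univ_poly_carrier)
 have "degree q = degree ?l + degree q'"
  using poly_mult_degree_eq[OF carrier_is_subring pol] nz unfolding q'(2) univ_poly_mult by simp
 then have dq: "degree q' = card S" using insert by simp
 have lq: "lead_coeff q = lead_coeff q'"
  using poly_mult_lead_coeff[OF carrier_is_subring pol] nz poly_in_carrierD[OF q'(1)]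
  unfolding q'(2) univ_poly_mult by (cases q') auto
 have evq: "eval q u = (u \<ominus> s) \<otimes> eval q' u" if "u \<in> carrier R" for u
  unfolding q'(2) univ_poly_mult
  using eval_poly_mult[OF poly_in_carrierD[OF lc] poly_in_carrierD[OF q'(1)] that] ev[OF that] by simp
 have "eval q' u = \<zero>" if u: "u \<in> S" for u
 proof -
  have uc: "u \<in> carrier R" using u insert by blast
  have "(u \<ominus> s) \<otimes> eval q' u = \<zero>" using evq[OF uc] insert.prems(5)[of u] u by simp
  then have "u \<ominus> s = \<zero> \<or> eval q' u = \<zero>"
   using integral uc s eval_in_carrier[OF poly_in_carrierD[OF q'(1)] uc] minus_closed by blast
  moreover have "u \<ominus> s \<noteq> \<zero>"
  proof
   assume "u \<ominus> s = \<zero>"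
   then have "u = s" using uc s sum_zero_eq_neg[of u "\<ominus> s"] by (simp add: minus_eq)
   then show False using u insert(2) by simp
  qed
  ultimately show ?thesis by blast
 qed
 then have IH: "eval q' \<zero> = lead_coeff q' \<otimes> (\<Otimes>s\<in>S. \<ominus> s)"
  using insert.IH[OF q'(1) nz dq] insert.prems(4) by simp
 have lc': "lead_coeff q' \<in> carrier R" using poly_in_carrierD[OF q'(1)] nz by (cases q') auto
 have pc: "(\<Otimes>s\<in>S. \<ominus> s) \<in> carrier R" using insert.prems(4) by (intro finprod_closed) auto
 have "(\<Otimes>s\<in>insert s S. \<ominus> s) = \<ominus> s \<otimes> (\<Otimes>s\<in>S. \<ominus> s)"
  using insert s by (intro finprod_insert) auto
 moreover have "eval q \<zero> = \<ominus> s \<otimes> (lead_coeff q' \<otimes> (\<Otimes>s\<in>S. \<ominus> s))"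
  using evq[of \<zero>] s IH by (simp add: minus_eq)
 ultimately show ?case unfolding lq using s lc' pc by (simp add: m_lcomm)
qed

text \<open>\<open>gen\<close> and \<open>ind\<close> say that 1, t, ..., t^(p-1) is a basis of C
  over Z, so that C is Z[X]/(X^p - lam). Of the field L only p distinct p-th roots of
  \<open>lam\<close> are demanded, which allows L = Z when the roots are already there.\<close>

locale radical_ext = Z: field Z + C: cring C + L: field L + E: coeff_hom Z C j + F: coeff_hom_field Z L \<iota>
 for Z :: "('k, 'a) ring_scheme" and C :: "('c, 'd) ring_scheme" and j
  and L :: "('l, 'b) ring_scheme" and \<iota> +
 fixes p :: nat and t :: 'c and lam :: 'k
 assumes p: "Factorial_Ring.prime p" and t: "t \<in> carrier C" and lam: "lam \<in> carrier Z" "lam \<noteq> \<zero>\<^sub>Z"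
  and tp: "t [^]\<^sub>C p = j lam"
  and gen: "\<And>v. v \<in> carrier C ==> \<exists>a. (\<forall>l. a l \<in> carrier Z) \<and> v = (\<Oplus>\<^sub>C l\<in>{..<p}. j (a l) \<otimes>\<^sub>C t [^]\<^sub>C l)"
  and ind: "\<And>a l. [|\<And>l. a l \<in> carrier Z; (\<Oplus>\<^sub>C l\<in>{..<p}. j (a l) \<otimes>\<^sub>C t [^]\<^sub>C l) = \<zero>\<^sub>C; l < p|] ==> a l = \<zero>\<^sub>Z"
  and cardR: "card {r \<in> carrier L. r [^]\<^sub>L p = \<iota> lam} = p"
  and p_nz: "add_pow Z p \<one>\<^sub>Z \<noteq> \<zero>\<^sub>Z"
begin

abbreviation P where "P \<equiv> poly_ring Z"
abbreviation R where "R \<equiv> {r \<in> carrier L. r [^]\<^sub>L p = \<iota> lam}"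
abbreviation ev where "ev \<equiv> evm C j t"
abbreviation \<phi> where "\<phi> r \<equiv> evm L \<iota> r"

sublocale P: domain P by (rule Z.poly_ring_facts(2))
sublocale ev: ring_hom_cring P C ev by (rule E.evm_hom[OF t])

lemma \<phi>_hom: "r \<in> carrier L ==> ring_hom_cring P L (\<phi> r)"
 by (rule F.evm_hom)

lemma p_pos: "p > 0" "p > 1" using p prime_gt_1_nat prime_gt_0_nat by auto

lemma finR: "finite R" using cardR p_pos by (metis card.infinite less_numeral_extra(3))

lemma R_nz: "r \<in> R ==> r \<noteq> \<zero>\<^sub>L"
 using lam F.\<iota>_zero_iff[OF lam(1)] L.nat_pow_zero[of p] p_pos by auto

lemma small_nonzero:
 assumes "q \<in> carrier P" "length q \<le> p" "ev q = \<zero>\<^sub>C" shows "q = []"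
proof -
 obtain a where a: "\<And>l. a l \<in> carrier Z" "q = E.pol p a" by (rule E.poly_is_pol[OF assms(1,2)]) blast
 have "(\<Oplus>\<^sub>C l\<in>{..<p}. j (a l) \<otimes>\<^sub>C t [^]\<^sub>C l) = \<zero>\<^sub>C" using E.evm_pol[of p a t] a t assms(3) by simp
 then have z: "a l = \<zero>\<^sub>Z" if "l < p" for l using ind[of a l] a(1) that by blast
 have "map a (rev [0..<p]) = replicate p \<zero>\<^sub>Z"
  by (rule nth_equalityI) (auto simp: rev_nth z)
 then show ?thesis using a(2) Z.normalize_replicate_zero[of p "[]"] by (simp add: E.pol_def)
qed

text \<open>The polynomial X^p - lam, with p - 1 zeros between its end coefficients.\<close>

definition xm where "xm = \<one>\<^sub>Z # replicate (p - 1) \<zero>\<^sub>Z @ [\<ominus>\<^sub>Z lam]"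

lemma xm: "xm \<in> carrier P" "xm \<noteq> []" "degree xm = p"
 using p_pos lam by (auto simp: xm_def univ_poly_def polynomial_def)

lemma ev_xm: "ev xm = \<zero>\<^sub>C" and \<phi>_xm: "r \<in> R ==> \<phi> r xm = \<zero>\<^sub>L"
proof -
 have "evm S k r xm = r [^]\<^sub>S p \<ominus>\<^sub>S k lam" if h: "coeff_hom Z S k" and r: "r \<in> carrier S"
  for S :: "('x, 'y) ring_scheme" and k r
 proof -
  interpret H: coeff_hom Z S k by (rule h)
  have "evm S k r xm = k \<one>\<^sub>Z \<otimes>\<^sub>S r [^]\<^sub>S p \<oplus>\<^sub>S H.S.eval (replicate (p - 1) \<zero>\<^sub>S @ [k (\<ominus>\<^sub>Z lam)]) r"
   unfolding evm_def xm_def using p_pos by simp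
  also have "... = r [^]\<^sub>S p \<ominus>\<^sub>S k lam"
   using H.S.eval_replicate[of "[k (\<ominus>\<^sub>Z lam)]" r "p - 1"] r lam by (simp add: H.S.minus_eq)
  finally show ?thesis .
 qed
 note * = this
 show "ev xm = \<zero>\<^sub>C" using *[OF E.coeff_hom_axioms t] tp lam by (simp add: C.minus_eq C.r_neg)
 show "r \<in> R ==> \<phi> r xm = \<zero>\<^sub>L"
  using *[OF F.coeff_hom_axioms, of r] lam by (simp add: L.minus_eq L.r_neg)
qed

lemma reduce:
 assumes q: "q \<in> carrier P"
 obtains b c where "b \<in> carrier P" "c \<in> carrier P" "q = (xm \<otimes>\<^sub>P b) \<oplus>\<^sub>P c" "length c \<le> p"
proof -
 obtain b c where bc: "b \<in> carrier P" "c \<in> carrier P" "q = (xm \<otimes>\<^sub>P b) \<oplus>\<^sub>P c" "c = \<zero>\<^sub>P \<or> degree c < degree xm"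
  using Z.field_long_division_theorem_shell[OF Z.carrier_is_subfield q xm(1)] xm(2) by (auto simp: univ_poly_zero)
 have "length c \<le> p" using bc(4) xm(3) by (auto simp: univ_poly_zero)
 then show ?thesis using that bc by blast
qed

text \<open>Both sides depend only on the remainder of q modulo X^p - lam. A remainder has degree
  below p: it vanishes at t only if it is zero, by independence of the powers of t, and at the p
  points of \<open>R\<close> only if it is zero, by counting roots.\<close>

lemma ev_zero_iff:
 assumes q: "q \<in> carrier P"
 shows "ev q = \<zero>\<^sub>C \<longleftrightarrow> (\<forall>r\<in>R. \<phi> r q = \<zero>\<^sub>L)"
proof -
 obtain b c where bc: "b \<in> carrier P" "c \<in> carrier P" "q = (xm \<otimes>\<^sub>P b) \<oplus>\<^sub>P c" "length c \<le> p"
  by (rule reduce[OF q])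
 have evq: "ev q = ev c"
  unfolding bc(3) using bc(1,2) xm(1) ev_xm ev.hom_closed[OF bc(1)] ev.hom_closed[OF bc(2)] by simp
 have phq: "\<phi> r q = \<phi> r c" if r: "r \<in> R" for r
 proof -
  interpret ph: ring_hom_cring P L "\<phi> r" using \<phi>_hom r by blast
  show ?thesis unfolding bc(3) using bc(1,2) xm(1) \<phi>_xm[OF r] ph.hom_closed[OF bc(1)] ph.hom_closed[OF bc(2)] by simp
 qed
 show ?thesis
 proof
  assume "ev q = \<zero>\<^sub>C"
  then have "c = []" using small_nonzero[OF bc(2,4)] evq by simp
  then have "\<phi> r c = \<zero>\<^sub>L" for r by (simp add: evm_def)
  then show "\<forall>r\<in>R. \<phi> r q = \<zero>\<^sub>L" using phq by simp
 next
  assume z: "\<forall>r\<in>R. \<phi> r q = \<zero>\<^sub>L"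
  have "c = []"
  proof (rule ccontr)
   assume c: "c \<noteq> []"
   have "card R \<le> degree c" using F.card_zeros_le[OF bc(2) c, of R] z phq by auto
   then show False using cardR bc(4) c p_pos by (cases c) auto
  qed
  then show "ev q = \<zero>\<^sub>C" unfolding evq by (simp add: evm_def)
 qed
qed

lemma surj: 
 assumes "v \<in> carrier C" obtains a where "\<And>l. a l \<in> carrier Z" "E.pol p a \<in> carrier P" "ev (E.pol p a) = v"
  "\<And>r. r \<in> R ==> \<phi> r (E.pol p a) = (\<Oplus>\<^sub>L l\<in>{..<p}. \<iota> (a l) \<otimes>\<^sub>L r [^]\<^sub>L l)"
proof -
 obtain a where a: "\<And>l. a l \<in> carrier Z" "v = (\<Oplus>\<^sub>C l\<in>{..<p}. j (a l) \<otimes>\<^sub>C t [^]\<^sub>C l)" using gen[OF assms] by blast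
 show ?thesis
  using that[of a] a E.pol_carrier[of p a] E.evm_pol[of p a t] F.evm_pol[of p a] t by auto
qed

lemma ev_eq_iff:
 assumes q: "q \<in> carrier P" "q' \<in> carrier P"
 shows "ev q = ev q' \<longleftrightarrow> (\<forall>r\<in>R. \<phi> r q = \<phi> r q')"
proof -
 have *: "a = b \<longleftrightarrow> a \<oplus>\<^sub>S (\<ominus>\<^sub>S b) = \<zero>\<^sub>S" if "cring S" "a \<in> carrier S" "b \<in> carrier S" for S :: "('x, 'y) ring_scheme" and a b
 proof -
  interpret S: cring S by fact
  show ?thesis using S.sum_zero_eq_neg[of a "\<ominus>\<^sub>S b"] that S.r_neg by auto
 qed
 have d: "q \<oplus>\<^sub>P (\<ominus>\<^sub>P q') \<in> carrier P" using q by simp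
 have "ev q = ev q' \<longleftrightarrow> ev (q \<oplus>\<^sub>P (\<ominus>\<^sub>P q')) = \<zero>\<^sub>C"
  using *[OF C.is_cring ev.hom_closed[OF q(1)] ev.hom_closed[OF q(2)]] q by simp
 also have "... \<longleftrightarrow> (\<forall>r\<in>R. \<phi> r (q \<oplus>\<^sub>P (\<ominus>\<^sub>P q')) = \<zero>\<^sub>L)" by (rule ev_zero_iff[OF d])
 also have "... \<longleftrightarrow> (\<forall>r\<in>R. \<phi> r q = \<phi> r q')"
 proof (rule ball_cong[OF refl])
  fix r assume r: "r \<in> R"
  interpret ph: ring_hom_cring P L "\<phi> r" using \<phi>_hom r by blast
  show "\<phi> r (q \<oplus>\<^sub>P (\<ominus>\<^sub>P q')) = \<zero>\<^sub>L \<longleftrightarrow> \<phi> r q = \<phi> r q'"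
   using *[OF L.is_cring ph.hom_closed[OF q(1)] ph.hom_closed[OF q(2)]] q by simp
 qed
 finally show ?thesis .
qed

text \<open>By \<open>ev_eq_iff\<close> elements of C are functions on the roots, and u is the
  characteristic function of S. Only those S occur on which a polynomial over Z takes these
  values.\<close>

definition indic :: "'l set \<Rightarrow> 'c \<Rightarrow> bool" where
 "indic S u \<longleftrightarrow> (\<exists>q\<in>carrier P. ev q = u \<and> (\<forall>r\<in>R. \<phi> r q = (if r \<in> S then \<one>\<^sub>L else \<zero>\<^sub>L)))"

lemma indic_unique: "indic S u ==> indic T v ==> S \<subseteq> R ==> T \<subseteq> R ==> u = v \<longleftrightarrow> S = T"
proof -
 assume u: "indic S u" and v: "indic T v" and ST: "S \<subseteq> R" "T \<subseteq> R"
 obtain q where q: "q \<in> carrier P" "ev q = u" "\<forall>r\<in>R. \<phi> r q = (if r \<in> S then \<one>\<^sub>L else \<zero>\<^sub>L)" using u by (auto simp: indic_def)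
 obtain q' where q': "q' \<in> carrier P" "ev q' = v" "\<forall>r\<in>R. \<phi> r q' = (if r \<in> T then \<one>\<^sub>L else \<zero>\<^sub>L)" using v by (auto simp: indic_def)
 have "u = v \<longleftrightarrow> (\<forall>r\<in>R. \<phi> r q = \<phi> r q')" using ev_eq_iff[OF q(1) q'(1)] q(2) q'(2) by simp
 also have "... \<longleftrightarrow> (\<forall>r\<in>R. r \<in> S \<longleftrightarrow> r \<in> T)" using q(3) q'(3) L.zero_not_one by (metis (no_types, lifting))
 also have "... \<longleftrightarrow> S = T" using ST by blast
 finally show ?thesis .
qed

lemma indic_carrier: "indic S u ==> u \<in> carrier C"
 using ev.hom_closed by (auto simp: indic_def)

lemma indic_empty: "indic {} \<zero>\<^sub>C"
 unfolding indic_def by (rule bexI[of _ "\<zero>\<^sub>P"]) (auto simp: univ_poly_zero evm_def)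

lemma indic_R: "indic R \<one>\<^sub>C"
 unfolding indic_def
proof (rule bexI[of _ "\<one>\<^sub>P"], intro conjI ballI)
 fix r assume r: "r \<in> R"
 interpret ph: ring_hom_cring P L "\<phi> r" using \<phi>_hom r by blast
 show "\<phi> r \<one>\<^sub>P = (if r \<in> R then \<one>\<^sub>L else \<zero>\<^sub>L)" using r by simp
qed auto

lemma indic_add:
 assumes "indic S u" "indic T v" "S \<inter> T = {}"
 shows "indic (S \<union> T) (u \<oplus>\<^sub>C v)"
proof -
 obtain q where q: "q \<in> carrier P" "ev q = u" "\<forall>r\<in>R. \<phi> r q = (if r \<in> S then \<one>\<^sub>L else \<zero>\<^sub>L)" using assms(1) by (auto simp: indic_def)
 obtain q' where q': "q' \<in> carrier P" "ev q' = v" "\<forall>r\<in>R. \<phi> r q' = (if r \<in> T then \<one>\<^sub>L else \<zero>\<^sub>L)" using assms(2) by (auto simp: indic_def)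
 have "\<phi> r (q \<oplus>\<^sub>P q') = (if r \<in> S \<union> T then \<one>\<^sub>L else \<zero>\<^sub>L)" if r: "r \<in> R" for r
 proof -
  interpret ph: ring_hom_cring P L "\<phi> r" using \<phi>_hom r by blast
  have "\<phi> r (q \<oplus>\<^sub>P q') = \<phi> r q \<oplus>\<^sub>L \<phi> r q'" using q q' by simp
  then show ?thesis using q(3) q'(3) r assms(3) by auto
 qed
 then show ?thesis unfolding indic_def using q(1,2) q'(1,2) by (intro bexI[of _ "q \<oplus>\<^sub>P q'"]) auto
qed

lemma indic_sum:
 assumes "finite A" "\<And>i. i \<in> A ==> indic (S i) (u i)" "\<And>i k. [|i \<in> A; k \<in> A; i \<noteq> k|] ==> S i \<inter> S k = {}"
 shows "indic (\<Union>i\<in>A. S i) (\<Oplus>\<^sub>C i\<in>A. u i)"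
 using assms
proof (induction rule: finite_induct)
 case empty
 then show ?case using indic_empty by simp
next
 case (insert a A)
 have "indic (S a \<union> (\<Union>i\<in>A. S i)) (u a \<oplus>\<^sub>C (\<Oplus>\<^sub>C i\<in>A. u i))"
 proof (rule indic_add)
  show "indic (\<Union>i\<in>A. S i) (\<Oplus>\<^sub>C i\<in>A. u i)" using insert by blast
  show "S a \<inter> (\<Union>i\<in>A. S i) = {}" using insert by fastforce
 qed (use insert in blast)
 moreover have "(\<Oplus>\<^sub>C i\<in>insert a A. u i) = u a \<oplus>\<^sub>C (\<Oplus>\<^sub>C i\<in>A. u i)"
  using insert.hyps indic_carrier[OF insert.prems(1)] by (intro C.finsum_insert) auto
 ultimately show ?case by simp
qed

lemma indic_idem:
 assumes "indic S u" shows "u \<otimes>\<^sub>C u = u"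
proof -
 obtain q where q: "q \<in> carrier P" "ev q = u" "\<forall>r\<in>R. \<phi> r q = (if r \<in> S then \<one>\<^sub>L else \<zero>\<^sub>L)" using assms by (auto simp: indic_def)
 have "\<forall>r\<in>R. \<phi> r (q \<otimes>\<^sub>P q) = \<phi> r q"
 proof
  fix r assume r: "r \<in> R"
  interpret ph: ring_hom_cring P L "\<phi> r" using \<phi>_hom r by blast
  show "\<phi> r (q \<otimes>\<^sub>P q) = \<phi> r q" using q r by simp
 qed
 then have "ev (q \<otimes>\<^sub>P q) = ev q" using ev_eq_iff[of "q \<otimes>\<^sub>P q" q] q(1) by simp
 then show ?thesis using q(1,2) by simp
qed

text \<open>An idempotent below \<open>u\<close> has values \<open>0\<close> or \<open>1\<close> at the points of \<open>S\<close>; if polynomials over \<open>Z\<close>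
 cannot separate the points of \<open>S\<close> by their zeros, these values are all equal.\<close>

lemma indic_primitive:
 assumes u: "indic S u" and S: "S \<subseteq> R"
  and conn: "\<And>q r s. [|q \<in> carrier P; r \<in> S; s \<in> S; \<phi> r q = \<zero>\<^sub>L|] ==> \<phi> s q = \<zero>\<^sub>L"
  and v: "v \<in> carrier C" "v \<otimes>\<^sub>C v = v" "v \<otimes>\<^sub>C u = v"
 shows "v = \<zero>\<^sub>C \<or> v = u"
proof -
 obtain q where q: "q \<in> carrier P" "ev q = u" "\<forall>r\<in>R. \<phi> r q = (if r \<in> S then \<one>\<^sub>L else \<zero>\<^sub>L)" using u by (auto simp: indic_def)
 obtain a where a: "E.pol p a \<in> carrier P" "ev (E.pol p a) = v" by (rule surj[OF v(1)]) blast
 define w where "w = E.pol p a"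
 have w: "w \<in> carrier P" "ev w = v" using a by (auto simp: w_def)
 have "ev (w \<otimes>\<^sub>P w) = ev w" "ev (w \<otimes>\<^sub>P q) = ev w" using w q v by auto
 then have e: "\<forall>r\<in>R. \<phi> r (w \<otimes>\<^sub>P w) = \<phi> r w" "\<forall>r\<in>R. \<phi> r (w \<otimes>\<^sub>P q) = \<phi> r w"
  using ev_eq_iff[of "w \<otimes>\<^sub>P w" w] ev_eq_iff[of "w \<otimes>\<^sub>P q" w] w(1) q(1) by auto
 have val: "\<phi> r w = \<zero>\<^sub>L \<or> \<phi> r w = \<one>\<^sub>L" "r \<notin> S ==> \<phi> r w = \<zero>\<^sub>L" if r: "r \<in> R" for r
 proof -
  interpret ph: ring_hom_cring P L "\<phi> r" using \<phi>_hom r by blast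
  have c: "\<phi> r w \<in> carrier L" using w(1) by (rule ph.hom_closed)
  have "\<phi> r w \<otimes>\<^sub>L \<phi> r w = \<phi> r w \<otimes>\<^sub>L \<one>\<^sub>L" using bspec[OF e(1) r] ph.hom_mult[OF w(1) w(1)] c by simp
  then show "\<phi> r w = \<zero>\<^sub>L \<or> \<phi> r w = \<one>\<^sub>L" using L.m_lcancel[of "\<phi> r w" "\<phi> r w" "\<one>\<^sub>L"] c by auto
  show "r \<notin> S ==> \<phi> r w = \<zero>\<^sub>L"
   using bspec[OF e(2) r] ph.hom_mult[OF w(1) q(1)] bspec[OF q(3) r] c by simp
 qed
 show ?thesis
 proof (cases "\<exists>s\<in>S. \<phi> s w = \<zero>\<^sub>L")
  case True
  then have "\<forall>r\<in>R. \<phi> r w = \<zero>\<^sub>L" using conn[OF w(1)] val(2) by blast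
  then show ?thesis using ev_zero_iff[OF w(1)] w(2) by simp
 next
  case False
  then have "\<forall>r\<in>R. \<phi> r w = \<phi> r q" using val q(3) S by auto
  then show ?thesis using ev_eq_iff[OF w(1) q(1)] w(2) q(2) by simp
 qed
qed

text \<open>The summands are the powers of w = r/s, which satisfies w^p = 1. For w = 1 the sum is p;
  otherwise w - 1 times the sum is w^p - 1 = 0.\<close>

lemma root_of_unity_sum:
 assumes "r \<in> R" "s \<in> R"
 shows "(\<Oplus>\<^sub>L l\<in>{..<p}. inv\<^bsub>L\<^esub> (s [^]\<^sub>L l) \<otimes>\<^sub>L r [^]\<^sub>L l) = (if r = s then add_pow L p \<one>\<^sub>L else \<zero>\<^sub>L)"
proof -
 have rc: "r \<in> carrier L" "s \<in> carrier L" "r [^]\<^sub>L p = s [^]\<^sub>L p" "s \<noteq> \<zero>\<^sub>L" using assms R_nz by auto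
 have sU: "s \<in> Units L" using rc L.field_Units by simp
 define w where "w = inv\<^bsub>L\<^esub> s \<otimes>\<^sub>L r"
 have w: "w \<in> carrier L" unfolding w_def using rc sU by simp
 have wl: "inv\<^bsub>L\<^esub> (s [^]\<^sub>L l) \<otimes>\<^sub>L r [^]\<^sub>L l = w [^]\<^sub>L l" for l :: nat
 proof -
  have "inv\<^bsub>L\<^esub> (s [^]\<^sub>L l) = (inv\<^bsub>L\<^esub> s) [^]\<^sub>L l"
  proof (rule L.comm_inv_char)
   show "s [^]\<^sub>L l \<otimes>\<^sub>L inv\<^bsub>L\<^esub> s [^]\<^sub>L l = \<one>\<^sub>L"
    using L.pow_mult_distrib[of s "inv\<^bsub>L\<^esub> s" l] L.m_comm rc sU by simp
  qed (use rc sU in auto)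
  then show ?thesis unfolding w_def using L.pow_mult_distrib[of "inv\<^bsub>L\<^esub> s" r l] L.m_comm rc sU by simp
 qed
 show ?thesis
 proof (cases "r = s")
  case True
  then have "w = \<one>\<^sub>L" unfolding w_def using sU by simp
  then have "(\<Oplus>\<^sub>L l\<in>{..<p}. inv\<^bsub>L\<^esub> (s [^]\<^sub>L l) \<otimes>\<^sub>L r [^]\<^sub>L l) = (\<Oplus>\<^sub>L l\<in>{..<p}. \<one>\<^sub>L)" unfolding wl by simp
  also have "... = add_pow L p \<one>\<^sub>L" using L.add.finprod_const[of "\<one>\<^sub>L" "{..<p}"] by simp
  finally show ?thesis using True by simp
 next
  case False
  have "w \<noteq> \<one>\<^sub>L"
  proof
   assume "w = \<one>\<^sub>L"
   then have "s \<otimes>\<^sub>L (inv\<^bsub>L\<^esub> s \<otimes>\<^sub>L r) = s" unfolding w_def using rc by simp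
   then show False using False rc sU by (simp add: L.m_assoc[symmetric])
  qed
  moreover have "w [^]\<^sub>L p = \<one>\<^sub>L"
  proof -
   have "s [^]\<^sub>L p \<in> Units L" using sU L.Units_pow_closed by blast
   then show ?thesis using wl[of p] rc(3) by simp
  qed
  moreover have sc: "(\<Oplus>\<^sub>L l\<in>{..<p}. w [^]\<^sub>L l) \<in> carrier L" using w by (intro L.finsum_closed) auto
  ultimately have "(w \<ominus>\<^sub>L \<one>\<^sub>L) \<otimes>\<^sub>L (\<Oplus>\<^sub>L l\<in>{..<p}. w [^]\<^sub>L l) = \<zero>\<^sub>L"
   using L.geometric_zero[OF w, of p] by (simp add: L.minus_eq L.r_neg)
  moreover have "w \<ominus>\<^sub>L \<one>\<^sub>L \<noteq> \<zero>\<^sub>L"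
   using \<open>w \<noteq> \<one>\<^sub>L\<close> L.sum_zero_eq_neg[of w "\<ominus>\<^sub>L \<one>\<^sub>L"] w by (auto simp: L.minus_eq)
  ultimately show ?thesis using False L.integral[of "w \<ominus>\<^sub>L \<one>\<^sub>L" "\<Oplus>\<^sub>L l\<in>{..<p}. w [^]\<^sub>L l"] w sc unfolding wl by auto
 qed
qed

text \<open>Up to the factor 1/p these are the Fourier coefficients of the characteristic function
  of S on the roots.\<close>

abbreviation ps :: "'l set \<Rightarrow> nat \<Rightarrow> 'l" where "ps S l \<equiv> (\<Oplus>\<^sub>L s\<in>S. inv\<^bsub>L\<^esub> (s [^]\<^sub>L l))"
abbreviation pinv :: 'k where "pinv \<equiv> inv\<^bsub>Z\<^esub> (add_pow Z p \<one>\<^sub>Z)"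

lemma inv_pow_closed: "s \<in> R ==> inv\<^bsub>L\<^esub> (s [^]\<^sub>L (l::nat)) \<in> carrier L"
proof -
 assume s: "s \<in> R"
 then have "s \<in> Units L" using R_nz L.field_Units by simp
 then show ?thesis using L.Units_pow_closed[of s l] by simp
qed

lemma ps_closed: "S \<subseteq> R ==> ps S l \<in> carrier L"
 by (rule L.finsum_closed, rule Pi_I, rule inv_pow_closed) (erule subsetD)

lemma pinv: "pinv \<in> carrier Z" "pinv \<otimes>\<^sub>Z add_pow Z p \<one>\<^sub>Z = \<one>\<^sub>Z"
 "\<iota> pinv \<otimes>\<^sub>L add_pow L p \<one>\<^sub>L = \<one>\<^sub>L"
proof -
 have U: "add_pow Z p \<one>\<^sub>Z \<in> Units Z" using p_nz Z.field_Units by simp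
 then show 1: "pinv \<in> carrier Z" "pinv \<otimes>\<^sub>Z add_pow Z p \<one>\<^sub>Z = \<one>\<^sub>Z" by auto
 have "\<iota> (add_pow Z n \<one>\<^sub>Z) = add_pow L n \<one>\<^sub>L" for n :: nat
  by (induction n) (use Z.add.nat_pow_closed[OF Z.one_closed, unfolded add_pow_def] in \<open>auto simp: add_pow_def\<close>)
 then show "\<iota> pinv \<otimes>\<^sub>L add_pow L p \<one>\<^sub>L = \<one>\<^sub>L"
  using F.J.hom_mult[OF 1(1), of "add_pow Z p \<one>\<^sub>Z"] 1(2) by simp
qed

text \<open>Fourier inversion: after exchanging the two sums, orthogonality of the roots leaves only
  the term s = r.\<close>

lemma fourier:
 assumes S: "S \<subseteq> R" and r: "r \<in> R"
 shows "(\<Oplus>\<^sub>L l\<in>{..<p}. \<iota> pinv \<otimes>\<^sub>L ps S l \<otimes>\<^sub>L r [^]\<^sub>L l) = (if r \<in> S then \<one>\<^sub>L else \<zero>\<^sub>L)"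
proof -
 have fS: "finite S" using S finR finite_subset by blast
 have rc: "r \<in> carrier L" using r by simp
 have ic: "inv\<^bsub>L\<^esub> (s [^]\<^sub>L l) \<in> carrier L" if "s \<in> S" for s and l :: nat using inv_pow_closed that S by blast
 have pc: "\<iota> pinv \<in> carrier L" using pinv by simp
 have "(\<Oplus>\<^sub>L l\<in>{..<p}. \<iota> pinv \<otimes>\<^sub>L ps S l \<otimes>\<^sub>L r [^]\<^sub>L l)
   = (\<Oplus>\<^sub>L l\<in>{..<p}. \<iota> pinv \<otimes>\<^sub>L (\<Oplus>\<^sub>L s\<in>S. inv\<^bsub>L\<^esub> (s [^]\<^sub>L l) \<otimes>\<^sub>L r [^]\<^sub>L l))"
 proof (rule L.finsum_cong')
  fix l assume "l \<in> {..<p}"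
  have "ps S l \<otimes>\<^sub>L r [^]\<^sub>L l = (\<Oplus>\<^sub>L s\<in>S. inv\<^bsub>L\<^esub> (s [^]\<^sub>L l) \<otimes>\<^sub>L r [^]\<^sub>L l)"
   by (rule L.finsum_ldistr) (use fS ic rc in auto)
  then show "\<iota> pinv \<otimes>\<^sub>L ps S l \<otimes>\<^sub>L r [^]\<^sub>L l = \<iota> pinv \<otimes>\<^sub>L (\<Oplus>\<^sub>L s\<in>S. inv\<^bsub>L\<^esub> (s [^]\<^sub>L l) \<otimes>\<^sub>L r [^]\<^sub>L l)"
   using ps_closed[OF S] rc pc by (simp add: L.m_assoc)
 qed (use ic rc pc in \<open>auto intro!: L.finsum_closed\<close>)
 also have "... = \<iota> pinv \<otimes>\<^sub>L (\<Oplus>\<^sub>L l\<in>{..<p}. \<Oplus>\<^sub>L s\<in>S. inv\<^bsub>L\<^esub> (s [^]\<^sub>L l) \<otimes>\<^sub>L r [^]\<^sub>L l)"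
  by (rule L.finsum_rdistr[symmetric]) (use ic rc pc in \<open>auto intro!: L.finsum_closed\<close>)
 also have "(\<Oplus>\<^sub>L l\<in>{..<p}. \<Oplus>\<^sub>L s\<in>S. inv\<^bsub>L\<^esub> (s [^]\<^sub>L l) \<otimes>\<^sub>L r [^]\<^sub>L l)
   = (\<Oplus>\<^sub>L s\<in>S. \<Oplus>\<^sub>L l\<in>{..<p}. inv\<^bsub>L\<^esub> (s [^]\<^sub>L l) \<otimes>\<^sub>L r [^]\<^sub>L l)"
  by (rule L.finsum_swap) (use fS ic rc in auto)
 also have "... = (\<Oplus>\<^sub>L s\<in>S. if r = s then add_pow L p \<one>\<^sub>L else \<zero>\<^sub>L)"
  by (rule L.finsum_cong') (use S r root_of_unity_sum in auto)
 also have "... = (if r \<in> S then add_pow L p \<one>\<^sub>L else \<zero>\<^sub>L)"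
 proof (cases "r \<in> S")
  case True
  then show ?thesis using L.finsum_singleton[OF True fS, of "\<lambda>_. add_pow L p \<one>\<^sub>L"] by simp
 next
  case False
  then show ?thesis by (auto intro!: L.add.finprod_one_eqI)
 qed
 finally show ?thesis using pinv(3) pc by simp
qed

text \<open>If the power sums of S come from Z, then the interpolating polynomial has coefficients
  in Z, and substituting t gives an explicit formula for the idempotent.\<close>

lemma indic_fourier:
 assumes S: "S \<subseteq> R" and z: "\<And>l. z l \<in> carrier Z" "\<And>l. l < p ==> \<iota> (z l) = ps S l"
 shows "indic S (\<Oplus>\<^sub>C l\<in>{..<p}. j (pinv \<otimes>\<^sub>Z z l) \<otimes>\<^sub>C t [^]\<^sub>C l)"
 unfolding indic_def
proof (rule bexI[of _ "E.pol p (\<lambda>l. pinv \<otimes>\<^sub>Z z l)"], intro conjI ballI)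
 have c: "pinv \<otimes>\<^sub>Z z l \<in> carrier Z" for l using pinv z by simp
 show "E.pol p (\<lambda>l. pinv \<otimes>\<^sub>Z z l) \<in> carrier P" using c by (rule E.pol_carrier)
 show "ev (E.pol p (\<lambda>l. pinv \<otimes>\<^sub>Z z l)) = (\<Oplus>\<^sub>C l\<in>{..<p}. j (pinv \<otimes>\<^sub>Z z l) \<otimes>\<^sub>C t [^]\<^sub>C l)"
  by (rule E.evm_pol[OF c t])
 fix r assume r: "r \<in> R"
 then have rc: "r \<in> carrier L" by simp
 have "\<phi> r (E.pol p (\<lambda>l. pinv \<otimes>\<^sub>Z z l)) = (\<Oplus>\<^sub>L l\<in>{..<p}. \<iota> (pinv \<otimes>\<^sub>Z z l) \<otimes>\<^sub>L r [^]\<^sub>L l)"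
  by (rule F.evm_pol[OF c rc])
 also have "... = (\<Oplus>\<^sub>L l\<in>{..<p}. \<iota> pinv \<otimes>\<^sub>L ps S l \<otimes>\<^sub>L r [^]\<^sub>L l)"
  by (rule L.finsum_cong') (use pinv z rc ps_closed[OF S] in auto)
 finally show "\<phi> r (E.pol p (\<lambda>l. pinv \<otimes>\<^sub>Z z l)) = (if r \<in> S then \<one>\<^sub>L else \<zero>\<^sub>L)"
  using fourier[OF S r] by simp
qed

text \<open>Converse of \<open>indic_fourier\<close>. The polynomial over Z of degree below p that
  gives u and the Fourier polynomial of S agree at all p roots, so their coefficients agree; the
  power sums are then p times elements of Z.\<close>

lemma indic_coeffs:
 assumes S: "S \<subseteq> R" and u: "indic S u" and l: "l < p"
 shows "ps S l \<in> \<iota> ` carrier Z"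
proof -
 obtain q where q: "q \<in> carrier P" "ev q = u" "\<forall>r\<in>R. \<phi> r q = (if r \<in> S then \<one>\<^sub>L else \<zero>\<^sub>L)" using u by (auto simp: indic_def)
 obtain a where a: "\<And>l. a l \<in> carrier Z" "E.pol p a \<in> carrier P" "ev (E.pol p a) = u"
  "\<And>r. r \<in> R ==> \<phi> r (E.pol p a) = (\<Oplus>\<^sub>L l\<in>{..<p}. \<iota> (a l) \<otimes>\<^sub>L r [^]\<^sub>L l)"
  by (rule surj[OF indic_carrier[OF u]]) blast
 have same: "\<phi> r (E.pol p a) = \<phi> r q" if "r \<in> R" for r using ev_eq_iff[OF a(2) q(1)] a(3) q(2) that by simp
 \<comment> \<open>The Fourier polynomial is known only over L, so the two are compared over L,
   where polynomials are evaluated along the identity map.\<close>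
 interpret I: coeff_hom_field L L id
  using L.field_axioms L.is_cring
  by (simp add: coeff_hom_field_def coeff_hom_def coeff_hom_axioms_def ring_hom_def)
 define b where "b l = \<iota> (a l) \<ominus>\<^sub>L \<iota> pinv \<otimes>\<^sub>L ps S l" for l
 have pc: "\<iota> pinv \<in> carrier L" using pinv by simp
 have psc: "ps S l \<in> carrier L" for l by (rule ps_closed[OF S])
 have bc: "b l \<in> carrier L" for l unfolding b_def using a(1) pc psc by simp
 have z: "evm L id r (I.pol p b) = \<zero>\<^sub>L" if r: "r \<in> R" for r
 proof -
  have rc: "r \<in> carrier L" using r by simp
  have evmb: "evm L id r (I.pol p b) = (\<Oplus>\<^sub>L l\<in>{..<p}. b l \<otimes>\<^sub>L r [^]\<^sub>L l)" using I.evm_pol[of p b, OF bc rc] by simp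
  have "(\<Oplus>\<^sub>L l\<in>{..<p}. b l \<otimes>\<^sub>L r [^]\<^sub>L l) \<oplus>\<^sub>L (\<Oplus>\<^sub>L l\<in>{..<p}. \<iota> pinv \<otimes>\<^sub>L ps S l \<otimes>\<^sub>L r [^]\<^sub>L l)
    = (\<Oplus>\<^sub>L l\<in>{..<p}. \<iota> (a l) \<otimes>\<^sub>L r [^]\<^sub>L l)"
  proof -
   have "(\<Oplus>\<^sub>L l\<in>{..<p}. \<iota> (a l) \<otimes>\<^sub>L r [^]\<^sub>L l)
    = (\<Oplus>\<^sub>L l\<in>{..<p}. b l \<otimes>\<^sub>L r [^]\<^sub>L l \<oplus>\<^sub>L \<iota> pinv \<otimes>\<^sub>L ps S l \<otimes>\<^sub>L r [^]\<^sub>L l)"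
   proof (rule L.finsum_cong')
    fix l assume "l \<in> {..<p}"
    have *: "x \<otimes>\<^sub>L m = (x \<ominus>\<^sub>L y) \<otimes>\<^sub>L m \<oplus>\<^sub>L y \<otimes>\<^sub>L m" if "x \<in> carrier L" "y \<in> carrier L" "m \<in> carrier L" for x y m
     using that by (simp add: L.minus_eq L.l_distr L.l_minus L.a_assoc L.l_neg)
    show "\<iota> (a l) \<otimes>\<^sub>L r [^]\<^sub>L l = b l \<otimes>\<^sub>L r [^]\<^sub>L l \<oplus>\<^sub>L \<iota> pinv \<otimes>\<^sub>L ps S l \<otimes>\<^sub>L r [^]\<^sub>L l"
     unfolding b_def by (rule *) (use a(1) pc psc rc in simp_all)
   qed (use bc rc pc psc in auto)
   then show ?thesis
    using L.finsum_addf[of "\<lambda>l. b l \<otimes>\<^sub>L r [^]\<^sub>L l" "{..<p}" "\<lambda>l. \<iota> pinv \<otimes>\<^sub>L ps S l \<otimes>\<^sub>L r [^]\<^sub>L l"] bc rc pc psc by simp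
  qed
  then have "(\<Oplus>\<^sub>L l\<in>{..<p}. b l \<otimes>\<^sub>L r [^]\<^sub>L l) \<oplus>\<^sub>L \<phi> r q = \<phi> r q"
   using fourier[OF S r] a(4)[OF r] same[OF r] q(3) r by simp
  moreover have "(\<Oplus>\<^sub>L l\<in>{..<p}. b l \<otimes>\<^sub>L r [^]\<^sub>L l) \<in> carrier L" "\<phi> r q \<in> carrier L"
   using bc rc q(3) r by (auto intro!: L.finsum_closed)
  ultimately have "(\<Oplus>\<^sub>L l\<in>{..<p}. b l \<otimes>\<^sub>L r [^]\<^sub>L l) = \<zero>\<^sub>L" by (metis L.add.l_cancel_one L.a_comm)
  then show "evm L id r (I.pol p b) = \<zero>\<^sub>L" using evmb by simp
 qed
 have nil: "I.pol p b = []"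
 proof (rule ccontr)
  assume c: "I.pol p b \<noteq> []"
  have "card R \<le> degree (I.pol p b)" using I.card_zeros_le[OF I.pol_carrier[OF bc] c, of R] z by auto
  moreover have "length (I.pol p b) \<le> p"
   unfolding I.pol_def using L.normalize_length_le[of "map b (rev [0..<p])"] by simp
  ultimately show False using cardR p_pos by (cases "I.pol p b") auto
 qed
 have "map b (rev [0..<p]) = replicate p \<zero>\<^sub>L"
  using L.normalize_trick[of "map b (rev [0..<p])"] nil unfolding I.pol_def by simp
 then have "b l \<in> set (replicate p \<zero>\<^sub>L)" using l by (metis (no_types, lifting) atLeastLessThan_iff image_eqI le0 list.set_map set_rev set_upt)
 then have "b l = \<zero>\<^sub>L" by simp
 then have "\<iota> (a l) = \<iota> pinv \<otimes>\<^sub>L ps S l"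
  unfolding b_def using L.sum_zero_eq_neg[of "\<iota> (a l)" "\<ominus>\<^sub>L (\<iota> pinv \<otimes>\<^sub>L ps S l)"] a(1) pc psc by (simp add: L.minus_eq)
 then have "\<iota> (add_pow Z p \<one>\<^sub>Z \<otimes>\<^sub>Z a l) = \<iota> (add_pow Z p \<one>\<^sub>Z \<otimes>\<^sub>Z pinv) \<otimes>\<^sub>L ps S l"
  using a(1) pinv(1) psc by (simp add: L.m_assoc)
 also have "... = ps S l" using pinv(1,2) psc Z.m_comm[of "add_pow Z p \<one>\<^sub>Z" pinv] by simp
 finally show ?thesis using a(1) by (metis Z.add.nat_pow_closed Z.m_closed Z.one_closed image_eqI)
qed

end

lemma (in algebraically_closed) root_exists:
 assumes "q \<in> carrier (poly_ring L)" "degree q > 0"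
 obtains r where "r \<in> carrier L" "eval q r = \<zero>"
proof -
 have "size (roots q) = degree q" using roots_over_carrier[OF assms(1)] by (simp add: splitted_def)
 then have "roots q \<noteq> {#}" using assms(2) by auto
 then obtain r where "r \<in># roots q" by blast
 then have "is_root q r" using roots_mem_iff_is_root[OF assms(1)] by simp
 then show ?thesis using that by (auto simp: is_root_def)
qed

lemma (in field) eval_replicate_one:
 assumes "r \<in> carrier R"
 shows "eval (replicate n \<one>) r = (\<Oplus>l\<in>{..<n}. r [^] l)"
proof (induction n)
 case (Suc n)
 have "(\<Oplus>l\<in>{..<Suc n}. r [^] l) = r [^] n \<oplus> (\<Oplus>l\<in>{..<n}. r [^] l)"
  unfolding lessThan_Suc using assms by (subst finsum_insert) auto
 then show ?case using Suc assms by simp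
qed simp

text \<open>One root of X^p - a and one root z of 1 + X + ... + X^(p-1) suffice for
  \<open>pth_root_powers\<close>. That z differs from 1 is seen from the value p of this sum at 1,
  which is nonzero in L.\<close>

lemma (in algebraically_closed) card_pth_roots:
 assumes p: "Factorial_Ring.prime (p::nat)" and pn: "add_pow L p \<one> \<noteq> \<zero>" and a: "a \<in> carrier L" "a \<noteq> \<zero>"
 shows "card {r \<in> carrier L. r [^] p = a} = p"
proof -
 have p1: "p > 1" using p prime_gt_1_nat by blast
 define f where "f = \<one> # replicate (p - 1) \<zero> @ [\<ominus> a]"
 have f: "f \<in> carrier (poly_ring L)" "degree f > 0"
  using p1 a by (auto simp: f_def univ_poly_def polynomial_def)
 obtain r where r: "r \<in> carrier L" "eval f r = \<zero>" by (rule root_exists[OF f])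
 have "eval f r = r [^] p \<oplus> (\<ominus> a)"
  unfolding f_def using eval_replicate[of "[\<ominus> a]" r "p - 1"] r(1) a p1 by simp
 then have "r [^] p \<oplus> (\<ominus> a) = \<zero>" using r(2) by metis
 then have "r [^] p = \<ominus> (\<ominus> a)" using r(1) a(1) by (intro sum_zero_eq_neg) auto
 then have ra: "r [^] p = a" using a(1) by simp
 have rn: "r \<noteq> \<zero>" using ra a(2) p1 nat_pow_zero[of p] by auto
 have g: "replicate p \<one> \<in> carrier (poly_ring L)" "degree (replicate p \<one>) > 0"
  using p1 by (auto simp: univ_poly_def polynomial_def)
 obtain z where z: "z \<in> carrier L" "eval (replicate p \<one>) z = \<zero>" by (rule root_exists[OF g])
 have s: "(\<Oplus>l\<in>{..<p}. z [^] l) = \<zero>" using z eval_replicate_one by simp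
 have "z \<noteq> \<one>"
 proof
  assume "z = \<one>"
  then show False using s pn add.finprod_const[of "\<one>" "{..<p}"] by simp
 qed
 moreover have "z [^] p = \<one>"
  using geometric_zero[OF z(1), of p] s z(1) sum_zero_eq_neg[of "z [^] p" "\<ominus> \<one>"] by (simp add: minus_eq)
 ultimately show ?thesis using pth_root_powers(3)[OF p z(1) _ _ r(1) rn] ra by simp
qed

section \<open>Zero sets of polynomials over Z among the roots\<close>

context radical_ext begin

text \<open>A partition of the roots into nonempty pieces that polynomials over Z cannot separate is
  the shape shared by (B), with single points, and (C), with the root 1 and the zeros of the factors
  of Phi_p.\<close>

lemma indic_partition:
 assumes A: "finite A" and u: "\<And>i. i \<in> A ==> indic (S i) (u i)"
  and S: "\<And>i. i \<in> A ==> S i \<noteq> {}" "\<And>i k. [|i \<in> A; k \<in> A; i \<noteq> k|] ==> S i \<inter> S k = {}" "(\<Union>i\<in>A. S i) = R"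
  and conn: "\<And>i q r s. [|i \<in> A; q \<in> carrier P; r \<in> S i; s \<in> S i; \<phi> r q = \<zero>\<^sub>L|] ==> \<phi> s q = \<zero>\<^sub>L"
 shows "inj_on u A" "(\<Oplus>\<^sub>C v\<in>u ` A. v) = \<one>\<^sub>C"
  "\<And>i. i \<in> A ==> u i \<in> carrier C \<and> u i \<otimes>\<^sub>C u i = u i \<and> u i \<noteq> \<zero>\<^sub>C \<and>
    (\<forall>v\<in>carrier C. v \<otimes>\<^sub>C v = v \<and> v \<otimes>\<^sub>C u i = v \<longrightarrow> v = \<zero>\<^sub>C \<or> v = u i)"
proof -
 have sub: "S i \<subseteq> R" if "i \<in> A" for i using S(3) that by blast
 show inj: "inj_on u A"
 proof (rule inj_onI, rule ccontr)
  fix i k assume i: "i \<in> A" and k: "k \<in> A" and eq: "u i = u k" and ne: "i \<noteq> k"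
  have "S i = S k" using indic_unique[OF u[OF i] u[OF k] sub[OF i] sub[OF k]] eq by simp
  then show False using S(1)[OF i] S(2)[OF i k ne] by simp
 qed
 have "indic R (\<Oplus>\<^sub>C i\<in>A. u i)" using indic_sum[of A S u, OF A u S(2)] S(3) by simp
 then have "(\<Oplus>\<^sub>C i\<in>A. u i) = \<one>\<^sub>C" using indic_unique[OF _ indic_R] by blast
 moreover have "(\<Oplus>\<^sub>C v\<in>u ` A. v) = (\<Oplus>\<^sub>C i\<in>A. u i)"
  by (rule C.add.finprod_reindex[OF _ inj]) (use u indic_carrier in blast)
 ultimately show "(\<Oplus>\<^sub>C v\<in>u ` A. v) = \<one>\<^sub>C" by simp
 fix i assume i: "i \<in> A"
 have "u i \<noteq> \<zero>\<^sub>C"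
  using indic_unique[OF u[OF i] indic_empty sub[OF i]] S(1)[OF i] by simp
 moreover have "v = \<zero>\<^sub>C \<or> v = u i" if "v \<in> carrier C" "v \<otimes>\<^sub>C v = v" "v \<otimes>\<^sub>C u i = v" for v
  by (rule indic_primitive[OF u[OF i] sub[OF i] conn[OF i] that])
 ultimately show "u i \<in> carrier C \<and> u i \<otimes>\<^sub>C u i = u i \<and> u i \<noteq> \<zero>\<^sub>C \<and>
    (\<forall>v\<in>carrier C. v \<otimes>\<^sub>C v = v \<and> v \<otimes>\<^sub>C u i = v \<longrightarrow> v = \<zero>\<^sub>C \<or> v = u i)"
  using indic_carrier[OF u[OF i]] indic_idem[OF u[OF i]] by blast
qed

text \<open>Up to a scalar m is the minimal polynomial of r over Z: a nonzero polynomial of least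
  degree vanishing at r divides all others by division with remainder.\<close>

lemma min_poly:
 assumes r: "r \<in> R"
 obtains m where "m \<in> carrier P" "m \<noteq> []" "\<phi> r m = \<zero>\<^sub>L"
  "\<And>q. [|q \<in> carrier P; \<phi> r q = \<zero>\<^sub>L|] ==> \<exists>h\<in>carrier P. q = m \<otimes>\<^sub>P h"
proof -
 interpret ph: ring_hom_cring P L "\<phi> r" using \<phi>_hom r by blast
 let ?A = "\<lambda>q. q \<in> carrier P \<and> q \<noteq> [] \<and> \<phi> r q = \<zero>\<^sub>L"
 have "?A xm" using xm \<phi>_xm[OF r] by simp
 then obtain m where m: "?A m" "\<forall>q. ?A q \<longrightarrow> degree m \<le> degree q"
  using ex_has_least_nat[of ?A xm degree] by blast
 show ?thesis
 proof (rule that[of m])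
  fix q assume q: "q \<in> carrier P" "\<phi> r q = \<zero>\<^sub>L"
  obtain b c where bc: "b \<in> carrier P" "c \<in> carrier P" "q = (m \<otimes>\<^sub>P b) \<oplus>\<^sub>P c" "c = \<zero>\<^sub>P \<or> degree c < degree m"
   using Z.field_long_division_theorem_shell[OF Z.carrier_is_subfield q(1), of m] m(1) by (auto simp: univ_poly_zero)
  have "\<phi> r c = \<zero>\<^sub>L" using q(2) bc(1,2) m(1) ph.hom_closed[OF bc(1)] ph.hom_closed[OF bc(2)] unfolding bc(3) by simp
  then have "c = \<zero>\<^sub>P" using bc(2,4) m(2) by (metis not_le univ_poly_zero)
  then show "\<exists>h\<in>carrier P. q = m \<otimes>\<^sub>P h" using bc m(1) by auto
 qed (use m(1) in blast)+
qed

lemma degree_mult: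
 assumes "f \<in> carrier P" "g \<in> carrier P" "f \<noteq> []" "g \<noteq> []"
 shows "degree (f \<otimes>\<^sub>P g) = degree f + degree g"
proof -
 have "polynomial\<^bsub>Z\<^esub> (carrier Z) f" "polynomial\<^bsub>Z\<^esub> (carrier Z) g"
  using assms(1,2) unfolding univ_poly_carrier[symmetric] .
 then have "degree (Z.poly_mult f g) = (if f = [] \<or> g = [] then 0 else degree f + degree g)"
  by (rule Z.poly_mult_degree_eq[OF Z.carrier_is_subring])
 then show ?thesis using assms(3,4) unfolding univ_poly_mult by simp
qed

abbreviation zeros :: "'k list \<Rightarrow> 'l set" where "zeros f \<equiv> {r \<in> R. \<phi> r f = \<zero>\<^sub>L}"

lemma card_zeros: "f \<in> carrier P ==> f \<noteq> [] ==> card (zeros f) \<le> degree f"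
 by (rule conjunct2[OF F.card_zeros_le]) simp_all

lemma zeros_mult: "f \<in> carrier P ==> g \<in> carrier P ==> zeros (f \<otimes>\<^sub>P g) = zeros f \<union> zeros g"
proof -
 assume fg: "f \<in> carrier P" "g \<in> carrier P"
 have "\<phi> r (f \<otimes>\<^sub>P g) = \<zero>\<^sub>L \<longleftrightarrow> \<phi> r f = \<zero>\<^sub>L \<or> \<phi> r g = \<zero>\<^sub>L" if r: "r \<in> R" for r
 proof -
  interpret ph: ring_hom_cring P L "\<phi> r" using \<phi>_hom r by blast
  show ?thesis using fg ph.hom_closed[OF fg(1)] ph.hom_closed[OF fg(2)] L.integral_iff by simp
 qed
 then show ?thesis by blast
qed

text \<open>If f did not divide q, a relation a f + b q = 1 would hold, which is absurd at r, where
  both f and q vanish. So q is a multiple of f and vanishes wherever f does.\<close>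

lemma conn_irreducible:
 assumes f: "f \<in> carrier P" "pirreducible\<^bsub>Z\<^esub> (carrier Z) f" and q: "q \<in> carrier P"
  and r: "r \<in> zeros f" "\<phi> r q = \<zero>\<^sub>L" and s: "s \<in> zeros f"
 shows "\<phi> s q = \<zero>\<^sub>L"
proof (cases "f divides\<^bsub>P\<^esub> q")
 case True
 then obtain h where h: "h \<in> carrier P" "q = f \<otimes>\<^sub>P h" unfolding factor_def by blast
 interpret ph: ring_hom_cring P L "\<phi> s" using \<phi>_hom s by blast
 show ?thesis using h f(1) s ph.hom_closed[OF h(1)] by simp
next
 case False
 obtain a b where ab: "a \<in> carrier P" "b \<in> carrier P" "(a \<otimes>\<^sub>P f) \<oplus>\<^sub>P (b \<otimes>\<^sub>P q) = \<one>\<^sub>P"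
  by (rule Z.irreducible_bezout[OF f q False])
 interpret ph: ring_hom_cring P L "\<phi> r" using \<phi>_hom r by blast
 have "\<phi> r ((a \<otimes>\<^sub>P f) \<oplus>\<^sub>P (b \<otimes>\<^sub>P q)) = \<zero>\<^sub>L"
  using ab(1,2) f(1) q r ph.hom_closed[OF ab(1)] ph.hom_closed[OF ab(2)] by simp
 then have False unfolding ab(3) by simp
 then show ?thesis ..
qed

text \<open>As k is prime to p, k x = p y + 1 for some x and y. With n = (-1)^p lam the element b^x
  / n^y is a p-th root of n, and the further factor -1 turns it into one of
  \<open>lam\<close>.\<close>

lemma root_from_power:
 assumes k: "0 < k" "k < p" and b: "b \<in> carrier Z" "b [^]\<^sub>Z p = ((\<ominus>\<^sub>Z \<one>\<^sub>Z) [^]\<^sub>Z p \<otimes>\<^sub>Z lam) [^]\<^sub>Z k"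
 shows "\<exists>\<mu>\<in>carrier Z. \<mu> [^]\<^sub>Z p = lam"
proof -
 define m where "m = \<ominus>\<^sub>Z \<one>\<^sub>Z"
 define n where "n = m [^]\<^sub>Z p \<otimes>\<^sub>Z lam"
 have m: "m \<in> carrier Z" "m \<otimes>\<^sub>Z m = \<one>\<^sub>Z" unfolding m_def by (auto simp: Z.l_minus)
 have mm: "m [^]\<^sub>Z p \<otimes>\<^sub>Z m [^]\<^sub>Z p = \<one>\<^sub>Z"
  using Z.pow_mult_distrib[of m m p] m by simp
 have mU: "m [^]\<^sub>Z p \<noteq> \<zero>\<^sub>Z" using mm m(1) by auto
 have n: "n \<in> carrier Z" "n \<noteq> \<zero>\<^sub>Z" using m mU lam Z.integral by (auto simp: n_def)
 have "coprime k p"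
  using prime_imp_coprime_nat[OF p] k by (metis coprime_commute nat_dvd_not_less)
 then obtain x y where xy: "k * x = p * y + 1"
  using bezout_nat[of k p] k(1) by (auto simp: coprime_iff_gcd_eq_1)
 define w where "w = n [^]\<^sub>Z y"
 have w: "w \<in> carrier Z" "w \<noteq> \<zero>\<^sub>Z"
  unfolding w_def using n Z.integral by (induction y) auto
 then have wU: "w \<in> Units Z" using Z.field_Units by simp
 define \<mu> where "\<mu> = m \<otimes>\<^sub>Z (b [^]\<^sub>Z x \<otimes>\<^sub>Z inv\<^bsub>Z\<^esub> w)"
 have bx: "(b [^]\<^sub>Z x) [^]\<^sub>Z p = w [^]\<^sub>Z p \<otimes>\<^sub>Z n"
 proof -
  have "(b [^]\<^sub>Z x) [^]\<^sub>Z p = (b [^]\<^sub>Z p) [^]\<^sub>Z x" using b(1) by (simp add: Z.nat_pow_pow mult.commute)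
  also have "... = n [^]\<^sub>Z (k * x)" using b(2) n(1) by (simp add: n_def m_def Z.nat_pow_pow)
  also have "... = w [^]\<^sub>Z p \<otimes>\<^sub>Z n" unfolding xy w_def using n(1) by (simp add: Z.nat_pow_pow mult.commute)
  finally show ?thesis .
 qed
 have iw: "(inv\<^bsub>Z\<^esub> w) [^]\<^sub>Z p \<otimes>\<^sub>Z w [^]\<^sub>Z p = \<one>\<^sub>Z"
  using Z.nat_pow_distrib[of "inv\<^bsub>Z\<^esub> w" w p] w wU by simp
 have c: "b [^]\<^sub>Z x \<in> carrier Z" "inv\<^bsub>Z\<^esub> w \<in> carrier Z" "w [^]\<^sub>Z p \<in> carrier Z" "(inv\<^bsub>Z\<^esub> w) [^]\<^sub>Z p \<in> carrier Z" "m [^]\<^sub>Z p \<in> carrier Z"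
  using b w wU m(1) by auto
 have "\<mu> [^]\<^sub>Z p = m [^]\<^sub>Z p \<otimes>\<^sub>Z (w [^]\<^sub>Z p \<otimes>\<^sub>Z n \<otimes>\<^sub>Z (inv\<^bsub>Z\<^esub> w) [^]\<^sub>Z p)"
  unfolding \<mu>_def using c m(1) by (simp add: Z.nat_pow_distrib bx)
 also have "w [^]\<^sub>Z p \<otimes>\<^sub>Z n \<otimes>\<^sub>Z (inv\<^bsub>Z\<^esub> w) [^]\<^sub>Z p = n \<otimes>\<^sub>Z ((inv\<^bsub>Z\<^esub> w) [^]\<^sub>Z p \<otimes>\<^sub>Z w [^]\<^sub>Z p)"
  using c n(1) by (simp add: Z.m_ac)
 also have "m [^]\<^sub>Z p \<otimes>\<^sub>Z (n \<otimes>\<^sub>Z ((inv\<^bsub>Z\<^esub> w) [^]\<^sub>Z p \<otimes>\<^sub>Z w [^]\<^sub>Z p)) = lam"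
  unfolding iw n_def using c(5) lam mm by (simp add: Z.m_assoc[symmetric])
 finally show ?thesis using c m(1) by (auto simp: \<mu>_def)
qed

text \<open>A nontrivial zero set of a polynomial would give a factor of \<open>X\<^sup>p - \<lambda>\<close> of degree \<open>0 < k < p\<close> over \<open>Z\<close>,
 whose constant term is, up to sign, the product \<open>b\<close> of \<open>k\<close> of the \<open>p\<close>-th roots; thus \<open>b\<^sup>p = \<plusminus>\<lambda>\<^sup>k\<close>.\<close>

lemma no_zero_divisors:
 assumes nr: "\<not> (\<exists>\<mu>\<in>carrier Z. \<mu> [^]\<^sub>Z p = lam)"
  and uv: "u \<in> carrier C" "v \<in> carrier C" "u \<otimes>\<^sub>C v = \<zero>\<^sub>C"
 shows "u = \<zero>\<^sub>C \<or> v = \<zero>\<^sub>C"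
proof -
 \<comment> \<open>A polynomial over Z with one zero in \<open>R\<close> vanishes on all of
   \<open>R\<close>. It is a multiple of the minimal polynomial \<open>m\<close> of that zero, so it
   is enough to exclude deg m < p.\<close>
 have conn: "zeros q = R" if q: "q \<in> carrier P" and r: "r \<in> zeros q" for q r
 proof -
  have rR: "r \<in> R" using r by blast
  obtain m where m: "m \<in> carrier P" "m \<noteq> []" "\<phi> r m = \<zero>\<^sub>L"
   "\<And>q. [|q \<in> carrier P; \<phi> r q = \<zero>\<^sub>L|] ==> \<exists>h\<in>carrier P. q = m \<otimes>\<^sub>P h"
   by (rule min_poly[OF rR]) blast
  obtain h where h: "h \<in> carrier P" "xm = m \<otimes>\<^sub>P h" using m(4)[OF xm(1) \<phi>_xm[OF rR]] by blast
  have hn: "h \<noteq> []" using h xm(2) m(1) P.r_null[of m] by (auto simp: univ_poly_zero)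
  have deg: "degree m + degree h = p" using degree_mult[OF m(1) h(1) m(2) hn] h(2) xm(3) by simp
  have "zeros xm = R" using \<phi>_xm by blast
  then have zR: "zeros m \<union> zeros h = R" using zeros_mult[OF m(1) h(1)] unfolding h(2) by blast
  have "card (zeros m \<union> zeros h) = p" unfolding zR by (rule cardR)
  moreover have "card (zeros m \<union> zeros h) \<le> card (zeros m) + card (zeros h)" by (rule card_Un_le)
  \<comment> \<open>X^p - lam = m h has p zeros, the degrees of m and h add up to p, and neither
    factor has more zeros than its degree. Hence m has as many zeros as its degree, as Vieta's
    formula requires.\<close>
  ultimately have cm: "card (zeros m) = degree m"
   using card_zeros[OF m(1,2)] card_zeros[OF h(1) hn] deg by linarith
  have fin: "finite (zeros m)" by (rule finite_subset[OF _ finR]) blast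
  have k0: "0 < degree m" using cm m(3) rR fin by (metis (mono_tags, lifting) card_gt_0_iff empty_iff mem_Collect_eq)
  have "\<not> degree m < p"
  proof
   assume kp: "degree m < p"
   define N where "N = map \<iota> m"
   have N: "N \<in> carrier (poly_ring L)" "N \<noteq> []" "degree N = card (zeros m)"
    using F.map_poly[OF m(1)] m(2) cm by (auto simp: N_def)
   have "L.eval N \<zero>\<^sub>L = Polynomials.lead_coeff N \<otimes>\<^sub>L (\<Otimes>\<^sub>L s\<in>zeros m. \<ominus>\<^sub>L s)"
    by (rule L.eval_zero_prod_roots[OF fin N]) (auto simp: N_def evm_def)
   moreover have "L.eval N \<zero>\<^sub>L = \<iota> (Z.eval m \<zero>\<^sub>Z)"
    using F.J.eval_hom'[OF Z.zero_closed Z.poly_in_carrierD[OF m(1)]] by (simp add: N_def)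
   moreover have l: "Polynomials.lead_coeff m \<in> carrier Z - {\<zero>\<^sub>Z}"
    using m(1,2) by (auto simp: univ_poly_def polynomial_def)
   moreover have "Polynomials.lead_coeff N = \<iota> (Polynomials.lead_coeff m)" using m(2) by (simp add: N_def hd_map)
   moreover define b where "b = inv\<^bsub>Z\<^esub> (Polynomials.lead_coeff m) \<otimes>\<^sub>Z Z.eval m \<zero>\<^sub>Z"
   moreover have lU: "Polynomials.lead_coeff m \<in> Units Z" using l Z.field_Units by simp
   moreover have ec: "Z.eval m \<zero>\<^sub>Z \<in> carrier Z" using Z.eval_in_carrier[OF Z.poly_in_carrierD[OF m(1)]] by simp
   moreover have pc: "(\<Otimes>\<^sub>L s\<in>zeros m. \<ominus>\<^sub>L s) \<in> carrier L" by (rule L.finprod_closed) auto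
   ultimately have e1: "\<iota> (Z.eval m \<zero>\<^sub>Z) = \<iota> (Polynomials.lead_coeff m) \<otimes>\<^sub>L (\<Otimes>\<^sub>L s\<in>zeros m. \<ominus>\<^sub>L s)" by simp
   have bc: "b \<in> carrier Z" using lU ec by (simp add: b_def)
   have "\<iota> (inv\<^bsub>Z\<^esub> (Polynomials.lead_coeff m)) \<otimes>\<^sub>L \<iota> (Polynomials.lead_coeff m) = \<one>\<^sub>L"
    using F.J.hom_mult[of "inv\<^bsub>Z\<^esub> (Polynomials.lead_coeff m)" "Polynomials.lead_coeff m"] lU l by simp
   then have ib: "\<iota> b = (\<Otimes>\<^sub>L s\<in>zeros m. \<ominus>\<^sub>L s)"
    using lU ec l pc by (simp add: b_def e1 L.m_assoc[symmetric])
   \<comment> \<open>Each root s satisfies (-s)^p = a, so the p-th power of the product of the -s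
     over k roots is a^k.\<close>
   define a where "a = (\<ominus>\<^sub>L \<one>\<^sub>L) [^]\<^sub>L p \<otimes>\<^sub>L \<iota> lam"
   have ac: "a \<in> carrier L" using lam by (simp add: a_def)
   have pa: "(\<Otimes>\<^sub>L s\<in>U. \<ominus>\<^sub>L s) [^]\<^sub>L p = a [^]\<^sub>L card U" if "finite U" "U \<subseteq> R" for U
    using that
   proof (induction U rule: finite_induct)
    case empty
    then show ?case by simp
   next
    case (insert s U)
    have s: "s \<in> carrier L" "s [^]\<^sub>L p = \<iota> lam" using insert by auto
    have Uc: "U \<subseteq> carrier L" using insert by auto
    have pU: "(\<Otimes>\<^sub>L s\<in>U. \<ominus>\<^sub>L s) \<in> carrier L" by (rule L.finprod_closed) (use Uc in auto)
    have "(\<Otimes>\<^sub>L s\<in>insert s U. \<ominus>\<^sub>L s) = \<ominus>\<^sub>L s \<otimes>\<^sub>L (\<Otimes>\<^sub>L s\<in>U. \<ominus>\<^sub>L s)"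
     using insert.hyps Uc s by (intro L.finprod_insert) auto
    moreover have "(\<ominus>\<^sub>L s) [^]\<^sub>L p = a"
    proof -
     have "\<ominus>\<^sub>L s = \<ominus>\<^sub>L \<one>\<^sub>L \<otimes>\<^sub>L s" using s by (simp add: L.l_minus)
     then show ?thesis using L.nat_pow_distrib[of "\<ominus>\<^sub>L \<one>\<^sub>L" s p] s by (simp add: a_def)
    qed
    ultimately have "(\<Otimes>\<^sub>L s\<in>insert s U. \<ominus>\<^sub>L s) [^]\<^sub>L p = a \<otimes>\<^sub>L a [^]\<^sub>L card U"
     using L.nat_pow_distrib[of "\<ominus>\<^sub>L s" "\<Otimes>\<^sub>L s\<in>U. \<ominus>\<^sub>L s" p] insert s pU by simp
    then show ?case using insert.hyps ac L.m_comm[of a "a [^]\<^sub>L card U"] by simp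
   qed
   have zsub: "zeros m \<subseteq> R" by blast
   have ibp: "(\<iota> b) [^]\<^sub>L p = a [^]\<^sub>L degree m"
    using pa[OF fin zsub] unfolding ib cm .
   have "\<iota> (b [^]\<^sub>Z p) = \<iota> (((\<ominus>\<^sub>Z \<one>\<^sub>Z) [^]\<^sub>Z p \<otimes>\<^sub>Z lam) [^]\<^sub>Z degree m)"
    using ibp bc lam by (simp add: a_def F.J.hom_nat_pow)
   then have "b [^]\<^sub>Z p = ((\<ominus>\<^sub>Z \<one>\<^sub>Z) [^]\<^sub>Z p \<otimes>\<^sub>Z lam) [^]\<^sub>Z degree m"
    by (rule inj_onD[OF F.\<iota>_inj]) (use bc lam in auto)
   then show False using root_from_power[OF k0 kp bc] nr by blast
  qed
  then have "card R \<le> card (zeros m)" unfolding cardR cm by simp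
  then have "zeros m = R" using finR by (intro card_seteq) auto
  moreover obtain g where g: "g \<in> carrier P" "q = m \<otimes>\<^sub>P g" using m(4)[OF q] r by blast
  ultimately show ?thesis using zeros_mult[OF m(1) g(1)] g(2) by blast
 qed
 obtain a where a: "E.pol p a \<in> carrier P" "ev (E.pol p a) = u" by (rule surj[OF uv(1)]) blast
 obtain b where b: "E.pol p b \<in> carrier P" "ev (E.pol p b) = v" by (rule surj[OF uv(2)]) blast
 have "ev (E.pol p a \<otimes>\<^sub>P E.pol p b) = \<zero>\<^sub>C" using a b uv(3) by simp
 then have "zeros (E.pol p a) \<union> zeros (E.pol p b) = R"
  using ev_zero_iff[of "E.pol p a \<otimes>\<^sub>P E.pol p b"] a(1) b(1) zeros_mult[OF a(1) b(1)] by auto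
 moreover have "R \<noteq> {}" using cardR p_pos by (metis card.empty less_not_refl)
 ultimately obtain r where "r \<in> zeros (E.pol p a) \<or> r \<in> zeros (E.pol p b)" by blast
 then have "zeros (E.pol p a) = R \<or> zeros (E.pol p b) = R" using conn[OF a(1), of r] conn[OF b(1), of r] by blast
 then show ?thesis using ev_zero_iff[OF a(1)] ev_zero_iff[OF b(1)] a(2) b(2) by blast
qed

end

text \<open>Each repeated entry of the list contributes at least 1 to the sum over the list, beyond
  the sum over the set.\<close>

lemma sum_distinct_le:
 fixes d :: "'a \<Rightarrow> nat"
 assumes "\<And>x. x \<in> set xs ==> d x \<ge> 1"
 shows "sum d (set xs) + length xs \<le> sum_list (map d xs) + card (set xs)"
 using assms
proof (induction xs)
 case (Cons x xs)
 have IH: "sum d (set xs) + length xs \<le> sum_list (map d xs) + card (set xs)" using Cons by simp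
 have "1 \<le> d x" using Cons by simp
 then show ?case using IH by (cases "x \<in> set xs") (simp_all add: insert_absorb)
qed simp

text \<open>Sets of at most \<open>d x\<close> points that cover as many points as the sum of the
  bounds over the list leave no slack: no entry is repeated, no bound is missed, no point is shared.
  For the factors of Phi_p this yields distinctness, full sets of zeros and disjointness
  together.\<close>

lemma tight_cover:
 fixes d :: "'a \<Rightarrow> nat"
 assumes d: "\<And>x. x \<in> set xs ==> d x \<ge> 1" "\<And>x. x \<in> set xs ==> finite (S x) \<and> card (S x) \<le> d x"
  and c: "sum_list (map d xs) \<le> card (\<Union>x\<in>set xs. S x)"
 shows "distinct xs" "\<And>x. x \<in> set xs ==> card (S x) = d x"
  "\<And>x y. [|x \<in> set xs; y \<in> set xs; x \<noteq> y|] ==> S x \<inter> S y = {}"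
proof -
 have le: "card (\<Union>x\<in>A. S x) \<le> sum d A" if A: "A \<subseteq> set xs" for A
 proof -
  have fA: "finite A" using A finite_subset by blast
  have "card (\<Union>x\<in>A. S x) \<le> (\<Sum>x\<in>A. card (S x))" by (rule card_UN_le[OF fA])
  also have "... \<le> sum d A" by (rule sum_mono) (use A d in blast)
  finally show ?thesis .
 qed
 have s: "sum d (set xs) + length xs \<le> sum_list (map d xs) + card (set xs)" by (rule sum_distinct_le[OF d(1)])
 then have "length xs \<le> card (set xs)" using le[of "set xs"] c by simp
 then have "card (set xs) = length xs" using card_length[of xs] by simp
 then show dist: "distinct xs" by (rule card_distinct)
 have tot: "sum d (set xs) \<le> card (\<Union>x\<in>set xs. S x)"
  using c sum_list_distinct_conv_sum_set[OF dist, of d] by simp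
 have rest: "card (\<Union>x\<in>set xs. S x) \<le> card T + sum d (set xs - {x})"
  if x: "x \<in> set xs" and T: "finite T" "S x \<subseteq> T \<union> (\<Union>y\<in>set xs - {x}. S y)" for x T
 proof -
  have fU: "finite (\<Union>y\<in>set xs - {x}. S y)" using d(2) by blast
  have "(\<Union>x\<in>set xs. S x) \<subseteq> T \<union> (\<Union>y\<in>set xs - {x}. S y)" using T(2) by blast
  then have "card (\<Union>x\<in>set xs. S x) \<le> card (T \<union> (\<Union>y\<in>set xs - {x}. S y))" using T fU by (intro card_mono) auto
  also have "... \<le> card T + card (\<Union>y\<in>set xs - {x}. S y)" by (rule card_Un_le)
  also have "... \<le> card T + sum d (set xs - {x})" using le[of "set xs - {x}"] by simp
  finally show ?thesis .
 qed
 have split: "sum d (set xs) = d x + sum d (set xs - {x})" if "x \<in> set xs" for x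
  using that by (simp add: sum.remove)
 show "card (S x) = d x" if x: "x \<in> set xs" for x
  using rest[OF x, of "S x"] split[OF x] tot d(2)[OF x] by simp
 show "S x \<inter> S y = {}" if x: "x \<in> set xs" "y \<in> set xs" "x \<noteq> y" for x y
 proof (rule ccontr)
  assume "S x \<inter> S y \<noteq> {}"
  then obtain r where r: "r \<in> S x" "r \<in> S y" by blast
  have "card (\<Union>x\<in>set xs. S x) \<le> card (S x - {r}) + sum d (set xs - {x})"
   by (rule rest[OF x(1)]) (use d(2)[OF x(1)] r x in auto)
  moreover have "card (S x - {r}) < d x"
   using d(2)[OF x(1)] d(1)[OF x(1)] r(1) by (meson card_Diff1_less le_trans not_le)
  ultimately show False using split[OF x(1)] tot by simp
 qed
qed

section \<open>The case lambda = 1 and the factors of Phi_p\<close>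

locale cyclotomic_ext = radical_ext Z C j L \<iota> p t lam
 for Z :: "('k, 'a) ring_scheme" and C :: "('c, 'd) ring_scheme" and j
  and L :: "('l, 'b) ring_scheme" and \<iota> and p t lam +
 fixes fs
 assumes lam_one: "lam = \<one>\<^sub>Z" and fs: "monic_irreducible_factorization Z (cyclotomic_prime Z p) fs"
begin

lemma one_R: "\<one>\<^sub>L \<in> R" by (simp add: lam_one)

lemma R_iff: "r \<in> R \<longleftrightarrow> r \<in> carrier L \<and> r [^]\<^sub>L p = \<one>\<^sub>L" by (simp add: lam_one)

text \<open>(r - 1) Phi_p(r) = r^p - 1, and Phi_p(1) = p is nonzero in L.\<close>

lemma zeros_cyclotomic:
 assumes r: "r \<in> carrier L"
 shows "\<phi> r (cyclotomic_prime Z p) = \<zero>\<^sub>L \<longleftrightarrow> r \<in> R - {\<one>\<^sub>L}"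
proof -
 let ?s = "\<Oplus>\<^sub>L l\<in>{..<p}. r [^]\<^sub>L l"
 have e: "\<phi> r (cyclotomic_prime Z p) = ?s"
  unfolding evm_def cyclotomic_prime_def using L.eval_replicate_one[OF r, of p] by simp
 have sc: "?s \<in> carrier L" using r by (intro L.finsum_closed) auto
 have g: "(r \<ominus>\<^sub>L \<one>\<^sub>L) \<otimes>\<^sub>L ?s = r [^]\<^sub>L p \<ominus>\<^sub>L \<one>\<^sub>L" by (rule L.geometric_zero[OF r])
 have d: "a \<ominus>\<^sub>L \<one>\<^sub>L = \<zero>\<^sub>L \<longleftrightarrow> a = \<one>\<^sub>L" if "a \<in> carrier L" for a
  using L.sum_zero_eq_neg[of a "\<ominus>\<^sub>L \<one>\<^sub>L"] that by (auto simp: L.minus_eq L.r_neg)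
 have one: "?s \<noteq> \<zero>\<^sub>L" if "r = \<one>\<^sub>L"
 proof
  assume "?s = \<zero>\<^sub>L"
  then have "add_pow L p \<one>\<^sub>L = \<zero>\<^sub>L" using that L.add.finprod_const[of "\<one>\<^sub>L" "{..<p}"] by simp
  then show False using pinv by simp
 qed
 show ?thesis unfolding e
 proof
  assume s: "?s = \<zero>\<^sub>L"
  have "r [^]\<^sub>L p = \<one>\<^sub>L" using g s d[of "r [^]\<^sub>L p"] r by simp
  then show "r \<in> R - {\<one>\<^sub>L}" using r s one R_iff by blast
 next
  assume R': "r \<in> R - {\<one>\<^sub>L}"
  then have "r [^]\<^sub>L p = \<one>\<^sub>L" using R_iff by blast
  then have "(r \<ominus>\<^sub>L \<one>\<^sub>L) \<otimes>\<^sub>L ?s = \<zero>\<^sub>L" unfolding g using d by simp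
  moreover have "r \<ominus>\<^sub>L \<one>\<^sub>L \<noteq> \<zero>\<^sub>L" using R' d[OF r] by simp
  ultimately show "?s = \<zero>\<^sub>L" using L.integral_iff[of "r \<ominus>\<^sub>L \<one>\<^sub>L" ?s] r sc by simp
 qed
qed

lemma factorD:
 assumes "f \<in> set fs"
 shows "f \<in> carrier P" "pirreducible\<^bsub>Z\<^esub> (carrier Z) f" "f \<noteq> []" "degree f \<ge> 1"
proof -
 show f: "f \<in> carrier P" "pirreducible\<^bsub>Z\<^esub> (carrier Z) f"
  using fs assms by (auto simp: monic_irreducible_factorization_def)
 show "degree f \<ge> 1" by (rule Z.pirreducible_degree[OF Z.carrier_is_subfield f])
 then show "f \<noteq> []" by auto
qed

lemma product:
 assumes "set gs \<subseteq> set fs"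
 shows "foldr (\<lambda>f g. f \<otimes>\<^sub>P g) gs \<one>\<^sub>P \<in> carrier P \<and> foldr (\<lambda>f g. f \<otimes>\<^sub>P g) gs \<one>\<^sub>P \<noteq> []
  \<and> degree (foldr (\<lambda>f g. f \<otimes>\<^sub>P g) gs \<one>\<^sub>P) = sum_list (map degree gs)
  \<and> (\<forall>r\<in>carrier L. \<phi> r (foldr (\<lambda>f g. f \<otimes>\<^sub>P g) gs \<one>\<^sub>P) = \<zero>\<^sub>L \<longleftrightarrow> (\<exists>g\<in>set gs. \<phi> r g = \<zero>\<^sub>L))"
 using assms
proof (induction gs)
 case Nil
 have "\<phi> r \<one>\<^sub>P = \<one>\<^sub>L" if "r \<in> carrier L" for r
 proof -
  interpret ph: ring_hom_cring P L "\<phi> r" by (rule \<phi>_hom[OF that])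
  show ?thesis by (rule ph.hom_one)
 qed
 moreover have "\<one>\<^sub>P = [\<one>\<^sub>Z]" by (rule univ_poly_one)
 ultimately show ?case using P.one_closed by simp
next
 case (Cons f gs)
 define g where "g = foldr (\<lambda>f g. f \<otimes>\<^sub>P g) gs \<one>\<^sub>P"
 have IH: "g \<in> carrier P" "g \<noteq> []" "degree g = sum_list (map degree gs)"
  "\<And>r. r \<in> carrier L ==> \<phi> r g = \<zero>\<^sub>L \<longleftrightarrow> (\<exists>g\<in>set gs. \<phi> r g = \<zero>\<^sub>L)"
  using Cons unfolding g_def by auto
 have f: "f \<in> carrier P" "f \<noteq> []" using Cons.prems factorD by auto
 have c: "f \<otimes>\<^sub>P g \<in> carrier P" using f IH by simp
 have n: "f \<otimes>\<^sub>P g \<noteq> []" using P.integral_iff[OF f(1) IH(1)] f IH by (simp add: univ_poly_zero)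
 have dg: "degree (f \<otimes>\<^sub>P g) = degree f + degree g" by (rule degree_mult[OF f(1) IH(1) f(2) IH(2)])
 have z: "\<phi> r (f \<otimes>\<^sub>P g) = \<zero>\<^sub>L \<longleftrightarrow> \<phi> r f = \<zero>\<^sub>L \<or> \<phi> r g = \<zero>\<^sub>L" if r: "r \<in> carrier L" for r
 proof -
  interpret ph: ring_hom_cring P L "\<phi> r" by (rule \<phi>_hom[OF r])
  show ?thesis using ph.hom_mult[OF f(1) IH(1)] ph.hom_closed[OF f(1)] ph.hom_closed[OF IH(1)] L.integral_iff by simp
 qed
 have F: "foldr (\<lambda>f g. f \<otimes>\<^sub>P g) (f # gs) \<one>\<^sub>P = f \<otimes>\<^sub>P g" by (simp add: g_def)
 show ?case unfolding F using c n dg z IH by simp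
qed

lemma foldr_fs: "foldr (\<lambda>f g. f \<otimes>\<^sub>P g) fs \<one>\<^sub>P = cyclotomic_prime Z p"
 using fs by (simp add: monic_irreducible_factorization_def)

lemma zeros_cover: "(\<Union>f\<in>set fs. zeros f) = R - {\<one>\<^sub>L}"
proof -
 have "r \<in> R - {\<one>\<^sub>L} \<longleftrightarrow> (\<exists>g\<in>set fs. \<phi> r g = \<zero>\<^sub>L)" if r: "r \<in> R" for r
 proof -
  have rc: "r \<in> carrier L" using r by blast
  show ?thesis using zeros_cyclotomic[OF rc] product[of fs] rc unfolding foldr_fs by blast
 qed
 then show ?thesis by blast
qed

lemma roots_in_eq_zeros:
 assumes f: "f \<in> set fs" shows "roots_in \<iota> L f = zeros f"
proof -
 have "r \<in> roots_in \<iota> L f \<longleftrightarrow> r \<in> carrier L \<and> \<phi> r f = \<zero>\<^sub>L" for r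
  using factorD(3)[OF f] by (auto simp: roots_in_def L.is_root_def evm_def)
 moreover have "r \<in> R" if r: "r \<in> carrier L" "\<phi> r f = \<zero>\<^sub>L" for r
  using zeros_cyclotomic[OF r(1)] product[of fs] r f unfolding foldr_fs by blast
 ultimately show ?thesis by blast
qed

lemma finite_zeros: "finite (zeros f)"
 by (rule finite_subset[OF _ finR]) blast

text \<open>Phi_p has degree p - 1 and its zeros are the p - 1 roots other than 1, so the zero sets
  of the factors form a tight cover.\<close>

lemma factors:
 shows "distinct fs" "\<And>f. f \<in> set fs ==> card (zeros f) = degree f"
  "\<And>f g. [|f \<in> set fs; g \<in> set fs; f \<noteq> g|] ==> zeros f \<inter> zeros g = {}"
proof -
 have "card (R - {\<one>\<^sub>L}) = card R - 1" by (rule card_Diff_singleton[OF one_R])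
 then have "card (\<Union>f\<in>set fs. zeros f) = p - 1" unfolding zeros_cover cardR .
 moreover have "sum_list (map degree fs) = p - 1"
  using product[of fs] unfolding foldr_fs cyclotomic_prime_def by simp
 ultimately have c: "sum_list (map degree fs) \<le> card (\<Union>f\<in>set fs. zeros f)" by simp
 have d: "finite (zeros f) \<and> card (zeros f) \<le> degree f" if "f \<in> set fs" for f
  using finite_zeros card_zeros factorD[OF that] by blast
 show "distinct fs" by (rule tight_cover(1)[OF factorD(4) d c])
 show "card (zeros f) = degree f" if "f \<in> set fs" for f by (rule tight_cover(2)[OF factorD(4) d c that])
 show "zeros f \<inter> zeros g = {}" if "f \<in> set fs" "g \<in> set fs" "f \<noteq> g" for f g
  by (rule tight_cover(3)[OF factorD(4) d c that])
qed

lemma zeros_nonempty: "f \<in> set fs ==> zeros f \<noteq> {}"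
 using factors(2)[of f] factorD(4)[of f] by (metis card.empty not_one_le_zero)

text \<open>w is the polynomial g(X^a), built in the polynomial ring from \<open>XX\<close>, which
  is X, and the constants \<open>cc\<close>.\<close>

lemma power_substitution:
 assumes g: "g \<in> carrier P"
 obtains w where "w \<in> carrier P" "\<And>u. u \<in> R ==> \<phi> u w = \<phi> (u [^]\<^sub>L (a::nat)) g"
proof -
 obtain c where c: "\<And>l. c l \<in> carrier Z" "g = E.pol (length g) c" by (rule E.poly_is_pol[OF g order_refl]) blast
 define n where "n = length g"
 define XX where "XX = E.pol 2 (\<lambda>l. if l = 1 then \<one>\<^sub>Z else \<zero>\<^sub>Z)"
 have Xc: "XX \<in> carrier P" unfolding XX_def by (rule E.pol_carrier) simp
 define cc where "cc l = E.pol 1 (\<lambda>_. c l)" for l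
 have ccc: "cc l \<in> carrier P" for l unfolding cc_def by (rule E.pol_carrier) (rule c(1))
 define w where "w = (\<Oplus>\<^sub>P l\<in>{..<n}. cc l \<otimes>\<^sub>P (XX [^]\<^sub>P a) [^]\<^sub>P l)"
 show ?thesis
 proof (rule that[of w])
  show "w \<in> carrier P" unfolding w_def using Xc ccc by (intro P.finsum_closed) auto
  fix u assume u: "u \<in> R"
  then have uc: "u \<in> carrier L" by blast
  interpret ph: ring_hom_cring P L "\<phi> u" by (rule \<phi>_hom[OF uc])
  have e1: "\<phi> u XX = u"
  proof -
   have "\<phi> u XX = (\<Oplus>\<^sub>L l\<in>{..<2::nat}. \<iota> (if l = 1 then \<one>\<^sub>Z else \<zero>\<^sub>Z) \<otimes>\<^sub>L u [^]\<^sub>L l)"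
    unfolding XX_def by (rule F.evm_pol) (use uc in auto)
   also have "{..<2::nat} = {0, 1}" by auto
   finally show ?thesis using uc by simp
  qed
  have e2: "\<phi> u (cc l) = \<iota> (c l)" for l
  proof -
   have "\<phi> u (cc l) = (\<Oplus>\<^sub>L i\<in>{..<1::nat}. \<iota> (c l) \<otimes>\<^sub>L u [^]\<^sub>L i)"
    unfolding cc_def by (rule F.evm_pol) (use uc c in auto)
   also have "{..<1::nat} = {0}" by auto
   finally show ?thesis using uc c(1) by simp
  qed
  have hp: "\<phi> u (q [^]\<^sub>P (k::nat)) = \<phi> u q [^]\<^sub>L k" if "q \<in> carrier P" for q k
   using that by (induction k) auto
  have "\<phi> u w = (\<Oplus>\<^sub>L l\<in>{..<n}. \<phi> u (cc l \<otimes>\<^sub>P (XX [^]\<^sub>P a) [^]\<^sub>P l))"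
   unfolding w_def using Xc ccc by (subst ph.hom_finsum) (auto simp: comp_def)
  also have "... = (\<Oplus>\<^sub>L l\<in>{..<n}. \<iota> (c l) \<otimes>\<^sub>L (u [^]\<^sub>L a) [^]\<^sub>L l)"
   by (rule L.finsum_cong') (use Xc ccc uc c(1) in \<open>auto simp: hp e1 e2\<close>)
  also have "... = \<phi> (u [^]\<^sub>L a) (E.pol n c)"
   by (rule F.evm_pol[symmetric]) (use uc c in auto)
  also have "E.pol n c = g" using c(2) by (simp add: n_def)
  finally show "\<phi> u w = \<phi> (u [^]\<^sub>L a) g" .
 qed
qed

text \<open>Roots r of f and s of g differ from 1, so s = r^a and r = s^b. As g(X^a) vanishes at r,
  it vanishes at all zeros of the irreducible f; thus u -> u^a maps zeros of f to zeros of g, and u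
  -> u^b undoes it. By symmetry all factors have the same degree.\<close>

lemma card_zeros_mono:
 assumes f: "f \<in> set fs" and g: "g \<in> set fs"
 shows "card (zeros f) \<le> card (zeros g)"
proof -
 obtain r where r: "r \<in> zeros f" using zeros_nonempty[OF f] by blast
 obtain s where s: "s \<in> zeros g" using zeros_nonempty[OF g] by blast
 have ne: "r \<noteq> \<one>\<^sub>L" "s \<noteq> \<one>\<^sub>L" using zeros_cover r s f g by blast+
 have rp: "r \<in> carrier L" "r [^]\<^sub>L p = \<one>\<^sub>L" and sp: "s \<in> carrier L" "s [^]\<^sub>L p = \<one>\<^sub>L"
  using r s by (auto simp: lam_one)
 have pw: "\<exists>i. v = u [^]\<^sub>L (i::nat)" if "u \<in> carrier L" "u \<noteq> \<one>\<^sub>L" "u [^]\<^sub>L p = \<one>\<^sub>L" "v \<in> R" for u v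
 proof -
  have "v \<in> {s \<in> carrier L. s [^]\<^sub>L p = \<one>\<^sub>L [^]\<^sub>L p}" using that(4) by (simp add: lam_one)
  then have "v \<in> (\<lambda>i. \<one>\<^sub>L \<otimes>\<^sub>L u [^]\<^sub>L i) ` {..<p}"
   using L.pth_root_powers(1)[OF p that(1-3) L.one_closed] by simp
  then show ?thesis using that(1) by auto
 qed
 obtain a :: nat where a: "s = r [^]\<^sub>L a" using pw[of r s] rp ne s by blast
 obtain b :: nat where b: "r = s [^]\<^sub>L b" using pw[of s r] sp ne r by blast
 obtain w where w: "w \<in> carrier P" "\<And>u. u \<in> R ==> \<phi> u w = \<phi> (u [^]\<^sub>L a) g"
  by (rule power_substitution[OF factorD(1)[OF g], of a]) blast
 have wr: "\<phi> r w = \<zero>\<^sub>L" using w(2)[of r] r s a by auto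
 have up: "u [^]\<^sub>L p = \<one>\<^sub>L" if "u \<in> zeros f" for u using that R_iff by blast
 have im: "u [^]\<^sub>L a \<in> zeros g" if u: "u \<in> zeros f" for u
 proof -
  have "\<phi> (u [^]\<^sub>L a) g = \<zero>\<^sub>L"
   using conn_irreducible[OF factorD(1,2)[OF f] w(1) r wr u] w(2)[of u] u by simp
  moreover have "(u [^]\<^sub>L a) [^]\<^sub>L p = \<one>\<^sub>L"
  proof -
   have uc: "u \<in> carrier L" using u by blast
   have "(u [^]\<^sub>L a) [^]\<^sub>L p = (u [^]\<^sub>L p) [^]\<^sub>L a" using uc by (simp add: L.nat_pow_pow mult.commute)
   then show ?thesis unfolding up[OF u] by simp
  qed
  ultimately show ?thesis using u by (simp add: lam_one)
 qed
 have bck: "(u [^]\<^sub>L a) [^]\<^sub>L b = u" if u: "u \<in> zeros f" for u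
 proof -
  obtain i :: nat where i: "u = r [^]\<^sub>L i" using pw[of r u] rp ne u by blast
  have "(u [^]\<^sub>L a) [^]\<^sub>L b = ((r [^]\<^sub>L a) [^]\<^sub>L b) [^]\<^sub>L i"
   unfolding i using rp(1) by (simp add: L.nat_pow_pow ac_simps)
  also have "... = u" by (simp only: a[symmetric] b[symmetric] i[symmetric])
  finally show ?thesis .
 qed
 have inj: "inj_on (\<lambda>u. u [^]\<^sub>L a) (zeros f)" by (rule inj_on_inverseI[of _ "\<lambda>u. u [^]\<^sub>L b"]) (rule bck)
 show ?thesis by (rule card_inj_on_le[OF inj _ finite_zeros]) (use im in blast)
qed

lemma linear_zero:
 obtains q where "q \<in> carrier P" "\<And>r. r \<in> carrier L ==> \<phi> r q = \<zero>\<^sub>L \<longleftrightarrow> r = \<one>\<^sub>L"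
proof (rule that[of "E.pol 2 (\<lambda>l. if l = 1 then \<one>\<^sub>Z else \<ominus>\<^sub>Z \<one>\<^sub>Z)"])
 show "E.pol 2 (\<lambda>l. if l = 1 then \<one>\<^sub>Z else \<ominus>\<^sub>Z \<one>\<^sub>Z) \<in> carrier P" by (rule E.pol_carrier) simp
 fix r assume r: "r \<in> carrier L"
 have "\<phi> r (E.pol 2 (\<lambda>l. if l = 1 then \<one>\<^sub>Z else \<ominus>\<^sub>Z \<one>\<^sub>Z))
   = (\<Oplus>\<^sub>L l\<in>{..<2::nat}. \<iota> (if l = 1 then \<one>\<^sub>Z else \<ominus>\<^sub>Z \<one>\<^sub>Z) \<otimes>\<^sub>L r [^]\<^sub>L l)"
  by (rule F.evm_pol) (use r in auto)
 also have "{..<2::nat} = {1, 0}" by auto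
 also have "(\<Oplus>\<^sub>L l\<in>{1, 0::nat}. \<iota> (if l = 1 then \<one>\<^sub>Z else \<ominus>\<^sub>Z \<one>\<^sub>Z) \<otimes>\<^sub>L r [^]\<^sub>L l) = r \<oplus>\<^sub>L (\<ominus>\<^sub>L \<one>\<^sub>L)"
  using r by simp
 finally show "\<phi> r (E.pol 2 (\<lambda>l. if l = 1 then \<one>\<^sub>Z else \<ominus>\<^sub>Z \<one>\<^sub>Z)) = \<zero>\<^sub>L \<longleftrightarrow> r = \<one>\<^sub>L"
  using L.sum_zero_eq_neg[of r "\<ominus>\<^sub>L \<one>\<^sub>L"] r by (auto simp: L.r_neg)
qed

text \<open>Let q be X - 1 times the product of the other factors: it vanishes at the roots outside
  the zero set of f, and f does not divide it. In a relation a f + b q = 1 the term b q takes the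
  value 1 on the zeros of f and 0 elsewhere.\<close>

lemma indic_factor_exists:
 assumes f: "f \<in> set fs" shows "\<exists>u. indic (zeros f) u"
proof -
 note fP = factorD(1,2)[OF f]
 obtain q0 where q0: "q0 \<in> carrier P" "\<And>r. r \<in> carrier L ==> \<phi> r q0 = \<zero>\<^sub>L \<longleftrightarrow> r = \<one>\<^sub>L" by (rule linear_zero) blast
 define q1 where "q1 = foldr (\<lambda>f g. f \<otimes>\<^sub>P g) (removeAll f fs) \<one>\<^sub>P"
 have q1: "q1 \<in> carrier P" "\<And>r. r \<in> carrier L ==> \<phi> r q1 = \<zero>\<^sub>L \<longleftrightarrow> (\<exists>g\<in>set fs - {f}. \<phi> r g = \<zero>\<^sub>L)"
  using product[of "removeAll f fs"] unfolding q1_def by auto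
 define q where "q = q0 \<otimes>\<^sub>P q1"
 have q: "q \<in> carrier P" "zeros q = zeros q0 \<union> zeros q1" unfolding q_def using q0 q1 zeros_mult by auto
 obtain r where r: "r \<in> zeros f" using zeros_nonempty[OF f] by blast
 have rc: "r \<in> carrier L" "r \<in> R" using r by blast+
 have qr: "\<phi> r q \<noteq> \<zero>\<^sub>L"
 proof
  assume "\<phi> r q = \<zero>\<^sub>L"
  then have "r \<in> zeros q0 \<or> r \<in> zeros q1" using q(2) rc by blast
  moreover have "r \<notin> zeros q0" using q0(2)[OF rc(1)] zeros_cover r f by blast
  moreover have "r \<notin> zeros q1" using q1(2)[OF rc(1)] factors(3)[OF f] r by blast
  ultimately show False by blast
 qed
 have nd: "\<not> f divides\<^bsub>P\<^esub> q"
 proof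
  assume "f divides\<^bsub>P\<^esub> q"
  then obtain h where h: "h \<in> carrier P" "q = f \<otimes>\<^sub>P h" unfolding factor_def by blast
  then show False using zeros_mult[OF fP(1) h(1)] qr r by blast
 qed
 obtain a b where ab: "a \<in> carrier P" "b \<in> carrier P" "(a \<otimes>\<^sub>P f) \<oplus>\<^sub>P (b \<otimes>\<^sub>P q) = \<one>\<^sub>P"
  by (rule Z.irreducible_bezout[OF fP q(1) nd])
 have "\<phi> s (b \<otimes>\<^sub>P q) = (if s \<in> zeros f then \<one>\<^sub>L else \<zero>\<^sub>L)" if s: "s \<in> R" for s
 proof -
  have sc: "s \<in> carrier L" using s by blast
  interpret ph: ring_hom_cring P L "\<phi> s" by (rule \<phi>_hom[OF sc])
  note cl = ph.hom_closed[OF ab(1)] ph.hom_closed[OF ab(2)] ph.hom_closed[OF fP(1)] ph.hom_closed[OF q(1)]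
  have e: "(\<phi> s a \<otimes>\<^sub>L \<phi> s f) \<oplus>\<^sub>L (\<phi> s b \<otimes>\<^sub>L \<phi> s q) = \<one>\<^sub>L"
   using arg_cong[OF ab(3), of "\<phi> s"] ab(1,2) fP(1) q(1) by simp
  show ?thesis
  proof (cases "s \<in> zeros f")
   case True
   then have "\<phi> s f = \<zero>\<^sub>L" by blast
   then show ?thesis using e cl True ab(2) q(1) by simp
  next
   case False
   then have "s = \<one>\<^sub>L \<or> (\<exists>g\<in>set fs - {f}. s \<in> zeros g)" using zeros_cover s by blast
   then have "s \<in> zeros q0 \<or> s \<in> zeros q1" using q0(2)[OF sc] q1(2)[OF sc] s by blast
   then have "\<phi> s q = \<zero>\<^sub>L" using q(2) by blast
   then show ?thesis using cl(2) False ab(2) q(1) by (auto simp del: mem_Collect_eq)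
  qed
 qed
 then have "indic (zeros f) (ev (b \<otimes>\<^sub>P q))"
  unfolding indic_def using ab(2) q(1) by (intro bexI[of _ "b \<otimes>\<^sub>P q"]) auto
 then show ?thesis by blast
qed

text \<open>The power sums are computed in L and pulled back to Z along the injective
  \<open>\<iota>\<close>; \<open>inv_power_sum_in\<close> shows that for l < p they are in its
  range.\<close>

definition factor_idem :: "'k list \<Rightarrow> 'c" where
 "factor_idem f = (\<Oplus>\<^sub>C l\<in>{..<p}. j (pinv \<otimes>\<^sub>Z inv_into (carrier Z) \<iota> (inv_power_sum \<iota> L f l)) \<otimes>\<^sub>C t [^]\<^sub>C l)"

definition trivial_idem :: 'c where
 "trivial_idem = (\<Oplus>\<^sub>C l\<in>{..<p}. j pinv \<otimes>\<^sub>C t [^]\<^sub>C l)"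

lemma inv_power_sum_eq: "f \<in> set fs ==> inv_power_sum \<iota> L f l = ps (zeros f) l"
 unfolding inv_power_sum_def by (simp only: roots_in_eq_zeros)

lemma zeros_sub: "zeros f \<subseteq> R" by blast

lemma inv_power_sum_in:
 assumes "f \<in> set fs" "l < p" shows "inv_power_sum \<iota> L f l \<in> \<iota> ` carrier Z"
proof -
 obtain u where u: "indic (zeros f) u" using indic_factor_exists[OF assms(1)] by blast
 show ?thesis unfolding inv_power_sum_eq[OF assms(1)] by (rule indic_coeffs[OF zeros_sub u assms(2)])
qed

lemma indic_factor_idem:
 assumes f: "f \<in> set fs" shows "indic (zeros f) (factor_idem f)"
proof -
 \<comment> \<open>For l \<ge> p the power sum is not shown to come from Z, whereas
   \<open>indic_fourier\<close> asks for a coefficient in Z at every l; hence the default 0.\<close>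
 define z where "z l = (if l < p then inv_into (carrier Z) \<iota> (inv_power_sum \<iota> L f l) else \<zero>\<^sub>Z)" for l
 have z: "z l \<in> carrier Z" "l < p ==> \<iota> (z l) = ps (zeros f) l" for l
  using inv_into_into[OF inv_power_sum_in[OF f]] f_inv_into_f[OF inv_power_sum_in[OF f]]
  unfolding inv_power_sum_eq[OF f] z_def by simp_all
 have "factor_idem f = (\<Oplus>\<^sub>C l\<in>{..<p}. j (pinv \<otimes>\<^sub>Z z l) \<otimes>\<^sub>C t [^]\<^sub>C l)"
  unfolding factor_idem_def
 proof (rule C.finsum_cong'[OF refl])
  show "(\<lambda>l. j (pinv \<otimes>\<^sub>Z z l) \<otimes>\<^sub>C t [^]\<^sub>C l) \<in> {..<p} \<rightarrow> carrier C" using z(1) pinv(1) t by simp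
 qed (simp add: z_def)
 then show ?thesis using indic_fourier[OF zeros_sub z] by simp
qed

lemma indic_trivial_idem: "indic {\<one>\<^sub>L} trivial_idem"
proof -
 have "indic {\<one>\<^sub>L} (\<Oplus>\<^sub>C l\<in>{..<p}. j (pinv \<otimes>\<^sub>Z \<one>\<^sub>Z) \<otimes>\<^sub>C t [^]\<^sub>C l)"
 proof (rule indic_fourier)
  show "{\<one>\<^sub>L} \<subseteq> R" using one_R by blast
 qed simp_all
 then show ?thesis unfolding trivial_idem_def using pinv(1) by simp
qed

lemma common_degree: "\<exists>d. \<forall>f\<in>set fs. degree f = d \<and> card (roots_in \<iota> L f) = d"
proof (cases "fs = []")
 case False
 then have h: "hd fs \<in> set fs" by simp
 have "degree f = degree (hd fs) \<and> card (roots_in \<iota> L f) = degree (hd fs)" if f: "f \<in> set fs" for f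
  using card_zeros_mono[OF f h] card_zeros_mono[OF h f] unfolding roots_in_eq_zeros[OF f] factors(2)[OF f] factors(2)[OF h] by simp
 then show ?thesis by blast
qed simp

lemma cyclotomic_partition:
 defines "T \<equiv> insert trivial_idem (factor_idem ` set fs)"
 shows "card T = 1 + length fs" "(\<Oplus>\<^sub>C v\<in>T. v) = \<one>\<^sub>C"
  "\<And>u. u \<in> T ==> u \<in> carrier C \<and> u \<otimes>\<^sub>C u = u \<and> u \<noteq> \<zero>\<^sub>C \<and>
    (\<forall>v\<in>carrier C. v \<otimes>\<^sub>C v = v \<and> v \<otimes>\<^sub>C u = v \<longrightarrow> v = \<zero>\<^sub>C \<or> v = u)"
proof -
 \<comment> \<open>\<open>None\<close> stands for the root 1 and \<open>Some f\<close> for the zeros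
   of f.\<close>
 define A where "A = insert None (Some ` set fs)"
 define S where "S i = (case i of None \<Rightarrow> {\<one>\<^sub>L} | Some f \<Rightarrow> zeros f)" for i
 define u where "u i = (case i of None \<Rightarrow> trivial_idem | Some f \<Rightarrow> factor_idem f)" for i
 have SN: "S None = {\<one>\<^sub>L}" and SS: "S (Some f) = zeros f" for f by (simp_all only: S_def option.case)
 have A: "finite A" by (simp add: A_def)
 have cases: "i = None \<or> (\<exists>f\<in>set fs. i = Some f)" if "i \<in> A" for i using that by (auto simp: A_def)
 have one: "\<one>\<^sub>L \<notin> zeros f" if "f \<in> set fs" for f using zeros_cover that by blast
 have T: "T = u ` A" unfolding T_def A_def u_def by (simp add: image_image)
 have i1: "indic (S i) (u i)" if "i \<in> A" for i
  using cases[OF that] indic_trivial_idem indic_factor_idem by (auto simp: u_def SN SS simp del: mem_Collect_eq)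
 have i2: "S i \<noteq> {}" if "i \<in> A" for i
  using cases[OF that] zeros_nonempty unfolding S_def by (metis (no_types, lifting) insert_not_empty option.case)
 have i3: "S i \<inter> S k = {}" if iA: "i \<in> A" and kA: "k \<in> A" and ik: "i \<noteq> k" for i k
  using cases[OF iA]
 proof (elim disjE bexE)
  assume i: "i = None"
  then obtain g where "g \<in> set fs" "k = Some g" using cases[OF kA] ik by blast
  then show ?thesis using one i by (simp only: SN SS Int_insert_left if_False Int_empty_left)
 next
  fix f assume f: "f \<in> set fs" "i = Some f"
  show ?thesis using cases[OF kA]
  proof (elim disjE bexE)
   assume "k = None"
   then show ?thesis using one[OF f(1)] f(2) by (simp only: SN SS Int_insert_right if_False Int_empty_right)
  next
   fix g assume "g \<in> set fs" "k = Some g"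
   then show ?thesis using factors(3)[OF f(1)] f(2) ik by (simp only: SS option.inject)
  qed
 qed
 have i4: "(\<Union>i\<in>A. S i) = R"
 proof -
  have "(\<Union>i\<in>A. S i) = {\<one>\<^sub>L} \<union> (\<Union>f\<in>set fs. zeros f)" unfolding A_def by (simp only: UN_insert SN UN_simps SS)
  then show ?thesis unfolding zeros_cover by (simp only: Un_insert_left Un_empty_left insert_Diff[OF one_R])
 qed
 have i5: "\<phi> s q = \<zero>\<^sub>L" if iA: "i \<in> A" and q: "q \<in> carrier P" and r: "r \<in> S i" and s: "s \<in> S i" and z: "\<phi> r q = \<zero>\<^sub>L" for i q r s
  using cases[OF iA]
 proof (elim disjE bexE)
  assume "i = None" then show ?thesis using r s z by (simp add: SN)
 next
  fix f assume f: "f \<in> set fs" "i = Some f"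
  show ?thesis by (rule conn_irreducible[OF factorD(1,2)[OF f(1)] q]) (use r s z in \<open>simp_all only: f(2) SS\<close>)
 qed
 have inj: "inj_on u A" by (rule indic_partition(1)[of A S u, OF A i1 i2 i3 i4 i5]) assumption+
 have "card A = 1 + length fs"
  unfolding A_def using distinct_card[OF factors(1)] by (simp add: card_image)
 then show "card T = 1 + length fs" unfolding T using card_image[OF inj] by simp
 show "(\<Oplus>\<^sub>C v\<in>T. v) = \<one>\<^sub>C" unfolding T by (rule indic_partition(2)[of A S u, OF A i1 i2 i3 i4 i5]) assumption+
 fix v assume "v \<in> T"
 then obtain i where i: "i \<in> A" "v = u i" unfolding T by blast
 show "v \<in> carrier C \<and> v \<otimes>\<^sub>C v = v \<and> v \<noteq> \<zero>\<^sub>C \<and>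
    (\<forall>w\<in>carrier C. w \<otimes>\<^sub>C w = w \<and> w \<otimes>\<^sub>C v = w \<longrightarrow> w = \<zero>\<^sub>C \<or> w = v)"
  unfolding i(2) by (rule indic_partition(3)[of A S u, OF A i1 i2 i3 i4 i5 i(1)]) assumption+
qed

end

section \<open>The case where all p-th roots of lambda lie in Z\<close>

context radical_ext begin

text \<open>The Fourier formula for the single point \<mu>, whose inverse power sums are
  \<mu>^-l.\<close>

definition kummer_idem :: "'k \<Rightarrow> 'c" where
 "kummer_idem \<mu> = (\<Oplus>\<^sub>C l\<in>{..<p}. j (pinv \<otimes>\<^sub>Z inv\<^bsub>Z\<^esub> (\<mu> [^]\<^sub>Z l)) \<otimes>\<^sub>C t [^]\<^sub>C l)"

text \<open>With all roots in Z the pieces of the partition are single points, and their power sums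
  lie in Z at once.\<close>

lemma kummer_partition:
 assumes split: "R \<subseteq> \<iota> ` carrier Z"
 defines "M \<equiv> {\<mu> \<in> carrier Z. \<mu> [^]\<^sub>Z p = lam}"
 shows "card M = p" "card (kummer_idem ` M) = p" "(\<Oplus>\<^sub>C v\<in>kummer_idem ` M. v) = \<one>\<^sub>C"
  "\<And>u. u \<in> kummer_idem ` M ==> u \<in> carrier C \<and> u \<otimes>\<^sub>C u = u \<and> u \<noteq> \<zero>\<^sub>C \<and>
    (\<forall>v\<in>carrier C. v \<otimes>\<^sub>C v = v \<and> v \<otimes>\<^sub>C u = v \<longrightarrow> v = \<zero>\<^sub>C \<or> v = u)"
proof -
 have hp: "\<iota> (\<mu> [^]\<^sub>Z (k::nat)) = \<iota> \<mu> [^]\<^sub>L k" if "\<mu> \<in> carrier Z" for \<mu> k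
  using that by (rule F.J.hom_nat_pow)
 have im: "\<iota> ` M = R"
 proof
  show "\<iota> ` M \<subseteq> R" unfolding M_def using hp[symmetric] by auto
  show "R \<subseteq> \<iota> ` M"
  proof
   fix r assume r: "r \<in> R"
   then obtain \<mu> where \<mu>: "\<mu> \<in> carrier Z" "r = \<iota> \<mu>" using split by blast
   have "\<iota> (\<mu> [^]\<^sub>Z p) = \<iota> lam" using r \<mu> hp by auto
   then have "\<mu> [^]\<^sub>Z p = lam" by (rule inj_onD[OF F.\<iota>_inj]) (use \<mu> lam in auto)
   then show "r \<in> \<iota> ` M" using \<mu> by (auto simp: M_def)
  qed
 qed
 have inj: "inj_on \<iota> M" by (rule inj_on_subset[OF F.\<iota>_inj]) (auto simp: M_def)
 have "card (\<iota> ` M) = p" unfolding im by (rule cardR)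
 then show cM: "card M = p" unfolding card_image[OF inj] .
 then have fM: "finite M" using p_pos by (metis card.infinite less_numeral_extra(3))
 have Mc: "\<mu> \<in> carrier Z" "\<iota> \<mu> \<in> R" if "\<mu> \<in> M" for \<mu> using that im by (auto simp: M_def)
 have i1: "indic {\<iota> \<mu>} (kummer_idem \<mu>)" if \<mu>: "\<mu> \<in> M" for \<mu>
  unfolding kummer_idem_def
 proof (rule indic_fourier)
  show "{\<iota> \<mu>} \<subseteq> R" using Mc(2)[OF \<mu>] by blast
  fix l :: nat
  have "\<mu> \<noteq> \<zero>\<^sub>Z" using R_nz[OF Mc(2)[OF \<mu>]] by auto
  then have U: "\<mu> [^]\<^sub>Z l \<in> Units Z" using Mc(1)[OF \<mu>] Z.field_Units Z.Units_pow_closed[of \<mu> l] by simp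
  then show c: "inv\<^bsub>Z\<^esub> (\<mu> [^]\<^sub>Z l) \<in> carrier Z" by simp
  have "\<iota> \<mu> [^]\<^sub>L l \<otimes>\<^sub>L \<iota> (inv\<^bsub>Z\<^esub> (\<mu> [^]\<^sub>Z l)) = \<one>\<^sub>L"
   using F.J.hom_mult[of "\<mu> [^]\<^sub>Z l" "inv\<^bsub>Z\<^esub> (\<mu> [^]\<^sub>Z l)"] U c Mc(1)[OF \<mu>] hp[OF Mc(1)[OF \<mu>], of l] by simp
  then have "inv\<^bsub>L\<^esub> (\<iota> \<mu> [^]\<^sub>L l) = \<iota> (inv\<^bsub>Z\<^esub> (\<mu> [^]\<^sub>Z l))"
   using Mc(1)[OF \<mu>] c by (intro L.comm_inv_char) auto
  moreover have "inv\<^bsub>L\<^esub> (\<iota> \<mu> [^]\<^sub>L l) \<in> carrier L" by (rule inv_pow_closed[OF Mc(2)[OF \<mu>]])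
  ultimately show "\<iota> (inv\<^bsub>Z\<^esub> (\<mu> [^]\<^sub>Z l)) = ps {\<iota> \<mu>} l" by simp
 qed
 have i3: "{\<iota> i} \<inter> {\<iota> k} = {}" if "i \<in> M" "k \<in> M" "i \<noteq> k" for i k using inj_onD[OF inj] that by auto
 have i4: "(\<Union>\<mu>\<in>M. {\<iota> \<mu>}) = R" using im by blast
 have i2: "{\<iota> i} \<noteq> {}" if "i \<in> M" for i by simp
 have i5: "\<phi> s q = \<zero>\<^sub>L" if "i \<in> M" "q \<in> carrier P" "r \<in> {\<iota> i}" "s \<in> {\<iota> i}" "\<phi> r q = \<zero>\<^sub>L" for i q r s using that(3-5) by simp
 note part = indic_partition[of M "\<lambda>\<mu>. {\<iota> \<mu>}" kummer_idem, OF fM i1 i2 i3 i4 i5]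
 have inj': "inj_on kummer_idem M" by (rule part(1)) assumption+
 show "card (kummer_idem ` M) = p" using card_image[OF inj'] cM by simp
 show "(\<Oplus>\<^sub>C v\<in>kummer_idem ` M. v) = \<one>\<^sub>C" by (rule part(2)) assumption+
 fix u assume "u \<in> kummer_idem ` M"
 then obtain i where i: "i \<in> M" "u = kummer_idem i" by blast
 show "u \<in> carrier C \<and> u \<otimes>\<^sub>C u = u \<and> u \<noteq> \<zero>\<^sub>C \<and>
    (\<forall>v\<in>carrier C. v \<otimes>\<^sub>C v = v \<and> v \<otimes>\<^sub>C u = v \<longrightarrow> v = \<zero>\<^sub>C \<or> v = u)"
  unfolding i(2) by (rule part(3)[OF _ _ _ _ _ _ _ _ _ _ i(1)]) assumption+
qed

end

section \<open>The center C as a graded algebra over Z\<close>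

context prime_index begin

lemma p_nz: "add_pow K p \<one>\<^sub>K \<noteq> \<zero>\<^sub>K"
proof
 assume z: "add_pow K p \<one>\<^sub>K = \<zero>\<^sub>K"
 have "card (carrier G) = p * card H"
  using G.lagrange_finite[OF fin H_sub] index by (simp add: order_def)
 then have "(\<Oplus>\<^sub>K g\<in>carrier G. \<one>\<^sub>K) = add_pow K (p * card H) \<one>\<^sub>K"
  using K.add.finprod_const[of "\<one>\<^sub>K" "carrier G"] by simp
 also have "... = add_pow K (card H) (add_pow K p \<one>\<^sub>K)"
  using K.add.nat_pow_pow[of "\<one>\<^sub>K" "card H" p] by simp
 also have "... = \<zero>\<^sub>K" unfolding z by (rule K.add.nat_pow_one)
 finally show False using order_nz by simp
qed

end

text \<open>The homogeneous unit t is left general because two choices occur: the class sum times e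
  in (A) and (B), and its quotient by a p-th root, with \<open>lam = e\<close>, in (C).\<close>

locale graded_unit = inv_block G K H p e x
 for G :: "('g, 'm) monoid_scheme" (structure) and K :: "('k, 'r) ring_scheme" and H p e x +
 fixes y :: 'g and t lam :: "'g \<Rightarrow> 'k"
 assumes fixed: fixed and y: "y \<in> carrier G" "y \<notin> H"
  and t: "t \<in> carrier C" "deg (H #> y) t" and tp: "t [^]\<^sub>C p = lam"
  and lam: "lam \<in> carrier Z" "lam \<noteq> \<zero>\<^bsub>KG\<^esub>"
begin

sublocale CC: cring C by (rule BC.cring_C)
sublocale ZF: field Z by (rule Z_field)

lemma C_KG [simp]: "v \<in> carrier C ==> v \<in> carrier KG" by (rule BC.C_carrierD(1))

lemma ZC [simp]: "z \<in> carrier Z ==> z \<in> carrier C" by (rule Z_in_C[OF fixed])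

lemma id_hom: "id \<in> ring_hom Z C"
proof (rule ring_hom_memI)
 fix u v assume u: "u \<in> carrier Z" "v \<in> carrier Z"
 show "id (u \<otimes>\<^sub>Z v) = id u \<otimes>\<^sub>C id v" "id (u \<oplus>\<^sub>Z v) = id u \<oplus>\<^sub>C id v"
  unfolding id_apply block_simps using KH_mult[OF Z_D(1) Z_D(1)] u by auto
qed simp_all

lemma finsum_C: "[|finite A; \<And>i. i \<in> A ==> f i \<in> carrier C|] ==> finsum C f A = finsum KG f A"
proof (induction A rule: finite_induct)
 case (insert a A)
 have "finsum C f (insert a A) = f a \<oplus>\<^sub>C finsum C f A" using insert by (intro CC.finsum_insert) auto
 moreover have "finsum KG f (insert a A) = f a \<oplus>\<^bsub>KG\<^esub> finsum KG f A" using insert by (intro A.finsum_insert) auto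
 ultimately show ?case using insert by simp
qed simp

definition li where "li = inv\<^bsub>Z\<^esub> lam"

lemma li: "li \<in> carrier Z" "lam \<otimes>\<^sub>C li = e"
proof -
 obtain w where "w \<in> carrier Z" "lam \<star> w = e" "w \<star> lam = e" "w = inv\<^bsub>Z\<^esub> lam"
  by (rule Z_inverse[OF lam])
 then show "li \<in> carrier Z" "lam \<otimes>\<^sub>C li = e" by (simp_all add: li_def)
qed

lemma t_pow_C: "t [^]\<^sub>C (k::nat) \<in> carrier C" using t(1) by simp

lemma t_deg_e: "deg (H #> (y [^] (k::nat))) (t [^]\<^sub>C k)"
proof -
 have "t [^]\<^sub>C k = t [^]\<^bsub>KG\<^esub> k \<star> e"
  using BC.block_pow[of t k] BC.C_carrierD[OF t(1)] by simp
 then show ?thesis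
  using deg_times_e[OF deg_pow[OF y(1) t(2), of k]] coset_in_Q y(1) by simp
qed

text \<open>t^(p-k) divided by \<open>lam\<close> is the inverse of t^k.\<close>

lemma cancel_pow:
 assumes "v \<in> carrier C" "k < p"
 shows "(v \<otimes>\<^sub>C t [^]\<^sub>C k) \<otimes>\<^sub>C t [^]\<^sub>C (p - k) \<otimes>\<^sub>C li = v"
  "(v \<otimes>\<^sub>C t [^]\<^sub>C (p - k) \<otimes>\<^sub>C li) \<otimes>\<^sub>C t [^]\<^sub>C k = v"
proof -
 have l: "t [^]\<^sub>C k \<otimes>\<^sub>C t [^]\<^sub>C (p - k) = lam"
  using CC.nat_pow_mult[OF t(1), of k "p - k"] assms(2) tp by simp
 have v1: "v \<otimes>\<^sub>C e = v" using CC.r_one[OF assms(1)] by (simp only: block_simps)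
 note c = assms(1) t_pow_C[of k] t_pow_C[of "p - k"] ZC[OF li(1)] ZC[OF lam(1)]
 have "(v \<otimes>\<^sub>C t [^]\<^sub>C k) \<otimes>\<^sub>C t [^]\<^sub>C (p - k) \<otimes>\<^sub>C li = v \<otimes>\<^sub>C ((t [^]\<^sub>C k \<otimes>\<^sub>C t [^]\<^sub>C (p - k)) \<otimes>\<^sub>C li)"
  using c by (simp only: CC.m_assoc CC.m_closed)
 then show 1: "(v \<otimes>\<^sub>C t [^]\<^sub>C k) \<otimes>\<^sub>C t [^]\<^sub>C (p - k) \<otimes>\<^sub>C li = v" unfolding l li(2) v1 .
 have "(v \<otimes>\<^sub>C t [^]\<^sub>C (p - k) \<otimes>\<^sub>C li) \<otimes>\<^sub>C t [^]\<^sub>C k = (v \<otimes>\<^sub>C t [^]\<^sub>C k) \<otimes>\<^sub>C t [^]\<^sub>C (p - k) \<otimes>\<^sub>C li"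
  using c by (simp only: CC.m_ac CC.m_closed)
 then show "(v \<otimes>\<^sub>C t [^]\<^sub>C (p - k) \<otimes>\<^sub>C li) \<otimes>\<^sub>C t [^]\<^sub>C k = v" using 1 by (rule trans)
qed

lemma HQ: "H #> \<one> = H" "H <#> H = H"
proof -
 show 1: "H #> \<one> = H" using coset_H_iff[of \<one>] N.one_closed by simp
 have "H \<in> carrier (G Mod H)" using coset_in_Q[of \<one>] unfolding 1 by simp
 then show "H <#> H = H" using Q.r_one[of H] by simp
qed

lemma deg_mult_coset:
 assumes "a \<in> carrier G" "b \<in> carrier G" "deg (H #> a) u" "deg (H #> b) v"
 shows "deg (H #> (a \<otimes> b)) (u \<star> v)"
 unfolding coset_mult[OF assms(1,2)] by (rule deg_mult[OF assms(3,4)])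

text \<open>The component of v of degree H y^k, divided by t^k, has degree H and therefore lies in
  Z.\<close>

lemma generated:
 assumes v: "v \<in> carrier C"
 shows "\<exists>a. (\<forall>l. a l \<in> carrier Z) \<and> v = (\<Oplus>\<^sub>C l\<in>{..<p}. id (a l) \<otimes>\<^sub>C t [^]\<^sub>C l)"
proof -
 define w where "w k = restr (H #> (y [^] (k::nat))) v" for k
 have w: "w k \<in> carrier C" for k
  using restr_central[OF BC.C_carrierD(2)[OF v]] restr_mult[OF BC.C_carrierD(1)[OF v] e_KH] BC.C_carrierD(3)[OF v]
  unfolding w_def BC.carrier_C by simp
 \<comment> \<open>The default matters: for k \<ge> p the exponent p - k is cut off at 0 and the
   quotient need not lie in Z, while \<open>radical_ext\<close> asks for coefficients in Z at every
   index.\<close>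
 define a where "a k = (if k < p then w k \<otimes>\<^sub>C t [^]\<^sub>C (p - k) \<otimes>\<^sub>C li else \<zero>\<^sub>Z)" for k
 have aZ: "a k \<in> carrier Z" for k
 proof (cases "k < p")
  case True
  have yc: "y [^] k \<in> carrier G" "y [^] (p - k) \<in> carrier G" using y by auto
  have "deg (H #> (y [^] k \<otimes> y [^] (p - k))) (w k \<star> t [^]\<^sub>C (p - k))"
   by (rule deg_mult_coset[OF yc _ t_deg_e]) (simp add: w_def restr_deg v)
  moreover have "y [^] k \<otimes> y [^] (p - k) = y [^] p" using G.nat_pow_mult[OF y(1), of k "p - k"] True by simp
  moreover have "H #> (y [^] p) = H" using coset_H_iff pow_p_in_H[OF y] by simp
  ultimately have "deg H (w k \<star> t [^]\<^sub>C (p - k))" by simp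
  moreover have "deg H li" using deg_H_iff Z_D(1)[OF li(1)] by simp
  ultimately have "deg H (w k \<star> t [^]\<^sub>C (p - k) \<star> li)" using deg_mult[of H _ H li] HQ(2) by metis
  then have d: "deg H (a k)" using True by (simp add: a_def)
  have "a k \<in> carrier C" using w t_pow_C ZC[OF li(1)] True CC.m_closed unfolding a_def by presburger
  then show ?thesis by (rule C_deg_H[OF _ d])
 qed (use ZF.zero_closed in \<open>simp add: a_def\<close>)
 have "v = (\<Oplus>\<^bsub>KG\<^esub>k\<in>{..<p}. w k)" unfolding w_def by (rule restr_sum[OF y C_KG[OF v]])
 also have "... = (\<Oplus>\<^sub>C k\<in>{..<p}. w k)" by (rule finsum_C[symmetric]) (auto intro: w)
 also have "... = (\<Oplus>\<^sub>C l\<in>{..<p}. id (a l) \<otimes>\<^sub>C t [^]\<^sub>C l)"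
 proof (rule CC.finsum_cong'[OF refl])
  show "(\<lambda>l. id (a l) \<otimes>\<^sub>C t [^]\<^sub>C l) \<in> {..<p} \<rightarrow> carrier C"
   using ZC[OF aZ] t_pow_C CC.m_closed by simp
  fix k assume "k \<in> {..<p}"
  then show "w k = id (a k) \<otimes>\<^sub>C t [^]\<^sub>C k"
   using cancel_pow(2)[OF w, of k] unfolding a_def by (simp del: block_simps)
 qed
 finally show ?thesis using aZ by blast
qed

text \<open>The summands have the distinct degrees H y^l, so each one vanishes separately, and t^k
  can be cancelled.\<close>

lemma independent:
 assumes a: "\<And>l. a l \<in> carrier Z" and z: "(\<Oplus>\<^sub>C l\<in>{..<p}. id (a l) \<otimes>\<^sub>C t [^]\<^sub>C l) = \<zero>\<^sub>C" and k: "k < p"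
 shows "a k = \<zero>\<^sub>Z"
proof -
 define f where "f l = a l \<otimes>\<^sub>C t [^]\<^sub>C l" for l :: nat
 have fC: "f l \<in> carrier C" for l unfolding f_def using ZC[OF a] t_pow_C CC.m_closed by blast
 have sum: "(\<Oplus>\<^bsub>KG\<^esub>l\<in>{..<p}. f l) = \<zero>\<^bsub>KG\<^esub>"
 proof -
  have "(\<Oplus>\<^sub>C l\<in>{..<p}. f l) = \<zero>\<^sub>C" using z unfolding f_def by (simp only: id_apply)
  then show ?thesis using finsum_C[of "{..<p}" f] fC by simp
 qed
 have df: "deg (H #> (y [^] l)) (f l)" for l
 proof -
  have "deg (H #> (\<one> \<otimes> y [^] l)) (f l)"
   unfolding f_def block_simps
   by (rule deg_mult_coset[OF _ _ _ t_deg_e]) (use y Z_D(1)[OF a] in \<open>simp_all add: deg_H_iff HQ\<close>)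
  then show ?thesis using y by simp
 qed
 have "f k = \<zero>\<^bsub>KG\<^esub>"
 proof (rule KG_eqI[OF C_KG[OF fC] A.zero_closed])
  fix g assume g: "g \<in> carrier G"
  show "f k g = \<zero>\<^bsub>KG\<^esub> g"
  proof (rule ccontr)
   assume n: "f k g \<noteq> \<zero>\<^bsub>KG\<^esub> g"
   have zg: "\<zero>\<^bsub>KG\<^esub> g = \<zero>\<^sub>K" by (simp add: group_algebra_simps)
   have ck: "H #> g = H #> (y [^] k)" using df[of k] g n zg by (auto simp: deg_def)
   have o: "f l g = \<zero>\<^sub>K" if "l < p" "l \<noteq> k" for l
   proof (rule ccontr)
    assume "f l g \<noteq> \<zero>\<^sub>K"
    then have "H #> (y [^] l) = H #> (y [^] k)" using df[of l] g ck by (auto simp: deg_def)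
    then show False using inj_onD[OF pow_coset_inj[OF y], of l k] that k by simp
   qed
   have fv: "f l g \<in> carrier K" for l by (rule KG_val[OF C_KG[OF fC]])
   have "(\<Oplus>\<^bsub>KG\<^esub>l\<in>{..<p}. f l) g = (\<Oplus>\<^sub>K l\<in>{..<p}. f l g)" by (rule KG_finsum) (auto intro: C_KG fC)
   also have "... = f k g"
    by (rule K.finsum_single) (use k o fv in auto)
   finally show False using n sum by simp
  qed
 qed
 then have "f k = \<zero>\<^sub>C" by (simp only: block_simps)
 then have "a k = \<zero>\<^sub>C \<otimes>\<^sub>C t [^]\<^sub>C (p - k) \<otimes>\<^sub>C li"
  using cancel_pow(1)[OF ZC[OF a] k] unfolding f_def by metis
 also have "... = \<zero>\<^sub>C" using CC.l_null t_pow_C ZC[OF li(1)] by presburger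
 finally show ?thesis by simp
qed

lemma add_pow_e: "add_pow Z (n::nat) e = add_pow K n \<one>\<^sub>K \<odot>\<^bsub>KG\<^esub> e"
proof (induction n)
 case 0
 then show ?case by (simp add: add_pow_def V.smult_l_null)
next
 case (Suc n)
 have "add_pow Z (Suc n) e = add_pow Z n e \<oplus>\<^bsub>KG\<^esub> e" by (simp add: add_pow_def nat_pow_def)
 also have "... = add_pow K n \<one>\<^sub>K \<odot>\<^bsub>KG\<^esub> e \<oplus>\<^bsub>KG\<^esub> \<one>\<^sub>K \<odot>\<^bsub>KG\<^esub> e" unfolding Suc by simp
 also have "... = (add_pow K n \<one>\<^sub>K \<oplus>\<^sub>K \<one>\<^sub>K) \<odot>\<^bsub>KG\<^esub> e"
  by (rule V.smult_l_distr[symmetric]) auto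
 also have "add_pow K n \<one>\<^sub>K \<oplus>\<^sub>K \<one>\<^sub>K = add_pow K (Suc n) \<one>\<^sub>K" by (simp add: add_pow_def nat_pow_def)
 finally show ?case .
qed

definition pK where "pK = inv\<^bsub>K\<^esub> (add_pow K p \<one>\<^sub>K)"

lemma pK: "pK \<in> carrier K" "pK \<otimes>\<^sub>K add_pow K p \<one>\<^sub>K = \<one>\<^sub>K"
proof -
 have "add_pow K p \<one>\<^sub>K \<in> Units K" using p_nz K.field_Units by simp
 then show "pK \<in> carrier K" "pK \<otimes>\<^sub>K add_pow K p \<one>\<^sub>K = \<one>\<^sub>K" unfolding pK_def by auto
qed

lemma pK_e: "(pK \<odot>\<^bsub>KG\<^esub> e) \<star> add_pow Z p e = e"
proof -
 have c: "add_pow K p \<one>\<^sub>K \<in> carrier K" by simp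
 have ec: "e \<in> carrier KG" by simp
 have "(pK \<odot>\<^bsub>KG\<^esub> e) \<star> (add_pow K p \<one>\<^sub>K \<odot>\<^bsub>KG\<^esub> e) = pK \<odot>\<^bsub>KG\<^esub> (add_pow K p \<one>\<^sub>K \<odot>\<^bsub>KG\<^esub> (e \<star> e))"
  unfolding smult_mult(1)[OF pK(1) ec V.smult_closed[OF c ec]] smult_mult(2)[OF c ec ec] ..
 also have "... = e" unfolding ee V.smult_assoc1[OF pK(1) c ec, symmetric] pK(2) by (rule V.smult_one[OF ec])
 finally show ?thesis unfolding add_pow_e .
qed

lemma smult_e_Z:
 assumes a: "a \<in> carrier K" shows "a \<odot>\<^bsub>KG\<^esub> e \<in> carrier Z"
proof (rule Z_I)
 have ec: "e \<in> carrier KG" by simp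
 show "(a \<odot>\<^bsub>KG\<^esub> e) \<star> e = a \<odot>\<^bsub>KG\<^esub> e" unfolding smult_mult(1)[OF a ec ec] ee ..
 show "a \<odot>\<^bsub>KG\<^esub> e \<in> ring_center KH"
  using B.ring_center_closed(3)[of e e a] central_KG_KH[OF e_central e_KH] a by simp
qed

lemma pinv_eq: "inv\<^bsub>Z\<^esub> (add_pow Z p \<one>\<^sub>Z) = pK \<odot>\<^bsub>KG\<^esub> e" and pZ_nz: "add_pow Z p \<one>\<^sub>Z \<noteq> \<zero>\<^sub>Z"
proof -
 have c: "add_pow Z p e \<in> carrier Z" using ZF.add.nat_pow_closed[OF ZF.one_closed] by simp
 have m: "add_pow Z p e \<otimes>\<^sub>Z (pK \<odot>\<^bsub>KG\<^esub> e) = \<one>\<^sub>Z"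
  using pK_e ZF.m_comm[OF c smult_e_Z[OF pK(1)]] Z_mult[OF Z_D(1)[OF smult_e_Z[OF pK(1)]] Z_D(1)[OF c]] by simp
 then show "inv\<^bsub>Z\<^esub> (add_pow Z p \<one>\<^sub>Z) = pK \<odot>\<^bsub>KG\<^esub> e"
  using ZF.comm_inv_char[OF c smult_e_Z[OF pK(1)]] by simp
 show "add_pow Z p \<one>\<^sub>Z \<noteq> \<zero>\<^sub>Z"
 proof
  assume "add_pow Z p \<one>\<^sub>Z = \<zero>\<^sub>Z"
  then have "add_pow Z p e = \<zero>\<^sub>Z" by simp
  then show False using m ZF.l_null[OF smult_e_Z[OF pK(1)]] ZF.zero_not_one by metis
 qed
qed

text \<open>\<open>mean\<close> divides by p in the base field, the Fourier formulas divide by p in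
  Z. The two agree because 1/p in Z is 1/p in the base field times e.\<close>

lemma mean_C:
 assumes a: "\<And>l. l < p ==> a l \<in> carrier C"
 shows "mean K KG p a = (\<Oplus>\<^sub>C l\<in>{..<p}. inv\<^bsub>Z\<^esub> (add_pow Z p \<one>\<^sub>Z) \<otimes>\<^sub>C a l)"
proof -
 have s: "(\<Oplus>\<^sub>C l\<in>{..<p}. a l) \<in> carrier C" using a by (intro CC.finsum_closed) auto
 have q: "pK \<odot>\<^bsub>KG\<^esub> e \<in> carrier C" by (rule ZC[OF smult_e_Z[OF pK(1)]])
 have "(\<Oplus>\<^sub>C l\<in>{..<p}. (pK \<odot>\<^bsub>KG\<^esub> e) \<otimes>\<^sub>C a l) = (pK \<odot>\<^bsub>KG\<^esub> e) \<otimes>\<^sub>C (\<Oplus>\<^sub>C l\<in>{..<p}. a l)"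
  by (rule CC.finsum_rdistr[symmetric, OF _ q]) (use a in auto)
 also have "... = pK \<odot>\<^bsub>KG\<^esub> (e \<star> (\<Oplus>\<^sub>C l\<in>{..<p}. a l))"
  using smult_mult(1)[OF pK(1) _ C_KG[OF s], of e] by simp
 also have "e \<star> (\<Oplus>\<^sub>C l\<in>{..<p}. a l) = (\<Oplus>\<^sub>C l\<in>{..<p}. a l)" by (rule BC.C_carrierD(4)[OF s])
 also have "... = (\<Oplus>\<^bsub>KG\<^esub>l\<in>{..<p}. a l)" by (rule finsum_C) (use a in auto)
 finally show ?thesis unfolding pinv_eq mean_def pK_def by simp
qed

lemma mean_times_e:
 assumes a: "\<And>l. l < p ==> a l \<in> carrier KG"
 shows "mean K KG p a \<star> e = mean K KG p (\<lambda>l. a l \<star> e)"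
proof -
 have s: "(\<Oplus>\<^bsub>KG\<^esub>l\<in>{..<p}. a l) \<in> carrier KG" using a by (intro A.finsum_closed) auto
 have "(\<Oplus>\<^bsub>KG\<^esub>l\<in>{..<p}. a l) \<star> e = (\<Oplus>\<^bsub>KG\<^esub>l\<in>{..<p}. a l \<star> e)"
  by (rule A.finsum_ldistr) (use a in auto)
 then show ?thesis unfolding mean_def using smult_mult(1)[OF pK(1) s, of e] by (simp add: pK_def)
qed

lemma pow_C:
 assumes "c \<in> carrier C"
 shows "c [^]\<^bsub>KG\<^esub> (l::nat) \<star> e = c [^]\<^sub>C l" "c [^]\<^bsub>block KG e\<^esub> l = c [^]\<^sub>C l"
 using BC.block_pow(1)[OF C_KG[OF assms] BC.C_carrierD(3)[OF assms], of l] BC.block_pow(2)[OF C_KG[OF assms], of l]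
 by (simp_all only:)

lemma radical:
 assumes L: "field L" "\<iota> \<in> ring_hom Z L" and c: "card {r \<in> carrier L. r [^]\<^sub>L p = \<iota> lam} = p"
 shows "radical_ext Z C id L \<iota> p t lam"
proof -
 interpret L: field L by (rule L(1))
 have "coeff_hom Z C id" "coeff_hom_field Z L \<iota>"
  using ZF.field_axioms CC.cring_axioms id_hom L L.is_cring
  by (simp_all add: coeff_hom_def coeff_hom_field_def coeff_hom_axioms_def)
 moreover have "radical_ext_axioms Z C id L \<iota> p t lam"
 proof (rule radical_ext_axioms.intro)
  show "lam \<noteq> \<zero>\<^sub>Z" using lam(2) by simp
  show "t [^]\<^sub>C p = id lam" unfolding id_apply by (rule tp)
 qed (rule p t(1) lam(1) generated independent c pZ_nz; assumption?)+
 ultimately show ?thesis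
  using ZF.field_axioms CC.cring_axioms L by (simp add: radical_ext_def)
qed

lemma partition_pci:
 assumes f: "finite T" and s: "(\<Oplus>\<^sub>C v\<in>T. v) = \<one>\<^sub>C"
  and T: "\<And>u. u \<in> T ==> u \<in> carrier C \<and> u \<otimes>\<^sub>C u = u \<and> u \<noteq> \<zero>\<^sub>C \<and>
    (\<forall>v\<in>carrier C. v \<otimes>\<^sub>C v = v \<and> v \<otimes>\<^sub>C u = v \<longrightarrow> v = \<zero>\<^sub>C \<or> v = u)"
 shows "pci_decomposition KG e T"
 unfolding pci_decomposition_def
proof (intro conjI ballI)
 show "finite T" by (rule f)
 show "(\<Oplus>\<^bsub>KG\<^esub>v\<in>T. v) = e" using s finsum_C[OF f, of "\<lambda>v. v"] T by simp
 fix u assume "u \<in> T"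
 then show "primitive_central_idempotent KG u" using T[of u] by (intro BC.primitive_in_C) auto
qed

text \<open>An algebraic closure of Z is brought in to supply the p roots that
  \<open>radical_ext\<close> asks for; the resulting absence of zero divisors concerns C
  alone.\<close>

lemma primitive_if_no_root:
 assumes "\<not> (\<exists>\<mu>\<in>carrier Z. \<mu> [^]\<^sub>Z p = lam)"
 shows "primitive_central_idempotent KG e"
proof -
 interpret CL: algebraic_closure ZF.alg_closure "ZF.indexed_const ` carrier Z" by (rule ZF.alg_closureE(1))
 have h: "ZF.indexed_const \<in> ring_hom Z ZF.alg_closure" by (rule ZF.alg_closureE(2))
 interpret HM: coeff_hom_field Z ZF.alg_closure ZF.indexed_const
  using ZF.field_axioms CL.field_axioms CL.is_cring h by (simp add: coeff_hom_def coeff_hom_field_def coeff_hom_axioms_def)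
 have "ZF.indexed_const (add_pow Z n \<one>\<^sub>Z) = add_pow ZF.alg_closure n \<one>\<^bsub>ZF.alg_closure\<^esub>" for n :: nat
  by (induction n) (use ZF.add.nat_pow_closed[OF ZF.one_closed, unfolded add_pow_def] in \<open>auto simp: add_pow_def simp del: block_simps\<close>)
 then have pn: "add_pow ZF.alg_closure p \<one>\<^bsub>ZF.alg_closure\<^esub> \<noteq> \<zero>\<^bsub>ZF.alg_closure\<^esub>"
  using HM.\<iota>_zero_iff[of "add_pow Z p \<one>\<^sub>Z"] pZ_nz ZF.add.nat_pow_closed[OF ZF.one_closed, of p] by metis
 have "ZF.indexed_const lam \<noteq> \<zero>\<^bsub>ZF.alg_closure\<^esub>" using HM.\<iota>_zero_iff[OF lam(1)] lam(2) by simp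
 then have "card {r \<in> carrier ZF.alg_closure. r [^]\<^bsub>ZF.alg_closure\<^esub> p = ZF.indexed_const lam} = p"
  using CL.card_pth_roots[OF p pn] HM.J.hom_closed[OF lam(1)] by blast
 then interpret radical_ext Z C id ZF.alg_closure ZF.indexed_const p t lam by (rule radical[OF CL.field_axioms h])
 show ?thesis
  by (rule primitive_if_no_zero_divisors) (use no_zero_divisors[OF assms] in simp)
qed

end

context graded_unit begin

lemma Z_pow: "z \<in> carrier Z ==> z [^]\<^sub>Z (n::nat) = z [^]\<^sub>C n"
proof (induction n)
 case (Suc n)
 have "z [^]\<^sub>Z n \<in> carrier Z" using Suc.prems by (rule ZF.nat_pow_closed)
 then have "z [^]\<^sub>Z n \<otimes>\<^sub>Z z = z [^]\<^sub>Z n \<star> z"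
  using Z_mult[OF Z_D(1) Z_D(1)] Suc.prems by blast
 then show ?case using Suc by (simp add: nat_pow_def)
qed (simp add: nat_pow_def)

lemma Z_mult_C: "[|u \<in> carrier Z; v \<in> carrier Z|] ==> u \<otimes>\<^sub>Z v = u \<otimes>\<^sub>C v"
 using Z_mult[OF Z_D(1) Z_D(1)] unfolding block_simps(5)[of KG] by blast

lemma add_pow_hom:
 assumes "\<iota> \<in> ring_hom Z L" "field L"
 shows "add_pow L p \<one>\<^sub>L \<noteq> \<zero>\<^sub>L"
proof -
 interpret L: field L by fact
 interpret HM: coeff_hom_field Z L \<iota>
  using ZF.field_axioms L.field_axioms L.is_cring assms(1) by (simp add: coeff_hom_def coeff_hom_field_def coeff_hom_axioms_def)
 have "\<iota> (add_pow Z n \<one>\<^sub>Z) = add_pow L n \<one>\<^sub>L" for n :: nat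
  by (induction n) (use ZF.add.nat_pow_closed[OF ZF.one_closed, unfolded add_pow_def] in \<open>auto simp: add_pow_def simp del: block_simps\<close>)
 then show ?thesis
  using HM.\<iota>_zero_iff[of "add_pow Z p \<one>\<^sub>Z"] pZ_nz ZF.add.nat_pow_closed[OF ZF.one_closed, of p] by metis
qed

end

section \<open>The cases (A), (B) and (C)\<close>

context inv_block begin

lemma class_sum_unit:
 assumes "fixed" "y \<in> carrier G - H" "lam \<in> carrier Z - {\<zero>\<^sub>Z}" "class_sum K G y [^]\<^bsub>KG\<^esub> p \<star> e = lam"
 shows "graded_unit G K H p e x y (class_sum K G y \<star> e) lam"
proof -
 have y: "y \<in> carrier G" "y \<notin> H" using assms(2) by auto
 have "(class_sum K G y \<star> e) [^]\<^sub>C p = lam"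
  using pow_times_e[OF class_sum_carrier[OF y(1)], of p] assms(4) by simp
 moreover have "deg (H #> y) (class_sum K G y \<star> e)"
  using deg_times_e[OF class_sum_deg[OF y(1)]] coset_in_Q y(1) by simp
 ultimately show ?thesis
  using assms(1,3) y class_sum_in_C[OF y(1)]
  by (intro graded_unit.intro graded_unit_axioms.intro inv_block_axioms) simp_all
qed

text \<open>The factor e is absorbed by the inverse of \<mu> in Z. Dividing by \<mu> keeps the
  degree Hy and turns the p-th power \<open>lam\<close> into e.\<close>

lemma normalized_unit:
 assumes "fixed" "y \<in> carrier G - H" "lam \<in> carrier Z - {\<zero>\<^sub>Z}" "class_sum K G y [^]\<^bsub>KG\<^esub> p \<star> e = lam"
  and \<mu>: "\<mu> \<in> carrier Z" "\<mu> [^]\<^sub>Z p = lam"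
 shows "class_sum K G y \<star> inv\<^bsub>Z\<^esub> \<mu> = (class_sum K G y \<star> e) \<otimes>\<^sub>C inv\<^bsub>Z\<^esub> \<mu>"
  and "\<mu> \<in> Units Z" "inv\<^bsub>Z\<^esub> \<mu> \<in> carrier Z"
  and "graded_unit G K H p e x y (class_sum K G y \<star> inv\<^bsub>Z\<^esub> \<mu>) e"
proof -
 define t where "t = class_sum K G y \<star> e"
 interpret GU: graded_unit G K H p e x y t lam unfolding t_def by (rule class_sum_unit[OF assms(1-4)])
 have cs: "class_sum K G y \<in> carrier KG" using class_sum_carrier assms(2) by simp
 have "\<mu> \<noteq> \<zero>\<^sub>Z"
 proof
  assume "\<mu> = \<zero>\<^sub>Z"
  then have "lam = \<zero>\<^sub>Z" using \<mu>(2) GU.ZF.nat_pow_zero[of p] p_pos by simp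
  then show False using assms(3) by simp
 qed
 then show U: "\<mu> \<in> Units Z" using \<mu>(1) GU.ZF.field_Units by simp
 then show i: "inv\<^bsub>Z\<^esub> \<mu> \<in> carrier Z" by (rule GU.ZF.Units_inv_closed)
 have "class_sum K G y \<star> inv\<^bsub>Z\<^esub> \<mu> = class_sum K G y \<star> (e \<star> inv\<^bsub>Z\<^esub> \<mu>)"
  unfolding Z_D(5)[OF i] ..
 also have "... = class_sum K G y \<star> e \<star> inv\<^bsub>Z\<^esub> \<mu>"
  by (rule A.m_assoc[symmetric]) (use cs Z_D(2)[OF i] in auto)
 finally show eq: "class_sum K G y \<star> inv\<^bsub>Z\<^esub> \<mu> = (class_sum K G y \<star> e) \<otimes>\<^sub>C inv\<^bsub>Z\<^esub> \<mu>"
  unfolding block_simps .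
 define c where "c = t \<otimes>\<^sub>C inv\<^bsub>Z\<^esub> \<mu>"
 have cC: "c \<in> carrier C" unfolding c_def by (rule GU.CC.m_closed[OF GU.t(1) GU.ZC[OF i]])
 have "deg H (inv\<^bsub>Z\<^esub> \<mu>)" using deg_H_iff Z_D(1)[OF i] by simp
 then have dc: "deg (H #> y) c"
  using deg_mult[OF GU.t(2), of H "inv\<^bsub>Z\<^esub> \<mu>"] Q.r_one[of "H #> y"] coset_in_Q GU.y(1) by (simp add: c_def)
 have "c [^]\<^sub>C p = t [^]\<^sub>C p \<otimes>\<^sub>C inv\<^bsub>Z\<^esub> \<mu> [^]\<^sub>C p"
  unfolding c_def by (rule GU.CC.nat_pow_distrib[OF GU.t(1) GU.ZC[OF i]])
 also have "... = \<mu> [^]\<^sub>C p \<otimes>\<^sub>C inv\<^bsub>Z\<^esub> \<mu> [^]\<^sub>C p"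
  unfolding GU.tp \<mu>(2)[symmetric] GU.Z_pow[OF \<mu>(1)] ..
 also have "... = (\<mu> \<otimes>\<^sub>C inv\<^bsub>Z\<^esub> \<mu>) [^]\<^sub>C p"
  by (rule GU.CC.nat_pow_distrib[symmetric, OF GU.ZC[OF \<mu>(1)] GU.ZC[OF i]])
 also have "\<mu> \<otimes>\<^sub>C inv\<^bsub>Z\<^esub> \<mu> = \<mu> \<otimes>\<^sub>Z inv\<^bsub>Z\<^esub> \<mu>" by (rule GU.Z_mult_C[symmetric, OF \<mu>(1) i])
 also have "... = \<one>\<^sub>C" using GU.ZF.Units_r_inv[OF U] by simp
 also have "\<one>\<^sub>C [^]\<^sub>C p = e" using GU.CC.nat_pow_one[of p] by (simp only: block_simps)
 finally have cp: "c [^]\<^sub>C p = e" .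
 have "graded_unit G K H p e x y c e"
  using assms(1) GU.y cC dc cp GU.ZF.one_closed e_nz
  by (intro graded_unit.intro graded_unit_axioms.intro inv_block_axioms) simp_all
 then show "graded_unit G K H p e x y (class_sum K G y \<star> inv\<^bsub>Z\<^esub> \<mu>) e"
  unfolding eq c_def t_def .
qed

lemma no_root_case:
 assumes "fixed" "y \<in> carrier G - H" "lam \<in> carrier Z - {\<zero>\<^sub>Z}" "class_sum K G y [^]\<^bsub>KG\<^esub> p \<star> e = lam"
  and "\<not> (\<exists>\<mu>\<in>carrier Z. \<mu> [^]\<^sub>Z p = lam)"
 shows "primitive_central_idempotent KG e"
 by (rule graded_unit.primitive_if_no_root[OF class_sum_unit[OF assms(1-4)] assms(5)])

text \<open>The idempotents are stated in powers of the elements t / \<mu>, while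
  \<open>kummer_idem\<close> is a polynomial in t itself. The factors \<mu>^-l of the former are the
  Fourier coefficients of the latter.\<close>

lemma kummer_case:
 assumes a: "fixed" "y \<in> carrier G - H" "lam \<in> carrier Z - {\<zero>\<^sub>Z}" "class_sum K G y [^]\<^bsub>KG\<^esub> p \<star> e = lam"
  and roots: "\<mu>0 \<in> carrier Z" "\<nu>0 \<in> carrier Z" "\<mu>0 \<noteq> \<nu>0" "\<mu>0 [^]\<^sub>Z p = lam" "\<nu>0 [^]\<^sub>Z p = lam"
 defines "M \<equiv> {\<mu> \<in> carrier Z. \<mu> [^]\<^sub>Z p = lam}"
  and "c \<equiv> \<lambda>\<mu>. class_sum K G y \<star> inv\<^bsub>Z\<^esub> \<mu>"
 defines "E \<equiv> \<lambda>\<mu>. mean K KG p (\<lambda>l. c \<mu> [^]\<^bsub>KG\<^esub> l) \<star> e"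
 shows "card M = p \<and> (\<forall>\<mu>\<in>M. E \<mu> = mean K KG p (\<lambda>l. c \<mu> [^]\<^bsub>block KG e\<^esub> l)) \<and>
  card (E ` M) = p \<and> pci_decomposition KG e (E ` M)"
proof -
 define t where "t = class_sum K G y \<star> e"
 interpret GU: graded_unit G K H p e x y t lam unfolding t_def by (rule class_sum_unit[OF a])
 note unit = normalized_unit[OF a]
 \<comment> \<open>The quotient of two different roots is a nontrivial p-th root of unity in Z. All
   p roots of \<open>lam\<close> then lie in Z, and Z serves as its own L.\<close>
 define \<zeta> where "\<zeta> = \<nu>0 \<otimes>\<^sub>Z inv\<^bsub>Z\<^esub> \<mu>0"
 note U = unit(2)[OF roots(1,4)] and i = unit(3)[OF roots(1,4)]
 have z: "\<zeta> \<in> carrier Z" unfolding \<zeta>_def by (rule GU.ZF.m_closed[OF roots(2) i])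
 have z1: "\<zeta> \<noteq> \<one>\<^sub>Z"
 proof
  assume "\<zeta> = \<one>\<^sub>Z"
  then have "\<zeta> \<otimes>\<^sub>Z \<mu>0 = \<mu>0" using GU.ZF.l_one[OF roots(1)] by metis
  then have "\<nu>0 = \<mu>0" unfolding \<zeta>_def using GU.ZF.m_assoc[OF roots(2) i roots(1)] GU.ZF.Units_l_inv[OF U] GU.ZF.r_one[OF roots(2)] by metis
  then show False using roots(3) by simp
 qed
 have zp: "\<zeta> [^]\<^sub>Z p = \<one>\<^sub>Z"
 proof -
  have "\<zeta> [^]\<^sub>Z p = \<mu>0 [^]\<^sub>Z p \<otimes>\<^sub>Z inv\<^bsub>Z\<^esub> \<mu>0 [^]\<^sub>Z p"
   unfolding \<zeta>_def GU.ZF.nat_pow_distrib[OF roots(2) i] roots(4,5) ..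
  also have "... = (\<mu>0 \<otimes>\<^sub>Z inv\<^bsub>Z\<^esub> \<mu>0) [^]\<^sub>Z p" by (rule GU.ZF.nat_pow_distrib[OF roots(1) i, symmetric])
  also have "... = \<one>\<^sub>Z" unfolding GU.ZF.Units_r_inv[OF U] by (rule GU.ZF.nat_pow_one)
  finally show ?thesis .
 qed
 have m0: "\<mu>0 \<noteq> \<zero>\<^sub>Z" using U unfolding GU.ZF.field_Units by blast
 have card: "card {r \<in> carrier Z. r [^]\<^sub>Z p = id lam} = p"
  using GU.ZF.pth_root_powers(3)[OF p z z1 zp roots(1) m0] unfolding roots(4) id_apply .
 have idZ: "id \<in> ring_hom Z Z" by (rule ring_hom_memI) simp_all
 interpret RE: radical_ext Z C id Z id p t lam by (rule GU.radical[OF Z_field idZ card])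
 have sub: "{r \<in> carrier Z. r [^]\<^sub>Z p = id lam} \<subseteq> id ` carrier Z" unfolding image_id id_apply by blast
 note part = RE.kummer_partition[OF sub, folded M_def]
 have pow: "c \<mu> [^]\<^sub>C l = inv\<^bsub>Z\<^esub> (\<mu> [^]\<^sub>Z l) \<otimes>\<^sub>C t [^]\<^sub>C l" and cC: "c \<mu> \<in> carrier C"
  and iZ: "inv\<^bsub>Z\<^esub> (\<mu> [^]\<^sub>Z l) \<in> carrier Z" if "\<mu> \<in> M" for \<mu> and l :: nat
 proof -
  have \<mu>: "\<mu> \<in> carrier Z" "\<mu> [^]\<^sub>Z p = lam" using that by (auto simp: M_def)
  note U = unit(2)[OF \<mu>] and i = unit(3)[OF \<mu>]
  have ct: "c \<mu> = t \<otimes>\<^sub>C inv\<^bsub>Z\<^esub> \<mu>" unfolding c_def t_def by (rule unit(1)[OF \<mu>])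
  show "c \<mu> \<in> carrier C" unfolding ct by (rule GU.CC.m_closed[OF GU.t(1) GU.ZC[OF i]])
  have il: "inv\<^bsub>Z\<^esub> \<mu> [^]\<^sub>Z l \<in> carrier Z" by (rule GU.ZF.nat_pow_closed[OF i])
  have "\<mu> [^]\<^sub>Z l \<otimes>\<^sub>Z inv\<^bsub>Z\<^esub> \<mu> [^]\<^sub>Z l = (\<mu> \<otimes>\<^sub>Z inv\<^bsub>Z\<^esub> \<mu>) [^]\<^sub>Z l"
   by (rule GU.ZF.nat_pow_distrib[OF \<mu>(1) i, symmetric])
  also have "... = \<one>\<^sub>Z" unfolding GU.ZF.Units_r_inv[OF U] by (rule GU.ZF.nat_pow_one)
  finally have inv: "inv\<^bsub>Z\<^esub> (\<mu> [^]\<^sub>Z l) = inv\<^bsub>Z\<^esub> \<mu> [^]\<^sub>Z l"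
   by (rule GU.ZF.comm_inv_char[OF GU.ZF.nat_pow_closed[OF \<mu>(1)] il])
  show "inv\<^bsub>Z\<^esub> (\<mu> [^]\<^sub>Z l) \<in> carrier Z" unfolding inv by (rule il)
  have "c \<mu> [^]\<^sub>C l = t [^]\<^sub>C l \<otimes>\<^sub>C inv\<^bsub>Z\<^esub> \<mu> [^]\<^sub>C l"
   unfolding ct by (rule GU.CC.nat_pow_distrib[OF GU.t(1) GU.ZC[OF i]])
  also have "... = inv\<^bsub>Z\<^esub> (\<mu> [^]\<^sub>Z l) \<otimes>\<^sub>C t [^]\<^sub>C l"
   unfolding inv GU.Z_pow[OF i] by (rule GU.CC.m_comm[OF GU.t_pow_C GU.CC.nat_pow_closed[OF GU.ZC[OF i]]])
  finally show "c \<mu> [^]\<^sub>C l = inv\<^bsub>Z\<^esub> (\<mu> [^]\<^sub>Z l) \<otimes>\<^sub>C t [^]\<^sub>C l" .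
 qed
 have E1: "E \<mu> = mean K KG p (\<lambda>l. c \<mu> [^]\<^bsub>block KG e\<^esub> l)" if "\<mu> \<in> M" for \<mu>
  unfolding E_def using GU.mean_times_e[of "\<lambda>l. c \<mu> [^]\<^bsub>KG\<^esub> l"] GU.pow_C[OF cC[OF that]] GU.C_KG[OF cC[OF that]]
  by (simp only: A.nat_pow_closed simp_thms)
 have E2: "E \<mu> = RE.kummer_idem \<mu>" if \<mu>: "\<mu> \<in> M" for \<mu>
 proof -
  have "E \<mu> = mean K KG p (\<lambda>l. c \<mu> [^]\<^sub>C l)" unfolding E1[OF \<mu>] GU.pow_C(2)[OF cC[OF \<mu>]] ..
  also have "... = (\<Oplus>\<^sub>C l\<in>{..<p}. RE.pinv \<otimes>\<^sub>C c \<mu> [^]\<^sub>C l)"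
   by (rule GU.mean_C) (rule GU.CC.nat_pow_closed[OF cC[OF \<mu>]])
  also have "... = RE.kummer_idem \<mu>"
   unfolding RE.kummer_idem_def
  proof (rule GU.CC.finsum_cong'[OF refl])
   note ic = GU.ZC[OF iZ[OF \<mu>]] and pc = GU.ZC[OF RE.pinv(1)]
   fix l :: nat
   have e: "id (RE.pinv \<otimes>\<^sub>Z inv\<^bsub>Z\<^esub> (\<mu> [^]\<^sub>Z l)) = RE.pinv \<otimes>\<^sub>C inv\<^bsub>Z\<^esub> (\<mu> [^]\<^sub>Z l)" for l :: nat
    unfolding id_apply by (rule GU.Z_mult_C[OF RE.pinv(1) iZ[OF \<mu>]])
   show "RE.pinv \<otimes>\<^sub>C c \<mu> [^]\<^sub>C l = id (RE.pinv \<otimes>\<^sub>Z inv\<^bsub>Z\<^esub> (\<mu> [^]\<^sub>Z l)) \<otimes>\<^sub>C t [^]\<^sub>C l"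
    unfolding e pow[OF \<mu>] by (rule GU.CC.m_assoc[symmetric, OF pc ic GU.t_pow_C])
   show "(\<lambda>l. id (RE.pinv \<otimes>\<^sub>Z inv\<^bsub>Z\<^esub> (\<mu> [^]\<^sub>Z l)) \<otimes>\<^sub>C t [^]\<^sub>C l) \<in> {..<p} \<rightarrow> carrier C"
    unfolding e using GU.CC.m_closed[OF GU.CC.m_closed[OF pc ic] GU.t_pow_C] by blast
  qed
  finally show ?thesis .
 qed
 have im: "E ` M = RE.kummer_idem ` M" by (rule image_cong[OF refl E2])
 have "card M > 0" using part(1) p_pos by simp
 then have "finite M" by (rule card_ge_0_finite)
 then have "pci_decomposition KG e (RE.kummer_idem ` M)"
  by (intro GU.partition_pci[OF _ part(3) part(4)]) auto
 then show ?thesis unfolding im using part(1,2) E1 by blast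
qed

text \<open>The normalized c takes the place of t and e that of \<open>lam\<close>, so the p roots
  required in L are the p-th roots of unity.\<close>

lemma cyclotomic_case:
 fixes L :: "('l, 's) ring_scheme"
 assumes a: "fixed" "y \<in> carrier G - H" "lam \<in> carrier Z - {\<zero>\<^sub>Z}" "class_sum K G y [^]\<^bsub>KG\<^esub> p \<star> e = lam"
  and \<mu>: "\<mu> \<in> carrier Z" "\<mu> [^]\<^sub>Z p = lam"
  and fs: "monic_irreducible_factorization Z (cyclotomic_prime Z p) fs"
  and L: "\<iota> \<in> ring_hom Z L" "algebraic_closure L (\<iota> ` carrier Z)"
 defines "c \<equiv> class_sum K G y \<star> inv\<^bsub>Z\<^esub> \<mu>"
 defines "E1 \<equiv> mean K KG p (\<lambda>l. c [^]\<^bsub>KG\<^esub> l) \<star> e"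
  and "E \<equiv> \<lambda>f. mean K KG p (\<lambda>l. inv_into (carrier Z) \<iota> (inv_power_sum \<iota> L f l) \<star> c [^]\<^bsub>block KG e\<^esub> l)"
 shows "(\<exists>d. \<forall>f\<in>set fs. degree f = d \<and> card (roots_in \<iota> L f) = d) \<and>
  (\<forall>f\<in>set fs. \<forall>l<p. inv_power_sum \<iota> L f l \<in> \<iota> ` carrier Z) \<and>
  E1 = mean K KG p (\<lambda>l. c [^]\<^bsub>block KG e\<^esub> l) \<and>
  card (insert E1 (E ` set fs)) = 1 + length fs \<and>
  pci_decomposition KG e (insert E1 (E ` set fs))"
proof -
 interpret GU: graded_unit G K H p e x y c e unfolding c_def by (rule normalized_unit(4)[OF a \<mu>])
 interpret CL: algebraic_closure L "\<iota> ` carrier Z" by (rule L(2))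
 interpret HM: coeff_hom_field Z L \<iota>
  using GU.ZF.field_axioms CL.field_axioms CL.is_cring L(1) by (simp add: coeff_hom_def coeff_hom_field_def coeff_hom_axioms_def)
 have ie: "\<iota> e = \<one>\<^sub>L" using HM.J.hom_one by simp
 have "card {r \<in> carrier L. r [^]\<^sub>L p = \<iota> e} = p"
  unfolding ie by (rule CL.card_pth_roots[OF p GU.add_pow_hom[OF L(1) CL.field_axioms]]) simp_all
 then interpret radical_ext Z C id L \<iota> p c e by (rule GU.radical[OF CL.field_axioms L(1)])
 interpret CE: cyclotomic_ext Z C id L \<iota> p c e fs by unfold_locales (simp_all add: fs)
 have E1: "E1 = mean K KG p (\<lambda>l. c [^]\<^bsub>block KG e\<^esub> l)"
  unfolding E1_def using GU.mean_times_e[of "\<lambda>l. c [^]\<^bsub>KG\<^esub> l"] GU.pow_C[OF GU.t(1)] GU.C_KG[OF GU.t(1)]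
  by (simp only: A.nat_pow_closed simp_thms)
 also have "... = mean K KG p (\<lambda>l. c [^]\<^sub>C l)" unfolding GU.pow_C(2)[OF GU.t(1)] ..
 also have "... = CE.trivial_idem"
  unfolding CE.trivial_idem_def id_apply by (rule GU.mean_C) (rule GU.t_pow_C)
 finally have e1: "E1 = CE.trivial_idem" .
 have e2: "E f = CE.factor_idem f" if f: "f \<in> set fs" for f
 proof -
  define z where "z l = inv_into (carrier Z) \<iota> (inv_power_sum \<iota> L f l)" for l
  have z: "z l \<in> carrier Z" if "l < p" for l unfolding z_def by (rule inv_into_into[OF CE.inv_power_sum_in[OF f that]])
  note pc = GU.ZC[OF pinv(1)]
  have zc: "z l \<otimes>\<^sub>C c [^]\<^sub>C l \<in> carrier C" if "l < p" for l by (rule GU.CC.m_closed[OF GU.ZC[OF z[OF that]] GU.t_pow_C])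
  have "E f = mean K KG p (\<lambda>l. z l \<otimes>\<^sub>C c [^]\<^sub>C l)"
   unfolding E_def GU.pow_C(2)[OF GU.t(1)] z_def block_simps ..
  also have "... = (\<Oplus>\<^sub>C l\<in>{..<p}. pinv \<otimes>\<^sub>C (z l \<otimes>\<^sub>C c [^]\<^sub>C l))"
   by (rule GU.mean_C) (rule zc)
  also have "... = (\<Oplus>\<^sub>C l\<in>{..<p}. id (pinv \<otimes>\<^sub>Z z l) \<otimes>\<^sub>C c [^]\<^sub>C l)"
  proof (rule GU.CC.finsum_cong'[OF refl])
   have e: "id (pinv \<otimes>\<^sub>Z z l) \<otimes>\<^sub>C c [^]\<^sub>C l = pinv \<otimes>\<^sub>C (z l \<otimes>\<^sub>C c [^]\<^sub>C l)" if l: "l < p" for l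
    unfolding id_apply GU.Z_mult_C[OF pinv(1) z[OF l]] by (rule GU.CC.m_assoc[OF pc GU.ZC[OF z[OF l]] GU.t_pow_C])
   fix l assume "l \<in> {..<p}"
   then have l: "l < p" by simp
   show "pinv \<otimes>\<^sub>C (z l \<otimes>\<^sub>C c [^]\<^sub>C l) = id (pinv \<otimes>\<^sub>Z z l) \<otimes>\<^sub>C c [^]\<^sub>C l" by (rule e[OF l, symmetric])
  next
   show "(\<lambda>l. id (pinv \<otimes>\<^sub>Z z l) \<otimes>\<^sub>C c [^]\<^sub>C l) \<in> {..<p} \<rightarrow> carrier C"
   proof (rule Pi_I)
    fix l assume "l \<in> {..<p}"
    then have l: "l < p" by simp
    show "id (pinv \<otimes>\<^sub>Z z l) \<otimes>\<^sub>C c [^]\<^sub>C l \<in> carrier C"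
     unfolding id_apply by (rule GU.CC.m_closed[OF GU.ZC[OF GU.ZF.m_closed[OF pinv(1) z[OF l]]] GU.t_pow_C])
   qed
  qed
  finally show ?thesis unfolding CE.factor_idem_def z_def .
 qed
 have im: "E ` set fs = CE.factor_idem ` set fs" by (rule image_cong[OF refl e2])
 have "pci_decomposition KG e (insert CE.trivial_idem (CE.factor_idem ` set fs))"
  by (rule GU.partition_pci[OF _ CE.cyclotomic_partition(2) CE.cyclotomic_partition(3)]) auto
 then show ?thesis
  unfolding im e1 using CE.common_degree CE.inv_power_sum_in CE.cyclotomic_partition(1) E1[unfolded e1] by blast
qed

end

section \<open>Conjugate representations and centrality of e in F[G]\<close>

lemma (in field) gel_nonzero: "gel R i \<noteq> \<zero>\<^bsub>fun_space R I\<^esub>"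
proof
 assume "gel R i = \<zero>\<^bsub>fun_space R I\<^esub>"
 then have "gel R i i = \<zero>\<^bsub>fun_space R I\<^esub> i" by (rule fun_cong)
 then show False by (simp add: gel_def)
qed

context normal_sub
begin

lemma inv_cancel: "[|g \<in> carrier G; k \<in> carrier G|] ==> inv g \<otimes> (g \<otimes> k) = k"
 by (simp add: G.m_assoc[symmetric])

lemma conj_bij: "g \<in> carrier G ==> bij_betw (\<lambda>k. g \<otimes> k \<otimes> inv g) H H"
proof (rule bij_betw_byWitness[where f' = "\<lambda>k. inv g \<otimes> k \<otimes> g"])
 assume g: "g \<in> carrier G"
 show "\<forall>a\<in>H. inv g \<otimes> (g \<otimes> a \<otimes> inv g) \<otimes> g = a" using g by (simp add: G.m_assoc inv_cancel)
 show "\<forall>a\<in>H. g \<otimes> (inv g \<otimes> a \<otimes> g) \<otimes> inv g = a"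
  using g by (metis G.inv_closed G.inv_solve_right G.m_assoc G.m_closed G.r_inv G.l_one H_in)
 show "(\<lambda>k. g \<otimes> k \<otimes> inv g) ` H \<subseteq> H" using conj_H g by blast
 show "(\<lambda>k. inv g \<otimes> k \<otimes> g) ` H \<subseteq> H" using conj_H[of "inv g"] g by auto
qed

lemma conj_rep_representation:
 assumes g: "g \<in> carrier G" and r: "representation HG K I \<rho>"
 shows "representation HG K I (conj_rep G g \<rho>)"
proof -
 have m: "g \<otimes> (h \<otimes> k) \<otimes> inv g = (g \<otimes> h \<otimes> inv g) \<otimes> (g \<otimes> k \<otimes> inv g)" if "h \<in> H" "k \<in> H" for h k
  using g that by (metis G.inv_closed G.inv_solve_left G.m_assoc G.m_closed G.l_inv G.l_one H_in)
 have "g \<otimes> \<one> \<otimes> inv g = \<one>" using g by simp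
 then show ?thesis using r conj_H[OF g] m unfolding representation_def conj_rep_def by simp
qed

text \<open>Substituting h -> g h g^-1 in the sum moves the conjugation from the representation to
  the element of the group algebra.\<close>

lemma rep_ext_conj:
 assumes g: "g \<in> carrier G" and r: "representation HG K I \<rho>" and a: "a \<in> carrier KH" and v: "v \<in> carrier (fun_space K I)"
 shows "rep_ext HG K I (conj_rep G g \<rho>) a v = rep_ext HG K I \<rho> (conj_by g a) v"
proof -
 interpret R: action HG K "fun_space K I" "\<lambda>g. mat_vec K I (\<rho> g)" by (rule B.rep_action[OF r])
 let ?V = "fun_space K I"
 have c: "conj_by g a h \<odot>\<^bsub>?V\<^esub> mat_vec K I (\<rho> h) v \<in> carrier ?V" if "h \<in> H" for h
  using R.V.smult_closed[OF B.KG_val[OF conj_by_KH[OF g a]] R.actD(4)[OF _ v]] that by simp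
 have "rep_ext HG K I \<rho> (conj_by g a) v = (\<Oplus>\<^bsub>?V\<^esub>h\<in>H. conj_by g a h \<odot>\<^bsub>?V\<^esub> mat_vec K I (\<rho> h) v)"
  unfolding ext_act_def by simp
 also have "... = (\<Oplus>\<^bsub>?V\<^esub>k\<in>H. conj_by g a (g \<otimes> k \<otimes> inv g) \<odot>\<^bsub>?V\<^esub> mat_vec K I (\<rho> (g \<otimes> k \<otimes> inv g)) v)"
  by (rule R.V.M.finsum_bij[OF conj_bij[OF g] c, symmetric])
 also have "... = (\<Oplus>\<^bsub>?V\<^esub>k\<in>H. a k \<odot>\<^bsub>?V\<^esub> mat_vec K I (conj_rep G g \<rho> k) v)"
 proof (rule R.V.M.finsum_cong'[OF refl])
  have e: "conj_by g a (g \<otimes> k \<otimes> inv g) = a k" if k: "k \<in> H" for k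
  proof -
   have "inv g \<otimes> (g \<otimes> k \<otimes> inv g) \<otimes> g = k" using g k by (simp add: G.m_assoc inv_cancel)
   then show ?thesis using conj_by_val[OF g KH_KG[OF a], of "g \<otimes> k \<otimes> inv g"] g k by simp
  qed
  fix k assume k: "k \<in> H"
  show "conj_by g a (g \<otimes> k \<otimes> inv g) \<odot>\<^bsub>?V\<^esub> mat_vec K I (\<rho> (g \<otimes> k \<otimes> inv g)) v = a k \<odot>\<^bsub>?V\<^esub> mat_vec K I (conj_rep G g \<rho> k) v"
   unfolding e[OF k] conj_rep_def ..
 next
  show "(\<lambda>k. a k \<odot>\<^bsub>?V\<^esub> mat_vec K I (conj_rep G g \<rho> k) v) \<in> H \<rightarrow> carrier ?V"
  proof (rule Pi_I)
   fix k assume k: "k \<in> H"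
   show "a k \<odot>\<^bsub>?V\<^esub> mat_vec K I (conj_rep G g \<rho> k) v \<in> carrier ?V"
    unfolding conj_rep_def using R.V.smult_closed[OF B.KG_val[OF a] R.actD(4)[OF _ v]] conj_H[OF g k] by simp
  qed
 qed
 finally show ?thesis unfolding ext_act_def by simp
qed

text \<open>The conjugate representation has the same operators, hence the same invariant
  subspaces.\<close>

lemma conj_irreducible:
 assumes g: "g \<in> carrier G" and r: "irreducible_representation HG K I \<rho>"
 shows "irreducible_representation HG K I (conj_rep G g \<rho>)"
 unfolding irreducible_representation_def
proof (intro conjI allI impI)
 note r' = irreducible_repD[OF r]
 show "representation HG K I (conj_rep G g \<rho>)" by (rule conj_rep_representation[OF g r'(1)])
 show "I \<noteq> {}" by (rule r'(2))
 fix W assume W: "submodule W K (fun_space K I) \<and> (\<forall>h\<in>carrier HG. \<forall>w\<in>W. mat_vec K I (conj_rep G g \<rho> h) w \<in> W)"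
 have "mat_vec K I (\<rho> h) w \<in> W" if h: "h \<in> H" and w: "w \<in> W" for h w
 proof -
  have "h \<in> (\<lambda>k. g \<otimes> k \<otimes> inv g) ` H" using conj_bij[OF g] h by (simp add: bij_betw_def)
  then obtain k where "k \<in> H" "h = g \<otimes> k \<otimes> inv g" by blast
  then show ?thesis using W w unfolding conj_rep_def by simp
 qed
 then show "W = {\<zero>\<^bsub>fun_space K I\<^esub>} \<or> W = carrier (fun_space K I)"
  using r W unfolding irreducible_representation_def by simp
qed

lemma conj_by_inv:
 assumes "g \<in> carrier G" "v \<in> carrier KG" shows "conj_by g (conj_by (inv g) v) = v"
proof (rule KG_eqI)
 show "conj_by g (conj_by (inv g) v) \<in> carrier KG" "v \<in> carrier KG" using assms by simp_all
 fix k assume k: "k \<in> carrier G"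
 have "g \<otimes> (inv g \<otimes> k \<otimes> g) \<otimes> inv g = k"
  using assms k by (metis G.inv_closed G.inv_solve_right G.m_assoc G.m_closed G.r_inv G.l_one)
 then show "conj_by g (conj_by (inv g) v) k = v k" using assms k by (simp add: conj_by_val)
qed

lemma conj_by_cong_rep:
 assumes g: "g \<in> carrier G" and r: "representation HG K I \<rho>"
  and eq: "rep_equiv HG K I (conj_rep G g \<rho>) I \<rho>" and a: "a \<in> carrier KH"
 obtains T S where "lin K (fun_space K I) (fun_space K I) T" "lin K (fun_space K I) (fun_space K I) S"
  "\<And>v. v \<in> carrier (fun_space K I) ==> S (T v) = v" "\<And>w. w \<in> carrier (fun_space K I) ==> T (S w) = w"
  "\<And>v. v \<in> carrier (fun_space K I) ==> T (rep_ext HG K I \<rho> (conj_by g a) v) = rep_ext HG K I \<rho> a (T v)"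
proof -
 have c: "cring K" "monoid HG" using K.is_cring B.G.is_monoid by simp_all
 note cr = conj_rep_representation[OF g r]
 obtain T S where TS: "lin K (fun_space K I) (fun_space K I) T" "lin K (fun_space K I) (fun_space K I) S"
  "\<And>v. v \<in> carrier (fun_space K I) ==> S (T v) = v" "\<And>w. w \<in> carrier (fun_space K I) ==> T (S w) = w"
  "\<And>h v. [|h \<in> carrier HG; v \<in> carrier (fun_space K I)|] ==> T (mat_vec K I (conj_rep G g \<rho> h) v) = mat_vec K I (\<rho> h) (T v)"
  by (rule rep_equivD[OF c cr r eq]) blast
 have "T (rep_ext HG K I \<rho> (conj_by g a) v) = rep_ext HG K I \<rho> a (T v)" if v: "v \<in> carrier (fun_space K I)" for v
  using B.rep_ext_equivariant[OF cr r TS(1) TS(5) a v] unfolding rep_ext_conj[OF g r a v] .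
 then show ?thesis using that[OF TS(1-4)] by blast
qed

lemma conj_by_identity:
 assumes g: "g \<in> carrier G" and r: "representation HG K I \<rho>"
  and eq: "rep_equiv HG K I (conj_rep G g \<rho>) I \<rho>" and a: "a \<in> carrier KH"
  and one: "\<And>v. v \<in> carrier (fun_space K I) ==> rep_ext HG K I \<rho> a v = v"
  and w: "w \<in> carrier (fun_space K I)"
 shows "rep_ext HG K I \<rho> (conj_by g a) w = w" "rep_ext HG K I \<rho> (conj_by (inv g) a) w = w"
proof -
 interpret R: action HG K "fun_space K I" "\<lambda>g. mat_vec K I (\<rho> g)" by (rule B.rep_action[OF r])
 show "rep_ext HG K I \<rho> (conj_by g a) w = w"
 proof (rule conj_by_cong_rep[OF g r eq a])
  fix T S assume T: "lin K (fun_space K I) (fun_space K I) T"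
   and ST: "\<And>v. v \<in> carrier (fun_space K I) ==> S (T v) = v"
   and e: "\<And>v. v \<in> carrier (fun_space K I) ==> T (rep_ext HG K I \<rho> (conj_by g a) v) = rep_ext HG K I \<rho> a (T v)"
  have "T (rep_ext HG K I \<rho> (conj_by g a) w) = T w" using e[OF w] one[OF linD(1)[OF T w]] by simp
  then have "S (T (rep_ext HG K I \<rho> (conj_by g a) w)) = S (T w)" by simp
  then show ?thesis using ST[OF w] ST[OF R.Ext_closed[OF conj_by_KH[OF g a] w]] by simp
 qed
 have ia: "conj_by (inv g) a \<in> carrier KH" using conj_by_KH[of "inv g"] g a by simp
 show "rep_ext HG K I \<rho> (conj_by (inv g) a) w = w"
 proof (rule conj_by_cong_rep[OF g r eq ia])
  fix T S assume S: "lin K (fun_space K I) (fun_space K I) S"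
   and TS: "\<And>v. v \<in> carrier (fun_space K I) ==> T (S v) = v"
   and e: "\<And>v. v \<in> carrier (fun_space K I) ==>
    T (rep_ext HG K I \<rho> (conj_by g (conj_by (inv g) a)) v) = rep_ext HG K I \<rho> (conj_by (inv g) a) (T v)"
  note Sw = linD(1)[OF S w]
  show ?thesis using e[OF Sw] one[OF Sw] TS[OF w] unfolding conj_by_inv[OF g KH_KG[OF a]] by simp
 qed
qed

end

text \<open>e lies below every central idempotent u that acts as the identity on \<eta>: e u is a
  nonzero idempotent of the field Z, hence e. Since \<eta> is equivalent to its conjugate, both x e
  x^-1 and x^-1 e x are such u; the two relations together force x e x^-1 = e.\<close>

lemma (in prime_index) conj_invariant_pci:
 assumes x: "x \<in> carrier G" "x \<notin> H" and r: "irreducible_representation HG K I \<rho>"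
  and e: "corresponding_pci HG K I \<rho> e" and eq: "rep_equiv HG K I (conj_rep G x \<rho>) I \<rho>"
 shows "e \<in> ring_center KG"
proof -
 note r' = irreducible_repD[OF r]
 interpret R: action HG K "fun_space K I" "\<lambda>g. mat_vec K I (\<rho> g)" by (rule B.rep_action[OF r'(1)])
 have pci: "primitive_central_idempotent KH e" and id: "acts_as_identity HG K I \<rho> e"
  using e by (auto simp: corresponding_pci_def)
 interpret BZ: ring_block KH e by (rule B.block_of_pci[OF pci])
 have eKH: "e \<in> carrier KH" by (rule BZ.e_closed)
 have one: "rep_ext HG K I \<rho> e v = v" if "v \<in> carrier (fun_space K I)" for v
  by (rule B.acts_as_identityD[OF r'(1) id eKH that])
 obtain i where i: "i \<in> I" using r'(2) by blast
 have gi: "gel K i \<in> carrier (fun_space K I)" using i by (rule K.gel_fs)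
 note ginz = K.gel_nonzero[of i I]
 have below: "e \<otimes>\<^bsub>KH\<^esub> u = e"
  if u: "u \<in> ring_center KH" "u \<otimes>\<^bsub>KH\<^esub> u = u" and a: "\<And>v. v \<in> carrier (fun_space K I) ==> rep_ext HG K I \<rho> u v = v" for u
 proof -
  have uc: "u \<in> carrier KH" using u(1) by (simp add: ring_center_def)
  define w where "w = e \<otimes>\<^bsub>KH\<^esub> u"
  have wC: "w \<in> carrier BZ.C" unfolding w_def BZ.e_comm[OF uc] by (rule BZ.center_times_e[OF u(1)])
  note wD = BZ.C_carrierD[OF wC]
  have ue: "u \<otimes>\<^bsub>KH\<^esub> e = e \<otimes>\<^bsub>KH\<^esub> u" by (rule BZ.e_comm[OF uc, symmetric])
  have "w \<otimes>\<^bsub>KH\<^esub> w = (w \<otimes>\<^bsub>KH\<^esub> e) \<otimes>\<^bsub>KH\<^esub> u" unfolding w_def using eKH uc by (simp add: B.A.m_assoc)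
  also have "... = e \<otimes>\<^bsub>KH\<^esub> (u \<otimes>\<^bsub>KH\<^esub> u)" unfolding wD(3) unfolding w_def by (rule B.A.m_assoc[OF eKH uc uc])
  finally have ww: "w \<otimes>\<^bsub>KH\<^esub> w = w" unfolding u(2) w_def .
  have "w \<noteq> \<zero>\<^bsub>KH\<^esub>"
  proof
   assume "w = \<zero>\<^bsub>KH\<^esub>"
   then have "rep_ext HG K I \<rho> w (gel K i) = \<zero>\<^bsub>fun_space K I\<^esub>" using R.Ext_zero[OF gi] by simp
   then show False using R.Ext_mult[OF eKH uc gi] a[OF gi] one[OF gi] ginz unfolding w_def by simp
  qed
  interpret F: field "block_center KH e" by (rule B.block_center_field[OF pci])
  have "w \<otimes>\<^bsub>BZ.C\<^esub> w = w \<otimes>\<^bsub>BZ.C\<^esub> e" using ww wD(3) by (simp only: block_simps)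
  then have "w = e" using F.m_lcancel[of w w e] wC BZ.e_in_C \<open>w \<noteq> \<zero>\<^bsub>KH\<^esub>\<close> by (simp only: block_simps simp_thms)
  then show ?thesis unfolding w_def .
 qed
 have cc: "conj_by g e \<in> ring_center KH" "conj_by g e \<otimes>\<^bsub>KH\<^esub> conj_by g e = conj_by g e" if g: "g \<in> carrier G" for g
 proof -
  show "conj_by g e \<in> ring_center KH" by (rule conj_by_center[OF g BZ.ec])
  have "conj_by g e \<star> conj_by g e = conj_by g (e \<star> e)" by (rule conj_by_mult[OF g KH_KG[OF eKH] KH_KG[OF eKH], symmetric])
  also have "e \<star> e = e" using BZ.ee unfolding KH_mult[OF eKH eKH] .
  finally show "conj_by g e \<otimes>\<^bsub>KH\<^esub> conj_by g e = conj_by g e"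
   unfolding KH_mult[OF conj_by_KH[OF g eKH] conj_by_KH[OF g eKH]] .
 qed
 have ix: "inv x \<in> carrier G" using x by simp
 have 1: "e \<otimes>\<^bsub>KH\<^esub> conj_by x e = e"
  by (rule below[OF cc[OF x(1)]]) (rule conj_by_identity(1)[OF x(1) r'(1) eq eKH one])
 have 2: "e \<otimes>\<^bsub>KH\<^esub> conj_by (inv x) e = e"
  by (rule below[OF cc[OF ix]]) (rule conj_by_identity(2)[OF x(1) r'(1) eq eKH one])
 have "conj_by x e = conj_by x (e \<star> conj_by (inv x) e)"
  using 2 unfolding KH_mult[OF eKH conj_by_KH[OF ix eKH]] by simp
 also have "... = conj_by x e \<star> e"
  unfolding conj_by_mult[OF x(1) KH_KG[OF eKH] KH_KG[OF conj_by_KH[OF ix eKH]]] conj_by_inv[OF x(1) KH_KG[OF eKH]] ..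
 also have "... = conj_by x e \<otimes>\<^bsub>KH\<^esub> e" by (rule KH_mult[OF conj_by_KH[OF x(1) eKH] eKH, symmetric])
 also have "... = e" using BZ.e_comm[OF conj_by_KH[OF x(1) eKH]] 1 by simp
 finally have "conj_by x e = e" .
 then have cx: "\<delta> x \<star> e = e \<star> \<delta> x" using conj_by_fixed_iff[OF x(1) KH_KG[OF eKH]] by simp
 show ?thesis
 proof (rule commute_generated[OF x KH_KG[OF eKH] _ cx])
  fix h assume h: "h \<in> H"
  show "\<delta> h \<star> e = e \<star> \<delta> h"
   using BZ.e_comm[OF gel_KH[OF h]] unfolding KH_mult[OF eKH gel_KH[OF h]] KH_mult[OF gel_KH[OF h] eKH] by simp
 qed
qed

section \<open>Dimension of the center of a block\<close>

lemma (in ring) Span_induct: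
 assumes "subfield K R" and "set Us \<subseteq> carrier R" and "w \<in> Span K Us"
  and "P \<zero>" "\<And>k u v. [|k \<in> K; u \<in> set Us; v \<in> carrier R; P v|] ==> P (k \<otimes> u \<oplus> v)"
 shows "P w"
 using assms(2-3,5)
proof (induction Us arbitrary: w)
 case Nil
 then show ?case using assms(4) by simp
next
 case (Cons u Us)
 obtain k v where kv: "k \<in> K" "v \<in> Span K Us" "w = k \<otimes> u \<oplus> v"
  using Cons.prems(2) line_extension_mem_iff[of w K u "Span K Us"] by auto
 have c: "set Us \<subseteq> carrier R" using Cons.prems(1) by simp
 have "P v" by (rule Cons.IH[OF c kv(2)]) (rule Cons.prems(3), simp_all)
 moreover have "v \<in> carrier R" using Span_subgroup_props(1)[OF assms(1) c] kv(2) by blast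
 ultimately show ?case unfolding kv(3) by (intro Cons.prems(3)[OF kv(1)]) simp_all
qed

lemma (in ring) dimension_Span_le:
 assumes K: "subfield K R" and "set Us \<subseteq> carrier R"
 shows "\<exists>n\<le>length Us. dimension n K (Span K Us)"
 using assms(2)
proof (induction Us)
 case Nil
 then show ?case by (auto intro: zero_dim)
next
 case (Cons u Us)
 then obtain n where n: "n \<le> length Us" "dimension n K (Span K Us)" by auto
 have c: "u \<in> carrier R" "set Us \<subseteq> carrier R" using Cons.prems by auto
 show ?case
 proof (cases "u \<in> Span K Us")
  case True
  have "set (u # Us) \<subseteq> Span K Us" using True Span_base_incl[OF K c(2)] by simp
  then have "Span K (u # Us) \<subseteq> Span K Us" by (rule mono_Span_subset[OF K _ c(2)])
  then have "Span K (u # Us) = Span K Us" using mono_Span[OF K c(2,1)] by blast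
  then show ?thesis using n by (metis le_Suc_eq length_Cons)
 next
  case False
  have "dimension (Suc n) K (line_extension K u (Span K Us))" by (rule Suc_dim[OF c(1) False n(2)])
  then show ?thesis using n(1) by (intro exI[of _ "Suc n"]) simp
 qed
qed

context inv_block begin

lemma emb_hom: "ring_hom_ring K Z (\<lambda>a. a \<odot>\<^bsub>KG\<^esub> e)"
proof (rule ring_hom_ringI)
 interpret Z: field Z by (rule Z_field)
 have eKG: "e \<in> carrier KG" by simp
 show "ring K" "ring Z" by (rule K.ring_axioms, rule Z.ring_axioms)
 show Zc: "a \<odot>\<^bsub>KG\<^esub> e \<in> carrier Z" if a: "a \<in> carrier K" for a
 proof (rule Z_I)
  show "(a \<odot>\<^bsub>KG\<^esub> e) \<star> e = a \<odot>\<^bsub>KG\<^esub> e" unfolding smult_mult(1)[OF a eKG eKG] ee ..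
  show "a \<odot>\<^bsub>KG\<^esub> e \<in> ring_center KH"
   using B.ring_center_closed(3)[of e e a] central_KG_KH[OF e_central e_KH] a by simp
 qed
 fix a b assume ab: "a \<in> carrier K" "b \<in> carrier K"
 show "(a \<oplus>\<^sub>K b) \<odot>\<^bsub>KG\<^esub> e = a \<odot>\<^bsub>KG\<^esub> e \<oplus>\<^sub>Z b \<odot>\<^bsub>KG\<^esub> e"
  unfolding Z_ops(1) by (rule V.smult_l_distr[OF ab eKG])
 have "(a \<odot>\<^bsub>KG\<^esub> e) \<otimes>\<^sub>Z (b \<odot>\<^bsub>KG\<^esub> e) = (a \<odot>\<^bsub>KG\<^esub> e) \<star> (b \<odot>\<^bsub>KG\<^esub> e)"
  by (rule Z_mult[OF Z_D(1)[OF Zc[OF ab(1)]] Z_D(1)[OF Zc[OF ab(2)]]])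
 also have "... = (a \<otimes>\<^sub>K b) \<odot>\<^bsub>KG\<^esub> e"
  unfolding smult_mult(1)[OF ab(1) eKG V.smult_closed[OF ab(2) eKG]] smult_mult(2)[OF ab(2) eKG eKG] ee
  by (rule V.smult_assoc1[OF ab eKG, symmetric])
 finally show "(a \<otimes>\<^sub>K b) \<odot>\<^bsub>KG\<^esub> e = (a \<odot>\<^bsub>KG\<^esub> e) \<otimes>\<^sub>Z (b \<odot>\<^bsub>KG\<^esub> e)" by simp
next
 show "\<one>\<^sub>K \<odot>\<^bsub>KG\<^esub> e = \<one>\<^sub>Z" using V.smult_one[of e] by (simp add: Z_ops)
qed

abbreviation Fe where "Fe \<equiv> (\<lambda>a. a \<odot>\<^bsub>KG\<^esub> e) ` carrier K"

lemma Fe_subfield: "subfield Fe Z"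
proof -
 interpret Z: field Z by (rule Z_field)
 show ?thesis by (rule ring_hom_ring.img_is_subfield(2)[OF emb_hom K.carrier_is_subfield Z.one_not_zero])
qed

lemma class_sum_e_Z: "y \<in> H ==> class_sum K HG y \<star> e \<in> carrier Z"
 using BZ.center_times_e[OF B.class_sum_central, of y] KH_mult[OF B.class_sum_carrier e_KH, of y] by simp

text \<open>Z is spanned by the elements C(y) e for y in H, with classes taken in H.\<close>

lemma finite_dimension_Z: "ring.finite_dimension Z Fe (carrier Z)"
proof -
 interpret Z: field Z by (rule Z_field)
 have "finite H" by (rule finite_subset[OF N.subset fin])
 then obtain hs where hs: "set hs = H" using finite_list by blast
 define Us where "Us = map (\<lambda>y. class_sum K HG y \<star> e) hs"
 have Us: "set Us \<subseteq> carrier Z" unfolding Us_def using class_sum_e_Z hs by auto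
 note sp = Z.Span_subgroup_props[OF Fe_subfield Us]
 have eKG: "e \<in> carrier KG" by simp
 have "z \<star> e \<in> Z.Span Fe Us" if z: "z \<in> ring_center KH" for z
 proof (rule B.center_induct[OF z, where P = "\<lambda>u. u \<star> e \<in> Z.Span Fe Us"])
  show "\<zero>\<^bsub>KH\<^esub> \<star> e \<in> Z.Span Fe Us" using sp(2) A.l_null[OF eKG] by simp
  fix u v assume u: "u \<in> carrier KH" "v \<in> carrier KH" "u \<star> e \<in> Z.Span Fe Us" "v \<star> e \<in> Z.Span Fe Us"
  show "(u \<oplus>\<^bsub>KH\<^esub> v) \<star> e \<in> Z.Span Fe Us"
   using sp(3)[OF u(3,4)] A.l_distr[of u v e] u(1,2) by (simp add: Z_ops)
 next
  fix a u assume u: "a \<in> carrier K" "u \<in> carrier KH" "u \<star> e \<in> Z.Span Fe Us"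
  have uKG: "u \<in> carrier KG" "u \<star> e \<in> carrier KG" using u(2) by auto
  have uZ: "u \<star> e \<in> carrier Z" using u(3) sp(1) by blast
  have aZ: "a \<odot>\<^bsub>KG\<^esub> e \<in> carrier Z" by (rule ring_hom_closed[OF ring_hom_ring.homh[OF emb_hom] u(1)])
  have "(a \<odot>\<^bsub>KG\<^esub> e) \<otimes>\<^sub>Z (u \<star> e) \<in> Z.Span Fe Us"
   by (rule Z.Span_smult_closed[OF Fe_subfield Us _ u(3)]) (use u(1) in blast)
  moreover have "(a \<odot>\<^bsub>KG\<^esub> e) \<otimes>\<^sub>Z (u \<star> e) = a \<odot>\<^bsub>KG\<^esub> (u \<star> e)"
   unfolding Z_mult[OF Z_D(1)[OF aZ] Z_D(1)[OF uZ]] smult_mult(1)[OF u(1) eKG uKG(2)] Z_D(5)[OF uZ] ..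
  moreover have "(a \<odot>\<^bsub>KG\<^esub> u) \<star> e = a \<odot>\<^bsub>KG\<^esub> (u \<star> e)" by (rule smult_mult(1)[OF u(1) uKG(1) eKG])
  ultimately show "(a \<odot>\<^bsub>KH\<^esub> u) \<star> e \<in> Z.Span Fe Us" by simp
 next
  fix y assume "y \<in> carrier HG"
  then have "class_sum K HG y \<star> e \<in> set Us" unfolding Us_def using hs by simp
  then show "class_sum K HG y \<star> e \<in> Z.Span Fe Us" using Z.Span_base_incl[OF Fe_subfield Us] by blast
 qed
 then have "carrier Z \<subseteq> Z.Span Fe Us" using Z_D(3,4) by (metis subsetI)
 then have "Z.Span Fe Us = carrier Z" using sp(1) by blast
 then show ?thesis using Z.Span_finite_dimension[OF Fe_subfield Us] by simp
qed

end

section \<open>Extending scalars to a splitting field\<close>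

text \<open>In the theorem L is Z and s maps a to a e. As a separate field with an embedding, Z in
  its role of coefficient field is kept apart from Z as a part of the group algebra.\<close>

locale split_rep = inv_block G K H p e x + L: field L + EM: coeff_hom_field K L s
 for G :: "('g, 'm) monoid_scheme" (structure) and K :: "('k, 'r) ring_scheme" and H p e x
  and L :: "('l, 'b) ring_scheme" and s +
 fixes n :: nat and \<eta> :: "'g \<Rightarrow> nat \<Rightarrow> nat \<Rightarrow> 'k" and d :: nat and m :: "nat \<Rightarrow> nat" and \<rho> :: "nat \<Rightarrow> 'g \<Rightarrow> nat \<Rightarrow> nat \<Rightarrow> 'l"
 assumes eta: "irreducible_representation HG K {..<n} \<eta>" "acts_as_identity HG K {..<n} \<eta> e"
  and d: "d = ring.dim Z Fe (carrier Z)"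
  and rho: "\<And>i. i \<in> {1..d} ==> irreducible_representation HG L {..<m i} (\<rho> i)"
  and ineq: "\<And>i k. [|i \<in> {1..d}; k \<in> {1..d}; i \<noteq> k|] ==> \<not> rep_equiv HG L {..<m i} (\<rho> i) {..<m k} (\<rho> k)"
  and decomp: "rep_equiv HG L {..<n} (extend_scalars s \<eta>) (SIGMA i:{1..d}. {..<m i}) (direct_sum L \<rho>)"
begin

lemma s_finsum: "(\<And>i. i \<in> A ==> f i \<in> carrier K) ==> s (\<Oplus>\<^sub>K i\<in>A. f i) = (\<Oplus>\<^sub>L i\<in>A. s (f i))"
proof -
 assume f: "\<And>i. i \<in> A ==> f i \<in> carrier K"
 have "ring_hom_cring K L s" by (rule ring_hom_cringI[OF K.is_cring L.is_cring EM.J.homh])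
 then show ?thesis using ring_hom_cring.hom_finsum[of K L s f A] f by (simp add: comp_def)
qed

sublocale W: prime_index G L H p
proof -
 have "(\<Oplus>\<^sub>L g\<in>carrier G. \<one>\<^sub>L) = s (\<Oplus>\<^sub>K g\<in>carrier G. \<one>\<^sub>K)" by (subst s_finsum) simp_all
 then have "(\<Oplus>\<^sub>L g\<in>carrier G. \<one>\<^sub>L) \<noteq> \<zero>\<^sub>L"
  using EM.\<iota>_zero_iff[of "\<Oplus>\<^sub>K g\<in>carrier G. \<one>\<^sub>K"] order_nz by simp
 then show "prime_index G L H p"
  using G.group_axioms L.field_axioms fin normal p index
  by (simp add: prime_index_def normal_sub_def fin_group_field_def prime_index_axioms_def normal_sub_axioms_def fin_group_field_axioms_def)
qed

text \<open>Extension of scalars from K[H] to L[H], a ring homomorphism that takes class sums to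
  class sums.\<close>

definition Th where "Th a = (\<lambda>h. s (a h))"

lemma Th_closed [simp]: "a \<in> carrier KH ==> Th a \<in> carrier W.KH"
 unfolding Th_def by (rule W.B.KG_carrierI) (use B.KG_val B.KG_out EM.J.hom_closed EM.J.hom_zero in auto)

lemma Th_add: "[|a \<in> carrier KH; b \<in> carrier KH|] ==> Th (a \<oplus>\<^bsub>KH\<^esub> b) = Th a \<oplus>\<^bsub>W.KH\<^esub> Th b"
 unfolding Th_def group_algebra_simps using B.KG_val EM.J.hom_add by (intro ext) auto

lemma Th_smult: "[|c \<in> carrier K; a \<in> carrier KH|] ==> Th (c \<odot>\<^bsub>KH\<^esub> a) = s c \<odot>\<^bsub>W.KH\<^esub> Th a"
 unfolding Th_def group_algebra_simps using B.KG_val EM.J.hom_mult by (intro ext) auto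

lemma Th_mult:
 assumes "a \<in> carrier KH" "b \<in> carrier KH"
 shows "Th (a \<otimes>\<^bsub>KH\<^esub> b) = Th a \<otimes>\<^bsub>W.KH\<^esub> Th b"
proof (rule W.B.KG_eqI)
 show "Th (a \<otimes>\<^bsub>KH\<^esub> b) \<in> carrier W.KH" by (rule Th_closed) (rule B.A.m_closed[OF assms])
 show "Th a \<otimes>\<^bsub>W.KH\<^esub> Th b \<in> carrier W.KH" by (rule W.B.A.m_closed) (simp_all add: assms)
 fix g assume g: "g \<in> carrier HG"
 note av = B.KG_val[OF assms(1)] and bv = B.KG_val[OF assms(2)]
 have "s (\<Oplus>\<^sub>K h\<in>carrier HG. a h \<otimes>\<^sub>K b (inv\<^bsub>HG\<^esub> h \<otimes>\<^bsub>HG\<^esub> g)) = (\<Oplus>\<^sub>L h\<in>carrier HG. s (a h \<otimes>\<^sub>K b (inv\<^bsub>HG\<^esub> h \<otimes>\<^bsub>HG\<^esub> g)))"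
  by (rule s_finsum) (rule K.m_closed[OF av bv])
 also have "... = (\<Oplus>\<^sub>L h\<in>carrier HG. s (a h) \<otimes>\<^sub>L s (b (inv\<^bsub>HG\<^esub> h \<otimes>\<^bsub>HG\<^esub> g)))"
  unfolding EM.J.hom_mult[OF av bv] ..
 finally show "Th (a \<otimes>\<^bsub>KH\<^esub> b) g = (Th a \<otimes>\<^bsub>W.KH\<^esub> Th b) g"
  using g unfolding group_algebra_def Th_def by simp
qed

lemma Th_class_sum: "Th (class_sum K HG y) = class_sum L HG y"
 unfolding Th_def class_sum_def by (intro ext) simp

lemma Th_conj:
 assumes "a \<in> carrier KH"
 shows "Th (conj_by x a) = W.conj_by x (Th a)"
proof (rule W.KG_eqI)
 have c: "conj_by x a \<in> carrier KH" by (rule conj_by_KH[OF x(1) assms])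
 show "Th (conj_by x a) \<in> carrier W.KG" by (rule W.KH_KG[OF Th_closed[OF c]])
 show "W.conj_by x (Th a) \<in> carrier W.KG" by (rule W.conj_by_closed[OF x(1) W.KH_KG[OF Th_closed[OF assms]]])
 fix g assume g: "g \<in> carrier G"
 show "Th (conj_by x a) g = W.conj_by x (Th a) g"
  unfolding W.conj_by_val[OF x(1) W.KH_KG[OF Th_closed[OF assms]] g]
  unfolding Th_def conj_by_val[OF x(1) KH_KG[OF assms] g] ..
qed

abbreviation E where "E i a v \<equiv> rep_ext HG L {..<m i} (\<rho> i) a v"
abbreviation FS where "FS i \<equiv> fun_space L {..<m i}"

lemma eta_L: "representation HG L {..<n} (extend_scalars s \<eta>)"
proof -
 note r = irreducible_repD(1)[OF eta(1)]
 have c: "\<And>g i j. [|g \<in> H; i < n; j < n|] ==> \<eta> g i j \<in> carrier K"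
  and o: "\<And>i j. [|i < n; j < n|] ==> \<eta> \<one> i j = mat_one K i j"
  and mu: "\<And>g h i j. [|g \<in> H; h \<in> H; i < n; j < n|] ==> \<eta> (g \<otimes> h) i j = mat_mult K {..<n} (\<eta> g) (\<eta> h) i j"
  using r unfolding representation_def mat_carrier_def mat_eq_on_def by auto
 have "s (mat_mult K {..<n} (\<eta> g) (\<eta> h) i j) = mat_mult L {..<n} (extend_scalars s \<eta> g) (extend_scalars s \<eta> h) i j"
  if "g \<in> H" "h \<in> H" "i < n" "j < n" for g h i j
 proof -
  have "s (mat_mult K {..<n} (\<eta> g) (\<eta> h) i j) = (\<Oplus>\<^sub>L k\<in>{..<n}. s (\<eta> g i k \<otimes>\<^sub>K \<eta> h k j))"
   unfolding mat_mult_def by (rule s_finsum) (use c that in simp)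
  also have "... = (\<Oplus>\<^sub>L k\<in>{..<n}. s (\<eta> g i k) \<otimes>\<^sub>L s (\<eta> h k j))"
   by (rule L.finsum_cong') (use c that EM.J.hom_mult EM.J.hom_closed in auto)
  finally show ?thesis unfolding mat_mult_def extend_scalars_def .
 qed
 then show ?thesis
  using c o mu unfolding representation_def mat_carrier_def mat_eq_on_def
  by (simp add: extend_scalars_def mat_one_def)
qed

lemma eta_L_one:
 assumes "v \<in> carrier (fun_space L {..<n})"
 shows "rep_ext HG L {..<n} (extend_scalars s \<eta>) (Th e) v = v"
proof (rule W.B.acts_as_identityD[OF eta_L _ Th_closed[OF e_KH] assms])
 have c: "\<And>g i j. [|g \<in> H; i < n; j < n|] ==> \<eta> g i j \<in> carrier K"
  using irreducible_repD(1)[OF eta(1)] unfolding representation_def mat_carrier_def by auto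
 have ec: "e g \<in> carrier K" for g using B.KG_val[OF e_KH] .
 have "(\<Oplus>\<^sub>L g\<in>H. s (e g) \<otimes>\<^sub>L s (\<eta> g i j)) = mat_one L i j" if ij: "i < n" "j < n" for i j
 proof -
  have "(\<Oplus>\<^sub>K g\<in>H. e g \<otimes>\<^sub>K \<eta> g i j) = mat_one K i j"
   using eta(2) ij unfolding acts_as_identity_def mat_eq_on_def by simp
  then have "s (\<Oplus>\<^sub>K g\<in>H. e g \<otimes>\<^sub>K \<eta> g i j) = mat_one L i j" by (simp add: mat_one_def)
  moreover have "s (\<Oplus>\<^sub>K g\<in>H. e g \<otimes>\<^sub>K \<eta> g i j) = (\<Oplus>\<^sub>L g\<in>H. s (e g \<otimes>\<^sub>K \<eta> g i j))"
   by (rule s_finsum) (use c ec ij in simp)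
  moreover have "(\<Oplus>\<^sub>L g\<in>H. s (e g \<otimes>\<^sub>K \<eta> g i j)) = (\<Oplus>\<^sub>L g\<in>H. s (e g) \<otimes>\<^sub>L s (\<eta> g i j))"
   by (rule L.finsum_cong') (use c ec ij EM.J.hom_mult EM.J.hom_closed in auto)
  ultimately show ?thesis by simp
 qed
 then show "acts_as_identity HG L {..<n} (extend_scalars s \<eta>) (Th e)"
  unfolding acts_as_identity_def mat_eq_on_def Th_def extend_scalars_def by simp
qed

text \<open>The equivalence with the direct sum is needed only through its component maps. As they
  are equivariant and onto, whatever acts as the identity on the extended \<eta> does so on each
  constituent.\<close>

lemma components:
 obtains \<tau> where
  "\<And>i. i \<in> {1..d} ==> lin L (fun_space L {..<n}) (FS i) (\<tau> i)"
  "\<And>i g v. [|i \<in> {1..d}; g \<in> carrier HG; v \<in> carrier (fun_space L {..<n})|] ==>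
   \<tau> i (mat_vec L {..<n} (extend_scalars s \<eta> g) v) = mat_vec L {..<m i} (\<rho> i g) (\<tau> i v)"
  "\<And>i w. [|i \<in> {1..d}; w \<in> carrier (FS i)|] ==> \<exists>v\<in>carrier (fun_space L {..<n}). \<tau> i v = w"
  "1 \<le> d"
proof -
 let ?I = "{..<n}" and ?J = "SIGMA i:{1..d}. {..<m i}" and ?\<eta> = "extend_scalars s \<eta>" and ?D = "direct_sum L \<rho>"
 have fJ: "finite ?J" by simp
 obtain M N where M: "M \<in> mat_carrier L ?J ?I" and N: "N \<in> mat_carrier L ?I ?J"
  and NM: "mat_eq_on ?I ?I (mat_mult L ?J N M) (mat_one L)" and MN: "mat_eq_on ?J ?J (mat_mult L ?I M N) (mat_one L)"
  and eq: "\<And>g. g \<in> carrier HG ==> mat_eq_on ?J ?I (mat_mult L ?I M (?\<eta> g)) (mat_mult L ?J (?D g) M)"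
  using decomp unfolding rep_equiv_def by blast
 define T where "T = mv L ?J ?I M"
 have T: "lin L (fun_space L ?I) (fun_space L ?J) T" unfolding T_def by (rule L.mv_lin[OF _ M]) simp
 have mmc: "mat_mult L B P Q \<in> mat_carrier L A C" if "finite B" "P \<in> mat_carrier L A B" "Q \<in> mat_carrier L B C" for A B C P Q
  using that unfolding mat_mult_def mat_carrier_def by (auto intro!: L.finsum_closed)
 have Dc: "?D g \<in> mat_carrier L ?J ?J" if "g \<in> carrier HG" for g
  using irreducible_repD(1)[OF rho] that unfolding mat_carrier_def direct_sum_def representation_def by auto
 have etac: "?\<eta> g \<in> mat_carrier L ?I ?I" if "g \<in> carrier HG" for g using eta_L that unfolding representation_def by blast
 have Teq: "T (mat_vec L ?I (?\<eta> g) v) = mv L ?J ?J (?D g) (T v)" if g: "g \<in> carrier HG" and v: "v \<in> carrier (fun_space L ?I)" for g v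
 proof -
  have "T (mat_vec L ?I (?\<eta> g) v) = mv L ?J ?I (mat_mult L ?I M (?\<eta> g)) v"
   unfolding T_def mat_vec_mv by (rule L.mv_mult[OF _ _ M etac[OF g] v, symmetric]) simp_all
  also have "... = mv L ?J ?I (mat_mult L ?J (?D g) M) v"
   by (rule L.mv_cong[OF eq[OF g] mmc[OF _ M etac[OF g]] v]) simp
  also have "... = mv L ?J ?J (?D g) (T v)" unfolding T_def by (rule L.mv_mult[OF fJ _ Dc[OF g] M v]) simp
  finally show ?thesis .
 qed
 define \<tau> where "\<tau> i v = (\<lambda>j. if j < m i then T v (i, j) else \<zero>\<^sub>L)" for i v
 note Tc = linD(1)[OF T]
 have tc: "\<tau> i v \<in> carrier (FS i)" if v: "v \<in> carrier (fun_space L ?I)" for i v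
  using L.fs_val[OF Tc[OF v]] unfolding fun_space_carrier \<tau>_def by simp
 have lin: "lin L (fun_space L ?I) (FS i) (\<tau> i)" for i
  unfolding lin_def
 proof (intro conjI ballI)
  fix v assume v: "v \<in> carrier (fun_space L ?I)"
  show "\<tau> i v \<in> carrier (FS i)" by (rule tc[OF v])
  show "\<tau> i (v \<oplus>\<^bsub>fun_space L ?I\<^esub> w) = \<tau> i v \<oplus>\<^bsub>FS i\<^esub> \<tau> i w" if w: "w \<in> carrier (fun_space L ?I)" for w
   unfolding \<tau>_def linD(2)[OF T v w] by (rule ext) simp
  show "\<tau> i (a \<odot>\<^bsub>fun_space L ?I\<^esub> v) = a \<odot>\<^bsub>FS i\<^esub> \<tau> i v" if a: "a \<in> carrier L" for a
   unfolding \<tau>_def linD(3)[OF T a v] using a by (intro ext) simp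
 qed
 have equiv: "\<tau> i (mat_vec L ?I (?\<eta> g) v) = mat_vec L {..<m i} (\<rho> i g) (\<tau> i v)"
  if i: "i \<in> {1..d}" and g: "g \<in> carrier HG" and v: "v \<in> carrier (fun_space L ?I)" for i g v
 proof (rule ext)
  fix j
  have rc: "\<And>j k. [|j < m i; k < m i|] ==> \<rho> i g j k \<in> carrier L"
   using irreducible_repD(1)[OF rho[OF i]] g unfolding representation_def mat_carrier_def by auto
  note wv = L.fs_val[OF Tc[OF v]]
  show "\<tau> i (mat_vec L ?I (?\<eta> g) v) j = mat_vec L {..<m i} (\<rho> i g) (\<tau> i v) j"
  proof (cases "j < m i")
   case True
   have inj: "inj_on (Pair i) {..<m i}" by (rule inj_onI) simp
   have Dv: "?D g (i, j) q \<otimes>\<^sub>L T v q \<in> carrier L" if "q \<in> ?J" for q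
    using Dc[OF g] that True i wv unfolding mat_carrier_def by (intro L.m_closed) auto
   have "\<tau> i (mat_vec L ?I (?\<eta> g) v) j = (\<Oplus>\<^sub>L q\<in>?J. ?D g (i, j) q \<otimes>\<^sub>L T v q)"
    unfolding \<tau>_def Teq[OF g v] mv_def using True i by simp
   also have "... = (\<Oplus>\<^sub>L q\<in>Pair i ` {..<m i}. ?D g (i, j) q \<otimes>\<^sub>L T v q)"
    by (rule L.add.finprod_mono_neutral_cong_left[symmetric, OF fJ])
     (use i Dv wv in \<open>auto simp: direct_sum_def\<close>)
   also have "... = (\<Oplus>\<^sub>L k\<in>{..<m i}. ?D g (i, j) (i, k) \<otimes>\<^sub>L T v (i, k))"
    by (rule L.finsum_reindex[OF _ inj]) (use Dv i in auto)
   also have "... = mat_vec L {..<m i} (\<rho> i g) (\<tau> i v) j"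
    unfolding mat_vec_def using True
    by (simp, intro L.finsum_cong') (use rc wv in \<open>auto simp: direct_sum_def \<tau>_def\<close>)
   finally show ?thesis .
  qed (simp add: \<tau>_def mat_vec_def)
 qed
 have surj: "\<exists>v\<in>carrier (fun_space L ?I). \<tau> i v = w" if i: "i \<in> {1..d}" and w: "w \<in> carrier (FS i)" for i w
 proof -
  define u where "u = (\<lambda>(k, j). if k = i then w j else \<zero>\<^sub>L)"
  have u: "u \<in> carrier (fun_space L ?J)"
   using w i L.fs_val[OF w] unfolding fun_space_carrier u_def by auto
  have Sc: "mv L ?I ?J N u \<in> carrier (fun_space L ?I)" using linD(1)[OF L.mv_lin[OF fJ N] u] .
  have "T (mv L ?I ?J N u) = mv L ?J ?J (mat_mult L ?I M N) u"
   unfolding T_def by (rule L.mv_mult[OF _ fJ M N u, symmetric]) simp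
  also have "... = mv L ?J ?J (mat_one L) u" by (rule L.mv_cong[OF MN mmc[OF _ M N] u]) simp
  also have "... = u" by (rule L.mv_one[OF fJ u])
  finally have "\<tau> i (mv L ?I ?J N u) = w"
   using w unfolding \<tau>_def fun_space_carrier by (intro ext) (auto simp: u_def)
  then show ?thesis using Sc by blast
 qed
 have "1 \<le> d"
 proof (rule ccontr)
  \<comment> \<open>With no constituents the intertwiner would factor through the zero space,
    although \<eta> has a nonzero vector.\<close>
  assume "\<not> 1 \<le> d"
  then have J: "?J = {}" by auto
  obtain i where i: "i \<in> ?I" using irreducible_repD(2)[OF eta(1)] by blast
  have gi: "gel L i \<in> carrier (fun_space L ?I)" by (rule L.gel_fs[OF i])
  have "mv L ?I ?J N (T (gel L i)) = mv L ?I ?I (mat_mult L ?J N M) (gel L i)"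
   unfolding T_def by (rule L.mv_mult[OF fJ _ N M gi, symmetric]) simp
  also have "... = mv L ?I ?I (mat_one L) (gel L i)" by (rule L.mv_cong[OF NM mmc[OF fJ N M] gi])
  also have "... = gel L i" by (rule L.mv_one[OF _ gi]) simp
  finally have "gel L i = mv L ?I {} N (T (gel L i))" unfolding J by simp
  also have "... = \<zero>\<^bsub>fun_space L ?I\<^esub>" by (rule ext) (simp add: mv_def)
  finally show False by (rule notE[OF L.gel_nonzero])
 qed
 then show ?thesis using that[of \<tau>] lin equiv surj by blast
qed

lemma d_pos: "1 \<in> {1..d}"
 by (rule components) simp

lemma rho_action: "i \<in> {1..d} ==> action HG L (FS i) (\<lambda>g. mat_vec L {..<m i} (\<rho> i g))"
 by (rule W.B.rep_action[OF irreducible_repD(1)[OF rho]])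

lemma E_one:
 assumes i: "i \<in> {1..d}" and w: "w \<in> carrier (FS i)"
 shows "E i (Th e) w = w"
proof (rule components)
 fix \<tau> assume lin: "\<And>i. i \<in> {1..d} ==> lin L (fun_space L {..<n}) (FS i) (\<tau> i)"
  and eq: "\<And>i g v. [|i \<in> {1..d}; g \<in> carrier HG; v \<in> carrier (fun_space L {..<n})|] ==>
   \<tau> i (mat_vec L {..<n} (extend_scalars s \<eta> g) v) = mat_vec L {..<m i} (\<rho> i g) (\<tau> i v)"
  and surj: "\<And>i w. [|i \<in> {1..d}; w \<in> carrier (FS i)|] ==> \<exists>v\<in>carrier (fun_space L {..<n}). \<tau> i v = w"
 obtain v where v: "v \<in> carrier (fun_space L {..<n})" "\<tau> i v = w" using surj[OF i w] by blast
 have "\<tau> i (rep_ext HG L {..<n} (extend_scalars s \<eta>) (Th e) v) = E i (Th e) (\<tau> i v)"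
  by (rule W.B.rep_ext_equivariant[OF eta_L irreducible_repD(1)[OF rho[OF i]] lin[OF i] eq[OF i] Th_closed[OF e_KH] v(1)])
 then show "E i (Th e) w = w" unfolding eta_L_one[OF v(1)] v(2) by simp
qed

lemma nonzero_vector:
 assumes "i \<in> {1..d}"
 obtains v where "v \<in> carrier (FS i)" "v \<noteq> \<zero>\<^bsub>FS i\<^esub>"
proof -
 obtain k where "k \<in> {..<m i}" using irreducible_repD(2)[OF rho[OF assms]] by blast
 then show ?thesis using that[OF L.gel_fs L.gel_nonzero] by blast
qed

end

context split_rep begin

abbreviation e' where "e' \<equiv> Th e"

lemma e'_closed: "e' \<in> carrier W.KH" by (rule Th_closed[OF e_KH])

lemma class_sum_e': 
 assumes y: "y \<in> H"
 shows "class_sum L HG y \<otimes>\<^bsub>W.KH\<^esub> e' = Th (class_sum K HG y \<star> e)"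
proof -
 have c: "class_sum K HG y \<in> carrier KH" by (rule B.class_sum_carrier) (simp add: y)
 have "class_sum L HG y \<otimes>\<^bsub>W.KH\<^esub> e' = Th (class_sum K HG y) \<otimes>\<^bsub>W.KH\<^esub> e'" unfolding Th_class_sum ..
 also have "... = Th (class_sum K HG y \<otimes>\<^bsub>KH\<^esub> e)" by (rule Th_mult[OF c e_KH, symmetric])
 finally show ?thesis unfolding KH_mult[OF c e_KH] .
qed

lemma E_mult:
 assumes "i \<in> {1..d}" "a \<in> carrier W.KH" "b \<in> carrier W.KH" "v \<in> carrier (FS i)"
 shows "E i (a \<otimes>\<^bsub>W.KH\<^esub> b) v = E i a (E i b v)"
 by (rule action.Ext_mult[OF rho_action[OF assms(1)] assms(2-4)])

lemma E_closed: "[|i \<in> {1..d}; a \<in> carrier W.KH; v \<in> carrier (FS i)|] ==> E i a v \<in> carrier (FS i)"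
 by (rule action.Ext_closed[OF rho_action])

lemma E_e': "[|i \<in> {1..d}; a \<in> carrier W.KH; v \<in> carrier (FS i)|] ==> E i (a \<otimes>\<^bsub>W.KH\<^esub> e') v = E i a v"
 using E_mult[OF _ _ e'_closed] E_one by metis

text \<open>By linearity u may be a class sum of H. Its product with \<open>e'\<close> is the image
  of an element of Z, and x commutes with Z.\<close>

lemma conj_center_e':
 assumes fixed: fixed and u: "u \<in> ring_center W.KH"
 shows "W.conj_by x (u \<otimes>\<^bsub>W.KH\<^esub> e') = u \<otimes>\<^bsub>W.KH\<^esub> e'"
proof -
 note lc = W.conj_by_lin[OF x(1)]
 have KG: "a \<otimes>\<^bsub>W.KH\<^esub> e' \<in> carrier W.KG" if "a \<in> carrier W.KH" for a
  by (rule W.KH_KG[OF W.B.A.m_closed[OF that e'_closed]])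
 show ?thesis
 proof (rule W.B.center_induct[OF u, where P = "\<lambda>u. W.conj_by x (u \<otimes>\<^bsub>W.KH\<^esub> e') = u \<otimes>\<^bsub>W.KH\<^esub> e'"])
  show "W.conj_by x (\<zero>\<^bsub>W.KH\<^esub> \<otimes>\<^bsub>W.KH\<^esub> e') = \<zero>\<^bsub>W.KH\<^esub> \<otimes>\<^bsub>W.KH\<^esub> e'"
   unfolding W.B.A.l_null[OF e'_closed] unfolding W.KH_ops by (rule lin_zero[OF W.module_KG W.module_KG lc])
  fix a b assume a: "a \<in> carrier W.KH" "b \<in> carrier W.KH"
   and f: "W.conj_by x (a \<otimes>\<^bsub>W.KH\<^esub> e') = a \<otimes>\<^bsub>W.KH\<^esub> e'" "W.conj_by x (b \<otimes>\<^bsub>W.KH\<^esub> e') = b \<otimes>\<^bsub>W.KH\<^esub> e'"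
  show "W.conj_by x ((a \<oplus>\<^bsub>W.KH\<^esub> b) \<otimes>\<^bsub>W.KH\<^esub> e') = (a \<oplus>\<^bsub>W.KH\<^esub> b) \<otimes>\<^bsub>W.KH\<^esub> e'"
   unfolding W.B.A.l_distr[OF a e'_closed] unfolding W.KH_ops linD(2)[OF lc KG[OF a(1)] KG[OF a(2)]] f ..
 next
  fix c a assume a: "c \<in> carrier L" "a \<in> carrier W.KH" and f: "W.conj_by x (a \<otimes>\<^bsub>W.KH\<^esub> e') = a \<otimes>\<^bsub>W.KH\<^esub> e'"
  show "W.conj_by x ((c \<odot>\<^bsub>W.KH\<^esub> a) \<otimes>\<^bsub>W.KH\<^esub> e') = (c \<odot>\<^bsub>W.KH\<^esub> a) \<otimes>\<^bsub>W.KH\<^esub> e'"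
   unfolding W.B.smult_mult(1)[OF a e'_closed] unfolding W.KH_ops linD(3)[OF lc a(1) KG[OF a(2)]] f ..
 next
  fix y assume "y \<in> carrier HG"
  then have y: "y \<in> H" by simp
  note z = class_sum_e_Z[OF y]
  have "conj_by x (class_sum K HG y \<star> e) = class_sum K HG y \<star> e"
   using conj_by_fixed_iff[OF x(1) Z_D(2)[OF z]] fixed z unfolding fixed_def by blast
  then show "W.conj_by x (class_sum L HG y \<otimes>\<^bsub>W.KH\<^esub> e') = class_sum L HG y \<otimes>\<^bsub>W.KH\<^esub> e'"
   unfolding class_sum_e'[OF y] using Th_conj[OF Z_D(1)[OF z]] by simp
 qed
qed

text \<open>Let f be the identity of the annihilator of \<rho> 1. Were the conjugate inequivalent, f
  would act on it as the identity, that is, x f x^-1 would do so on \<rho> 1. But x f x^-1 and f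
  agree after multiplication by \<open>e'\<close>, which acts as 1, and f kills \<rho> 1.\<close>

lemma equiv_if_fixed:
 assumes fixed: fixed
 shows "rep_equiv HG L {..<m 1} (conj_rep G x (\<rho> 1)) {..<m 1} (\<rho> 1)"
proof (rule ccontr)
 assume ne: "\<not> rep_equiv HG L {..<m 1} (conj_rep G x (\<rho> 1)) {..<m 1} (\<rho> 1)"
 note i = d_pos and r = rho[OF d_pos]
 note rep = irreducible_repD(1)[OF r]
 obtain f where f: "W.B.annihilator_gen {..<m 1} (\<rho> 1) f" by (rule W.B.annihilator_gen_exists[OF rep])
 then have fc: "f \<in> ring_center W.KH" "f \<in> carrier W.KH"
  and f0: "\<And>w. w \<in> carrier (FS 1) ==> E 1 f w = (\<lambda>_. \<zero>\<^sub>L)"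
  unfolding W.B.annihilator_gen_def ring_center_def by auto
 obtain v where v: "v \<in> carrier (FS 1)" "v \<noteq> \<zero>\<^bsub>FS 1\<^esub>" by (rule nonzero_vector[OF i])
 have cf: "W.conj_by x f \<in> carrier W.KH" by (rule W.conj_by_KH[OF x(1) fc(2)])
 have ce: "W.conj_by x e' = e'" using Th_conj[OF e_KH] conj_by_e[OF x(1)] by simp
 have "v = rep_ext HG L {..<m 1} (conj_rep G x (\<rho> 1)) f v"
  by (rule W.B.separation[OF W.conj_irreducible[OF x(1) r] r ne f v(1), symmetric])
 also have "... = E 1 (W.conj_by x f) v" by (rule W.rep_ext_conj[OF x(1) rep fc(2) v(1)])
 also have "... = E 1 (W.conj_by x f \<otimes>\<^bsub>W.KH\<^esub> e') v" by (rule E_e'[OF i cf v(1), symmetric])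
 also have "W.conj_by x f \<otimes>\<^bsub>W.KH\<^esub> e' = W.conj_by x (f \<otimes>\<^bsub>W.KH\<^esub> e')"
  unfolding W.KH_mult[OF cf e'_closed] W.KH_mult[OF fc(2) e'_closed]
   W.conj_by_mult[OF x(1) W.KH_KG[OF fc(2)] W.KH_KG[OF e'_closed]] ce ..
 also have "... = f \<otimes>\<^bsub>W.KH\<^esub> e'" by (rule conj_center_e'[OF fixed fc(1)])
 also have "E 1 (f \<otimes>\<^bsub>W.KH\<^esub> e') v = E 1 f v" by (rule E_e'[OF i fc(2) v(1)])
 also have "... = (\<lambda>_. \<zero>\<^sub>L)" by (rule f0[OF v(1)])
 finally show False using v(2) by simp
qed

text \<open>Dimension is taken over a subfield of the ambient ring, so the field L is embedded in
  L[H] as multiples of 1.\<close>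

definition scal where "scal c = c \<odot>\<^bsub>W.KH\<^esub> \<one>\<^bsub>W.KH\<^esub>"

lemma scal_mult: "[|c \<in> carrier L; a \<in> carrier W.KH|] ==> scal c \<otimes>\<^bsub>W.KH\<^esub> a = c \<odot>\<^bsub>W.KH\<^esub> a"
 unfolding scal_def W.B.smult_mult(1)[OF _ W.B.A.one_closed] W.B.A.l_one ..

lemma scal_subfield: "subfield (scal ` carrier L) W.KH"
proof (rule ring_hom_ring.img_is_subfield(2)[OF _ L.carrier_is_subfield])
 have one: "\<one>\<^bsub>W.KH\<^esub> \<in> carrier W.KH" by (rule W.B.A.one_closed)
 show "ring_hom_ring L W.KH scal"
 proof (rule ring_hom_ringI)
  show "ring L" "ring W.KH" by (rule L.ring_axioms, rule W.B.ring_KG)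
  fix a b assume ab: "a \<in> carrier L" "b \<in> carrier L"
  show "scal a \<in> carrier W.KH" unfolding scal_def by (rule W.B.V.smult_closed[OF ab(1) one])
  show "scal (a \<oplus>\<^sub>L b) = scal a \<oplus>\<^bsub>W.KH\<^esub> scal b" unfolding scal_def by (rule W.B.V.smult_l_distr[OF ab one])
  have "scal a \<otimes>\<^bsub>W.KH\<^esub> scal b = a \<odot>\<^bsub>W.KH\<^esub> scal b"
   by (rule scal_mult[OF ab(1)]) (unfold scal_def, rule W.B.V.smult_closed[OF ab(2) one])
  then show "scal (a \<otimes>\<^sub>L b) = scal a \<otimes>\<^bsub>W.KH\<^esub> scal b"
   unfolding scal_def W.B.V.smult_assoc1[OF ab one] by simp
 next
  show "scal \<one>\<^sub>L = \<one>\<^bsub>W.KH\<^esub>" unfolding scal_def by (rule W.B.V.smult_one[OF one])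
 qed
 show "\<one>\<^bsub>W.KH\<^esub> \<noteq> \<zero>\<^bsub>W.KH\<^esub>"
 proof
  assume "\<one>\<^bsub>W.KH\<^esub> = \<zero>\<^bsub>W.KH\<^esub>"
  then have "gel L \<one>\<^bsub>HG\<^esub> = \<zero>\<^bsub>fun_space L (carrier HG)\<^esub>" unfolding W.B.one_KG group_algebra_simps by simp
  then show False by (rule notE[OF L.gel_nonzero])
 qed
qed

lemma Th_span:
 assumes "set Vs \<subseteq> carrier Z" "z \<in> ring.Span Z Fe Vs"
 shows "Th z \<in> W.B.A.Span (scal ` carrier L) (map Th Vs)"
 using assms
proof (induction Vs arbitrary: z)
 case Nil
 interpret ZF: field Z by (rule Z_field)
 have "Th \<zero>\<^bsub>KH\<^esub> = \<zero>\<^bsub>W.KH\<^esub>" unfolding Th_def group_algebra_simps by simp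
 then show ?case using Nil by (simp add: Z_ops)
next
 case (Cons v Vs)
 interpret ZF: field Z by (rule Z_field)
 have vZ: "v \<in> carrier Z" "set Vs \<subseteq> carrier Z" using Cons.prems(1) by auto
 obtain k z' where kz: "k \<in> Fe" "z' \<in> ZF.Span Fe Vs" "z = k \<otimes>\<^sub>Z v \<oplus>\<^sub>Z z'"
  using Cons.prems(2) ZF.line_extension_mem_iff[of z Fe v "ZF.Span Fe Vs"] by auto
 obtain a where a: "a \<in> carrier K" "k = a \<odot>\<^bsub>KG\<^esub> e" using kz(1) by blast
 have kZ: "k \<in> carrier Z" unfolding a(2) by (rule ring_hom_closed[OF ring_hom_ring.homh[OF emb_hom] a(1)])
 have z'Z: "z' \<in> carrier Z" using ZF.Span_subgroup_props(1)[OF Fe_subfield vZ(2)] kz(2) by blast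
 have eKG: "e \<in> carrier KG" by simp
 have "k \<otimes>\<^sub>Z v = a \<odot>\<^bsub>KH\<^esub> v"
  unfolding Z_mult[OF Z_D(1)[OF kZ] Z_D(1)[OF vZ(1)]]
  unfolding a(2) smult_mult(1)[OF a(1) eKG Z_D(2)[OF vZ(1)]] Z_D(5)[OF vZ(1)] by simp
 then have z: "z = (a \<odot>\<^bsub>KH\<^esub> v) \<oplus>\<^bsub>KH\<^esub> z'" unfolding kz(3) by (simp add: Z_ops)
 have "Th z = (s a \<odot>\<^bsub>W.KH\<^esub> Th v) \<oplus>\<^bsub>W.KH\<^esub> Th z'"
  unfolding z Th_add[OF B.V.smult_closed[OF a(1) Z_D(1)[OF vZ(1)]] Z_D(1)[OF z'Z]] Th_smult[OF a(1) Z_D(1)[OF vZ(1)]] ..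
 also have "s a \<odot>\<^bsub>W.KH\<^esub> Th v = scal (s a) \<otimes>\<^bsub>W.KH\<^esub> Th v"
  by (rule scal_mult[symmetric]) (use a(1) Z_D(1)[OF vZ(1)] EM.J.hom_closed in simp_all)
 finally have "Th z = scal (s a) \<otimes>\<^bsub>W.KH\<^esub> Th v \<oplus>\<^bsub>W.KH\<^esub> Th z'" .
 moreover have "scal (s a) \<in> scal ` carrier L" using a(1) EM.J.hom_closed by blast
 moreover have "Th z' \<in> W.B.A.Span (scal ` carrier L) (map Th Vs)" by (rule Cons.IH[OF vZ(2) kz(2)])
 ultimately show ?case
  using W.B.A.line_extension_mem_iff[of "Th z" "scal ` carrier L" "Th v" "W.B.A.Span (scal ` carrier L) (map Th Vs)"]
  unfolding list.map W.B.A.Span.simps foldr.simps o_apply by blast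
qed

text \<open>One minus the identity of the annihilator of \<rho> i: it acts as 1 on \<rho> i and, by
  \<open>separation\<close>, as 0 on the other constituents.\<close>

lemma selector:
 assumes i: "i \<in> {1..d}"
 shows "\<exists>g. g \<in> ring_center W.KH \<and> (\<forall>k\<in>{1..d}. \<forall>v\<in>carrier (FS k). E k g v = (if k = i then v else \<zero>\<^bsub>FS k\<^esub>))"
proof -
 obtain f where f: "W.B.annihilator_gen {..<m i} (\<rho> i) f" by (rule W.B.annihilator_gen_exists[OF irreducible_repD(1)[OF rho[OF i]]])
 then have fc: "f \<in> ring_center W.KH" "f \<in> carrier W.KH"
  and f0: "\<And>w. w \<in> carrier (FS i) ==> E i f w = \<zero>\<^bsub>FS i\<^esub>"
  unfolding W.B.annihilator_gen_def ring_center_def by auto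
 define mo where "mo = \<ominus>\<^sub>L \<one>\<^sub>L"
 have mo: "mo \<in> carrier L" by (simp add: mo_def)
 define g where "g = \<one>\<^bsub>W.KH\<^esub> \<oplus>\<^bsub>W.KH\<^esub> (mo \<odot>\<^bsub>W.KH\<^esub> f)"
 have oc: "\<one>\<^bsub>W.KH\<^esub> \<in> ring_center W.KH"
  unfolding ring_center_def using W.B.A.l_one W.B.A.r_one W.B.A.one_closed by (intro CollectI conjI ballI) (simp_all del: W.KH_ops)
 have gc: "g \<in> ring_center W.KH"
  unfolding g_def by (rule W.B.ring_center_closed(1)[OF oc W.B.ring_center_closed(3)[OF fc(1) fc(1) mo]])
 have "E k g v = (if k = i then v else \<zero>\<^bsub>FS k\<^esub>)" if k: "k \<in> {1..d}" and v: "v \<in> carrier (FS k)" for k v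
 proof -
  interpret R: action HG L "FS k" "\<lambda>g. mat_vec L {..<m k} (\<rho> k g)" by (rule rho_action[OF k])
  have fv: "E k f v = (if k = i then \<zero>\<^bsub>FS k\<^esub> else v)"
   using f0 v W.B.separation[OF rho[OF k] rho[OF i] ineq[OF k i] f v] by auto
  have "E k \<one>\<^bsub>W.KH\<^esub> v = v" unfolding W.B.one_KG R.Ext_gel[OF B.G.one_closed v] by (rule R.actD(3)[OF v])
  then have "E k g v = v \<oplus>\<^bsub>FS k\<^esub> mo \<odot>\<^bsub>FS k\<^esub> E k f v"
   unfolding g_def R.Ext_add[OF W.B.A.one_closed W.B.V.smult_closed[OF mo fc(2)] v] R.Ext_smult[OF fc(2) mo v] by simp
  moreover have "v \<oplus>\<^bsub>FS k\<^esub> mo \<odot>\<^bsub>FS k\<^esub> v = \<zero>\<^bsub>FS k\<^esub>"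
  proof -
   have "v \<oplus>\<^bsub>FS k\<^esub> mo \<odot>\<^bsub>FS k\<^esub> v = \<one>\<^sub>L \<odot>\<^bsub>FS k\<^esub> v \<oplus>\<^bsub>FS k\<^esub> mo \<odot>\<^bsub>FS k\<^esub> v" using R.V.smult_one[OF v] by (simp del: fun_space_simps)
   also have "... = (\<one>\<^sub>L \<oplus>\<^sub>L mo) \<odot>\<^bsub>FS k\<^esub> v" by (rule R.V.smult_l_distr[symmetric, OF L.one_closed mo v])
   also have "\<one>\<^sub>L \<oplus>\<^sub>L mo = \<zero>\<^sub>L" unfolding mo_def by (rule L.r_neg) simp
   also have "\<zero>\<^sub>L \<odot>\<^bsub>FS k\<^esub> v = \<zero>\<^bsub>FS k\<^esub>" by (rule R.V.smult_l_null[OF v])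
   finally show ?thesis .
  qed
  moreover have "v \<oplus>\<^bsub>FS k\<^esub> mo \<odot>\<^bsub>FS k\<^esub> \<zero>\<^bsub>FS k\<^esub> = v"
   unfolding R.V.smult_r_null[OF mo] by (rule R.V.M.r_zero[OF v])
  ultimately show ?thesis unfolding fv by (simp split: if_splits del: fun_space_simps)
 qed
 then show ?thesis using gc by blast
qed

lemma scalar:
 assumes z: "z \<in> carrier Z"
 shows "\<exists>c\<in>carrier L. \<forall>v\<in>carrier (FS 1). E 1 (Th z) v = c \<odot>\<^bsub>FS 1\<^esub> v"
proof -
 interpret ZF: field Z by (rule Z_field)
 let ?K = "scal ` carrier L"
 have "ZF.dimension d Fe (carrier Z)"
  using ZF.finite_dimensionE[OF Fe_subfield finite_dimension_Z] unfolding d over_def .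
 then obtain Vs where Vs: "set Vs \<subseteq> carrier Z" "length Vs = d" "ZF.Span Fe Vs = carrier Z"
  using ZF.exists_base[OF Fe_subfield] by blast
 define Us where "Us = map Th Vs"
 have Us: "set Us \<subseteq> carrier W.KH" unfolding Us_def using Vs(1) Th_closed Z_D(1) by auto
 have inU: "Th z \<in> W.B.A.Span ?K Us" if "z \<in> carrier Z" for z
  unfolding Us_def by (rule Th_span[OF Vs(1)]) (use that Vs(3) in simp)
 note sp = W.B.A.Span_subgroup_props[OF scal_subfield Us]
 \<comment> \<open>Central elements are combinations of class sums, and a class sum times
   \<open>e'\<close> is the image of an element of Z. This bounds the block part of the center of
   L[H] by the dimension of Z.\<close>
 have center: "u \<otimes>\<^bsub>W.KH\<^esub> e' \<in> W.B.A.Span ?K Us" if u: "u \<in> ring_center W.KH" for u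
 proof (rule W.B.center_induct[OF u, where P = "\<lambda>u. u \<otimes>\<^bsub>W.KH\<^esub> e' \<in> W.B.A.Span ?K Us"])
  show "\<zero>\<^bsub>W.KH\<^esub> \<otimes>\<^bsub>W.KH\<^esub> e' \<in> W.B.A.Span ?K Us" unfolding W.B.A.l_null[OF e'_closed] by (rule sp(2))
  show "(a \<oplus>\<^bsub>W.KH\<^esub> b) \<otimes>\<^bsub>W.KH\<^esub> e' \<in> W.B.A.Span ?K Us"
   if "a \<in> carrier W.KH" "b \<in> carrier W.KH" "a \<otimes>\<^bsub>W.KH\<^esub> e' \<in> W.B.A.Span ?K Us" "b \<otimes>\<^bsub>W.KH\<^esub> e' \<in> W.B.A.Span ?K Us" for a b
   unfolding W.B.A.l_distr[OF that(1,2) e'_closed] by (rule sp(3)[OF that(3,4)])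
  show "(c \<odot>\<^bsub>W.KH\<^esub> a) \<otimes>\<^bsub>W.KH\<^esub> e' \<in> W.B.A.Span ?K Us"
   if "c \<in> carrier L" "a \<in> carrier W.KH" "a \<otimes>\<^bsub>W.KH\<^esub> e' \<in> W.B.A.Span ?K Us" for c a
   unfolding W.B.smult_mult(1)[OF that(1,2) e'_closed] scal_mult[OF that(1) W.B.A.m_closed[OF that(2) e'_closed], symmetric]
   by (rule W.B.A.Span_smult_closed[OF scal_subfield Us _ that(3)]) (use that(1) in blast)
  fix y assume "y \<in> carrier HG"
  then have y: "y \<in> H" by simp
  show "class_sum L HG y \<otimes>\<^bsub>W.KH\<^esub> e' \<in> W.B.A.Span ?K Us"
   unfolding class_sum_e'[OF y] by (rule inU[OF class_sum_e_Z[OF y]])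
 qed
 obtain g where g: "\<And>i. i \<in> {1..d} ==> g i \<in> ring_center W.KH"
  "\<And>i k v. [|i \<in> {1..d}; k \<in> {1..d}; v \<in> carrier (FS k)|] ==> E k (g i) v = (if k = i then v else \<zero>\<^bsub>FS k\<^esub>)"
  using bchoice[of "{1..d}" "\<lambda>i g. g \<in> ring_center W.KH \<and> (\<forall>k\<in>{1..d}. \<forall>v\<in>carrier (FS k). E k g v = (if k = i then v else \<zero>\<^bsub>FS k\<^esub>))"] selector
  by blast
 \<comment> \<open>The factor \<open>e'\<close> leaves the action on the constituents unchanged and
   puts the selectors into the span of the image of Z.\<close>
 define q where "q i = g i \<otimes>\<^bsub>W.KH\<^esub> e'" for i
 have gcl: "g i \<in> carrier W.KH" if "i \<in> {1..d}" for i using g(1)[OF that] unfolding ring_center_def by blast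
 have qc: "q i \<in> carrier W.KH" if "i \<in> {1..d}" for i unfolding q_def by (rule W.B.A.m_closed[OF gcl[OF that] e'_closed])
 have Eq: "E k (q i) v = (if k = i then v else \<zero>\<^bsub>FS k\<^esub>)" if "i \<in> {1..d}" "k \<in> {1..d}" "v \<in> carrier (FS k)" for i k v
  unfolding q_def E_e'[OF that(2) gcl[OF that(1)] that(3)] by (rule g(2)[OF that])
 have step: "E k (scal c \<otimes>\<^bsub>W.KH\<^esub> q i \<oplus>\<^bsub>W.KH\<^esub> w) v = (if k = i then c else \<zero>\<^sub>L) \<odot>\<^bsub>FS k\<^esub> v \<oplus>\<^bsub>FS k\<^esub> E k w v"
  if c: "c \<in> carrier L" and i: "i \<in> {1..d}" and k: "k \<in> {1..d}" and w: "w \<in> carrier W.KH" and v: "v \<in> carrier (FS k)" for c i k w v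
 proof -
  interpret R: action HG L "FS k" "\<lambda>g. mat_vec L {..<m k} (\<rho> k g)" by (rule rho_action[OF k])
  show ?thesis
   unfolding scal_mult[OF c qc[OF i]] R.Ext_add[OF W.B.V.smult_closed[OF c qc[OF i]] w v] R.Ext_smult[OF qc[OF i] c v] Eq[OF i k v]
   using R.V.smult_l_null[OF v] R.V.smult_r_null[OF c] by (simp del: fun_space_simps)
 qed
 \<comment> \<open>A combination of the other \<open>q l\<close> acts as 0 on \<rho> i, where
   \<open>q i\<close> acts as 1.\<close>
 have indep: "W.B.A.independent ?K (map q is)" if "distinct is" "set is \<subseteq> {1..d}" for "is"
  using that
 proof (induction "is")
  case Nil
  then show ?case using W.B.A.li_Nil by simp
 next
  case (Cons i "is")
  have i: "i \<in> {1..d}" "i \<notin> set is" "distinct is" "set is \<subseteq> {1..d}" using Cons.prems by auto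
  obtain v where v: "v \<in> carrier (FS i)" "v \<noteq> \<zero>\<^bsub>FS i\<^esub>" by (rule nonzero_vector[OF i(1)])
  interpret R: action HG L "FS i" "\<lambda>g. mat_vec L {..<m i} (\<rho> i g)" by (rule rho_action[OF i(1)])
  have c: "set (map q is) \<subseteq> carrier W.KH" using qc i(4) by auto
  have "q i \<notin> W.B.A.Span ?K (map q is)"
  proof
   assume a: "q i \<in> W.B.A.Span ?K (map q is)"
   have "E i (q i) v = \<zero>\<^bsub>FS i\<^esub>"
   proof (rule W.B.A.Span_induct[OF scal_subfield c a, where P = "\<lambda>w. E i w v = \<zero>\<^bsub>FS i\<^esub>"])
    show "E i \<zero>\<^bsub>W.KH\<^esub> v = \<zero>\<^bsub>FS i\<^esub>" by (rule R.Ext_zero[OF v(1)])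
    fix k u w assume k: "k \<in> ?K" and u: "u \<in> set (map q is)" and w: "w \<in> carrier W.KH" "E i w v = \<zero>\<^bsub>FS i\<^esub>"
    obtain c where c: "c \<in> carrier L" "k = scal c" using k by blast
    obtain l where l: "l \<in> set is" "u = q l" using u by auto
    have l': "l \<in> {1..d}" "i \<noteq> l" using l i by auto
    show "E i (k \<otimes>\<^bsub>W.KH\<^esub> u \<oplus>\<^bsub>W.KH\<^esub> w) v = \<zero>\<^bsub>FS i\<^esub>"
     unfolding c(2) l(2) step[OF c(1) l'(1) i(1) w(1) v(1)] w(2) if_not_P[OF l'(2)] R.V.smult_l_null[OF v(1)]
     by (rule R.V.M.r_zero[OF R.V.M.zero_closed])
   qed
   then show False using Eq[OF i(1) i(1) v(1)] v(2) by simp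
  qed
  then show ?case using W.B.A.li_Cons[OF qc[OF i(1)] _ Cons.IH[OF i(3,4)]] by simp
 qed
 define Qs where "Qs = map q [1..<Suc d]"
 have Qi: "W.B.A.independent ?K Qs" unfolding Qs_def by (rule indep) auto
 have Qlen: "length Qs = d" unfolding Qs_def by simp
 have Qsub: "set Qs \<subseteq> W.B.A.Span ?K Us" unfolding Qs_def q_def using center g(1) by auto
 have Qc: "set Qs \<subseteq> carrier W.KH" using Qsub sp(1) by blast
 \<comment> \<open>The span has at most d generators and contains d independent \<open>q i\<close>,
   so these span it.\<close>
 obtain k where k: "k \<le> length Us" "W.B.A.dimension k ?K (W.B.A.Span ?K Us)"
  using W.B.A.dimension_Span_le[OF scal_subfield Us] by blast
 have "length Qs \<le> k" by (rule W.B.A.independent_length_le_dimension[OF scal_subfield k(2) Qi Qsub])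
 then have "length Qs = k" using k(1) Qlen Vs(2) by (simp add: Us_def)
 then have QU: "W.B.A.Span ?K Qs = W.B.A.Span ?K Us"
  using W.B.A.independent_length_eq_dimension[OF scal_subfield k(2) Qi Qsub] by simp
 interpret R: action HG L "FS 1" "\<lambda>g. mat_vec L {..<m 1} (\<rho> 1 g)" by (rule rho_action[OF d_pos])
 have mem: "Th z \<in> W.B.A.Span ?K Qs" using inU[OF z] QU by simp
 show ?thesis
 proof (rule W.B.A.Span_induct[OF scal_subfield Qc mem, where P = "\<lambda>w. \<exists>c\<in>carrier L. \<forall>v\<in>carrier (FS 1). E 1 w v = c \<odot>\<^bsub>FS 1\<^esub> v"])
  show "\<exists>c\<in>carrier L. \<forall>v\<in>carrier (FS 1). E 1 \<zero>\<^bsub>W.KH\<^esub> v = c \<odot>\<^bsub>FS 1\<^esub> v"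
   by (rule bexI[of _ "\<zero>\<^sub>L"]) (use R.Ext_zero R.V.smult_l_null in \<open>simp_all del: fun_space_simps W.KH_ops\<close>)
  fix h u w assume h: "h \<in> ?K" and u: "u \<in> set Qs" and w: "w \<in> carrier W.KH"
   and IH: "\<exists>c\<in>carrier L. \<forall>v\<in>carrier (FS 1). E 1 w v = c \<odot>\<^bsub>FS 1\<^esub> v"
  obtain c where c: "c \<in> carrier L" "h = scal c" using h by blast
  obtain i where i: "i \<in> {1..d}" "u = q i"
   using u unfolding Qs_def set_map set_upt atLeastLessThanSuc_atLeastAtMost by blast
  obtain b where b: "b \<in> carrier L" "\<And>v. v \<in> carrier (FS 1) ==> E 1 w v = b \<odot>\<^bsub>FS 1\<^esub> v" using IH by blast
  define a where "a = (if 1 = i then c else \<zero>\<^sub>L)"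
  have a: "a \<in> carrier L" using c by (simp add: a_def)
  have "E 1 (h \<otimes>\<^bsub>W.KH\<^esub> u \<oplus>\<^bsub>W.KH\<^esub> w) v = (a \<oplus>\<^sub>L b) \<odot>\<^bsub>FS 1\<^esub> v" if v: "v \<in> carrier (FS 1)" for v
   unfolding c(2) i(2) step[OF c(1) i(1) d_pos w v] b(2)[OF v] a_def[symmetric]
   by (rule R.V.smult_l_distr[symmetric, OF a b(1) v])
  then show "\<exists>c\<in>carrier L. \<forall>v\<in>carrier (FS 1). E 1 (h \<otimes>\<^bsub>W.KH\<^esub> u \<oplus>\<^bsub>W.KH\<^esub> w) v = c \<odot>\<^bsub>FS 1\<^esub> v"
   using L.a_closed[OF a b(1)] by blast
 qed
qed

text \<open>z and x z x^-1 act on \<rho> 1 by scalars, and an intertwiner with the conjugate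
  representation identifies the two scalars.\<close>

lemma fixed_if_equiv:
 assumes eq: "rep_equiv HG L {..<m 1} (conj_rep G x (\<rho> 1)) {..<m 1} (\<rho> 1)"
 shows fixed
 unfolding fixed_def
proof
 fix z assume z: "z \<in> carrier Z"
 interpret ZF: field Z by (rule Z_field)
 interpret R: action HG L "FS 1" "\<lambda>g. mat_vec L {..<m 1} (\<rho> 1 g)" by (rule rho_action[OF d_pos])
 note rep = irreducible_repD(1)[OF rho[OF d_pos]]
 define y where "y = conj_by x z"
 have y: "y \<in> carrier Z" unfolding y_def by (rule conj_by_Z[OF x(1) z])
 note zH = Z_D(1)[OF z] and yH = Z_D(1)[OF y]
 obtain c where c: "c \<in> carrier L" "\<And>v. v \<in> carrier (FS 1) ==> E 1 (Th z) v = c \<odot>\<^bsub>FS 1\<^esub> v" using scalar[OF z] by blast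
 obtain b where b: "b \<in> carrier L" "\<And>v. v \<in> carrier (FS 1) ==> E 1 (Th y) v = b \<odot>\<^bsub>FS 1\<^esub> v" using scalar[OF y] by blast
 have bc: "b = c"
 proof (rule W.conj_by_cong_rep[OF x(1) rep eq Th_closed[OF zH]])
  fix T S assume T: "lin L (FS 1) (FS 1) T" and S: "lin L (FS 1) (FS 1) S"
   and ST: "\<And>v. v \<in> carrier (FS 1) ==> S (T v) = v"
   and TE: "\<And>v. v \<in> carrier (FS 1) ==> T (E 1 (W.conj_by x (Th z)) v) = E 1 (Th z) (T v)"
  obtain v where v: "v \<in> carrier (FS 1)" "v \<noteq> \<zero>\<^bsub>FS 1\<^esub>" by (rule nonzero_vector[OF d_pos])
  note Tv = linD(1)[OF T v(1)]
  have "T v \<noteq> \<zero>\<^bsub>FS 1\<^esub>" using ST[OF v(1)] lin_zero[OF L.fs_module L.fs_module S] v(2) by metis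
  then obtain k where k: "T v k \<noteq> \<zero>\<^sub>L" by auto
  have "b \<odot>\<^bsub>FS 1\<^esub> T v = T (b \<odot>\<^bsub>FS 1\<^esub> v)" by (rule linD(3)[OF T b(1) v(1), symmetric])
  also have "... = T (E 1 (Th y) v)" unfolding b(2)[OF v(1)] ..
  also have "... = c \<odot>\<^bsub>FS 1\<^esub> T v" unfolding y_def Th_conj[OF zH] TE[OF v(1)] by (rule c(2)[OF Tv])
  finally have "(b \<odot>\<^bsub>FS 1\<^esub> T v) k = (c \<odot>\<^bsub>FS 1\<^esub> T v) k" by simp
  then have "b \<otimes>\<^sub>L T v k = c \<otimes>\<^sub>L T v k" by simp
  then show "b = c" using L.m_rcancel[OF k L.fs_val[OF Tv] b(1) c(1)] by simp
 qed
 \<comment> \<open>D acts as 0 on \<rho> 1. A nonzero element of the field Z would be invertible,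
   and then \<open>e'\<close> would act as 0 as well.\<close>
 define D where "D = y \<ominus>\<^sub>Z z"
 have D: "D \<in> carrier Z" unfolding D_def by (rule ZF.minus_closed[OF y z])
 have yD: "y = D \<oplus>\<^sub>Z z" unfolding D_def ZF.minus_eq using y z by (metis ZF.a_assoc ZF.a_inv_closed ZF.l_neg ZF.r_zero)
 have "D = \<zero>\<^bsub>KG\<^esub>"
 proof (rule ccontr)
  assume nz: "D \<noteq> \<zero>\<^bsub>KG\<^esub>"
  obtain w where w: "w \<in> carrier Z" "D \<star> w = e" by (rule Z_inverse[OF D nz])
  obtain v where v: "v \<in> carrier (FS 1)" "v \<noteq> \<zero>\<^bsub>FS 1\<^esub>" by (rule nonzero_vector[OF d_pos])
  have D0: "E 1 (Th D) u = \<zero>\<^bsub>FS 1\<^esub>" if u: "u \<in> carrier (FS 1)" for u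
  proof -
   have "Th y = Th D \<oplus>\<^bsub>W.KH\<^esub> Th z" using Th_add[OF Z_D(1)[OF D] zH] yD by (simp add: Z_ops)
   then have "E 1 (Th y) u = E 1 (Th D) u \<oplus>\<^bsub>FS 1\<^esub> E 1 (Th z) u"
    using R.Ext_add[OF Th_closed[OF Z_D(1)[OF D]] Th_closed[OF zH] u] by metis
   then have "E 1 (Th D) u \<oplus>\<^bsub>FS 1\<^esub> E 1 (Th z) u = E 1 (Th z) u" unfolding b(2)[OF u] c(2)[OF u] bc by (rule sym)
   then show ?thesis
    using R.V.M.add.r_cancel_one[OF E_closed[OF d_pos Th_closed[OF zH] u] E_closed[OF d_pos Th_closed[OF Z_D(1)[OF D]] u]] by metis
  qed
  have wH: "Th w \<in> carrier W.KH" by (rule Th_closed[OF Z_D(1)[OF w(1)]])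
  have "e' = Th D \<otimes>\<^bsub>W.KH\<^esub> Th w"
   using Th_mult[OF Z_D(1)[OF D] Z_D(1)[OF w(1)]] w(2) KH_mult[OF Z_D(1)[OF D] Z_D(1)[OF w(1)]] by simp
  then have "E 1 e' v = E 1 (Th D) (E 1 (Th w) v)" using E_mult[OF d_pos Th_closed[OF Z_D(1)[OF D]] wH v(1)] by metis
  also have "... = \<zero>\<^bsub>FS 1\<^esub>" by (rule D0[OF E_closed[OF d_pos wH v(1)]])
  finally show False using E_one[OF d_pos v(1)] v(2) by metis
 qed
 then have "y = z" using yD ZF.l_zero[OF z] by (simp add: Z_ops)
 then show "\<delta> x \<star> z = z \<star> \<delta> x" using conj_by_fixed_iff[OF x(1) Z_D(2)[OF z]] unfolding y_def by blast
qed

end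

text \<open>\<open>characteristic\<close> is the additive order of 1, with value 0 for infinite
  order. If |G| were 0 in F, it would be a divisor of the positive number |G|, hence not 0; being
  prime to |G|, it would be 1, which means 1 = 0.\<close>

lemma order_nonzero:
 assumes F: "field F" and G: "group G" "finite (carrier G)"
  and c: "characteristic F = 0 \<or> coprime (characteristic F) (order G)"
 shows "(\<Oplus>\<^sub>F g\<in>carrier G. \<one>\<^sub>F) \<noteq> \<zero>\<^sub>F"
proof
 interpret F: field F by (rule F)
 interpret G: group G by (rule G(1))
 assume "(\<Oplus>\<^sub>F g\<in>carrier G. \<one>\<^sub>F) = \<zero>\<^sub>F"
 then have z: "add_pow F (order G) \<one>\<^sub>F = \<zero>\<^sub>F"
  using F.add.finprod_const[of "\<one>\<^sub>F" "carrier G"] by (simp add: order_def)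
 have grp: "group (add_monoid F)" by (rule F.a_group)
 have one: "\<one>\<^sub>F \<in> carrier (add_monoid F)" by simp
 have dvd: "characteristic F dvd order G"
  using group.pow_eq_id[OF grp one, of "order G"] z unfolding characteristic_def add_pow_def by simp
 have "order G > 0" using G(2) G.one_closed by (auto simp: order_def card_gt_0_iff)
 then have "characteristic F = 1" using c dvd by (auto simp: coprime_absorb_left)
 then show False using group.ord_eq_1[OF grp one] unfolding characteristic_def by simp
qed

theorem theorem5p1p1:
  fixes G :: "('g, 'm) monoid_scheme" and F :: "('f, 'r) ring_scheme"
    and H :: "'g set" and x :: 'g and p n \<delta> :: nat
    and \<eta> :: "'g \<Rightarrow> nat \<Rightarrow> nat \<Rightarrow> 'f"
    and e :: "'g \<Rightarrow> 'f"
    and FG FH Z :: "('f, 'g \<Rightarrow> 'f) module"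
    and m :: "nat \<Rightarrow> nat"
    and \<eta>s :: "nat \<Rightarrow> 'g \<Rightarrow> nat \<Rightarrow> nat \<Rightarrow> 'g \<Rightarrow> 'f"
  assumes G: "group G" "finite (carrier G)"
    and p: "Factorial_Ring.prime p"
    and H: "H \<lhd> G" "card (rcosets\<^bsub>G\<^esub> H) = p"
    and x: "x \<in> carrier G" "generate (G Mod H) {H #>\<^bsub>G\<^esub> x} = carrier (G Mod H)"
    and F: "field F" "characteristic F = 0 \<or> coprime (characteristic F) (order G)"
    and FG: "FG = group_algebra F G"
    and FH: "FH = group_algebra F (G\<lparr>carrier := H\<rparr>)"
    and eta: "irreducible_representation (G\<lparr>carrier := H\<rparr>) F {..<n} \<eta>"
    and e: "corresponding_pci (G\<lparr>carrier := H\<rparr>) F {..<n} \<eta> e"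
    and eta_x: "rep_equiv (G\<lparr>carrier := H\<rparr>) F {..<n} (conj_rep G x \<eta>) {..<n} \<eta>"
    and Z: "Z = block_center FH e"
    and delta: "\<delta> = ring.dim Z ((\<lambda>a. a \<odot>\<^bsub>FH\<^esub> e) ` carrier F) (carrier Z)"
    and etas: "\<forall>i\<in>{1..\<delta>}. irreducible_representation (G\<lparr>carrier := H\<rparr>) Z {..<m i} (\<eta>s i)"
    and etas_inequiv: "\<forall>i\<in>{1..\<delta>}. \<forall>j\<in>{1..\<delta>}. i \<noteq> j \<longrightarrow>
          \<not> rep_equiv (G\<lparr>carrier := H\<rparr>) Z {..<m i} (\<eta>s i) {..<m j} (\<eta>s j)"
    and decomposition: "rep_equiv (G\<lparr>carrier := H\<rparr>) Z
          {..<n} (extend_scalars (\<lambda>a. a \<odot>\<^bsub>FH\<^esub> e) \<eta>)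
          (SIGMA i:{1..\<delta>}. {..<m i}) (direct_sum Z \<eta>s)"
  shows
    "e \<in> ring_center FG \<and>
     field Z \<and> ring.finite_dimension Z ((\<lambda>a. a \<odot>\<^bsub>FH\<^esub> e) ` carrier F) (carrier Z) \<and>
     (\<not> rep_equiv (G\<lparr>carrier := H\<rparr>) Z {..<m 1} (conj_rep G x (\<eta>s 1)) {..<m 1} (\<eta>s 1) \<longrightarrow>
        primitive_central_idempotent FG e) \<and>
     (rep_equiv (G\<lparr>carrier := H\<rparr>) Z {..<m 1} (conj_rep G x (\<eta>s 1)) {..<m 1} (\<eta>s 1) \<longrightarrow>
        (\<exists>y\<in>carrier G - H.
           class_sum F G y [^]\<^bsub>FG\<^esub> p \<otimes>\<^bsub>FG\<^esub> e \<in> carrier Z - {\<zero>\<^bsub>Z\<^esub>}) \<and>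
        (\<forall>y\<in>carrier G - H. \<forall>lam\<in>carrier Z - {\<zero>\<^bsub>Z\<^esub>}.
           class_sum F G y [^]\<^bsub>FG\<^esub> p \<otimes>\<^bsub>FG\<^esub> e = lam \<longrightarrow>
           ((\<not> (\<exists>\<mu>\<in>carrier Z. \<mu> [^]\<^bsub>Z\<^esub> p = lam)) \<longrightarrow>
              primitive_central_idempotent FG e) \<and>
           ((\<exists>\<mu>\<in>carrier Z. \<exists>\<nu>\<in>carrier Z. \<mu> \<noteq> \<nu> \<and> \<mu> [^]\<^bsub>Z\<^esub> p = lam \<and> \<nu> [^]\<^bsub>Z\<^esub> p = lam) \<longrightarrow>
              (let M = {\<mu> \<in> carrier Z. \<mu> [^]\<^bsub>Z\<^esub> p = lam};
                   c = (\<lambda>\<mu>. class_sum F G y \<otimes>\<^bsub>FG\<^esub> inv\<^bsub>Z\<^esub> \<mu>);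
                   E = (\<lambda>\<mu>. mean F FG p (\<lambda>l. c \<mu> [^]\<^bsub>FG\<^esub> l) \<otimes>\<^bsub>FG\<^esub> e)
               in card M = p \<and>
                  (\<forall>\<mu>\<in>M. E \<mu> = mean F FG p (\<lambda>l. c \<mu> [^]\<^bsub>block FG e\<^esub> l)) \<and>
                  card (E ` M) = p \<and> pci_decomposition FG e (E ` M))) \<and>
           (\<forall>\<mu>\<in>carrier Z.
              \<mu> [^]\<^bsub>Z\<^esub> p = lam \<and> (\<forall>\<nu>\<in>carrier Z. \<nu> [^]\<^bsub>Z\<^esub> p = lam \<longrightarrow> \<nu> = \<mu>) \<longrightarrow>
              (\<forall>fs (L :: ('l, 's) ring_scheme) \<iota>.
                 monic_irreducible_factorization Z (cyclotomic_prime Z p) fs \<and>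
                 \<iota> \<in> ring_hom Z L \<and> algebraic_closure L (\<iota> ` carrier Z) \<longrightarrow>
                 (let c = class_sum F G y \<otimes>\<^bsub>FG\<^esub> inv\<^bsub>Z\<^esub> \<mu>;
                      E1 = mean F FG p (\<lambda>l. c [^]\<^bsub>FG\<^esub> l) \<otimes>\<^bsub>FG\<^esub> e;
                      E = (\<lambda>f. mean F FG p (\<lambda>l.
                             inv_into (carrier Z) \<iota> (inv_power_sum \<iota> L f l)
                               \<otimes>\<^bsub>FG\<^esub> c [^]\<^bsub>block FG e\<^esub> l))
                  in (\<exists>d. \<forall>f\<in>set fs. Polynomials.degree f = d \<and> card (roots_in \<iota> L f) = d) \<and>
                     (\<forall>f\<in>set fs. \<forall>l<p. inv_power_sum \<iota> L f l \<in> \<iota> ` carrier Z) \<and>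
                     E1 = mean F FG p (\<lambda>l. c [^]\<^bsub>block FG e\<^esub> l) \<and>
                     card (insert E1 (E ` set fs)) = 1 + length fs \<and>
                     pci_decomposition FG e (insert E1 (E ` set fs)))))))"
proof -
 let ?HG = "G\<lparr>carrier := H\<rparr>" and ?s = "\<lambda>a. a \<odot>\<^bsub>FH\<^esub> e"
 interpret G: group G by (rule G(1))
 interpret F: field F by (rule F(1))
 have GF: "fin_group_field G F"
  using G F(1) order_nonzero[OF F(1) G F(2)] by (simp add: fin_group_field_def fin_group_field_axioms_def)
 interpret PI: prime_index G F H p
  using GF H p by (simp add: prime_index_def normal_sub_def prime_index_axioms_def normal_sub_axioms_def)
 \<comment> \<open>For x in H the coset of x would generate only the trivial subgroup, but the
   quotient has order p > 1.\<close>
 have xH: "x \<notin> H"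
 proof
  assume "x \<in> H"
  then have "H #>\<^bsub>G\<^esub> x = \<one>\<^bsub>G Mod H\<^esub>" using PI.coset_H_iff[OF x(1)] by simp
  then have "carrier (G Mod H) = {\<one>\<^bsub>G Mod H\<^esub>}" using x(2) PI.Q.generate_one by simp
  then have "order (G Mod H) = 1" by (simp add: order_def)
  then show False using PI.order_Q PI.p_pos by simp
 qed
 have ecen: "e \<in> ring_center (group_algebra F G)"
  by (rule PI.conj_invariant_pci[OF x(1) xH eta e eta_x])
 have pci: "primitive_central_idempotent (group_algebra F ?HG) e" and id: "acts_as_identity ?HG F {..<n} \<eta> e"
  using e by (simp_all add: corresponding_pci_def)
 interpret IB: inv_block G F H p e x
  using PI.prime_index_axioms pci ecen x(1) xH by (simp add: inv_block_def inv_block_axioms_def)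
 have Z': "Z = IB.Z" unfolding Z FH ..
 have s: "?s = (\<lambda>a. a \<odot>\<^bsub>group_algebra F G\<^esub> e)" unfolding FH PI.KH_ops ..
 have fZ: "field Z" unfolding Z' by (rule IB.Z_field)
 have hom: "coeff_hom_field F Z ?s"
 proof -
  interpret Z: field Z by (rule fZ)
  have "?s \<in> ring_hom F Z" unfolding s Z' by (rule ring_hom_ring.homh[OF IB.emb_hom])
  then show ?thesis
   using F.field_axioms Z.field_axioms Z.is_cring by (simp add: coeff_hom_field_def coeff_hom_def coeff_hom_axioms_def)
 qed
 have dim: "\<delta> = ring.dim IB.Z IB.Fe (carrier IB.Z)" unfolding delta s Z' ..
 interpret SR: split_rep G F H p e x Z ?s n \<eta> \<delta> m \<eta>s
  using IB.inv_block_axioms fZ hom eta id dim etas etas_inequiv decomposition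
  by (intro split_rep.intro split_rep_axioms.intro) blast+
 let ?eq = "rep_equiv ?HG Z {..<m 1} (conj_rep G x (\<eta>s 1)) {..<m 1} (\<eta>s 1)"
 \<comment> \<open>From here on the equivalence of the first constituent with its conjugate is
   replaced by the statement that x centralizes Z.\<close>
 have fixed: "?eq \<longleftrightarrow> IB.fixed" using SR.equiv_if_fixed SR.fixed_if_equiv by blast
 have one: "\<not> ?eq \<longrightarrow> primitive_central_idempotent FG e"
  using fixed IB.primitive_if_not_fixed unfolding FG by blast
 have fd: "ring.finite_dimension Z (?s ` carrier F) (carrier Z)"
  unfolding s Z' by (rule IB.finite_dimension_Z)
 show ?thesis
 proof (intro conjI impI ballI allI)
  show "e \<in> ring_center FG" unfolding FG by (rule ecen)
  show "field Z" by (rule fZ)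
  show "ring.finite_dimension Z (?s ` carrier F) (carrier Z)" by (rule fd)
  show "\<not> ?eq ==> primitive_central_idempotent FG e" using one by blast
 next
  assume ?eq
  then have fx: IB.fixed using fixed by blast
  show "\<exists>y\<in>carrier G - H. class_sum F G y [^]\<^bsub>FG\<^esub> p \<otimes>\<^bsub>FG\<^esub> e \<in> carrier Z - {\<zero>\<^sub>Z}"
   using IB.exists_class_sum[OF fx] unfolding FG Z' IB.Z_ops .
 next
  fix y lam
  assume ?eq and y: "y \<in> carrier G - H" and lam: "lam \<in> carrier Z - {\<zero>\<^sub>Z}"
   and p': "class_sum F G y [^]\<^bsub>FG\<^esub> p \<otimes>\<^bsub>FG\<^esub> e = lam"
  then have fx: IB.fixed using fixed by blast
  note a = fx y lam[unfolded Z'] p'[unfolded FG]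
  show "primitive_central_idempotent FG e" if "\<not> (\<exists>\<mu>\<in>carrier Z. \<mu> [^]\<^sub>Z p = lam)"
   using IB.no_root_case[OF a] that unfolding Z' FG by blast
  show "let M = {\<mu> \<in> carrier Z. \<mu> [^]\<^sub>Z p = lam};
       c = (\<lambda>\<mu>. class_sum F G y \<otimes>\<^bsub>FG\<^esub> inv\<^bsub>Z\<^esub> \<mu>);
       E = (\<lambda>\<mu>. mean F FG p (\<lambda>l. c \<mu> [^]\<^bsub>FG\<^esub> l) \<otimes>\<^bsub>FG\<^esub> e)
     in card M = p \<and>
       (\<forall>\<mu>\<in>M. E \<mu> = mean F FG p (\<lambda>l. c \<mu> [^]\<^bsub>block FG e\<^esub> l)) \<and>
       card (E ` M) = p \<and> pci_decomposition FG e (E ` M)"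
   if r: "\<exists>\<mu>\<in>carrier Z. \<exists>\<nu>\<in>carrier Z. \<mu> \<noteq> \<nu> \<and> \<mu> [^]\<^sub>Z p = lam \<and> \<nu> [^]\<^sub>Z p = lam"
  proof -
   obtain \<mu> \<nu> where "\<mu> \<in> carrier IB.Z" "\<nu> \<in> carrier IB.Z" "\<mu> \<noteq> \<nu>" "\<mu> [^]\<^bsub>IB.Z\<^esub> p = lam" "\<nu> [^]\<^bsub>IB.Z\<^esub> p = lam"
    using r unfolding Z' by blast
   from IB.kummer_case[OF a this] show ?thesis unfolding Let_def Z' FG .
  qed
  fix \<mu> fs and L :: "('l, 's) ring_scheme" and \<iota>
  assume \<mu>: "\<mu> \<in> carrier Z" "\<mu> [^]\<^sub>Z p = lam \<and> (\<forall>\<nu>\<in>carrier Z. \<nu> [^]\<^sub>Z p = lam \<longrightarrow> \<nu> = \<mu>)"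
   and f: "monic_irreducible_factorization Z (cyclotomic_prime Z p) fs \<and>
    \<iota> \<in> ring_hom Z L \<and> algebraic_closure L (\<iota> ` carrier Z)"
  have b: "\<mu> \<in> carrier IB.Z" "\<mu> [^]\<^bsub>IB.Z\<^esub> p = lam"
   "monic_irreducible_factorization IB.Z (cyclotomic_prime IB.Z p) fs"
   "\<iota> \<in> ring_hom IB.Z L" "algebraic_closure L (\<iota> ` carrier IB.Z)"
   using \<mu> f unfolding Z' by blast+
  show "let c = class_sum F G y \<otimes>\<^bsub>FG\<^esub> inv\<^bsub>Z\<^esub> \<mu>;
       E1 = mean F FG p (\<lambda>l. c [^]\<^bsub>FG\<^esub> l) \<otimes>\<^bsub>FG\<^esub> e;
       E = (\<lambda>f. mean F FG p (\<lambda>l.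
           inv_into (carrier Z) \<iota> (inv_power_sum \<iota> L f l)
            \<otimes>\<^bsub>FG\<^esub> c [^]\<^bsub>block FG e\<^esub> l))
     in (\<exists>d. \<forall>f\<in>set fs. Polynomials.degree f = d \<and> card (roots_in \<iota> L f) = d) \<and>
       (\<forall>f\<in>set fs. \<forall>l<p. inv_power_sum \<iota> L f l \<in> \<iota> ` carrier Z) \<and>
       E1 = mean F FG p (\<lambda>l. c [^]\<^bsub>block FG e\<^esub> l) \<and>
       card (insert E1 (E ` set fs)) = 1 + length fs \<and>
       pci_decomposition FG e (insert E1 (E ` set fs))"
   using IB.cyclotomic_case[OF a b] unfolding Let_def Z' FG .
 qed
qed

end
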